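(* Let $\delta t>0$ be a constant and, for $m\in\mathbb N$, $m\ge1$, let $\Delta t_m=\delta t/m^2$ and let $\eta_m(z)=k\Delta t_m$ whenever $k\Delta t_m<z\le(k+1)\Delta t_m$ for an integer $k\ge0$. For each $m$ let the process $X_m$ be defined by $$X_m(t)=X_0+\int_0^t b(X_m(\eta_m(z)-))\,dz+\int_0^t\int_{\mathbb R^5}g(s,u,X_m(\eta_m(z)-))\,\widetilde N_{\overline\Gamma}(dz,ds\,du)$$ (with $X_m(0-):=X_0$). Then $X_m(t)$ is well defined up to a Markov time $\tau_m$ such that $\mathbf Q(\tau_m>0)=1$. Moreover, for almost every $\omega\in\Omega$ and every $T<\widetilde\tau^X(\omega)$ there exists $m_0\in\mathbb N$ such that $\tau_m(\omega)>T$ for every $m\ge m_0$ and $$\lim_{m\to+\infty}\ \sup_{t\in[0,T]}|X(t,\omega)-X_m(t,\omega)|=0.$$ Here $X$, $\widetilde\tau^X$, $b$, $g$, $\widetilde N_{\overline\Gamma}$ and $X_0$ are as defined in the context.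
   Context: Driving noise. $(\Omega,\mathcal F,\{\mathcal F_t\}_{t\ge0},\mathbf Q)$ is a complete filtered probability space. $\mathbf W=(W_1,W_2,W_3,W_4)$ is a $4$-dimensional Brownian motion with instantaneous correlation matrix $$\Sigma_{\mathbf W}=\begin{pmatrix}1&\rho_{sv}&\rho_{sd}&\rho_{sf}\\ \rho_{sv}&1&\rho_{vd}&\rho_{vf}\\ \rho_{sd}&\rho_{vd}&1&\rho_{df}\\ \rho_{sf}&\rho_{vf}&\rho_{df}&1\end{pmatrix}$$ (positive definite), $H=(H_{i,j})$ is its lower triangular Cholesky factor, $\Sigma_{\mathbf W}=HH^T$, and $\overline{\mathbf W}^T=H^{-1}\mathbf W^T$, a standard $4$-dimensional Brownian motion. $\gamma$ is a Gamma subordinator independent of $\mathbf W$: a pure-jump increasing Lévy process with $\gamma(0)=0$ and Lévy measure $g_\gamma(s)ds=\frac{\alpha}{s}e^{-\beta s}1_{(0,+\infty)}(s)ds$, $\alpha,\beta>0$. $\overline\Gamma(t)=\overline{\mathbf W}(\gamma(t))$. The process $(\gamma,\overline\Gamma)$ is a Lévy process on $\mathbb R^5$ with Lévy measure $\nu_4(ds\,du)=g_\gamma(s)p_4(s,u)\,ds\,du$, where $p_4(s,u)=\frac{1}{4\pi^2s^2}e^{-|u|^2/(2s)}1_{(0,+\infty)}(s)$, $s\in\mathbb R$, $u\in\mathbb R^4$. Its Poisson random measure is $N_{\overline\Gamma}(t,A)=\sum_{0\le s\le t}1_A((\Delta\gamma(s),\Delta\overline\Gamma(s)))$, $A\in\mathcal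 B(\mathbb R^5\setminus\{0\})$, with $\Delta f(s)=f(s)-f(s-)$, and the compensated measure is $\widetilde N_{\overline\Gamma}(dt,ds\,du)=N_{\overline\Gamma}(dt,ds\,du)-\nu_4(ds\,du)\,dt$. Coefficients. Parameters: $\kappa_v,\kappa_d,\kappa_f,a_v,a_d,a_f,\sigma_v,\sigma_d,\sigma_f>0$, $\theta_s,\theta_v,\theta_d,\theta_f\ge0$. For $x\in\mathbb R^4$ with non-negative $x_2,x_3,x_4$, $s\in\mathbb R$, $u\in\mathbb R^4$: $$b(x)=\begin{pmatrix}x_1(x_3-x_4)\\ \kappa_v(a_v-x_2)\\ \kappa_d(a_d-x_3)\\ \kappa_f(a_f-x_4)-\sigma_f\rho_{sf}\sqrt{x_2x_4}\end{pmatrix},\qquad g(s,u,x)=\begin{pmatrix}x_1(\theta_ss+H_{1,1}u_1\sqrt{x_2})\\ \theta_vs+(H_{2,1}u_1+H_{2,2}u_2)\sigma_v\sqrt{x_2}\\ \theta_ds+(H_{3,1}u_1+H_{3,2}u_2+H_{3,3}u_3)\sigma_d\sqrt{x_3}\\ \theta_fs+(H_{4,1}u_1+H_{4,2}u_2+H_{4,3}u_3+H_{4,4}u_4)\sigma_f\sqrt{x_4}\end{pmatrix}.$$ Initial datum: $X_0=(S_0,V_0,r^d_0,r^f_0)^T$ deterministic with positive components; $n_0\in\mathbb N$ is such that $X_0\in[\frac1{n_0},n_0]^4$. Localization. For $n\ge n_0$, $\psi_n\in C_c^\infty(\mathbb R)$ satisfies $0\le\psi_n\le1$, $\psi_n=1$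 on $[\frac1n,n]$, $\mathrm{supp}\,\psi_n\subset(\frac1{n+1},n+1)$; $\Psi_n(x)=\prod_{j=1}^4\psi_n(x_j)$; $b_n(x)=\Psi_n(x)b(x)$, $g_n(s,u,x)=\Psi_n(x)g(s,u,x)$ (understood as $0$ where $\Psi_n(x)=0$). $X^n$ is the pathwise unique global càdlàg strong solution of $$dX^n(t)=b_n(X^n(t-))dt+\int_{\mathbb R^5}g_n(s,u,X^n(t-))\widetilde N_{\overline\Gamma}(dt,ds\,du),\quad X^n(0)=X_0,$$ and $\tau_n^X=\inf\{t\ge0:\ X^n(t)\notin[\frac1n,n]^4\}$, which is non-decreasing in $n$; $\widetilde\tau^X=\lim_{n\to\infty}\tau^X_n$. The process $X=(S,V,r^d,r^f)^T$ is the (pathwise unique) solution of $dX(t)=b(X(t-))dt+\int_{\mathbb R^5}g(s,u,X(t-))\widetilde N_{\overline\Gamma}(dt,ds\,du)$, $X(0)=X_0$, on $[0,\widetilde\tau^X)$; it satisfies $X(t)=X^n(t)$ for $t<\tau^X_n$, $n\ge n_0$. A Markov time is a stopping time; "well defined up to $\tau_m$" means that the recursion defining $X_m$ makes sense on $[0,\tau_m)$. *)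

theory Defs
  imports "HOL-Probability.Probability"
begin

section \<open>Paths with jumps\<close>

text \<open>The left limit at \<open>t > 0\<close>, with the convention \<open>f(0-) = f(0)\<close>.\<close>

definition left_lim :: "(real \<Rightarrow> 'a::t2_space) \<Rightarrow> real \<Rightarrow> 'a" where
  "left_lim f t = (if t \<le> 0 then f 0 else Lim (at_left t) f)"

definition jump :: "(real \<Rightarrow> 'a::real_normed_vector) \<Rightarrow> real \<Rightarrow> 'a" where
  "jump f t = f t - left_lim f t"

definition cadlag_on :: "ereal \<Rightarrow> (real \<Rightarrow> 'a::real_normed_vector) \<Rightarrow> bool" where
  "cadlag_on \<tau> f \<longleftrightarrow>
     (\<forall>t\<ge>0. ereal t < \<tau> \<longrightarrow>
        (f \<longlongrightarrow> f t) (at_right t) \<and> (0 < t \<longrightarrow> (\<exists>l. (f \<longlongrightarrow> l) (at_left t))))"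

text \<open>The jump measure of a path on \<open>time \<times> marks\<close>, i.e. the sum of the Dirac masses at
  \<open>(z, \<Delta>f(z))\<close> over all jump times \<open>z\<close>; the counting variable \<open>N(t,A)\<close> is its value on
  \<open>{0<..t} \<times> A\<close>.  There is no jump at time \<open>0\<close>.\<close>

definition jump_measure :: "(real \<Rightarrow> 'a::euclidean_space) \<Rightarrow> (real \<times> 'a) measure" where
  "jump_measure f = distr (count_space {z. 0 < z \<and> jump f z \<noteq> 0}) borel (\<lambda>z. (z, jump f z))"

lemma jump_measure_count:
  assumes "A \<in> sets borel" "0 \<notin> A" "finite {z\<in>{0<..t}. jump f z \<in> A}"
  shows "emeasure (jump_measure f) ({0<..t} \<times> A) = of_nat (card {z\<in>{0<..t}. jump f z \<in> A})"
proof -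
  have A: "{0<..t} \<times> A \<in> sets borel"
    using assms(1) by (simp add: borel_prod[symmetric])
  have "(\<lambda>z. (z, jump f z)) -` ({0<..t} \<times> A) \<inter> space (count_space {z. 0 < z \<and> jump f z \<noteq> 0})
      = {z\<in>{0<..t}. jump f z \<in> A}"
    using assms(2) by auto
  moreover have "{z\<in>{0<..t}. jump f z \<in> A} \<subseteq> {z. 0 < z \<and> jump f z \<noteq> 0}"
    using assms(2) by auto
  ultimately show ?thesis
    unfolding jump_measure_def using A assms(3)
    by (subst emeasure_distr) (auto simp: emeasure_count_space_finite)
qed

section \<open>Filtrations and driving processes\<close>

definition complete_filtered_prob_space :: "'w measure \<Rightarrow> (real \<Rightarrow> 'w measure) \<Rightarrow> bool" where
  "complete_filtered_prob_space M F \<longleftrightarrow>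
     prob_space M \<and> complete_measure M \<and>
     (\<forall>t\<ge>0. subalgebra M (F t)) \<and>
     (\<forall>s t. 0 \<le> s \<longrightarrow> s \<le> t \<longrightarrow> sets (F s) \<subseteq> sets (F t)) \<and>
     null_sets M \<subseteq> sets (F 0)"

text \<open>The library's \<open>stopping_time\<close> uses the same type for the index of the filtration and the
  value of the time; here the times may be infinite.\<close>

definition markov_time :: "'w measure \<Rightarrow> (real \<Rightarrow> 'w measure) \<Rightarrow> ('w \<Rightarrow> ereal) \<Rightarrow> bool" where
  "markov_time M F \<tau> \<longleftrightarrow>
     (\<forall>\<omega>\<in>space M. 0 \<le> \<tau> \<omega>) \<and> (\<forall>t\<ge>0. {\<omega>\<in>space M. \<tau> \<omega> \<le> ereal t} \<in> sets (F t))"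

definition process_sigma ::
  "'w measure \<Rightarrow> real set \<Rightarrow> (real \<Rightarrow> 'w \<Rightarrow> 'a::topological_space) \<Rightarrow> 'w measure" where
  "process_sigma M I Y = vimage_algebra (space M) (\<lambda>\<omega>. \<lambda>t\<in>I. Y t \<omega>) (PiM I (\<lambda>_. borel))"

definition increment_sigma ::
  "'w measure \<Rightarrow> (real \<Rightarrow> 'w \<Rightarrow> 'a::real_normed_vector) \<Rightarrow> real \<Rightarrow> real \<Rightarrow> 'w measure" where
  "increment_sigma M Y s t = vimage_algebra (space M) (\<lambda>\<omega>. Y t \<omega> - Y s \<omega>) borel"

definition independent_processes ::
  "'w measure \<Rightarrow> (real \<Rightarrow> 'w \<Rightarrow> 'a::topological_space) \<Rightarrow> (real \<Rightarrow> 'w \<Rightarrow> 'b::topological_space) \<Rightarrow> bool"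
  where
  "independent_processes M Y Z \<longleftrightarrow>
     prob_space.indep_set M (sets (process_sigma M {0..} Y)) (sets (process_sigma M {0..} Z))"

text \<open>Brownian motion with instantaneous covariance matrix \<open>\<Sigma>\<close> (assumed positive definite),
  relative to its own filtration.  The Gaussian law of an increment is expressed by all its
  non-trivial linear combinations being normal.\<close>

definition brownian_motion ::
  "'w measure \<Rightarrow> real^'n^'n \<Rightarrow> (real \<Rightarrow> 'w \<Rightarrow> real^'n) \<Rightarrow> bool" where
  "brownian_motion M \<Sigma> W \<longleftrightarrow>
     (\<forall>t\<ge>0. W t \<in> borel_measurable M) \<and>
     (AE \<omega> in M. W 0 \<omega> = 0) \<and>
     (AE \<omega> in M. continuous_on {0..} (\<lambda>t. W t \<omega>)) \<and>
     (\<forall>s t. 0 \<le> s \<longrightarrow> s \<le> t \<longrightarrow>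
        prob_space.indep_set M (sets (process_sigma M {0..s} W)) (sets (increment_sigma M W s t))) \<and>
     (\<forall>s t a. 0 \<le> s \<longrightarrow> s < t \<longrightarrow> a \<noteq> 0 \<longrightarrow>
        distributed M lborel (\<lambda>\<omega>. a \<bullet> (W t \<omega> - W s \<omega>))
          (\<lambda>x. ennreal (normal_density 0 (sqrt ((t - s) * (a \<bullet> (\<Sigma> *v a)))) x)))"

definition levy_process ::
  "'w measure \<Rightarrow> (real \<Rightarrow> 'w measure) \<Rightarrow> (real \<Rightarrow> 'w \<Rightarrow> 'a::euclidean_space) \<Rightarrow> bool" where
  "levy_process M F L \<longleftrightarrow>
     (\<forall>t\<ge>0. L t \<in> borel_measurable (F t)) \<and>
     (AE \<omega> in M. L 0 \<omega> = 0) \<and>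
     (\<forall>s t. 0 \<le> s \<longrightarrow> s \<le> t \<longrightarrow>
        prob_space.indep_set M (sets (F s)) (sets (increment_sigma M L s t))) \<and>
     (\<forall>s t. 0 \<le> s \<longrightarrow> s \<le> t \<longrightarrow>
        distr M borel (\<lambda>\<omega>. L t \<omega> - L s \<omega>) = distr M borel (\<lambda>\<omega>. L (t - s) \<omega> - L 0 \<omega>)) \<and>
     (\<forall>t\<ge>0. \<forall>e>0.
        ((\<lambda>s. measure M {\<omega>\<in>space M. e < norm (L s \<omega> - L t \<omega>)}) \<longlongrightarrow> 0) (at t within {0..})) \<and>
     (AE \<omega> in M. cadlag_on \<infinity> (\<lambda>t. L t \<omega>))"

text \<open>The Levy measure of a set is the expected number of jumps in it per unit of time.\<close>

definition has_levy_measure ::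
  "'w measure \<Rightarrow> (real \<Rightarrow> 'w \<Rightarrow> 'a::euclidean_space) \<Rightarrow> 'a measure \<Rightarrow> bool" where
  "has_levy_measure M L \<nu> \<longleftrightarrow>
     (\<forall>A\<in>sets borel. 0 \<notin> A \<longrightarrow>
        emeasure \<nu> A = (\<integral>\<^sup>+\<omega>. emeasure (jump_measure (\<lambda>t. L t \<omega>)) ({0<..1} \<times> A) \<partial>M))"

definition pure_jump_increasing :: "'w measure \<Rightarrow> (real \<Rightarrow> 'w \<Rightarrow> real) \<Rightarrow> bool" where
  "pure_jump_increasing M \<gamma> \<longleftrightarrow>
     (AE \<omega> in M. mono_on {0..} (\<lambda>t. \<gamma> t \<omega>) \<and>
        (\<forall>t\<ge>0. ((\<lambda>z. jump (\<lambda>s. \<gamma> s \<omega>) z) has_sum \<gamma> t \<omega>) {0<..t}))"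

definition gamma_density :: "real \<Rightarrow> real \<Rightarrow> real \<Rightarrow> real" where
  "gamma_density \<alpha> \<beta> s = (if 0 < s then \<alpha> / s * exp (- \<beta> * s) else 0)"

definition gamma_subordinator ::
  "'w measure \<Rightarrow> (real \<Rightarrow> 'w measure) \<Rightarrow> real \<Rightarrow> real \<Rightarrow> (real \<Rightarrow> 'w \<Rightarrow> real) \<Rightarrow> bool" where
  "gamma_subordinator M F \<alpha> \<beta> \<gamma> \<longleftrightarrow>
     levy_process M F \<gamma> \<and> pure_jump_increasing M \<gamma> \<and>
     has_levy_measure M \<gamma> (density lborel (\<lambda>s. ennreal (gamma_density \<alpha> \<beta> s)))"

definition p4 :: "real \<Rightarrow> real^4 \<Rightarrow> real" where
  "p4 s u = (if 0 < s then 1 / (4 * pi\<^sup>2 * s\<^sup>2) * exp (- (norm u)\<^sup>2 / (2 * s)) else 0)"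

definition nu4 :: "real \<Rightarrow> real \<Rightarrow> (real \<times> (real^4)) measure" where
  "nu4 \<alpha> \<beta> = density lborel (\<lambda>(s, u). ennreal (gamma_density \<alpha> \<beta> s * p4 s u))"

definition positive_definite :: "real^'n^'n \<Rightarrow> bool" where
  "positive_definite A \<longleftrightarrow> transpose A = A \<and> (\<forall>x. x \<noteq> 0 \<longrightarrow> 0 < x \<bullet> (A *v x))"

text \<open>In the index type \<open>4\<close> one has \<open>4 = 0\<close>, hence \<open>4 < 1\<close>, so the order of the type
  cannot be used to describe triangularity.\<close>

definition cholesky_factor :: "real^4^4 \<Rightarrow> real^4^4 \<Rightarrow> bool" where
  "cholesky_factor H A \<longleftrightarrow>
     H$1$2 = 0 \<and> H$1$3 = 0 \<and> H$1$4 = 0 \<and> H$2$3 = 0 \<and> H$2$4 = 0 \<and> H$3$4 = 0 \<and>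
     (\<forall>i. 0 < H$i$i) \<and> A = H ** transpose H"

definition correlation_matrix ::
  "real \<Rightarrow> real \<Rightarrow> real \<Rightarrow> real \<Rightarrow> real \<Rightarrow> real \<Rightarrow> real^4^4" where
  "correlation_matrix \<rho>sv \<rho>sd \<rho>sf \<rho>vd \<rho>vf \<rho>df =
     vector [vector [1,   \<rho>sv, \<rho>sd, \<rho>sf],
             vector [\<rho>sv, 1,   \<rho>vd, \<rho>vf],
             vector [\<rho>sd, \<rho>vd, 1,   \<rho>df],
             vector [\<rho>sf, \<rho>vf, \<rho>df, 1]]"

lemma vector_4 [simp]:
  "(vector [a, b, c, d] :: 'a::zero^4) $ 1 = a"
  "(vector [a, b, c, d] :: 'a::zero^4) $ 2 = b"
  "(vector [a, b, c, d] :: 'a::zero^4) $ 3 = c"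
  "(vector [a, b, c, d] :: 'a::zero^4) $ 4 = d"
  unfolding vector_def by simp_all

section \<open>Compensated Poisson integrals and equations\<close>

text \<open>With \<open>N\<close> the jump measure of \<open>L\<close>, the integral
  \<open>\<integral>\<^sub>0\<^sup>t \<integral> 1(|y| > \<epsilon>) G(z,\<omega>,y) (N(dz,dy) - \<nu>(dy) dz)\<close>; only finitely many jumps contribute.\<close>

definition truncated_compensated_integral ::
  "(real \<Rightarrow> 'w \<Rightarrow> 'y::euclidean_space) \<Rightarrow> 'y measure \<Rightarrow> (real \<Rightarrow> 'w \<Rightarrow> 'y \<Rightarrow> 'e::euclidean_space) \<Rightarrow>
     real \<Rightarrow> real \<Rightarrow> 'w \<Rightarrow> 'e" where
  "truncated_compensated_integral L \<nu> G \<epsilon> t \<omega> =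
     set_lebesgue_integral (jump_measure (\<lambda>z. L z \<omega>)) ({0<..t} \<times> {y. \<epsilon> < norm y})
       (\<lambda>(z, y). G z \<omega> y)
     - set_lebesgue_integral (lborel \<Otimes>\<^sub>M \<nu>) ({0<..t} \<times> {y. \<epsilon> < norm y}) (\<lambda>(z, y). G z \<omega> y)"

text \<open>\<open>J\<close> is (a version of) the stochastic integral
  \<open>J(t) = \<integral>\<^sub>0\<^sup>t \<integral> G(z,y) (N - \<nu> dz)(dz,dy)\<close> for \<open>t < \<tau>\<close>: the integrand is almost surely locally
  square integrable before \<open>\<tau>\<close>, and \<open>J\<close> is the limit, as the truncation of the small jumps is
  removed, of the truncated integrals, uniformly on compact time intervals in probability (on
  \<open>{T < \<tau>}\<close>, for every \<open>T\<close>).  Probabilities of the exceptional events are taken as outer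
  probabilities, since \<open>measure\<close> is \<open>0\<close> on non-measurable sets.  The definition is meant for
  predictable integrands; the ones used below are functions of left limits of adapted
  processes.\<close>

definition has_compensated_integral ::
  "'w measure \<Rightarrow> (real \<Rightarrow> 'w \<Rightarrow> 'y::euclidean_space) \<Rightarrow> 'y measure \<Rightarrow> ('w \<Rightarrow> ereal) \<Rightarrow>
     (real \<Rightarrow> 'w \<Rightarrow> 'y \<Rightarrow> 'e::euclidean_space) \<Rightarrow> (real \<Rightarrow> 'w \<Rightarrow> 'e) \<Rightarrow> bool" where
  "has_compensated_integral M L \<nu> \<tau> G J \<longleftrightarrow>
     (AE \<omega> in M. \<forall>t\<ge>0. ereal t < \<tau> \<omega> \<longrightarrow>
        set_borel_measurable (lborel \<Otimes>\<^sub>M \<nu>) ({0<..t} \<times> UNIV) (\<lambda>(z, y). G z \<omega> y) \<and>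
        set_integrable (lborel \<Otimes>\<^sub>M \<nu>) ({0<..t} \<times> UNIV) (\<lambda>(z, y). (norm (G z \<omega> y))\<^sup>2)) \<and>
     (\<forall>T\<ge>0. \<forall>\<delta>>0. \<forall>e>0. eventually
        (\<lambda>\<epsilon>. \<exists>A\<in>sets M. measure M A < e \<and>
           {\<omega>\<in>space M. ereal T < \<tau> \<omega> \<and>
              (\<exists>t\<in>{0..T}. \<delta> < norm (J t \<omega> - truncated_compensated_integral L \<nu> G \<epsilon> t \<omega>))} \<subseteq> A)
        (at_right 0))"

text \<open>\<open>Y\<close> is an adapted cadlag process satisfying, for \<open>t < \<tau>\<close>,
  \<open>Y(t) = x\<^sub>0 + \<integral>\<^sub>0\<^sup>t b(Y(h(z)-)) dz + \<integral>\<^sub>0\<^sup>t \<integral> g(y, Y(h(z)-)) (N - \<nu> dz)(dz,dy)\<close>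
  up to a null set, where all the arguments \<open>Y(h(z)-)\<close> lie in the domain \<open>D\<close> of the coefficients.
  Taking \<open>h(z) = z\<close> gives a stochastic differential equation, taking for \<open>h\<close> the left grid point
  gives its Euler scheme.  Nothing is required of \<open>Y\<close> at or after \<open>\<tau>\<close>.\<close>

definition solves_equation ::
  "'w measure \<Rightarrow> (real \<Rightarrow> 'w measure) \<Rightarrow> (real \<Rightarrow> 'w \<Rightarrow> 'y::euclidean_space) \<Rightarrow> 'y measure \<Rightarrow>
     ('e \<Rightarrow> 'e) \<Rightarrow> ('y \<Rightarrow> 'e \<Rightarrow> 'e) \<Rightarrow> 'e set \<Rightarrow> (real \<Rightarrow> real) \<Rightarrow> 'e \<Rightarrow> ('w \<Rightarrow> ereal) \<Rightarrow>
     (real \<Rightarrow> 'w \<Rightarrow> 'e::euclidean_space) \<Rightarrow> bool" where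
  "solves_equation M F L \<nu> b g D h x0 \<tau> Y \<longleftrightarrow>
     (\<forall>t\<ge>0. (\<lambda>\<omega>. if ereal t < \<tau> \<omega> then Y t \<omega> else 0) \<in> borel_measurable (F t)) \<and>
     (AE \<omega> in M. cadlag_on (\<tau> \<omega>) (\<lambda>t. Y t \<omega>)) \<and>
     (AE \<omega> in M. \<forall>t\<ge>0. ereal t < \<tau> \<omega> \<longrightarrow>
        (\<forall>z\<in>{0<..t}. left_lim (\<lambda>r. Y r \<omega>) (h z) \<in> D) \<and>
        set_integrable lborel {0<..t} (\<lambda>z. b (left_lim (\<lambda>r. Y r \<omega>) (h z)))) \<and>
     (\<exists>J. has_compensated_integral M L \<nu> \<tau> (\<lambda>z \<omega> y. g y (left_lim (\<lambda>r. Y r \<omega>) (h z))) J \<and>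
        (AE \<omega> in M. \<forall>t\<ge>0. ereal t < \<tau> \<omega> \<longrightarrow>
           Y t \<omega> = x0 + (LINT z:{0<..t}|lborel. b (left_lim (\<lambda>r. Y r \<omega>) (h z))) + J t \<omega>))"

section \<open>The model and its Euler scheme\<close>

definition coeff_domain :: "(real^4) set" where
  "coeff_domain = {x. 0 \<le> x$2 \<and> 0 \<le> x$3 \<and> 0 \<le> x$4}"

definition drift_coeff ::
  "real \<Rightarrow> real \<Rightarrow> real \<Rightarrow> real \<Rightarrow> real \<Rightarrow> real \<Rightarrow> real \<Rightarrow> real \<Rightarrow> real^4 \<Rightarrow> real^4" where
  "drift_coeff \<kappa>v \<kappa>d \<kappa>f av ad af \<sigma>f \<rho>sf x =
     vector [x$1 * (x$3 - x$4),
             \<kappa>v * (av - x$2),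
             \<kappa>d * (ad - x$3),
             \<kappa>f * (af - x$4) - \<sigma>f * \<rho>sf * sqrt (x$2 * x$4)]"

definition jump_coeff ::
  "real \<Rightarrow> real \<Rightarrow> real \<Rightarrow> real \<Rightarrow> real \<Rightarrow> real \<Rightarrow> real \<Rightarrow> real^4^4 \<Rightarrow> real \<times> (real^4) \<Rightarrow> real^4 \<Rightarrow> real^4"
  where
  "jump_coeff \<theta>s \<theta>v \<theta>d \<theta>f \<sigma>v \<sigma>d \<sigma>f H = (\<lambda>(s, u) x.
     vector [x$1 * (\<theta>s * s + H$1$1 * u$1 * sqrt (x$2)),
             \<theta>v * s + (H$2$1 * u$1 + H$2$2 * u$2) * \<sigma>v * sqrt (x$2),
             \<theta>d * s + (H$3$1 * u$1 + H$3$2 * u$2 + H$3$3 * u$3) * \<sigma>d * sqrt (x$3),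
             \<theta>f * s + (H$4$1 * u$1 + H$4$2 * u$2 + H$4$3 * u$3 + H$4$4 * u$4) * \<sigma>f * sqrt (x$4)])"

definition cutoff :: "nat \<Rightarrow> (real \<Rightarrow> real) \<Rightarrow> bool" where
  "cutoff n \<psi> \<longleftrightarrow>
     (\<forall>k. (deriv ^^ k) \<psi> differentiable_on UNIV) \<and>
     (\<forall>x. 0 \<le> \<psi> x \<and> \<psi> x \<le> 1) \<and>
     (\<forall>x\<in>{1 / real n..real n}. \<psi> x = 1) \<and>
     closure {x. \<psi> x \<noteq> 0} \<subseteq> {1 / (real n + 1)<..<real n + 1}"

definition cutoff4 :: "(real \<Rightarrow> real) \<Rightarrow> real^4 \<Rightarrow> real" where
  "cutoff4 \<psi> x = (\<Prod>j\<in>UNIV. \<psi> (x$j))"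

definition box4 :: "nat \<Rightarrow> (real^4) set" where
  "box4 n = {x. \<forall>i. 1 / real n \<le> x$i \<and> x$i \<le> real n}"

text \<open>The infimum of the empty set is \<open>\<infinity>\<close>.\<close>

definition exit_time :: "'e set \<Rightarrow> (real \<Rightarrow> 'e) \<Rightarrow> ereal" where
  "exit_time B f = Inf (ereal ` {t. 0 \<le> t \<and> f t \<notin> B})"

definition grid_left :: "real \<Rightarrow> real \<Rightarrow> real" where
  "grid_left \<Delta> z = real_of_int (\<lceil>z / \<Delta>\<rceil> - 1) * \<Delta>"

lemma grid_left_eq:
  assumes "0 < \<Delta>" "real k * \<Delta> < z" "z \<le> (real k + 1) * \<Delta>"
  shows "grid_left \<Delta> z = real k * \<Delta>"
proof -
  have "\<lceil>z / \<Delta>\<rceil> = int k + 1"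
    using assms by (intro ceiling_unique) (auto simp: field_simps)
  then show ?thesis by (simp add: grid_left_def)
qed

end

theory Submission
  imports Defs
begin

text \<open>Although the Levy measure of \<open>L\<close> is infinite, its jumps are almost surely absolutely summable:
  given \<open>\<gamma>\<close>, the expected size of a jump of \<open>Wbar\<close> at the time-changed clock is of order
  \<open>sqrt (\<Delta>\<gamma>)\<close>, and \<open>sqrt\<close> is integrable for the Gamma Levy measure.  Hence every compensated
  integral occurring here is the difference of an absolutely convergent sum over the jumps and of
  its compensator, and the equation and its Euler scheme may be solved path by path.  For a fixed
  path and globally Lipschitz coefficients the scheme converges by a Gronwall inequality for a
  measure with atoms; the error of freezing the coefficients tends to 0 by dominated convergence,
  since the grid points approach each time strictly from the left.  Before \<open>\<tau>lim\<close> the solution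
  stays in a compact box away from the boundary, where the coefficients are Lipschitz, and so does
  the scheme for a fine grid.  The scheme is stopped at the first grid point at which its left
  limit has left the domain of the coefficients.\<close>

section \<open>Cadlag paths\<close>

text \<open>The hypotheses tie the jumps of \<gamma> to a Levy measure, whereas for \<open>L\<close>
  they give laws of increments. So the jumps of \<open>L\<close> are controlled through increments:
  the mean of \<open>norm (L h)\<close> is of order h, because the square root is subadditive along
  the jumps of \<gamma>, and sums over a fine grid of increments converge to sums over jumps. The
  same device makes sums over jumps adapted. A second obstacle is that the equations only assert
  some version \<open>J\<close> of the integral, known as a limit in probability. Uniqueness of that
  limit and completeness of the filtration replace \<open>J\<close> by the pathwise integral. The
  jump coefficient is linear in the mark. Hence the compensator is \<open>g\<close> at the mean jump
  and can be moved into the drift, and a frozen coefficient integrates to \<open>g\<close> at an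
  increment of the sum of jumps. The scheme thus has a closed formula, from which adaptedness can be
  read. The Gronwall constant depends on the path: the measure dz + |y| N(dz,dy) has atoms of any
  size, and each large atom costs a factor.\<close>

lemma left_lim_zero [simp]: "left_lim f 0 = f 0"
  by (simp add: left_lim_def)

lemma left_lim_unique:
  assumes "0 < t" "(f \<longlongrightarrow> l) (at_left t)"
  shows "left_lim f t = l"
  using assms by (simp add: left_lim_def tendsto_Lim trivial_limit_at_left_real)

lemma cadlag_on_left_lim:
  assumes "cadlag_on \<tau> f" "0 < t" "ereal t < \<tau>"
  shows "(f \<longlongrightarrow> left_lim f t) (at_left t)"
proof -
  obtain l where l: "(f \<longlongrightarrow> l) (at_left t)"
    using assms unfolding cadlag_on_def by force
  then show ?thesis
    using left_lim_unique[OF assms(2) l] by simp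
qed

text \<open>The disjunction follows the convention f(0-) = f 0: for t > 0 only values strictly
  before t matter, and at t = 0 only the value there.\<close>

lemma left_lim_closed:
  assumes "cadlag_on \<tau> f" "0 \<le> t" "ereal t < \<tau>" "closed S"
    and S: "\<And>u. 0 \<le> u \<Longrightarrow> u < t \<or> t = 0 \<and> u = 0 \<Longrightarrow> f u \<in> S"
  shows "left_lim f t \<in> S"
proof (cases "t = 0")
  case True then show ?thesis using S[of 0] by simp
next
  case False
  then have t: "0 < t" using assms by simp
  show ?thesis
  proof (rule Lim_in_closed_set[OF assms(4) _ _ cadlag_on_left_lim[OF assms(1) t assms(3)]])
    show "eventually (\<lambda>u. f u \<in> S) (at_left t)"
      unfolding eventually_at_left_field using t S by (intro exI[of _ 0]) auto
  qed simp
qed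

lemma left_lim_cong:
  assumes "\<And>u. 0 \<le> u \<Longrightarrow> u < t \<or> t = 0 \<and> u = 0 \<Longrightarrow> f u = g u" "0 \<le> t"
  shows "left_lim f t = left_lim g t"
proof (cases "t = 0")
  case False
  then have "eventually (\<lambda>u. f u = g u) (at_left t)"
    unfolding eventually_at_left_field using assms by (intro exI[of _ 0]) auto
  then have "(f \<longlongrightarrow> l) (at_left t) \<longleftrightarrow> (g \<longlongrightarrow> l) (at_left t)" for l
    by (rule tendsto_cong)
  then show ?thesis
    using False assms(2) by (simp add: left_lim_def Topological_Spaces.Lim_def)
qed (use assms in simp)

text \<open>One radius serves both sides of z, with the left limit as reference before z and the
  value as reference from z on. The compactness arguments on \<open>{0..T}\<close> start from
  it.\<close>

lemma cadlag_on_local: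
  assumes "cadlag_on \<tau> f" "0 \<le> z" "ereal z < \<tau>" "0 < e"
  obtains d where "0 < d" "\<And>a. 0 \<le> a \<Longrightarrow> z - d < a \<Longrightarrow> a < z \<Longrightarrow> norm (f a - left_lim f z) < e"
    "\<And>b. z \<le> b \<Longrightarrow> b < z + d \<Longrightarrow> norm (f b - f z) < e"
proof -
  have "(f \<longlongrightarrow> f z) (at_right z)" using assms by (auto simp: cadlag_on_def)
  then have "eventually (\<lambda>b. dist (f b) (f z) < e) (at_right z)"
    using assms(4) by (rule tendstoD)
  then obtain c where c: "z < c" "\<And>b. z < b \<Longrightarrow> b < c \<Longrightarrow> dist (f b) (f z) < e"
    unfolding eventually_at_right_field by blast
  obtain c' where c': "c' < z" "\<And>b. 0 \<le> b \<Longrightarrow> c' < b \<Longrightarrow> b < z \<Longrightarrow> dist (f b) (left_lim f z) < e"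
  proof (cases "z = 0")
    case True then show ?thesis using that[of "-1"] by auto
  next
    case False
    then have "eventually (\<lambda>b. dist (f b) (left_lim f z) < e) (at_left z)"
      using tendstoD[OF cadlag_on_left_lim[OF assms(1) _ assms(3)] assms(4)] assms(2) by simp
    then show ?thesis
      unfolding eventually_at_left_field using that by blast
  qed
  show ?thesis
  proof (rule that[of "min (c - z) (z - c')"])
    show "0 < min (c - z) (z - c')" using c(1) c'(1) by simp
    show "norm (f a - left_lim f z) < e" if "0 \<le> a" "z - min (c - z) (z - c') < a" "a < z" for a
      using c'(2)[of a] that by (auto simp: dist_norm)
    show "norm (f b - f z) < e" if "z \<le> b" "b < z + min (c - z) (z - c')" for b
      using c(2)[of b] that assms(4) by (cases "b = z") (auto simp: dist_norm)
  qed
qed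

lemma cadlag_on_mono: "cadlag_on \<tau> f \<Longrightarrow> \<tau>' \<le> \<tau> \<Longrightarrow> cadlag_on \<tau>' f"
  by (auto simp: cadlag_on_def)

text \<open>Near each z the path is within 1 of its left limit or of its value, and finitely many
  such neighbourhoods cover \<open>{0..T}\<close>.\<close>

lemma cadlag_on_bounded:
  assumes "cadlag_on \<tau> f" "ereal T < \<tau>"
  obtains B where "0 \<le> B" "\<And>t. 0 \<le> t \<Longrightarrow> t \<le> T \<Longrightarrow> norm (f t) \<le> B"
proof -
  have "\<exists>d>0. \<exists>B. \<forall>a. 0 \<le> a \<longrightarrow> \<bar>a - z\<bar> < d \<longrightarrow> norm (f a) \<le> B" if z: "z \<in> {0..T}" for z
  proof -
    from z have "ereal z < \<tau>" using assms(2) by (auto intro: le_less_trans[of _ "ereal T"])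
    from cadlag_on_local[OF assms(1) _ this, of 1] z obtain d where d: "0 < d"
      "\<And>a. 0 \<le> a \<Longrightarrow> z - d < a \<Longrightarrow> a < z \<Longrightarrow> norm (f a - left_lim f z) < 1"
      "\<And>b. z \<le> b \<Longrightarrow> b < z + d \<Longrightarrow> norm (f b - f z) < 1" by auto
    have "norm (f a) \<le> max (norm (left_lim f z)) (norm (f z)) + 1" if a: "0 \<le> a" "\<bar>a - z\<bar> < d" for a
    proof (cases "a < z")
      case True
      then have "norm (f a - left_lim f z) < 1" using d(2)[of a] a by auto
      then show ?thesis using norm_triangle_sub[of "f a" "left_lim f z"] by linarith
    next
      case False
      then have "norm (f a - f z) < 1" using d(3)[of a] a by auto
      then show ?thesis using norm_triangle_sub[of "f a" "f z"] by linarith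
    qed
    then show ?thesis using d(1) by blast
  qed
  then obtain d B where dB: "\<And>z. z \<in> {0..T} \<Longrightarrow> 0 < d z"
    "\<And>z a. z \<in> {0..T} \<Longrightarrow> 0 \<le> a \<Longrightarrow> \<bar>a - z\<bar> < d z \<Longrightarrow> norm (f a) \<le> B z" by metis
  obtain C where C: "C \<subseteq> {0..T}" "finite C" "{0..T} \<subseteq> (\<Union>z\<in>C. ball z (d z))"
  proof (rule compactE_image[of "{0..T}" "{0..T}" "\<lambda>z. ball z (d z)"])
    show "{0..T} \<subseteq> (\<Union>z\<in>{0..T}. ball z (d z))" using dB(1) by force
  qed auto
  \<comment> \<open>A sum of absolute values instead of a maximum makes sense for an empty cover
    too, which occurs when T < 0.\<close>
  have "norm (f t) \<le> (\<Sum>z\<in>C. \<bar>B z\<bar>)" if t: "0 \<le> t" "t \<le> T" for t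
  proof -
    have "t \<in> (\<Union>z\<in>C. ball z (d z))" using t by (intro subsetD[OF C(3)]) auto
    then obtain z where z: "z \<in> C" "t \<in> ball z (d z)" by blast
    then have "norm (f t) \<le> B z" using dB(2)[of z t] C(1) t by (auto simp: dist_real_def)
    also have "\<dots> \<le> \<bar>B z\<bar>" by simp
    also have "\<dots> \<le> (\<Sum>z\<in>C. \<bar>B z\<bar>)" using member_le_sum[OF z(1), of "\<lambda>z. \<bar>B z\<bar>"] C(2) by simp
    finally show ?thesis .
  qed
  then show ?thesis using that[of "\<Sum>z\<in>C. \<bar>B z\<bar>"] by (simp add: sum_nonneg)
qed

lemma left_lim_norm_le:
  assumes "cadlag_on \<tau> f" "0 \<le> t" "ereal t < \<tau>" "\<And>u. 0 \<le> u \<Longrightarrow> u \<le> t \<Longrightarrow> norm (f u) \<le> B"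
  shows "norm (left_lim f t) \<le> B"
proof -
  have "left_lim f t \<in> cball 0 B"
    by (rule left_lim_closed[OF assms(1-3) closed_cball]) (use assms(2,4) in auto)
  then show ?thesis by simp
qed

text \<open>In a punctured neighbourhood of any z the path clusters at the left limit or at the
  value, so a large jump can only sit at z itself. By compactness the large jumps are among finitely
  many centres.\<close>

lemma finite_large_jumps:
  assumes "cadlag_on \<tau> f" "ereal T < \<tau>" "0 < e"
  shows "finite {z\<in>{0<..T}. e \<le> norm (jump f z)}"
proof -
  have "\<exists>d>0. \<forall>w. 0 < w \<longrightarrow> ereal w < \<tau> \<longrightarrow> \<bar>w - z\<bar> < d \<longrightarrow> w \<noteq> z \<longrightarrow> norm (jump f w) < e" if z: "z \<in> {0..T}" for z
  proof -
    from z have "ereal z < \<tau>" using assms(2) by (auto intro: le_less_trans[of _ "ereal T"])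
    from cadlag_on_local[OF assms(1) _ this, of "e/4"] z assms(3) obtain d where d: "0 < d"
      "\<And>a. 0 \<le> a \<Longrightarrow> z - d < a \<Longrightarrow> a < z \<Longrightarrow> norm (f a - left_lim f z) < e/4"
      "\<And>b. z \<le> b \<Longrightarrow> b < z + d \<Longrightarrow> norm (f b - f z) < e/4" by auto
    have "norm (jump f w) < e" if w: "0 < w" "ereal w < \<tau>" "\<bar>w - z\<bar> < d" "w \<noteq> z" for w
    proof -
      \<comment> \<open>The reference point \<open>l\<close> is the left limit of f at z if w < z
        and the value at z otherwise; on an interval ending at w the path stays within e/4 of it.
        Closed balls keep this for the left limit at w, so the jump is at most e/2.\<close>
      obtain c l where cl: "c < w" "norm (f w - l) \<le> e/4" "\<And>u. 0 \<le> u \<Longrightarrow> c < u \<Longrightarrow> u < w \<Longrightarrow> norm (f u - l) \<le> e/4"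
      proof (cases "w < z")
        case True
        show ?thesis using that[of "z - d" "left_lim f z"] d(2) w True by (force intro: less_imp_le)
      next
        case False
        then show ?thesis using that[of z "f z"] d(3) w by (force intro: less_imp_le)
      qed
      have "left_lim f w \<in> cball l (e/4)"
      proof (rule Lim_in_closed_set[OF closed_cball _ _ cadlag_on_left_lim[OF assms(1) w(1,2)]])
        show "eventually (\<lambda>u. f u \<in> cball l (e/4)) (at_left w)"
          unfolding eventually_at_left_field using cl w
          by (intro exI[of _ "max c 0"]) (auto simp: dist_norm norm_minus_commute)
      qed simp
      then have "norm (left_lim f w - l) \<le> e/4" by (simp add: dist_norm norm_minus_commute)
      then have "norm (jump f w) \<le> e/4 + e/4"
        unfolding jump_def using cl(2) norm_triangle_ineq4[of "f w - l" "left_lim f w - l"] by simp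
      then show ?thesis using assms(3) by simp
    qed
    then show ?thesis using d(1) by blast
  qed
  then obtain d where d: "\<And>z. z \<in> {0..T} \<Longrightarrow> 0 < d z"
    "\<And>z w. z \<in> {0..T} \<Longrightarrow> 0 < w \<Longrightarrow> ereal w < \<tau> \<Longrightarrow> \<bar>w - z\<bar> < d z \<Longrightarrow> w \<noteq> z \<Longrightarrow> norm (jump f w) < e" by metis
  obtain C where C: "C \<subseteq> {0..T}" "finite C" "{0..T} \<subseteq> (\<Union>z\<in>C. ball z (d z))"
  proof (rule compactE_image[of "{0..T}" "{0..T}" "\<lambda>z. ball z (d z)"])
    show "{0..T} \<subseteq> (\<Union>z\<in>{0..T}. ball z (d z))" using d(1) by force
  qed auto
  have "{z\<in>{0<..T}. e \<le> norm (jump f z)} \<subseteq> C"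
  proof safe
    fix w assume w: "w \<in> {0<..T}" "e \<le> norm (jump f w)"
    then have "w \<in> (\<Union>z\<in>C. ball z (d z))" using w by (intro subsetD[OF C(3)]) auto
    then obtain z where z: "z \<in> C" "w \<in> ball z (d z)" by blast
    have "ereal w < \<tau>" using w assms(2) by (auto intro: le_less_trans[of _ "ereal T"])
    then show "w \<in> C" using d(2)[of z w] z C(1) w by (force simp: dist_real_def)
  qed
  then show ?thesis using C(2) finite_subset by blast
qed

text \<open>This is the modulus of continuity of a cadlag path: an increment over a short interval
  is small unless the interval contains a large jump. Across a centre z the increment is the jump at
  z up to two small errors.\<close>

lemma cadlag_on_increment:
  assumes "cadlag_on \<tau> f" "ereal T < \<tau>" "0 < e"
  obtains d where "0 < d" "\<And>a b. 0 \<le> a \<Longrightarrow> a < b \<Longrightarrow> b \<le> T \<Longrightarrow> b - a < d \<Longrightarrow>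
    norm (f b - f a) < e \<or> (\<exists>z. a < z \<and> z \<le> b \<and> e \<le> norm (jump f z))"
proof -
  have "\<exists>d>0. \<forall>a b. 0 \<le> a \<longrightarrow> a < b \<longrightarrow> z - d < a \<longrightarrow> b < z + d \<longrightarrow>
      norm (f b - f a) < e \<or> (a < z \<and> z \<le> b \<and> e \<le> norm (jump f z))" if z: "z \<in> {0..T}" for z
  proof -
    \<comment> \<open>When the jump at z is below e, half of the remaining gap is allowed on each
      side, so that jump plus both errors stays within e.\<close>
    define e' where "e' = (if e \<le> norm (jump f z) then e/2 else min (e/2) ((e - norm (jump f z))/2))"
    have e': "0 < e'" "e' \<le> e/2" "norm (jump f z) < e \<Longrightarrow> norm (jump f z) + 2*e' \<le> e"
      using assms(3) by (auto simp: e'_def min_def field_simps)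
    from z have "ereal z < \<tau>" using assms(2) by (auto intro: le_less_trans[of _ "ereal T"])
    from cadlag_on_local[OF assms(1) _ this e'(1)] z obtain d where d: "0 < d"
      "\<And>a. 0 \<le> a \<Longrightarrow> z - d < a \<Longrightarrow> a < z \<Longrightarrow> norm (f a - left_lim f z) < e'"
      "\<And>b. z \<le> b \<Longrightarrow> b < z + d \<Longrightarrow> norm (f b - f z) < e'" by auto
    have "norm (f b - f a) < e \<or> (a < z \<and> z \<le> b \<and> e \<le> norm (jump f z))"
      if ab: "0 \<le> a" "a < b" "z - d < a" "b < z + d" for a b
    proof -
      consider "b < z" | "z \<le> a" | "a < z" "z \<le> b" by linarith
      then show ?thesis
      proof cases
        case 1
        then have "norm (f a - left_lim f z) < e'" "norm (f b - left_lim f z) < e'"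
          using d(2)[of a] d(2)[of b] ab by auto
        then show ?thesis using norm_triangle_ineq4[of "f b - left_lim f z" "f a - left_lim f z"] e'(2) by simp
      next
        case 2
        then have "norm (f a - f z) < e'" "norm (f b - f z) < e'"
          using d(3)[of a] d(3)[of b] ab by auto
        then show ?thesis using norm_triangle_ineq4[of "f b - f z" "f a - f z"] e'(2) by simp
      next
        case 3
        then have n: "norm (f a - left_lim f z) < e'" "norm (f b - f z) < e'"
          using d(2)[of a] d(3)[of b] ab by auto
        have "f b - f a = jump f z + ((f b - f z) - (f a - left_lim f z))"
          by (simp add: jump_def)
        then have "norm (f b - f a) \<le> norm (jump f z) + norm ((f b - f z) - (f a - left_lim f z))"
          by (metis norm_triangle_ineq)
        also have "\<dots> < norm (jump f z) + 2*e'"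
          using n norm_triangle_ineq4[of "f b - f z" "f a - left_lim f z"] by linarith
        finally show ?thesis using 3 e'(3) by linarith
      qed
    qed
    then show ?thesis using d(1) by blast
  qed
  then obtain d where d: "\<And>z. z \<in> {0..T} \<Longrightarrow> 0 < d z"
    "\<And>z a b. z \<in> {0..T} \<Longrightarrow> 0 \<le> a \<Longrightarrow> a < b \<Longrightarrow> z - d z < a \<Longrightarrow> b < z + d z \<Longrightarrow>
      norm (f b - f a) < e \<or> (a < z \<and> z \<le> b \<and> e \<le> norm (jump f z))" by metis
  have "{0..T} \<subseteq> \<Union> ((\<lambda>z. ball z (d z)) ` {0..T})" using d(1) by force
  \<comment> \<open>The Lebesgue number of the cover turns the local radii into one mesh width for
    the whole interval.\<close>
  from Heine_Borel_lemma[OF compact_Icc this] obtain \<delta> where \<delta>: "0 < \<delta>"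
    "\<And>x. x \<in> {0..T} \<Longrightarrow> \<exists>G\<in>(\<lambda>z. ball z (d z)) ` {0..T}. ball x \<delta> \<subseteq> G" by auto
  have "norm (f b - f a) < e \<or> (\<exists>z. a < z \<and> z \<le> b \<and> e \<le> norm (jump f z))"
    if ab: "0 \<le> a" "a < b" "b \<le> T" "b - a < \<delta>" for a b
  proof -
    obtain z where z: "z \<in> {0..T}" "ball a \<delta> \<subseteq> ball z (d z)" using \<delta>(2)[of a] ab by auto
    have "a \<in> ball z (d z)" "b \<in> ball z (d z)" using z(2) \<delta>(1) ab by (auto simp: dist_real_def subset_iff)
    then show ?thesis using d(2)[OF z(1) ab(1,2)] by (auto simp: dist_real_def abs_less_iff)
  qed
  then show ?thesis using that \<delta>(1) by blast
qed


text \<open>This is the bridge from increments to jumps, used both for adaptedness and for moment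
  bounds. As \<phi> vanishes near 0, on a fine grid only the cells holding a large jump contribute,
  and the increment over such a cell tends to the jump.\<close>

lemma riemann_jump_sum:
  fixes f :: "real \<Rightarrow> 'a::real_normed_vector" and \<phi> :: "'a \<Rightarrow> 'b::real_normed_vector"
  assumes f: "cadlag_on \<tau> f" "ereal T < \<tau>" and T: "0 < T" and e: "0 < e"
    and \<phi>: "continuous_on UNIV \<phi>" "\<And>y. norm y < e \<Longrightarrow> \<phi> y = 0"
  shows "(\<lambda>n. \<Sum>i<Suc n. \<phi> (f (T * real (Suc i) / real (Suc n)) - f (T * real i / real (Suc n))))
    \<longlonglongrightarrow> (\<Sum>z\<in>{z\<in>{0<..T}. e \<le> norm (jump f z)}. \<phi> (jump f z))"
proof -
  define J where "J = {z\<in>{0<..T}. e \<le> norm (jump f z)}"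
  \<comment> \<open>\<open>k n z\<close> is the cell holding z. Cells are open on the left and
    closed on the right, hence the ceiling minus one.\<close>
  define k where "k n z = nat (\<lceil>z * real (Suc n) / T\<rceil> - 1)" for n z
  define a where "a n i = T * real i / real (Suc n)" for n i :: nat
  have fin: "finite J" unfolding J_def by (rule finite_large_jumps[OF f e])
  have a_Suc: "a n (Suc i) = a n i + T / real (Suc n)" for n i
    by (simp add: a_def add_divide_distrib distrib_left)
  have k: "k n z < Suc n" "a n (k n z) < z" "z \<le> a n (Suc (k n z))" if z: "0 < z" "z \<le> T" for n z
  proof -
    define c where "c = z * real (Suc n) / T"
    have c: "0 < c" "c \<le> real (Suc n)" "z = T * c / real (Suc n)"
      using z T by (auto simp: c_def divide_le_eq mult_right_mono simp del: of_nat_Suc)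
    have kk: "real (k n z) = real_of_int \<lceil>c\<rceil> - 1" using c(1) by (simp add: k_def c_def)
    have "\<lceil>c\<rceil> \<le> int (Suc n)" using c(2) by (simp add: ceiling_le_iff)
    then have "real_of_int \<lceil>c\<rceil> \<le> real (Suc n)" by linarith
    then show "k n z < Suc n" using kk by linarith
    have "real (k n z) < c" using kk by linarith
    then have "a n (k n z) < T * c / real (Suc n)"
      unfolding a_def using T by (intro divide_strict_right_mono mult_strict_left_mono) auto
    then show "a n (k n z) < z" using c(3) by simp
    have "c \<le> real (Suc (k n z))" using kk by linarith
    then have "T * c / real (Suc n) \<le> a n (Suc (k n z))"
      unfolding a_def using T by (intro divide_right_mono mult_left_mono) auto
    then show "z \<le> a n (Suc (k n z))" using c(3) by simp
  qed
  have k_unique: "k n z = i" if "a n i < z" "z \<le> a n (Suc i)" "i < Suc n" "0 < z" "z \<le> T" for n z i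
  proof -
    have m: "x < y \<Longrightarrow> a n (Suc x) \<le> a n y" for x y :: nat
      unfolding a_def using T by (intro divide_right_mono mult_left_mono) auto
    show ?thesis using k[OF that(4,5), of n] m[of i "k n z"] m[of "k n z" i] that(1,2)
      by (meson leD linorder_neqE_nat order_le_less_trans order_less_le_trans)
  qed
  have step: "(\<lambda>n. T / real (Suc n)) \<longlonglongrightarrow> 0"
    using LIMSEQ_Suc[OF lim_const_over_n[of T]] by simp
  have small: "eventually (\<lambda>n. T / real (Suc n) < d) sequentially" if "0 < d" for d
    using order_tendstoD(2)[OF step that] .
  have incr: "(\<lambda>n. f (a n (Suc (k n z))) - f (a n (k n z))) \<longlonglongrightarrow> jump f z" if "z \<in> J" for z
  proof (rule LIMSEQ_I)
    fix r :: real assume r: "0 < r"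
    have z: "0 < z" "z \<le> T" using that by (auto simp: J_def)
    then have "ereal z < \<tau>" using f(2) by (auto intro: le_less_trans[of _ "ereal T"])
    from cadlag_on_local[OF f(1) _ this, of "r/2"] z r obtain d where d: "0 < d"
      "\<And>a. 0 \<le> a \<Longrightarrow> z - d < a \<Longrightarrow> a < z \<Longrightarrow> norm (f a - left_lim f z) < r/2"
      "\<And>b. z \<le> b \<Longrightarrow> b < z + d \<Longrightarrow> norm (f b - f z) < r/2" by auto
    obtain N where N: "\<And>n. N \<le> n \<Longrightarrow> T / real (Suc n) < d"
      using small[OF d(1)] by (auto simp: eventually_sequentially)
    have "norm (f (a n (Suc (k n z))) - f (a n (k n z)) - jump f z) < r" if "N \<le> n" for n
    proof -
      have A: "norm (f (a n (k n z)) - left_lim f z) < r/2"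
        by (rule d(2)) (use k[OF z, of n] N[OF that] a_Suc[of n "k n z"] T in \<open>auto simp: a_def\<close>)
      have B: "norm (f (a n (Suc (k n z))) - f z) < r/2"
        by (rule d(3)) (use k[OF z, of n] N[OF that] a_Suc[of n "k n z"] in auto)
      have eq: "f (a n (Suc (k n z))) - f (a n (k n z)) - jump f z
        = (f (a n (Suc (k n z))) - f z) - (f (a n (k n z)) - left_lim f z)" by (simp add: jump_def)
      show ?thesis unfolding eq
        using A B norm_triangle_ineq4[of "f (a n (Suc (k n z))) - f z" "f (a n (k n z)) - left_lim f z"] by linarith
    qed
    then show "\<exists>no. \<forall>n\<ge>no. norm (f (a n (Suc (k n z))) - f (a n (k n z)) - jump f z) < r" by blast
  qed
  have lim: "(\<lambda>n. \<Sum>z\<in>J. \<phi> (f (a n (Suc (k n z))) - f (a n (k n z)))) \<longlonglongrightarrow> (\<Sum>z\<in>J. \<phi> (jump f z))"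
  proof (rule tendsto_sum)
    fix z assume "z \<in> J"
    have "isCont \<phi> (jump f z)" using \<phi>(1) by (simp add: continuous_on_eq_continuous_at)
    then show "(\<lambda>n. \<phi> (f (a n (Suc (k n z))) - f (a n (k n z)))) \<longlonglongrightarrow> \<phi> (jump f z)"
      by (rule isCont_tendsto_compose[OF _ incr[OF \<open>z \<in> J\<close>]])
  qed
  obtain d where d: "0 < d" "\<And>a b. 0 \<le> a \<Longrightarrow> a < b \<Longrightarrow> b \<le> T \<Longrightarrow> b - a < d \<Longrightarrow>
    norm (f b - f a) < e \<or> (\<exists>z. a < z \<and> z \<le> b \<and> e \<le> norm (jump f z))"
    using cadlag_on_increment[OF f e] by blast
  \<comment> \<open>On a grid finer than every gap between two large jumps, distinct large jumps
    occupy distinct cells. If it is also finer than the modulus \<open>d\<close>, all other cells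
    have increments below e, where \<phi> vanishes.\<close>
  have "eventually (\<lambda>n. z \<noteq> z' \<longrightarrow> T / real (Suc n) < \<bar>z - z'\<bar>) sequentially" for z z'
    using small[of "\<bar>z - z'\<bar>"] by (cases "z = z'") simp_all
  then have "eventually (\<lambda>n. \<forall>z\<in>J. \<forall>z'\<in>J. z \<noteq> z' \<longrightarrow> T / real (Suc n) < \<bar>z - z'\<bar>) sequentially"
    by (intro eventually_ball_finite fin ballI)
  then have "eventually (\<lambda>n. (\<Sum>z\<in>J. \<phi> (f (a n (Suc (k n z))) - f (a n (k n z))))
      = (\<Sum>i<Suc n. \<phi> (f (a n (Suc i)) - f (a n i)))) sequentially"
    using small[OF d(1)]
  proof eventually_elim
    case (elim n)
    have J: "0 < z" "z \<le> T" if "z \<in> J" for z using that by (auto simp: J_def)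
    have inj: "inj_on (k n) J"
    proof (rule inj_onI)
      fix z z' assume z: "z \<in> J" "z' \<in> J" "k n z = k n z'"
      then have "\<bar>z - z'\<bar> < T / real (Suc n)"
        using k(2,3)[OF J[OF z(1)], of n] k(2,3)[OF J[OF z(2)], of n] a_Suc[of n "k n z"] by auto
      then show "z = z'" using elim(1) z(1,2) by force
    qed
    have "(\<Sum>z\<in>J. \<phi> (f (a n (Suc (k n z))) - f (a n (k n z))))
      = (\<Sum>i\<in>k n ` J. \<phi> (f (a n (Suc i)) - f (a n i)))"
      by (simp add: sum.reindex[OF inj] comp_def)
    also have "\<dots> = (\<Sum>i<Suc n. \<phi> (f (a n (Suc i)) - f (a n i)))"
    proof (rule sum.mono_neutral_left)
      show "k n ` J \<subseteq> {..<Suc n}" using k(1) J by blast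
      show "\<forall>i\<in>{..<Suc n} - k n ` J. \<phi> (f (a n (Suc i)) - f (a n i)) = 0"
      proof
        fix i assume i: "i \<in> {..<Suc n} - k n ` J"
        have le: "a n (Suc i) \<le> T" using i T by (simp add: a_def field_simps)
        have "0 \<le> a n i" using T by (simp add: a_def)
        have "a n i < a n (Suc i)" using T by (simp add: a_Suc)
        have "\<not> (\<exists>z. a n i < z \<and> z \<le> a n (Suc i) \<and> e \<le> norm (jump f z))"
        proof
          assume "\<exists>z. a n i < z \<and> z \<le> a n (Suc i) \<and> e \<le> norm (jump f z)"
          then obtain z where z: "a n i < z" "z \<le> a n (Suc i)" "e \<le> norm (jump f z)" by blast
          have zz: "0 < z" "z \<le> T" using z \<open>0 \<le> a n i\<close> le by auto
          then have "z \<in> J" using z by (simp add: J_def)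
          moreover have "k n z = i" using k_unique[OF z(1,2) _ zz] i by simp
          ultimately show False using i by blast
        qed
        then have "norm (f (a n (Suc i)) - f (a n i)) < e"
          using d(2)[OF \<open>0 \<le> a n i\<close> \<open>a n i < a n (Suc i)\<close> le] elim(2) a_Suc[of n i] by auto
        then show "\<phi> (f (a n (Suc i)) - f (a n i)) = 0" by (rule \<phi>(2))
      qed
    qed simp
    finally show ?case .
  qed
  from Lim_transform_eventually[OF lim this] show ?thesis unfolding a_def J_def .
qed

section \<open>Left grid points and left limits\<close>

lemma grid_left_bounds:
  assumes "0 < \<Delta>" "0 < z"
  shows "0 \<le> grid_left \<Delta> z" "grid_left \<Delta> z < z" "z - \<Delta> \<le> grid_left \<Delta> z"
    "\<exists>k::nat. grid_left \<Delta> z = real k * \<Delta>"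
proof -
  have c: "1 \<le> \<lceil>z / \<Delta>\<rceil>" using assms by (simp add: le_ceiling_iff)
  then show "0 \<le> grid_left \<Delta> z" using assms by (simp add: grid_left_def)
  define c where "c = z / \<Delta>"
  have z: "z = c * \<Delta>" using assms by (simp add: c_def)
  have "real_of_int \<lceil>c\<rceil> - 1 < c" "c - 1 \<le> real_of_int \<lceil>c\<rceil> - 1" by linarith+
  from mult_strict_right_mono[OF this(1) assms(1)] mult_right_mono[OF this(2) less_imp_le[OF assms(1)]]
  show "grid_left \<Delta> z < z" "z - \<Delta> \<le> grid_left \<Delta> z"
    by (simp_all add: grid_left_def flip: c_def) (simp_all add: z left_diff_distrib)
  have "grid_left \<Delta> z = real (nat (\<lceil>z / \<Delta>\<rceil> - 1)) * \<Delta>" using c by (simp add: grid_left_def)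
  then show "\<exists>k::nat. grid_left \<Delta> z = real k * \<Delta>" by blast
qed

text \<open>The composition factors through the integers, on which every function is measurable;
  therefore f may be arbitrary.\<close>

lemma borel_measurable_grid_comp:
  fixes f :: "real \<Rightarrow> 'a::topological_space"
  shows "(\<lambda>z. f (grid_left \<Delta> z)) \<in> borel_measurable borel"
proof -
  have "(\<lambda>i::int. f (real_of_int (i - 1) * \<Delta>)) \<in> measurable (count_space UNIV) borel" by simp
  moreover have "(\<lambda>z::real. \<lceil>z / \<Delta>\<rceil>) \<in> measurable borel (count_space UNIV)" by measurable
  ultimately have "(\<lambda>i::int. f (real_of_int (i - 1) * \<Delta>)) \<circ> (\<lambda>z::real. \<lceil>z / \<Delta>\<rceil>) \<in> borel_measurable borel"
    by (rule measurable_comp[rotated])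
  then show ?thesis by (simp add: grid_left_def comp_def)
qed

lemma filterlim_at_left_seq:
  fixes u :: "nat \<Rightarrow> real"
  assumes "\<And>n. u n < z" "u \<longlonglongrightarrow> z"
  shows "filterlim u (at_left z) sequentially"
  unfolding filterlim_at using assms by (auto intro!: always_eventually simp: less_imp_neq)

lemma grid_left_tendsto:
  assumes "0 < z" "\<And>n. 0 < \<Delta> n" "\<Delta> \<longlonglongrightarrow> 0"
  shows "(\<lambda>n. grid_left (\<Delta> n) z) \<longlonglongrightarrow> z"
proof (rule tendsto_sandwich[where f = "\<lambda>n. z - \<Delta> n" and h = "\<lambda>_. z"])
  show "(\<lambda>n. z - \<Delta> n) \<longlonglongrightarrow> z" using tendsto_diff[OF tendsto_const assms(3), of z] by simp
qed (use grid_left_bounds[OF assms(2) assms(1)] in \<open>auto intro: less_imp_le always_eventually\<close>)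

text \<open>Grid points approach z strictly from the left, so the left limit is a pointwise limit of
  grid-frozen values, which are measurable.\<close>

lemma borel_measurable_left_lim:
  fixes f :: "real \<Rightarrow> 'a::{real_normed_vector, second_countable_topology}"
  assumes "cadlag_on \<tau> f" "ereal t < \<tau>"
  shows "(\<lambda>z. indicator {0<..t} z *\<^sub>R left_lim f z) \<in> borel_measurable borel"
proof (rule borel_measurable_LIMSEQ_metric)
  show "(\<lambda>z. indicator {0<..t} z *\<^sub>R f (grid_left (1 / real (Suc n)) z)) \<in> borel_measurable borel" for n
    by (intro borel_measurable_scaleR borel_measurable_grid_comp borel_measurable_indicator) auto
  fix z :: real
  have "(\<lambda>n. f (grid_left (1 / real (Suc n)) z)) \<longlonglongrightarrow> left_lim f z" if z: "0 < z" "z \<le> t"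
  proof (rule filterlim_compose[OF cadlag_on_left_lim[OF assms(1) z(1)]])
    show "ereal z < \<tau>" using z assms(2) by (auto intro: le_less_trans[of _ "ereal t"])
    show "filterlim (\<lambda>n. grid_left (1 / real (Suc n)) z) (at_left z) sequentially"
      using z grid_left_bounds(2) LIMSEQ_Suc[OF lim_const_over_n[of 1]]
      by (intro filterlim_at_left_seq grid_left_tendsto) auto
  qed
  then show "(\<lambda>n. indicator {0<..t} z *\<^sub>R f (grid_left (1 / real (Suc n)) z))
      \<longlonglongrightarrow> indicator {0<..t} z *\<^sub>R left_lim f z"
    by (auto simp: indicator_def)
qed

text \<open>The scheme freezes left limits, not values, at grid points. Strictly before z all values
  near z lie in a closed ball around the left limit at z, and closed balls retain their left
  limits.\<close>

lemma left_lim_tendsto_left_lim: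
  assumes "cadlag_on \<tau> f" "0 < z" "ereal z < \<tau>"
    and "u \<longlonglongrightarrow> z" "\<And>n. 0 \<le> u n" "\<And>n. u n < z"
  shows "(\<lambda>n. left_lim f (u n)) \<longlonglongrightarrow> left_lim f z"
proof (rule LIMSEQ_I)
  fix r :: real assume r: "0 < r"
  from cadlag_on_local[OF assms(1) _ assms(3), of "r/2"] assms(2) r obtain d where d: "0 < d"
      "\<And>a. 0 \<le> a \<Longrightarrow> z - d < a \<Longrightarrow> a < z \<Longrightarrow> norm (f a - left_lim f z) < r/2"
      "\<And>b. z \<le> b \<Longrightarrow> b < z + d \<Longrightarrow> norm (f b - f z) < r/2" by auto
  have "eventually (\<lambda>n. max 0 (z - d) < u n) sequentially" if "0 < z"
    using order_tendstoD(1)[OF assms(4), of "max 0 (z - d)"] d(1) that by (simp only: max_less_iff_conj) simp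
  then obtain N where N: "\<And>n. N \<le> n \<Longrightarrow> max 0 (z - d) < u n"
    using assms(2) by (auto simp: eventually_sequentially)
  have "norm (left_lim f (u n) - left_lim f z) < r" if n: "N \<le> n" for n
  proof -
    have un: "0 < u n" "z - d < u n" using N[OF n] by auto
    have "left_lim f (u n) \<in> cball (left_lim f z) (r/2)"
    proof (rule Lim_in_closed_set[OF closed_cball _ _ cadlag_on_left_lim[OF assms(1) un(1)]])
      show "ereal (u n) < \<tau>" using assms(3) assms(6)[of n] by (auto intro: less_trans[of _ "ereal z"])
      have "norm (left_lim f z - f a) \<le> r/2" if "max 0 (z - d) < a" "a < u n" for a
        using d(2)[of a] that assms(6)[of n] by (simp add: norm_minus_commute less_imp_le)
      then show "eventually (\<lambda>a. f a \<in> cball (left_lim f z) (r/2)) (at_left (u n))"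
        unfolding eventually_at_left_field using un N[OF n]
        by (intro exI[of _ "max 0 (z - d)"]) (auto simp: dist_norm)
    qed simp
    then show ?thesis using r by (simp add: dist_norm norm_minus_commute)
  qed
  then show "\<exists>no. \<forall>n\<ge>no. norm (left_lim f (u n) - left_lim f z) < r" by blast
qed

section \<open>Jump measures and their intensity\<close>

lemma sets_jump_measure [simp, measurable_cong]: "sets (jump_measure f) = sets borel"
  by (simp add: jump_measure_def)

lemma nn_integral_jump_measure:
  assumes "h \<in> borel_measurable borel"
  shows "(\<integral>\<^sup>+x. h x \<partial>jump_measure f)
    = (\<integral>\<^sup>+z. h (z, jump f z) \<partial>count_space {z. 0 < z \<and> jump f z \<noteq> 0})"
  using assms by (simp add: jump_measure_def nn_integral_distr)

lemma borel_measurable_time_mark: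
  fixes \<phi> :: "'a::euclidean_space \<Rightarrow> ennreal"
  assumes [measurable]: "\<phi> \<in> borel_measurable borel" "S \<in> sets borel"
  shows "(\<lambda>(z::real, y). indicator S z * \<phi> y) \<in> borel_measurable borel"
proof -
  have "(\<lambda>(z::real, y). indicator S z * \<phi> y) \<in> borel_measurable (borel \<Otimes>\<^sub>M borel)" by measurable
  then show ?thesis by (simp add: borel_prod)
qed

lemma nn_integral_jump_measure_vanishing:
  fixes \<phi> :: "'a::euclidean_space \<Rightarrow> ennreal"
  assumes "cadlag_on \<tau> f" "ereal T < \<tau>" "0 < e"
    and [measurable]: "\<phi> \<in> borel_measurable borel" and "\<And>y. norm y < e \<Longrightarrow> \<phi> y = 0"
  shows "(\<integral>\<^sup>+(z, y). indicator {0<..T} z * \<phi> y \<partial>jump_measure f)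
    = (\<Sum>z\<in>{z\<in>{0<..T}. e \<le> norm (jump f z)}. \<phi> (jump f z))"
proof -
  have "(\<integral>\<^sup>+(z, y). indicator {0<..T} z * \<phi> y \<partial>jump_measure f)
    = (\<integral>\<^sup>+z. indicator {0<..T} z * \<phi> (jump f z) \<partial>count_space {z. 0 < z \<and> jump f z \<noteq> 0})"
    by (subst nn_integral_jump_measure[OF borel_measurable_time_mark]) auto
  also have "\<dots> = (\<Sum>z\<in>{z\<in>{0<..T}. e \<le> norm (jump f z)}. indicator {0<..T} z * \<phi> (jump f z))"
    using assms(3,5) finite_large_jumps[OF assms(1-3)]
    by (intro nn_integral_count_space') (auto simp: indicator_def not_le)
  also have "\<dots> = (\<Sum>z\<in>{z\<in>{0<..T}. e \<le> norm (jump f z)}. \<phi> (jump f z))"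
    by (intro sum.cong) auto
  finally show ?thesis .
qed

lemma sets_time_mark: "S \<in> sets borel \<Longrightarrow> A \<in> sets borel \<Longrightarrow> (S \<times> A :: (real \<times> 'a::euclidean_space) set) \<in> sets borel"
  by (simp add: borel_prod[symmetric])

lemma nn_integral_jump_SUP:
  fixes \<phi> :: "nat \<Rightarrow> 'a::euclidean_space \<Rightarrow> ennreal"
  assumes "\<And>y. incseq (\<lambda>j. \<phi> j y)" "\<And>j. \<phi> j \<in> borel_measurable borel"
  shows "(\<integral>\<^sup>+(z, y). indicator {0<..T} z * (SUP j. \<phi> j y) \<partial>jump_measure f)
    = (SUP j. \<integral>\<^sup>+(z, y). indicator {0<..T} z * \<phi> j y \<partial>jump_measure f)"
proof -
  have "(SUP j. \<integral>\<^sup>+(z, y). indicator {0<..T} z * \<phi> j y \<partial>jump_measure f)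
    = (\<integral>\<^sup>+x. (SUP j. (\<lambda>(z, y). indicator {0<..T} z * \<phi> j y) x) \<partial>jump_measure f)"
  proof (rule nn_integral_monotone_convergence_SUP[symmetric])
    show "incseq (\<lambda>j. (\<lambda>(z, y). indicator {0<..T} z * \<phi> j y))"
      using assms(1) by (auto simp: incseq_def le_fun_def intro!: mult_left_mono)
    show "(\<lambda>(z, y). indicator {0<..T} z * \<phi> j y) \<in> borel_measurable (jump_measure f)" for j
      using borel_measurable_time_mark[OF assms(2), of "{0<..T}"]
      by (simp add: measurable_cong_sets[OF sets_jump_measure refl])
  qed
  also have "\<dots> = (\<integral>\<^sup>+(z, y). indicator {0<..T} z * (SUP j. \<phi> j y) \<partial>jump_measure f)"
    by (intro nn_integral_cong) (simp add: case_prod_beta flip: SUP_mult_left_ennreal)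
  finally show ?thesis by simp
qed

text \<open>Lowering a continuous nonnegative function of the mark by 1/(j+1) and taking the
  positive part makes it vanish near 0 without destroying continuity, as
  \<open>riemann_jump_sum\<close> demands; a sharp cut-off would not.\<close>

lemma SUP_truncation:
  assumes "0 \<le> a"
  shows "incseq (\<lambda>j. ennreal (max (a - 1 / real (Suc j)) 0))"
    "(SUP j. ennreal (max (a - 1 / real (Suc j)) 0)) = ennreal a"
proof -
  show inc: "incseq (\<lambda>j. ennreal (max (a - 1 / real (Suc j)) 0))"
    by (intro incseq_SucI ennreal_leI max.mono diff_left_mono) (auto simp: frac_le)
  have "(\<lambda>j. max (a - 1 / real (Suc j)) 0) \<longlonglongrightarrow> max (a - 0) 0"
    by (intro tendsto_max tendsto_diff tendsto_const LIMSEQ_Suc[OF lim_const_over_n])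
  then have "(\<lambda>j. ennreal (max (a - 1 / real (Suc j)) 0)) \<longlonglongrightarrow> ennreal (max (a - 0) 0)"
    by (rule tendsto_ennrealI)
  then have "(\<lambda>j. ennreal (max (a - 1 / real (Suc j)) 0)) \<longlonglongrightarrow> ennreal a"
    using assms by (simp only: diff_zero max_absorb1)
  then show "(SUP j. ennreal (max (a - 1 / real (Suc j)) 0)) = ennreal a"
    by (rule LIMSEQ_unique[OF LIMSEQ_SUP[OF inc]])
qed

lemma emeasure_jump_eq:
  assumes "A \<in> sets borel"
  shows "emeasure (jump_measure f) ({0<..T} \<times> A)
    = (\<integral>\<^sup>+(z, y). indicator {0<..T} z * indicator A y \<partial>jump_measure f)"
proof -
  have "{0<..T} \<times> A \<in> sets borel" using assms by (simp add: borel_prod[symmetric])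
  then have "emeasure (jump_measure f) ({0<..T} \<times> A) = (\<integral>\<^sup>+x. indicator ({0<..T} \<times> A) x \<partial>jump_measure f)"
    by simp
  also have "\<dots> = (\<integral>\<^sup>+(z, y). indicator {0<..T} z * indicator A y \<partial>jump_measure f)"
    by (intro nn_integral_cong) (auto simp: indicator_def)
  finally show ?thesis .
qed

section \<open>Adapted functionals of the jumps\<close>

locale complete_filtration =
  fixes M :: "'w measure" and F :: "real \<Rightarrow> 'w measure"
  assumes complete_filtered: "complete_filtered_prob_space M F"
begin

sublocale prob_space M
  using complete_filtered by (simp add: complete_filtered_prob_space_def)

lemma complete_M: "complete_measure M"
  using complete_filtered by (simp add: complete_filtered_prob_space_def)

lemma subalgebra_F: "0 \<le> t \<Longrightarrow> subalgebra M (F t)"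
  using complete_filtered by (simp add: complete_filtered_prob_space_def)

lemma space_F: "0 \<le> t \<Longrightarrow> space (F t) = space M"
  using subalgebra_F by (simp add: subalgebra_def)

lemma sets_F_mono: "0 \<le> s \<Longrightarrow> s \<le> t \<Longrightarrow> sets (F s) \<subseteq> sets (F t)"
  using complete_filtered by (simp add: complete_filtered_prob_space_def)

lemma borel_measurable_F_mono:
  assumes "f \<in> borel_measurable (F s)" "0 \<le> s" "s \<le> t"
  shows "f \<in> borel_measurable (F t)"
  using measurable_mono[OF order_refl refl, of "F s" "F t" borel] assms sets_F_mono[of s t] space_F[of s] space_F[of t]
  by auto

lemma borel_measurable_F_M:
  assumes "f \<in> borel_measurable (F s)" "0 \<le> s"
  shows "f \<in> borel_measurable M"
  using measurable_from_subalg[OF subalgebra_F] assms by auto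

lemma subset_null_set_F:
  assumes "N \<in> null_sets M" "A \<subseteq> N" "0 \<le> t"
  shows "A \<in> sets (F t)"
proof -
  have "A \<in> null_sets M"
    using assms complete_M null_sets_subset complete_measure.complete by metis
  moreover have "null_sets M \<subseteq> sets (F 0)"
    using complete_filtered by (simp add: complete_filtered_prob_space_def)
  ultimately show ?thesis
    using sets_F_mono[of 0 t] assms(3) by blast
qed

lemma borel_measurable_F_AE_cong:
  fixes g :: "'w \<Rightarrow> 'b::topological_space"
  assumes "f \<in> borel_measurable (F t)" "AE \<omega> in M. f \<omega> = g \<omega>" "0 \<le> t"
  shows "g \<in> borel_measurable (F t)"
proof (rule measurableI)
  from assms(2) obtain N where N: "{\<omega>\<in>space M. \<not> f \<omega> = g \<omega>} \<subseteq> N" "N \<in> null_sets M"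
    by (auto elim!: AE_E simp: null_sets_def)
  fix A :: "'b set" assume "A \<in> sets borel"
  then have f: "f -` A \<inter> space (F t) \<in> sets (F t)" using assms(1) by (rule measurable_sets[rotated])
  have "g -` A \<inter> space (F t) = (f -` A \<inter> space (F t) - N) \<union> (g -` A \<inter> space (F t) \<inter> N)"
    using N(1) space_F[OF assms(3)] by auto
  also have "\<dots> \<in> sets (F t)"
    using f subset_null_set_F[OF N(2) _ assms(3), of N] subset_null_set_F[OF N(2) _ assms(3), of "g -` A \<inter> space (F t) \<inter> N"]
    by (intro sets.Un sets.Diff) auto
  finally show "g -` A \<inter> space (F t) \<in> sets (F t)" .
qed simp

lemma borel_measurable_F_AE_LIMSEQ:
  fixes g :: "'w \<Rightarrow> 'b::metric_space"
  assumes "\<And>n. f n \<in> borel_measurable (F t)" "AE \<omega> in M. (\<lambda>n. f n \<omega>) \<longlonglongrightarrow> g \<omega>" "0 \<le> t"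
  shows "g \<in> borel_measurable (F t)"
proof -
  from assms(2) obtain N where N: "{\<omega>\<in>space M. \<not> (\<lambda>n. f n \<omega>) \<longlonglongrightarrow> g \<omega>} \<subseteq> N" "N \<in> null_sets M"
    by (auto elim!: AE_E simp: null_sets_def)
  \<comment> \<open>Replacing all terms by one constant on the null set \<open>N\<close> makes the
    convergence hold everywhere. \<open>N\<close> and its subsets belong to every
    \<open>F t\<close>, so nothing changes for measurability.\<close>
  let ?f = "\<lambda>n \<omega>. if \<omega> \<in> N then undefined else f n \<omega>"
  let ?g = "\<lambda>\<omega>. if \<omega> \<in> N then undefined else g \<omega>"
  have NF: "N \<in> sets (F t)" by (rule subset_null_set_F[OF N(2) order_refl assms(3)])
  have "?g \<in> borel_measurable (F t)"
  proof (rule borel_measurable_LIMSEQ_metric)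
    show "?f n \<in> borel_measurable (F t)" for n
      using assms(1) NF by (intro measurable_If_set) (auto simp: sets.Int_space_eq2)
    show "(\<lambda>n. ?f n \<omega>) \<longlonglongrightarrow> ?g \<omega>" if "\<omega> \<in> space (F t)" for \<omega>
      using that N(1) space_F[OF assms(3)] by auto
  qed
  moreover have "AE \<omega> in M. ?g \<omega> = g \<omega>"
    using AE_not_in[OF N(2)] by eventually_elim auto
  ultimately show ?thesis using assms(3) by (rule borel_measurable_F_AE_cong)
qed

end

locale cadlag_process = complete_filtration M F
  for M :: "'w measure" and F +
  fixes L :: "real \<Rightarrow> 'w \<Rightarrow> 'y::euclidean_space"
  assumes adapted: "0 \<le> t \<Longrightarrow> L t \<in> borel_measurable (F t)"
    and cadlag: "AE \<omega> in M. cadlag_on \<infinity> (\<lambda>t. L t \<omega>)"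
begin

abbreviation path :: "'w \<Rightarrow> real \<Rightarrow> 'y" where "path \<omega> \<equiv> \<lambda>t. L t \<omega>"

text \<open>The approximating sums of \<open>riemann_jump_sum\<close> involve only values of the
  path at times up to T, and null sets of exceptional paths are known at time 0.\<close>

lemma jump_sum_adapted:
  fixes \<phi> :: "'y \<Rightarrow> 'z::euclidean_space"
  assumes "0 \<le> T" "0 < e" "continuous_on UNIV \<phi>" "\<And>y. norm y < e \<Longrightarrow> \<phi> y = 0"
  shows "(\<lambda>\<omega>. \<Sum>z\<in>{z\<in>{0<..T}. e \<le> norm (jump (path \<omega>) z)}. \<phi> (jump (path \<omega>) z)) \<in> borel_measurable (F T)"
proof (cases "T = 0")
  case False
  then have T: "0 < T" using assms by simp
  show ?thesis
  proof (rule borel_measurable_F_AE_LIMSEQ[OF _ _ assms(1)])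
    fix n :: nat
    show "(\<lambda>\<omega>. \<Sum>i<Suc n. \<phi> (L (T * real (Suc i) / real (Suc n)) \<omega> - L (T * real i / real (Suc n)) \<omega>))
        \<in> borel_measurable (F T)"
    proof (rule borel_measurable_sum)
      fix i assume "i \<in> {..<Suc n}"
      then have i: "Suc i \<le> Suc n" by simp
      have *: "T * real j / real (Suc n) \<le> T" if "j \<le> Suc n" for j
      proof -
        have "T * real j \<le> T * real (Suc n)" using T that by (intro mult_left_mono) auto
        then show ?thesis by (subst pos_divide_le_eq) auto
      qed
      have L: "L (T * real j / real (Suc n)) \<in> borel_measurable (F T)" if "j \<le> Suc n" for j
        using borel_measurable_F_mono[OF adapted] *[OF that] T by simp
      have [measurable]: "L (T * real (Suc i) / real (Suc n)) \<in> borel_measurable (F T)"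
        "L (T * real i / real (Suc n)) \<in> borel_measurable (F T)"
        using L[of i] L[OF i] i by (simp_all del: of_nat_Suc)
      show "(\<lambda>\<omega>. \<phi> (L (T * real (Suc i) / real (Suc n)) \<omega> - L (T * real i / real (Suc n)) \<omega>))
        \<in> borel_measurable (F T)"
        by (intro measurable_compose[OF _ borel_measurable_continuous_onI[OF assms(3)]] borel_measurable_diff) measurable
    qed
    show "AE \<omega> in M. (\<lambda>n. \<Sum>i<Suc n. \<phi> (L (T * real (Suc i) / real (Suc n)) \<omega> - L (T * real i / real (Suc n)) \<omega>))
      \<longlonglongrightarrow> (\<Sum>z\<in>{z\<in>{0<..T}. e \<le> norm (jump (path \<omega>) z)}. \<phi> (jump (path \<omega>) z))"
      using cadlag by eventually_elim (rule riemann_jump_sum[OF _ _ T assms(2-4)], auto)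
  qed
qed simp

lemma nn_integral_jump_adapted_vanishing:
  fixes \<phi> :: "'y \<Rightarrow> real"
  assumes "0 \<le> T" "0 < e" "continuous_on UNIV \<phi>" "\<And>y. norm y < e \<Longrightarrow> \<phi> y = 0" "\<And>y. 0 \<le> \<phi> y"
  shows "(\<lambda>\<omega>. \<integral>\<^sup>+(z, y). indicator {0<..T} z * ennreal (\<phi> y) \<partial>jump_measure (path \<omega>)) \<in> borel_measurable (F T)"
proof (rule borel_measurable_F_AE_cong[OF _ _ assms(1)])
  show "(\<lambda>\<omega>. ennreal (\<Sum>z\<in>{z\<in>{0<..T}. e \<le> norm (jump (path \<omega>) z)}. \<phi> (jump (path \<omega>) z))) \<in> borel_measurable (F T)"
    using jump_sum_adapted[OF assms(1-4)] by measurable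
  have [measurable]: "\<phi> \<in> borel_measurable borel" by (rule borel_measurable_continuous_onI[OF assms(3)])
  show "AE \<omega> in M. ennreal (\<Sum>z\<in>{z\<in>{0<..T}. e \<le> norm (jump (path \<omega>) z)}. \<phi> (jump (path \<omega>) z))
    = (\<integral>\<^sup>+(z, y). indicator {0<..T} z * ennreal (\<phi> y) \<partial>jump_measure (path \<omega>))"
    using cadlag
    by eventually_elim (subst nn_integral_jump_measure_vanishing[OF _ _ assms(2)], auto simp: assms(4,5) sum_ennreal)
qed

text \<open>Monotone limit of the truncations of \<open>SUP_truncation\<close>: by continuity and
  \<phi> 0 = 0 each of them vanishes in a neighbourhood of 0.\<close>

lemma nn_integral_jump_adapted:
  fixes \<phi> :: "'y \<Rightarrow> real"
  assumes "0 \<le> T" "continuous_on UNIV \<phi>" "\<phi> 0 = 0" "\<And>y. 0 \<le> \<phi> y"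
  shows "(\<lambda>\<omega>. \<integral>\<^sup>+(z, y). indicator {0<..T} z * ennreal (\<phi> y) \<partial>jump_measure (path \<omega>)) \<in> borel_measurable (F T)"
proof -
  define \<psi> where "\<psi> j y = max (\<phi> y - 1 / real (Suc j)) 0" for j :: nat and y
  have [measurable]: "\<phi> \<in> borel_measurable borel" by (rule borel_measurable_continuous_onI[OF assms(2)])
  have sup: "incseq (\<lambda>j. ennreal (\<psi> j y))" "(SUP j. ennreal (\<psi> j y)) = ennreal (\<phi> y)" for y
    unfolding \<psi>_def by (rule SUP_truncation[OF assms(4)])+
  have [measurable]: "\<psi> j \<in> borel_measurable borel" for j unfolding \<psi>_def by measurable
  have eq: "(\<integral>\<^sup>+(z, y). indicator {0<..T} z * ennreal (\<phi> y) \<partial>jump_measure (path \<omega>))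
    = (SUP j. \<integral>\<^sup>+(z, y). indicator {0<..T} z * ennreal (\<psi> j y) \<partial>jump_measure (path \<omega>))" for \<omega>
    unfolding sup(2)[symmetric] by (rule nn_integral_jump_SUP[OF sup(1)]) measurable
  show ?thesis
    unfolding eq
  proof (rule borel_measurable_SUP)
    fix j :: nat
    have "isCont \<phi> 0" using assms(2) by (simp add: continuous_on_eq_continuous_at)
    then have "(\<phi> \<longlongrightarrow> \<phi> 0) (nhds 0)" by (simp only: isCont_def tendsto_at_iff_tendsto_nhds)
    then have "eventually (\<lambda>y. \<phi> y < 1 / real (Suc j)) (nhds 0)"
      using assms(3) by (intro order_tendstoD(2)[of \<phi> 0]) auto
    then obtain e where e: "0 < e" "\<And>y. norm y < e \<Longrightarrow> \<phi> y < 1 / real (Suc j)"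
      by (auto simp: eventually_nhds_metric)
    show "(\<lambda>\<omega>. \<integral>\<^sup>+(z, y). indicator {0<..T} z * ennreal (\<psi> j y) \<partial>jump_measure (path \<omega>)) \<in> borel_measurable (F T)"
    proof (rule nn_integral_jump_adapted_vanishing[OF assms(1) e(1)])
      show "continuous_on UNIV (\<psi> j)" unfolding \<psi>_def by (intro continuous_intros assms(2))
      show "\<psi> j y = 0" if "norm y < e" for y using e(2)[OF that] by (simp add: \<psi>_def)
    qed (simp add: \<psi>_def)
  qed simp
qed

end

lemma finite_emeasure_large_jumps:
  assumes "cadlag_on \<tau> f" "ereal T < \<tau>" "0 < a" "A \<in> sets borel" "A \<subseteq> {y. a \<le> norm y}"
  shows "emeasure (jump_measure f) ({0<..T} \<times> A) < \<infinity>"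
proof -
  have "emeasure (jump_measure f) ({0<..T} \<times> A) = (\<Sum>z\<in>{z\<in>{0<..T}. a \<le> norm (jump f z)}. indicator A (jump f z))"
    using assms(4,5) by (subst emeasure_jump_eq, simp)
      (intro nn_integral_jump_measure_vanishing[OF assms(1-3)], auto simp: indicator_def)
  also have "\<dots> < \<infinity>" using finite_large_jumps[OF assms(1-3)] by (simp add: indicator_def of_nat_less_top)
  finally show ?thesis .
qed

context cadlag_process
begin

abbreviation jump_count :: "real \<Rightarrow> 'y set \<Rightarrow> 'w \<Rightarrow> ennreal" where
  "jump_count T A \<omega> \<equiv> emeasure (jump_measure (path \<omega>)) ({0<..T} \<times> A)"

lemma jump_count_open:
  assumes T: "0 \<le> T" and A: "open A" "0 \<notin> A"
  shows "jump_count T A \<in> borel_measurable (F T)"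
proof -
  \<comment> \<open>These continuous functions increase to the indicator of the open set and vanish
    at the mark 0.\<close>
  define \<phi> where "\<phi> j y = min 1 (real j * infdist y (-A))" for j :: nat and y :: 'y
  have ind: "(SUP j. ennreal (\<phi> j y)) = indicator A y" for y
  proof (cases "y \<in> A")
    case True
    \<comment> \<open>The complement of \<open>A\<close> is closed and, containing 0, nonempty; the
      distance to an empty set would be 0 by convention.\<close>
    have "infdist y (-A) \<noteq> 0"
      using A True in_closed_iff_infdist_zero[of "-A" y] by auto
    then have "0 < infdist y (-A)" using infdist_nonneg[of y "-A"] by linarith
    then obtain j :: nat where "1 < real j * infdist y (-A)" using reals_Archimedean3 by blast
    then have "\<phi> j y = 1" by (simp add: \<phi>_def)
    then have "1 \<le> (SUP j. ennreal (\<phi> j y))" by (intro SUP_upper2[of j]) auto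
    moreover have "(SUP j. ennreal (\<phi> j y)) \<le> 1" by (intro SUP_least) (simp add: \<phi>_def)
    ultimately show ?thesis using True by simp
  next
    case False
    then have "\<phi> j y = 0" for j by (simp add: \<phi>_def)
    then show ?thesis using False by simp
  qed
  have cont: "continuous_on UNIV (\<phi> j)" for j
    unfolding \<phi>_def by (intro continuous_intros)
  have [measurable]: "\<phi> j \<in> borel_measurable borel" for j by (rule borel_measurable_continuous_onI[OF cont])
  have "jump_count T A \<omega> = (SUP j. \<integral>\<^sup>+(z, y). indicator {0<..T} z * ennreal (\<phi> j y) \<partial>jump_measure (path \<omega>))" for \<omega>
  proof -
    have "incseq (\<lambda>j. ennreal (\<phi> j y))" for y
      unfolding \<phi>_def by (intro incseq_SucI ennreal_leI min.mono mult_right_mono infdist_nonneg) auto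
    then have "(\<integral>\<^sup>+(z, y). indicator {0<..T} z * (SUP j. ennreal (\<phi> j y)) \<partial>jump_measure (path \<omega>))
      = (SUP j. \<integral>\<^sup>+(z, y). indicator {0<..T} z * ennreal (\<phi> j y) \<partial>jump_measure (path \<omega>))"
      by (intro nn_integral_jump_SUP) auto
    then show ?thesis using A(1) by (simp add: emeasure_jump_eq ind)
  qed
  moreover have "(\<lambda>\<omega>. \<integral>\<^sup>+(z, y). indicator {0<..T} z * ennreal (\<phi> j y) \<partial>jump_measure (path \<omega>)) \<in> borel_measurable (F T)" for j
    using A by (intro nn_integral_jump_adapted[OF T(1) cont]) (auto simp: \<phi>_def infdist_nonneg)
  ultimately show ?thesis by (simp add: borel_measurable_SUP)
qed

text \<open>Dynkin's theorem starting from open sets. Keeping marks away from 0 makes all counts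
  finite almost surely, which allows the subtraction in the complement step.\<close>

lemma jump_count_large:
  assumes T: "0 \<le> T" and a: "0 < a" and A: "A \<in> sets borel"
  shows "jump_count T (A \<inter> {y. a < norm y}) \<in> borel_measurable (F T)"
proof -
  let ?U = "{y::'y. a < norm y}"
  have U: "open ?U" by (intro open_Collect_less continuous_intros)
  have "A \<in> sigma_sets UNIV {S. open S}" using A by (simp add: borel_def)
  from sigma_sets_induct_disjoint[OF _ _ this, of "\<lambda>A. jump_count T (A \<inter> ?U) \<in> borel_measurable (F T)"]
  show ?thesis
  proof
    show "Int_stable {S::'y set. open S}" by (auto simp: Int_stable_def)
  next
    fix S :: "'y set" assume "S \<in> {S. open S}"
    then show "jump_count T (S \<inter> ?U) \<in> borel_measurable (F T)"
      using a U by (intro jump_count_open T) auto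
  next
    fix S :: "'y set" assume S: "S \<in> sigma_sets UNIV {S. open S}" and IH: "jump_count T (S \<inter> ?U) \<in> borel_measurable (F T)"
    have [measurable]: "S \<in> sets borel" using S by (simp add: borel_def)
    show "jump_count T ((UNIV - S) \<inter> ?U) \<in> borel_measurable (F T)"
    proof (rule borel_measurable_F_AE_cong[OF _ _ T])
      show "(\<lambda>\<omega>. jump_count T ?U \<omega> - jump_count T (S \<inter> ?U) \<omega>) \<in> borel_measurable (F T)"
        using IH jump_count_open[OF T U] a by (intro borel_measurable_minus_ennreal) auto
      show "AE \<omega> in M. jump_count T ?U \<omega> - jump_count T (S \<inter> ?U) \<omega> = jump_count T ((UNIV - S) \<inter> ?U) \<omega>"
        using cadlag
      proof eventually_elim
        case (elim \<omega>)
        have eq: "{0<..T} \<times> ((UNIV - S) \<inter> ?U) = {0<..T} \<times> ?U - {0<..T} \<times> (S \<inter> ?U)" by auto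
        have "emeasure (jump_measure (path \<omega>)) ({0<..T} \<times> (S \<inter> ?U)) \<noteq> \<infinity>"
          using finite_emeasure_large_jumps[OF elim _ a, of T "S \<inter> ?U"] by (auto simp: less_imp_le subset_iff)
        moreover have "{0<..T} \<times> ?U \<in> sets borel" "{0<..T} \<times> (S \<inter> ?U) \<in> sets borel"
          by (intro sets_time_mark; simp)+
        ultimately show ?case unfolding eq by (intro emeasure_Diff[symmetric]) auto
      qed
    qed
  next
    fix S :: "nat \<Rightarrow> 'y set" assume d: "disjoint_family S" and S: "range S \<subseteq> sigma_sets UNIV {S. open S}"
      and IH: "\<And>i. jump_count T (S i \<inter> ?U) \<in> borel_measurable (F T)"
    have [measurable]: "S i \<in> sets borel" for i using S by (auto simp: borel_def)
    have "jump_count T ((\<Union>i. S i) \<inter> ?U) \<omega> = (\<Sum>i. jump_count T (S i \<inter> ?U) \<omega>)" for \<omega>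
    proof -
      have eq: "{0<..T} \<times> ((\<Union>i. S i) \<inter> ?U) = (\<Union>i. {0<..T} \<times> (S i \<inter> ?U))" by auto
      show ?thesis unfolding eq
      proof (rule suminf_emeasure[symmetric])
        show "disjoint_family (\<lambda>i. {0<..T} \<times> (S i \<inter> ?U))" using d by (auto simp: disjoint_family_on_def)
        have "{0<..T} \<times> (S i \<inter> ?U) \<in> sets borel" for i by (intro sets_time_mark) auto
        then show "range (\<lambda>i. {0<..T} \<times> (S i \<inter> ?U)) \<subseteq> sets (jump_measure (path \<omega>))" by auto
      qed
    qed
    then show "jump_count T (\<Union> (range S) \<inter> ?U) \<in> borel_measurable (F T)"
      using IH by simp
  qed auto
qed

lemma jump_count_adapted:
  assumes T: "0 \<le> T" and A: "A \<in> sets borel" "0 \<notin> A"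
  shows "jump_count T A \<in> borel_measurable (F T)"
proof -
  let ?A = "\<lambda>j::nat. A \<inter> {y. 1 / real (Suc j) < norm y}"
  have "jump_count T A \<omega> = (SUP j. jump_count T (?A j) \<omega>)" for \<omega>
  proof -
    have "\<exists>j. 1 / real (Suc j) < norm y" if "y \<in> A" for y
      using that A(2) nat_approx_posE[of "norm y"] by (metis zero_less_norm_iff)
    then have eq: "{0<..T} \<times> A = (\<Union>j. {0<..T} \<times> ?A j)" by auto
    show ?thesis unfolding eq
    proof (rule SUP_emeasure_incseq[symmetric])
      have "1 / real (Suc n) < x" if "m \<le> n" "1 / real (Suc m) < x" for m n x
        using that frac_le[of 1 1 "real (Suc m)" "real (Suc n)"] by simp
      then show "incseq (\<lambda>j. {0<..T} \<times> ?A j)" unfolding incseq_def by blast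
      have "{0<..T} \<times> ?A j \<in> sets borel" for j using A(1) by (intro sets_time_mark) auto
      then show "range (\<lambda>j. {0<..T} \<times> ?A j) \<subseteq> sets (jump_measure (path \<omega>))" by auto
    qed
  qed
  then show ?thesis
    using jump_count_large[OF T _ A(1)] by (simp add: borel_measurable_SUP)
qed

text \<open>Campbell's formula: \<open>has_levy_measure\<close> is the case of indicators, and both
  sides pass through the usual induction over nonnegative measurable functions.\<close>

lemma campbell:
  assumes lm: "has_levy_measure M L \<nu>" and \<nu>[simp]: "sets \<nu> = sets borel"
    and \<phi>: "\<phi> \<in> borel_measurable borel" "\<phi> 0 = 0"
  shows "(\<integral>\<^sup>+\<omega>. (\<integral>\<^sup>+(z, y). indicator {0<..1} z * \<phi> y \<partial>jump_measure (path \<omega>)) \<partial>M) = (\<integral>\<^sup>+y. \<phi> y \<partial>\<nu>)"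
proof -
  \<comment> \<open>The factor \<open>indicator (-{0})\<close> is carried along because
    \<open>has_levy_measure\<close> speaks only of sets avoiding 0, while the functions met in the
    induction need not vanish there.\<close>
  define I where "I \<phi> \<omega> = (\<integral>\<^sup>+(z, y). indicator {0<..1} z * (\<phi> y * indicator (-{0}) y) \<partial>jump_measure (path \<omega>))"
    for \<phi> :: "'y \<Rightarrow> ennreal" and \<omega>
  have meas: "(\<lambda>(z, y). indicator {0<..1} z * (\<phi> y * indicator (-{0}) y)) \<in> borel_measurable (jump_measure (path \<omega>))"
    if "\<phi> \<in> borel_measurable borel" for \<phi> :: "'y \<Rightarrow> ennreal" and \<omega>
    using borel_measurable_time_mark[of "\<lambda>y. \<phi> y * indicator (-{0}) y" "{0<..1}"] that
    by (simp add: measurable_cong_sets[OF sets_jump_measure refl])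
  have [measurable_cong]: "sets \<nu> = sets borel" by simp
  have "I \<phi> \<in> borel_measurable M \<and> (\<integral>\<^sup>+\<omega>. I \<phi> \<omega> \<partial>M) = (\<integral>\<^sup>+y. \<phi> y * indicator (-{0}) y \<partial>\<nu>)"
    using \<phi>(1)
  proof (induct rule: borel_measurable_induct)
    case (cong f g)
    then have "f = g" by auto
    then show ?case using cong by simp
  next
    case (set A)
    then have A: "A \<inter> -{0} \<in> sets borel" by auto
    have "indicator A y * indicator (-{0}) y = (indicator (A \<inter> -{0}) y :: ennreal)" for y :: 'y
      by (simp add: indicator_def)
    then have "I (indicator A) = jump_count 1 (A \<inter> -{0})"
      by (auto simp: I_def emeasure_jump_eq[OF A])
    moreover have "jump_count 1 (A \<inter> -{0}) \<in> borel_measurable M"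
      using borel_measurable_F_M[OF jump_count_adapted[OF _ A]] by simp
    moreover have "(\<integral>\<^sup>+y. indicator A y * indicator (-{0}) y \<partial>\<nu>) = emeasure \<nu> (A \<inter> -{0})"
      using A by (simp add: nn_integral_indicator[symmetric] indicator_inter_arith)
    ultimately show ?case using lm A unfolding has_levy_measure_def by simp
  next
    case (mult u c)
    have "I (\<lambda>x. c * u x) = (\<lambda>\<omega>. c * I u \<omega>)"
    proof
      fix \<omega> show "I (\<lambda>x. c * u x) \<omega> = c * I u \<omega>"
        unfolding I_def using meas[OF mult(2), of \<omega>]
        by (subst nn_integral_cmult[symmetric]) (auto simp: ac_simps intro!: nn_integral_cong)
    qed
    moreover have [measurable]: "I u \<in> borel_measurable M" "u \<in> borel_measurable borel" using mult by auto
    have "(\<lambda>\<omega>. c * I u \<omega>) \<in> borel_measurable M" by measurable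
    ultimately show ?case using mult by (simp add: nn_integral_cmult mult.assoc)
  next
    case (add u v)
    have "I (\<lambda>x. v x + u x) = (\<lambda>\<omega>. I v \<omega> + I u \<omega>)"
    proof
      fix \<omega> show "I (\<lambda>x. v x + u x) \<omega> = I v \<omega> + I u \<omega>"
        unfolding I_def using meas[OF add(1), of \<omega>] meas[OF add(4), of \<omega>]
        by (subst nn_integral_add[symmetric]) (auto simp: distrib_left distrib_right intro!: nn_integral_cong)
    qed
    moreover have [measurable]: "I u \<in> borel_measurable M" "u \<in> borel_measurable borel"
      "I v \<in> borel_measurable M" "v \<in> borel_measurable borel" using add by auto
    have "(\<lambda>\<omega>. I v \<omega> + I u \<omega>) \<in> borel_measurable M" by measurable
    ultimately show ?case using add by (simp add: nn_integral_add distrib_right)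
  next
    case (seq U)
    have inc: "incseq (\<lambda>i. U i y * indicator (-{0}) y)" for y
      using seq(4) by (auto simp: incseq_def le_fun_def intro: mult_right_mono)
    have Sup: "(SUP i. U i) y * indicator (-{0}) y = (SUP i. U i y * indicator (-{0}) y)" for y
      by (simp add: SUP_mult_right_ennreal image_comp)
    have eq: "I (SUP i. U i) = (\<lambda>\<omega>. SUP i. I (U i) \<omega>)"
      unfolding I_def Sup using seq(1) by (intro ext nn_integral_jump_SUP inc) auto
    have inc2: "incseq (\<lambda>i. I (U i))"
      unfolding I_def using seq(4)
      by (auto simp: incseq_def le_fun_def intro!: nn_integral_mono mult_left_mono mult_right_mono)
    have "(\<integral>\<^sup>+\<omega>. I (SUP i. U i) \<omega> \<partial>M) = (SUP i. \<integral>\<^sup>+\<omega>. I (U i) \<omega> \<partial>M)"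
      unfolding eq using seq(3) by (intro nn_integral_monotone_convergence_SUP inc2) auto
    also have "\<dots> = (SUP i. \<integral>\<^sup>+y. U i y * indicator (-{0}) y \<partial>\<nu>)" using seq(3) by simp
    also have "\<dots> = (\<integral>\<^sup>+y. (SUP i. U i y * indicator (-{0}) y) \<partial>\<nu>)"
      using seq(1) inc by (intro nn_integral_monotone_convergence_SUP[symmetric]) (auto simp: incseq_def le_fun_def)
    finally have "(\<integral>\<^sup>+\<omega>. I (SUP i. U i) \<omega> \<partial>M) = (\<integral>\<^sup>+y. (SUP i. U i) y * indicator (-{0}) y \<partial>\<nu>)"
      unfolding Sup .
    moreover have "I (SUP i. U i) \<in> borel_measurable M"
      unfolding eq using seq(3) by (intro borel_measurable_SUP) auto
    ultimately show ?case by blast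
  qed
  moreover have "\<phi> y * indicator (-{0}) y = \<phi> y" for y using \<phi>(2) by (simp add: indicator_def)
  ultimately show ?thesis by (simp add: I_def)
qed

end

section \<open>Moments of the Levy measures\<close>

lemma gamma_density_nonneg: "0 < \<alpha> \<Longrightarrow> 0 \<le> gamma_density \<alpha> \<beta> s"
  by (simp add: gamma_density_def)

lemma borel_measurable_gamma_density [measurable]: "gamma_density \<alpha> \<beta> \<in> borel_measurable borel"
  unfolding gamma_density_def[abs_def] by measurable

text \<open>The substitution t = \<beta> s turns the integral into a multiple of
  \<open>Gamma p\<close>. The factor s in the denominator of the density is compensated by any
  positive power, in particular by the square root.\<close>

lemma gamma_density_moment:
  assumes "0 < \<alpha>" "0 < \<beta>" "0 < p"
  shows "(\<integral>\<^sup>+s. ennreal (gamma_density \<alpha> \<beta> s * s powr p) \<partial>lborel) < \<infinity>"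
proof -
  have G: "(\<integral>\<^sup>+t. ennreal (indicator {0..} t * t powr (p - 1) / exp t) \<partial>lborel) = ennreal (Gamma p)"
    using Gamma_conv_nn_integral_real[OF assms(3)] by simp
  have "(\<integral>\<^sup>+s. ennreal (gamma_density \<alpha> \<beta> s * s powr p) \<partial>lborel)
    = (\<integral>\<^sup>+s. ennreal (\<alpha> * \<beta> powr (1 - p)) * ennreal (indicator {0..} (\<beta> * s) * (\<beta> * s) powr (p - 1) / exp (\<beta> * s)) \<partial>lborel)"
  proof (rule nn_integral_cong_AE)
    have "ennreal (gamma_density \<alpha> \<beta> s * s powr p)
      = ennreal (\<alpha> * \<beta> powr (1 - p)) * ennreal (indicator {0..} (\<beta> * s) * (\<beta> * s) powr (p - 1) / exp (\<beta> * s))"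
      if "s \<noteq> 0" for s
    proof (cases "0 < s")
      case True
      have "\<beta> powr (1 - p) * (\<beta> * s) powr (p - 1) = s powr (p - 1)"
        using True assms by (simp add: powr_mult mult.assoc[symmetric] powr_add[symmetric])
      moreover have "s powr p = s * s powr (p - 1)"
        using True by (simp add: powr_mult_base)
      ultimately have "gamma_density \<alpha> \<beta> s * s powr p = \<alpha> * \<beta> powr (1 - p) * ((\<beta> * s) powr (p - 1) / exp (\<beta> * s))"
        using True by (simp add: gamma_density_def exp_minus field_simps)
      then show ?thesis using True assms by (simp add: ennreal_mult[symmetric])
    next
      case False
      then have "\<beta> * s < 0" using \<open>s \<noteq> 0\<close> assms by (simp add: mult_pos_neg)
      then show ?thesis using False by (simp add: gamma_density_def)
    qed
    then show "AE s in lborel. ennreal (gamma_density \<alpha> \<beta> s * s powr p)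
      = ennreal (\<alpha> * \<beta> powr (1 - p)) * ennreal (indicator {0..} (\<beta> * s) * (\<beta> * s) powr (p - 1) / exp (\<beta> * s))"
      using AE_lborel_singleton[of "0::real"] by (auto elim: eventually_mono)
  qed
  also have "\<dots> = ennreal (\<alpha> * \<beta> powr (1 - p)) * (\<integral>\<^sup>+s. ennreal (indicator {0..} (\<beta> * s) * (\<beta> * s) powr (p - 1) / exp (\<beta> * s)) \<partial>lborel)"
    by (intro nn_integral_cmult) measurable
  also have "\<dots> < \<infinity>"
  proof -
    define f where "f t = ennreal (indicator {0..} t * t powr (p - 1) / exp t)" for t
    have [measurable]: "f \<in> borel_measurable borel" unfolding f_def by measurable
    have "ennreal (Gamma p) = ennreal \<beta> * (\<integral>\<^sup>+s. f (\<beta> * s) \<partial>lborel)"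
      unfolding G[symmetric] f_def[symmetric] using assms nn_integral_real_affine[of f \<beta> 0] by simp
    then have "ennreal \<beta> * (\<integral>\<^sup>+s. f (\<beta> * s) \<partial>lborel) \<noteq> \<infinity>"
      by (metis ennreal_neq_top infinity_ennreal_def)
    then have "(\<integral>\<^sup>+s. f (\<beta> * s) \<partial>lborel) < \<infinity>"
      using assms by (auto simp: ennreal_mult_eq_top_iff less_top)
    then have "(\<integral>\<^sup>+s. ennreal (indicator {0..} (\<beta> * s) * (\<beta> * s) powr (p - 1) / exp (\<beta> * s)) \<partial>lborel) < \<infinity>"
      unfolding f_def .
    then show ?thesis by (simp add: ennreal_mult_less_top)
  qed
  finally show ?thesis .
qed

text \<open>\<open>p4 s\<close> is the law of a standard four-dimensional Brownian motion at time s: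
  four independent normal coordinates of variance s, with constant (2 pi s) to the power -2.\<close>

lemma p4_eq_normal:
  assumes "0 < s"
  shows "p4 s u = (\<Prod>i\<in>UNIV. normal_density 0 (sqrt s) (u $ i))"
proof -
  have "(\<Prod>i\<in>UNIV. normal_density 0 (sqrt s) (u $ i)) = (1 / sqrt (2 * pi * s))^4 * exp (\<Sum>i\<in>UNIV. - (u $ i)\<^sup>2 / (2 * s))"
    using assms by (simp add: normal_density_def prod.distrib exp_sum power_divide prod_dividef)
  also have "(\<Sum>i\<in>UNIV. - (u $ i)\<^sup>2 / (2 * s)) = - (norm u)\<^sup>2 / (2 * s)"
    by (simp add: norm_vec_def L2_set_def sum_nonneg sum_divide_distrib[symmetric] sum_negf)
  also have "(1 / sqrt (2 * pi * s))^4 = 1 / (4 * pi\<^sup>2 * s\<^sup>2)"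
  proof -
    have "sqrt (2 * pi * s) ^ 4 = (sqrt (2 * pi * s) ^ 2) ^ 2" by (simp flip: power_mult)
    also have "\<dots> = 4 * pi\<^sup>2 * s\<^sup>2" using assms by (simp add: power_mult_distrib)
    finally show ?thesis by (simp add: power_divide)
  qed
  finally show ?thesis using assms by (simp add: p4_def)
qed

lemma nn_integral_normal_moments:
  assumes "0 < \<sigma>"
  shows "(\<integral>\<^sup>+x. ennreal (normal_density 0 \<sigma> x) \<partial>lborel) = 1"
    "(\<integral>\<^sup>+x. ennreal (normal_density 0 \<sigma> x * x\<^sup>2) \<partial>lborel) = ennreal (\<sigma>\<^sup>2)"
    "(\<integral>\<^sup>+x. ennreal (normal_density 0 \<sigma> x * \<bar>x\<bar>) \<partial>lborel) \<le> ennreal \<sigma>"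
proof -
  show "(\<integral>\<^sup>+x. ennreal (normal_density 0 \<sigma> x) \<partial>lborel) = 1"
    using assms by (subst nn_integral_eq_integral) auto
  have "has_bochner_integral lborel (\<lambda>x. normal_density 0 \<sigma> x * (x - 0)^(2*1)) (fact (2*1) / ((2 / \<sigma>\<^sup>2)^1 * fact 1))"
    by (rule normal_moment_even[OF assms])
  then show "(\<integral>\<^sup>+x. ennreal (normal_density 0 \<sigma> x * x\<^sup>2) \<partial>lborel) = ennreal (\<sigma>\<^sup>2)"
    by (subst nn_integral_eq_integral) (auto simp: has_bochner_integral_iff fact_numeral)
  have "has_bochner_integral lborel (\<lambda>x. normal_density 0 \<sigma> x * \<bar>x - 0\<bar>^(2*0+1)) (2^0 * \<sigma>^(2*0+1) * fact 0 * sqrt (2/pi))"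
    by (rule normal_moment_abs_odd) (fact assms)
  then have "(\<integral>\<^sup>+x. ennreal (normal_density 0 \<sigma> x * \<bar>x\<bar>) \<partial>lborel) = ennreal (\<sigma> * sqrt (2/pi))"
    by (subst nn_integral_eq_integral) (auto simp: has_bochner_integral_iff)
  also have "\<dots> \<le> ennreal \<sigma>"
    using assms pi_gt3 by (intro ennreal_leI mult_left_le) auto
  finally show "(\<integral>\<^sup>+x. ennreal (normal_density 0 \<sigma> x * \<bar>x\<bar>) \<partial>lborel) \<le> ennreal \<sigma>" .
qed

lemma nn_integral_lborel_vec_prod:
  fixes f :: "'n::finite \<Rightarrow> real \<Rightarrow> real"
  assumes [measurable]: "\<And>i. f i \<in> borel_measurable borel" and nn: "\<And>i x. 0 \<le> f i x"
  shows "(\<integral>\<^sup>+u. ennreal (\<Prod>i\<in>UNIV. f i (u $ i)) \<partial>(lborel :: (real^'n) measure)) = (\<Prod>i\<in>UNIV. \<integral>\<^sup>+x. ennreal (f i x) \<partial>lborel)"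
proof -
  let ?a = "\<lambda>i. axis i 1 :: real^'n"
  have inj: "inj ?a" by (auto simp: inj_def axis_eq_axis)
  have B: "(Basis :: (real^'n) set) = ?a ` UNIV"
    by (auto simp: Basis_vec_def)
  \<comment> \<open>Lebesgue measure factorizes over the abstract \<open>Basis\<close>; the inverse
    of \<open>axis\<close> carries the coordinate index over to the basis vector.\<close>
  define g where "g b = f (the_inv ?a b)" for b
  have g: "g (?a i) = f i" for i by (simp add: g_def the_inv_f_f[OF inj])
  have P: "(\<Prod>b\<in>Basis. h b) = (\<Prod>i\<in>UNIV. h (?a i))" for h :: "real^'n \<Rightarrow> ennreal"
    unfolding B by (subst prod.reindex[OF inj]) simp
  have "(\<integral>\<^sup>+u. (\<Prod>b\<in>Basis. ennreal (g b (u \<bullet> b))) \<partial>(lborel :: (real^'n) measure)) = (\<Prod>b\<in>(Basis::(real^'n) set). \<integral>\<^sup>+x. ennreal (g b x) \<partial>lborel)"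
    by (intro nn_integral_lborel_prod) (auto simp: B g)
  then show ?thesis by (simp add: P g inner_axis prod_ennreal nn)
qed

lemma p4_moments:
  assumes "0 < s"
  shows "(\<integral>\<^sup>+u. ennreal (p4 s u) \<partial>lborel) = 1"
    "(\<integral>\<^sup>+u. ennreal (p4 s u * (norm u)\<^sup>2) \<partial>lborel) = ennreal (4 * s)"
proof -
  note N = nn_integral_normal_moments[of "sqrt s"]
  show "(\<integral>\<^sup>+u. ennreal (p4 s u) \<partial>lborel) = 1"
    using assms unfolding p4_eq_normal[OF assms]
    by (subst nn_integral_lborel_vec_prod) (auto simp: N)
  have one: "(\<integral>\<^sup>+u. ennreal (p4 s u * (u $ j)\<^sup>2) \<partial>lborel) = ennreal s" for j :: 4
  proof -
    define f where "f i x = normal_density 0 (sqrt s) x * (if i = j then x\<^sup>2 else 1)" for i x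
    have "p4 s u * (u $ j)\<^sup>2 = (\<Prod>i\<in>UNIV. f i (u $ i))" for u
      unfolding p4_eq_normal[OF assms] f_def by (simp add: prod.distrib prod.delta)
    then have "(\<integral>\<^sup>+u. ennreal (p4 s u * (u $ j)\<^sup>2) \<partial>lborel) = (\<integral>\<^sup>+u. ennreal (\<Prod>i\<in>UNIV. f i (u $ i)) \<partial>lborel)" by simp
    also have "\<dots> = (\<Prod>i\<in>UNIV. \<integral>\<^sup>+x. ennreal (f i x) \<partial>lborel)"
      by (intro nn_integral_lborel_vec_prod) (auto simp: f_def)
    also have "\<dots> = (\<Prod>i\<in>UNIV. if i = j then ennreal s else 1)"
      using assms by (intro prod.cong) (auto simp: f_def N)
    finally show ?thesis by (simp add: prod.delta)
  qed
  have [measurable]: "(\<lambda>u. p4 s u) \<in> borel_measurable borel"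
    unfolding p4_def by measurable
  have nn: "0 \<le> p4 s u" for u by (simp add: p4_def)
  have "p4 s u * (norm u)\<^sup>2 = (\<Sum>j\<in>UNIV. p4 s u * (u $ j)\<^sup>2)" for u
    by (simp add: norm_vec_def L2_set_def sum_nonneg sum_distrib_left)
  then have "(\<integral>\<^sup>+u. ennreal (p4 s u * (norm u)\<^sup>2) \<partial>lborel) = (\<integral>\<^sup>+u. (\<Sum>j\<in>UNIV. ennreal (p4 s u * (u $ j)\<^sup>2)) \<partial>lborel)"
    using nn by (simp add: sum_ennreal[symmetric] del: sum_ennreal)
  also have "\<dots> = (\<Sum>j\<in>(UNIV::4 set). ennreal s)"
    by (subst nn_integral_sum) (auto simp: one)
  also have "\<dots> = ennreal (4 * s)" using assms by (subst sum_ennreal) auto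
  finally show "(\<integral>\<^sup>+u. ennreal (p4 s u * (norm u)\<^sup>2) \<partial>lborel) = ennreal (4 * s)" .
qed

lemma borel_measurable_p4 [measurable]: "(\<lambda>(s, u). p4 s u) \<in> borel_measurable (borel \<Otimes>\<^sub>M borel)"
  unfolding p4_def by measurable

lemma sets_nu4 [simp]: "sets (nu4 \<alpha> \<beta>) = sets borel"
  by (simp add: nu4_def)

lemma nn_integral_nu4:
  assumes f[measurable]: "f \<in> borel_measurable borel" and a: "0 < \<alpha>"
  shows "(\<integral>\<^sup>+y. f y \<partial>nu4 \<alpha> \<beta>) = (\<integral>\<^sup>+s. ennreal (gamma_density \<alpha> \<beta> s) * (\<integral>\<^sup>+u. ennreal (p4 s u) * f (s, u) \<partial>lborel) \<partial>lborel)"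
proof -
  have [measurable]: "f \<in> borel_measurable (borel \<Otimes>\<^sub>M borel)" using f by (simp add: borel_prod)
  have p4: "0 \<le> p4 s u" for s u by (simp add: p4_def)
  have D: "(\<lambda>(s, u). ennreal (gamma_density \<alpha> \<beta> s * p4 s u)) \<in> borel_measurable (borel \<Otimes>\<^sub>M borel)" by measurable
  have "(\<integral>\<^sup>+y. f y \<partial>nu4 \<alpha> \<beta>) = (\<integral>\<^sup>+y. (case y of (s, u) \<Rightarrow> ennreal (gamma_density \<alpha> \<beta> s * p4 s u)) * f y \<partial>lborel)"
    unfolding nu4_def using D by (intro nn_integral_density) (auto simp: borel_prod)
  also have "\<dots> = (\<integral>\<^sup>+y. (case y of (s, u) \<Rightarrow> ennreal (gamma_density \<alpha> \<beta> s * p4 s u) * f (s, u)) \<partial>(lborel \<Otimes>\<^sub>M lborel))"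
    unfolding lborel_prod by (intro nn_integral_cong) auto
  also have "\<dots> = (\<integral>\<^sup>+s. \<integral>\<^sup>+u. ennreal (gamma_density \<alpha> \<beta> s * p4 s u) * f (s, u) \<partial>lborel \<partial>lborel)"
    by (subst lborel.nn_integral_fst[symmetric]) auto
  also have "\<dots> = (\<integral>\<^sup>+s. \<integral>\<^sup>+u. ennreal (gamma_density \<alpha> \<beta> s) * (ennreal (p4 s u) * f (s, u)) \<partial>lborel \<partial>lborel)"
    using p4 a by (simp add: ennreal_mult gamma_density_nonneg mult.assoc)
  also have "\<dots> = (\<integral>\<^sup>+s. ennreal (gamma_density \<alpha> \<beta> s) * (\<integral>\<^sup>+u. ennreal (p4 s u) * f (s, u) \<partial>lborel) \<partial>lborel)"
    by (intro nn_integral_cong nn_integral_cmult) measurable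
  finally show ?thesis .
qed

lemma sigma_finite_nu4: "sigma_finite_measure (nu4 \<alpha> \<beta>)"
proof -
  have D: "(\<lambda>(s, u). ennreal (gamma_density \<alpha> \<beta> s * p4 s u)) \<in> borel_measurable (borel \<Otimes>\<^sub>M borel)" by measurable
  show ?thesis
    unfolding nu4_def using D by (subst sigma_finite_measure.sigma_finite_iff_density_finite[OF lborel.sigma_finite_measure_axioms]) (auto simp: borel_prod)
qed

text \<open>The three powers are those met below: the root from the mean size of a normal vector of
  variance s, and s and its square from the time component and from second moments.\<close>

lemma gamma_density_sqrt_moment:
  assumes "0 < \<alpha>" "0 < \<beta>" "\<And>s. 0 < s \<Longrightarrow> f s \<le> c * (sqrt s + s + s\<^sup>2)" "0 \<le> c"
    "f \<in> borel_measurable borel" "\<And>s. 0 \<le> f s"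
  shows "(\<integral>\<^sup>+s. ennreal (gamma_density \<alpha> \<beta> s) * ennreal (f s) \<partial>lborel) < \<infinity>"
proof -
  let ?g = "gamma_density \<alpha> \<beta>"
  have "(\<integral>\<^sup>+s. ennreal (?g s) * ennreal (f s) \<partial>lborel)
    \<le> (\<integral>\<^sup>+s. ennreal c * ennreal (?g s * s powr (1/2)) + ennreal c * ennreal (?g s * s powr 1) + ennreal c * ennreal (?g s * s powr 2) \<partial>lborel)"
  proof (intro nn_integral_mono)
    fix s :: real
    show "ennreal (?g s) * ennreal (f s) \<le> ennreal c * ennreal (?g s * s powr (1/2)) + ennreal c * ennreal (?g s * s powr 1) + ennreal c * ennreal (?g s * s powr 2)"
    proof (cases "0 < s")
      case True
      have "?g s * f s \<le> ?g s * (c * (sqrt s + s + s\<^sup>2))"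
        using assms(3)[OF True] gamma_density_nonneg[OF assms(1)] by (intro mult_left_mono) auto
      then have "?g s * f s \<le> c * (?g s * s powr (1/2)) + c * (?g s * s powr 1) + c * (?g s * s powr 2)"
        using True by (simp add: powr_half_sqrt algebra_simps)
      then show ?thesis
        using gamma_density_nonneg[OF assms(1), of \<beta> s] assms(4,6)
        by (simp add: ennreal_mult[symmetric] ennreal_plus[symmetric] ennreal_leI del: ennreal_plus)
    qed (simp add: gamma_density_def)
  qed
  also have "\<dots> = ennreal c * (\<integral>\<^sup>+s. ennreal (?g s * s powr (1/2)) \<partial>lborel) + ennreal c * (\<integral>\<^sup>+s. ennreal (?g s * s powr 1) \<partial>lborel)
      + ennreal c * (\<integral>\<^sup>+s. ennreal (?g s * s powr 2) \<partial>lborel)"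
    by (simp add: nn_integral_add nn_integral_cmult)
  also have "\<dots> < \<infinity>"
    using gamma_density_moment[OF assms(1,2), of "1/2"] gamma_density_moment[OF assms(1,2), of 1] gamma_density_moment[OF assms(1,2), of 2]
    by (simp add: ennreal_mult_less_top)
  finally show ?thesis .
qed

lemma nu4_moments:
  assumes "0 < \<alpha>" "0 < \<beta>"
  shows "(\<integral>\<^sup>+y. ennreal (norm y) \<partial>nu4 \<alpha> \<beta>) < \<infinity>" "(\<integral>\<^sup>+y. ennreal ((norm y)\<^sup>2) \<partial>nu4 \<alpha> \<beta>) < \<infinity>"
proof -
  have [measurable]: "(\<lambda>u. p4 s u) \<in> borel_measurable borel" for s
    unfolding p4_def by measurable
  have nn: "0 \<le> p4 s u" for s u by (simp add: p4_def)
  have affine: "(\<integral>\<^sup>+u. ennreal (p4 s u) * ennreal (a + b * (norm u)\<^sup>2) \<partial>lborel) = ennreal (a + b * (4 * s))"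
    if "0 < s" "0 \<le> a" "0 \<le> b" for s a b
  proof -
    have "(\<integral>\<^sup>+u. ennreal (p4 s u) * ennreal (a + b * (norm u)\<^sup>2) \<partial>lborel)
      = (\<integral>\<^sup>+u. ennreal a * ennreal (p4 s u) + ennreal b * ennreal (p4 s u * (norm u)\<^sup>2) \<partial>lborel)"
      using that nn by (intro nn_integral_cong) (simp add: ennreal_mult[symmetric] ennreal_plus[symmetric] algebra_simps del: ennreal_plus)
    also have "\<dots> = ennreal a * 1 + ennreal b * ennreal (4 * s)"
      by (simp add: nn_integral_add nn_integral_cmult p4_moments[OF that(1)])
    also have "\<dots> = ennreal (a + b * (4 * s))"
      using that by (simp add: ennreal_mult[symmetric] ennreal_plus[symmetric] del: ennreal_plus)
    finally show ?thesis .
  qed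
  have sq: "(norm (s, u))\<^sup>2 = s\<^sup>2 + 1 * (norm u)\<^sup>2" for s :: real and u :: "real^4"
    by (simp add: norm_Pair)
  have "(\<integral>\<^sup>+y. ennreal ((norm y)\<^sup>2) \<partial>nu4 \<alpha> \<beta>)
    = (\<integral>\<^sup>+s. ennreal (gamma_density \<alpha> \<beta> s) * ennreal (s\<^sup>2 + 1 * (4 * \<bar>s\<bar>)) \<partial>lborel)"
  proof (subst nn_integral_nu4[OF _ assms(1)], measurable, intro nn_integral_cong)
    fix s :: real
    show "ennreal (gamma_density \<alpha> \<beta> s) * (\<integral>\<^sup>+u. ennreal (p4 s u) * ennreal ((norm (s, u))\<^sup>2) \<partial>lborel)
      = ennreal (gamma_density \<alpha> \<beta> s) * ennreal (s\<^sup>2 + 1 * (4 * \<bar>s\<bar>))"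
      unfolding sq using affine[of s "s\<^sup>2" 1] by (cases "0 < s") (auto simp: gamma_density_def)
  qed
  also have "\<dots> < \<infinity>"
    by (rule gamma_density_sqrt_moment[OF assms, of _ 4]) auto
  finally show "(\<integral>\<^sup>+y. ennreal ((norm y)\<^sup>2) \<partial>nu4 \<alpha> \<beta>) < \<infinity>" .
  \<comment> \<open>The inequality 2ab \<le> a^2 + b^2 with a = \<open>sqrt s\<close> bounds the
    norm by an affine function of its square, so the second moment of \<open>p4 s\<close> suffices,
    and the weight gives the right order in s.\<close>
  have le: "norm (s, u) \<le> (s + sqrt s / 2) + (1 / (2 * sqrt s)) * (norm u)\<^sup>2" if "0 < s" for s :: real and u :: "real^4"
  proof -
    have "2 * sqrt s * norm u \<le> (sqrt s)\<^sup>2 + (norm u)\<^sup>2" by (rule sum_squares_bound)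
    then have "norm u \<le> sqrt s / 2 + (1 / (2 * sqrt s)) * (norm u)\<^sup>2"
      using that by (simp add: field_simps power2_eq_square)
    moreover have "norm (s, u) \<le> s + norm u" using norm_Pair_le[of s u] that by simp
    ultimately show ?thesis by simp
  qed
  \<comment> \<open>The coefficient 5/2 is 1/2 from the constant term plus 2 from the second moment
    4s divided by 2 \<open>sqrt s\<close>. Absolute values keep the bound nonnegative for s \<le> 0,
    where the density vanishes.\<close>
  have "(\<integral>\<^sup>+y. ennreal (norm y) \<partial>nu4 \<alpha> \<beta>)
    \<le> (\<integral>\<^sup>+s. ennreal (gamma_density \<alpha> \<beta> s) * ennreal (\<bar>s\<bar> + 5 / 2 * sqrt \<bar>s\<bar>) \<partial>lborel)"
  proof (subst nn_integral_nu4[OF _ assms(1)], measurable, intro nn_integral_mono)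
    fix s :: real
    show "ennreal (gamma_density \<alpha> \<beta> s) * (\<integral>\<^sup>+u. ennreal (p4 s u) * ennreal (norm (s, u)) \<partial>lborel)
      \<le> ennreal (gamma_density \<alpha> \<beta> s) * ennreal (\<bar>s\<bar> + 5 / 2 * sqrt \<bar>s\<bar>)"
    proof (cases "0 < s")
      case True
      have "(\<integral>\<^sup>+u. ennreal (p4 s u) * ennreal (norm (s, u)) \<partial>lborel)
        \<le> (\<integral>\<^sup>+u. ennreal (p4 s u) * ennreal ((s + sqrt s / 2) + (1 / (2 * sqrt s)) * (norm u)\<^sup>2) \<partial>lborel)"
        by (intro nn_integral_mono mult_left_mono ennreal_leI le True) auto
      also have "\<dots> = ennreal ((s + sqrt s / 2) + (1 / (2 * sqrt s)) * (4 * s))"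
        by (rule affine) (use True in auto)
      also have "(1 / (2 * sqrt s)) * (4 * s) = 2 * sqrt s"
        using True by (simp add: field_simps)
      finally show ?thesis using True by (intro mult_left_mono) (auto simp: add.commute)
    qed (simp add: gamma_density_def)
  qed
  also have "\<dots> < \<infinity>"
    by (rule gamma_density_sqrt_moment[OF assms, of _ 4]) auto
  finally show "(\<integral>\<^sup>+y. ennreal (norm y) \<partial>nu4 \<alpha> \<beta>) < \<infinity>" .
qed

section \<open>Summability of the jumps\<close>

text \<open>Brownian scaling: coordinate i at time t is normal with standard deviation
  \<open>sqrt (t * q i)\<close>, where \<open>q i\<close> is a diagonal entry of \<Sigma>, positive
  by positive definiteness. Time 0 is separate because normal laws are given only for s < t.\<close>

lemma brownian_norm_bound:
  fixes W :: "real \<Rightarrow> 'w \<Rightarrow> real^'n" and B :: "real^'n^'m"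
  assumes M: "prob_space M" and W: "brownian_motion M \<Sigma> W" and \<Sigma>: "positive_definite \<Sigma>"
  obtains c where "0 \<le> c" "\<And>t. 0 \<le> t \<Longrightarrow> (\<integral>\<^sup>+\<omega>. ennreal (norm (B *v W t \<omega>)) \<partial>M) \<le> ennreal (c * sqrt t)"
proof -
  interpret prob_space M by fact
  obtain K where K: "0 < K" "\<And>v. norm (B *v v) \<le> norm v * K"
    using bounded_linear.pos_bounded[OF matrix_vector_mul_bounded_linear[of B]] by blast
  define q where "q i = axis i 1 \<bullet> (\<Sigma> *v axis i 1)" for i :: 'n
  have q: "0 < q i" for i
    using \<Sigma> unfolding positive_definite_def q_def by (auto simp: axis_eq_0_iff)
  have meas[measurable]: "W t \<in> borel_measurable M" if "0 \<le> t" for t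
    using W that by (simp add: brownian_motion_def)
  have W0: "AE \<omega> in M. W 0 \<omega> = 0" using W by (simp add: brownian_motion_def)
  have comp: "(\<integral>\<^sup>+\<omega>. ennreal \<bar>W t \<omega> $ i\<bar> \<partial>M) \<le> ennreal (sqrt (q i) * sqrt t)" if t: "0 < t" for t i
  proof -
    define \<sigma> where "\<sigma> = sqrt (t * q i)"
    have \<sigma>: "0 < \<sigma>" using t q by (simp add: \<sigma>_def)
    have "\<forall>a. a \<noteq> 0 \<longrightarrow> distributed M lborel (\<lambda>\<omega>. a \<bullet> (W t \<omega> - W 0 \<omega>))
          (\<lambda>x. ennreal (normal_density 0 (sqrt ((t - 0) * (a \<bullet> (\<Sigma> *v a)))) x))"
      using W t unfolding brownian_motion_def by blast
    from this[rule_format, of "axis i 1"]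
    have D: "distributed M lborel (\<lambda>\<omega>. axis i 1 \<bullet> (W t \<omega> - W 0 \<omega>)) (\<lambda>x. ennreal (normal_density 0 \<sigma> x))"
      by (simp add: axis_eq_0_iff \<sigma>_def q_def)
    have "(\<integral>\<^sup>+\<omega>. ennreal \<bar>W t \<omega> $ i\<bar> \<partial>M) = (\<integral>\<^sup>+\<omega>. ennreal \<bar>axis i 1 \<bullet> (W t \<omega> - W 0 \<omega>)\<bar> \<partial>M)"
      using W0 by (intro nn_integral_cong_AE) (auto simp: inner_axis' elim!: eventually_mono)
    also have "\<dots> = (\<integral>\<^sup>+x. ennreal (normal_density 0 \<sigma> x) * ennreal \<bar>x\<bar> \<partial>lborel)"
      using distributed_nn_integral[OF D, of "\<lambda>x. ennreal \<bar>x\<bar>"] by simp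
    also have "\<dots> = (\<integral>\<^sup>+x. ennreal (normal_density 0 \<sigma> x * \<bar>x\<bar>) \<partial>lborel)"
      by (simp add: ennreal_mult)
    also have "\<dots> \<le> ennreal \<sigma>" by (rule nn_integral_normal_moments(3)[OF \<sigma>])
    finally show ?thesis by (simp add: \<sigma>_def real_sqrt_mult mult.commute)
  qed
  have "(\<integral>\<^sup>+\<omega>. ennreal (norm (B *v W t \<omega>)) \<partial>M) \<le> ennreal ((K * (\<Sum>i\<in>UNIV. sqrt (q i))) * sqrt t)" if t: "0 \<le> t" for t
  proof (cases "t = 0")
    case True
    have "(\<integral>\<^sup>+\<omega>. ennreal (norm (B *v W t \<omega>)) \<partial>M) = (\<integral>\<^sup>+\<omega>. 0 \<partial>M)"
      using W0 True by (intro nn_integral_cong_AE) (auto elim!: eventually_mono)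
    then show ?thesis using True by simp
  next
    case False
    then have t: "0 < t" using t by simp
    have "(\<integral>\<^sup>+\<omega>. ennreal (norm (B *v W t \<omega>)) \<partial>M) \<le> (\<integral>\<^sup>+\<omega>. ennreal K * (\<Sum>i\<in>UNIV. ennreal \<bar>W t \<omega> $ i\<bar>) \<partial>M)"
    proof (rule nn_integral_mono)
      fix \<omega>
      have "norm (B *v W t \<omega>) \<le> K * (\<Sum>i\<in>UNIV. \<bar>W t \<omega> $ i\<bar>)"
        using K(2)[of "W t \<omega>"] mult_left_mono[OF norm_le_l1_cart[of "W t \<omega>"], of K] K(1)
        by (auto simp: mult.commute intro: order_trans)
      then show "ennreal (norm (B *v W t \<omega>)) \<le> ennreal K * (\<Sum>i\<in>UNIV. ennreal \<bar>W t \<omega> $ i\<bar>)"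
        using K(1) by (simp add: ennreal_mult[symmetric] sum_nonneg ennreal_leI)
    qed
    also have "\<dots> = ennreal K * (\<Sum>i\<in>UNIV. \<integral>\<^sup>+\<omega>. ennreal \<bar>W t \<omega> $ i\<bar> \<partial>M)"
    proof -
      have [measurable]: "W t \<in> borel_measurable M" using meas t by simp
      have [measurable]: "(\<lambda>\<omega>. W t \<omega> $ i) \<in> borel_measurable M" for i
        unfolding cart_eq_inner_axis by measurable
      show ?thesis by (simp add: nn_integral_cmult nn_integral_sum del: sum_ennreal)
    qed
    also have "\<dots> \<le> ennreal K * (\<Sum>i\<in>UNIV. ennreal (sqrt (q i) * sqrt t))"
      by (intro mult_left_mono sum_mono comp t) auto
    also have "\<dots> = ennreal ((K * (\<Sum>i\<in>UNIV. sqrt (q i))) * sqrt t)"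
      using K(1) t q by (subst sum_ennreal) (auto simp: ennreal_mult[symmetric] sum_nonneg less_imp_le sum_distrib_right mult.assoc)
    finally show ?thesis .
  qed
  moreover have "0 \<le> K * (\<Sum>i\<in>UNIV. sqrt (q i))" using K(1) q by (simp add: sum_nonneg less_imp_le)
  ultimately show ?thesis using that by blast
qed

text \<open>Factorization of a mean over an independent event. This is the form of independence
  needed when a random time has been rounded to countably many values.\<close>

lemma (in prob_space) nn_integral_indep_event:
  assumes indep: "indep_set \<A> (sets N)" and N: "space N = space M" and E: "E \<in> \<A>" and f: "f \<in> borel_measurable N"
  shows "(\<integral>\<^sup>+\<omega>. indicator E \<omega> * f \<omega> \<partial>M) = emeasure M E * (\<integral>\<^sup>+\<omega>. f \<omega> \<partial>M)"
proof -
  have [measurable]: "E \<in> events" using indep_setD_ev1[OF indep] E by blast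
  have sub: "subalgebra M N" using indep_setD_ev2[OF indep] N by (simp add: subalgebra_def)
  have m: "g \<in> borel_measurable M" if "g \<in> borel_measurable N" for g :: "'a \<Rightarrow> ennreal"
    using measurable_from_subalg[OF sub that] .
  show ?thesis
    using f
  proof (induct rule: borel_measurable_induct)
    case (cong f g)
    then show ?case using N by (auto cong: nn_integral_cong)
  next
    case (set A)
    then have [measurable]: "A \<in> events" using indep_setD_ev2[OF indep] by blast
    have "(\<integral>\<^sup>+\<omega>. indicator E \<omega> * indicator A \<omega> \<partial>M) = emeasure M (E \<inter> A)"
      by (simp add: indicator_inter_arith[symmetric])
    also have "\<dots> = emeasure M E * emeasure M A"
      using indep_setD[OF indep E set] by (simp add: emeasure_eq_measure ennreal_mult)
    finally show ?case by simp
  next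
    case (mult u c)
    then have [measurable]: "u \<in> borel_measurable M" using m by blast
    have "(\<integral>\<^sup>+\<omega>. indicator E \<omega> * (c * u \<omega>) \<partial>M) = (\<integral>\<^sup>+\<omega>. c * (indicator E \<omega> * u \<omega>) \<partial>M)" by (simp add: ac_simps)
    then show ?case using mult by (simp add: nn_integral_cmult ac_simps)
  next
    case (add u v)
    then have [measurable]: "u \<in> borel_measurable M" "v \<in> borel_measurable M" using m by blast+
    show ?case using add by (simp add: nn_integral_add distrib_left)
  next
    case (seq U)
    then have [measurable]: "U i \<in> borel_measurable M" for i using m by blast
    have "(\<integral>\<^sup>+\<omega>. indicator E \<omega> * (SUP i. U i) \<omega> \<partial>M) = (\<integral>\<^sup>+\<omega>. (SUP i. indicator E \<omega> * U i \<omega>) \<partial>M)"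
      by (simp add: SUP_mult_left_ennreal image_comp)
    also have "\<dots> = (SUP i. \<integral>\<^sup>+\<omega>. indicator E \<omega> * U i \<omega> \<partial>M)"
      using seq(4) by (intro nn_integral_monotone_convergence_SUP) (auto simp: incseq_def le_fun_def intro: mult_left_mono)
    also have "\<dots> = emeasure M E * (SUP i. \<integral>\<^sup>+\<omega>. U i \<omega> \<partial>M)"
      using seq(3) by (simp add: SUP_mult_left_ennreal)
    also have "(SUP i. \<integral>\<^sup>+\<omega>. U i \<omega> \<partial>M) = (\<integral>\<^sup>+\<omega>. (SUP i. U i) \<omega> \<partial>M)"
      using nn_integral_monotone_convergence_SUP[OF seq(4), of M] by (simp add: image_comp)
    finally show ?case .
  qed
qed

text \<open>The bound at deterministic times is transferred to an independent random time: the time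
  is rounded to a grid, on each event of constancy independence applies, and continuity of the path
  with Fatou's lemma removes the rounding.\<close>

lemma (in prob_space) nn_integral_time_change:
  fixes W :: "real \<Rightarrow> 'a \<Rightarrow> 'b::euclidean_space" and h :: "'b \<Rightarrow> real"
  assumes indep: "indep_set \<A> (sets (process_sigma M {0..} W))"
    and Z: "\<And>A. A \<in> sets borel \<Longrightarrow> Z -` A \<inter> space M \<in> \<A>" "AE \<omega> in M. 0 \<le> Z \<omega>"
    and W: "AE \<omega> in M. continuous_on {0..} (\<lambda>t. W t \<omega>)"
    and h: "continuous_on UNIV h" "\<And>y. 0 \<le> h y" and c: "0 \<le> c"
    and bound: "\<And>t. 0 \<le> t \<Longrightarrow> (\<integral>\<^sup>+\<omega>. ennreal (h (W t \<omega>)) \<partial>M) \<le> ennreal (c * sqrt t)"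
  shows "(\<integral>\<^sup>+\<omega>. ennreal (h (W (Z \<omega>) \<omega>)) \<partial>M) \<le> ennreal c * (\<integral>\<^sup>+\<omega>. ennreal (sqrt (Z \<omega>)) \<partial>M)"
proof -
  let ?N = "process_sigma M {0..} W"
  have Zm[measurable]: "Z \<in> borel_measurable M"
    using Z(1) indep_setD_ev1[OF indep] by (intro measurableI) auto
  have spN: "space ?N = space M" by (simp add: process_sigma_def)
  have hm: "h \<in> borel_measurable borel" by (rule borel_measurable_continuous_onI[OF h(1)])
  have WN: "W t \<in> borel_measurable ?N" if "0 \<le> t" for t
  proof -
    have "(\<lambda>\<omega>. \<lambda>t\<in>{0..}. W t \<omega>) \<in> measurable ?N (PiM {0..} (\<lambda>_. borel))"
      unfolding process_sigma_def by (rule measurable_vimage_algebra1) (auto simp: space_PiM)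
    from measurable_compose[OF this measurable_component_singleton[of t]] that
    show ?thesis by simp
  qed
  have sub: "subalgebra M ?N" using indep_setD_ev2[OF indep] spN by (simp add: subalgebra_def)
  have hWN: "(\<lambda>\<omega>. ennreal (h (W t \<omega>))) \<in> borel_measurable ?N" if "0 \<le> t" for t
    using measurable_compose[OF WN[OF that] hm] by measurable
  have hWM: "(\<lambda>\<omega>. ennreal (h (W t \<omega>))) \<in> borel_measurable M" if "0 \<le> t" for t
    by (rule measurable_from_subalg[OF sub hWN[OF that]])
  \<comment> \<open>Rounding up leaves an error of at most 1/(k+1) in the time, hence of at most
    \<open>sqrt (1 / real (Suc k))\<close> in its root, which vanishes in the limit.\<close>
  define N where "N k \<omega> = nat \<lceil>Z \<omega> * real (Suc k)\<rceil>" for k \<omega>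
  define E where "E k i = {\<omega>\<in>space M. N k \<omega> = i}" for k i
  define u where "u k \<omega> = (\<Sum>i. indicator (E k i) \<omega> * ennreal (h (W (real i / real (Suc k)) \<omega>)))" for k \<omega>
  have E: "E k i \<in> \<A>" "E k i \<in> events" for k i
  proof -
    have "E k i = Z -` ((\<lambda>x. nat \<lceil>x * real (Suc k)\<rceil>) -` {i} \<inter> space borel) \<inter> space M" by (auto simp: E_def N_def)
    moreover have "(\<lambda>x::real. nat \<lceil>x * real (Suc k)\<rceil>) \<in> measurable borel (count_space UNIV)" by measurable
    then have "(\<lambda>x::real. nat \<lceil>x * real (Suc k)\<rceil>) -` {i} \<inter> space borel \<in> sets borel" by (rule measurable_sets) simp
    ultimately show "E k i \<in> \<A>" using Z(1) by simp
    then show "E k i \<in> events" using indep_setD_ev1[OF indep] by blast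
  qed
  have sum_E: "(\<Sum>i. indicator (E k i) \<omega> * g i) = g (N k \<omega>)" if "\<omega> \<in> space M" for k \<omega> and g :: "nat \<Rightarrow> ennreal"
  proof -
    have "(\<Sum>i. indicator (E k i) \<omega> * g i) = (\<Sum>i\<in>{N k \<omega>}. indicator (E k i) \<omega> * g i)"
      using that by (intro suminf_finite) (auto simp: E_def)
    then show ?thesis using that by (simp add: E_def)
  qed
  have u_eq: "u k \<omega> = ennreal (h (W (real (N k \<omega>) / real (Suc k)) \<omega>))" if "\<omega> \<in> space M" for k \<omega>
    unfolding u_def by (rule sum_E[OF that])
  have Nk: "Z \<omega> \<le> real (N k \<omega>) / real (Suc k)" "real (N k \<omega>) / real (Suc k) \<le> Z \<omega> + 1 / real (Suc k)" if "0 \<le> Z \<omega>" for k \<omega>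
  proof -
    have "0 \<le> Z \<omega> * real (Suc k)" using that by simp
    then have "0 \<le> \<lceil>Z \<omega> * real (Suc k)\<rceil>" by linarith
    then have r: "real (N k \<omega>) = of_int \<lceil>Z \<omega> * real (Suc k)\<rceil>" unfolding N_def by simp
    have "Z \<omega> * real (Suc k) \<le> real (N k \<omega>)" unfolding r by linarith
    then show "Z \<omega> \<le> real (N k \<omega>) / real (Suc k)" by (subst pos_le_divide_eq) auto
    have "real (N k \<omega>) \<le> Z \<omega> * real (Suc k) + 1" unfolding r by linarith
    then have "real (N k \<omega>) / real (Suc k) \<le> (Z \<omega> * real (Suc k) + 1) / real (Suc k)" by (rule divide_right_mono) simp
    also have "\<dots> = Z \<omega> + 1 / real (Suc k)" by (simp add: add_divide_distrib)
    finally show "real (N k \<omega>) / real (Suc k) \<le> Z \<omega> + 1 / real (Suc k)" .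
  qed
  have um: "u k \<in> borel_measurable M" for k
    unfolding u_def using hWM E by (intro borel_measurable_suminf_order borel_measurable_times_ennreal borel_measurable_indicator) auto
  have int_u: "(\<integral>\<^sup>+\<omega>. u k \<omega> \<partial>M) \<le> ennreal c * (\<integral>\<^sup>+\<omega>. ennreal (sqrt (Z \<omega>)) \<partial>M) + ennreal (c * sqrt (1 / real (Suc k)))" for k
  proof -
    have "(\<integral>\<^sup>+\<omega>. u k \<omega> \<partial>M) = (\<Sum>i. \<integral>\<^sup>+\<omega>. indicator (E k i) \<omega> * ennreal (h (W (real i / real (Suc k)) \<omega>)) \<partial>M)"
      unfolding u_def using hWM E by (intro nn_integral_suminf borel_measurable_times_ennreal borel_measurable_indicator) auto
    also have "\<dots> = (\<Sum>i. emeasure M (E k i) * (\<integral>\<^sup>+\<omega>. ennreal (h (W (real i / real (Suc k)) \<omega>)) \<partial>M))"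
      by (intro suminf_cong nn_integral_indep_event[OF indep spN E(1) hWN]) auto
    also have "\<dots> \<le> (\<Sum>i. emeasure M (E k i) * ennreal (c * sqrt (real i / real (Suc k))))"
      by (intro suminf_le mult_left_mono bound) auto
    also have "\<dots> = (\<Sum>i. \<integral>\<^sup>+\<omega>. indicator (E k i) \<omega> * ennreal (c * sqrt (real i / real (Suc k))) \<partial>M)"
      using E by (simp add: nn_integral_multc)
    also have "\<dots> = (\<integral>\<^sup>+\<omega>. (\<Sum>i. indicator (E k i) \<omega> * ennreal (c * sqrt (real i / real (Suc k)))) \<partial>M)"
      using E by (intro nn_integral_suminf[symmetric]) auto
    also have "\<dots> = (\<integral>\<^sup>+\<omega>. ennreal (c * sqrt (real (N k \<omega>) / real (Suc k))) \<partial>M)"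
      by (intro nn_integral_cong sum_E)
    also have "\<dots> \<le> (\<integral>\<^sup>+\<omega>. ennreal c * ennreal (sqrt (Z \<omega>)) + ennreal (c * sqrt (1 / real (Suc k))) \<partial>M)"
    proof (rule nn_integral_mono_AE)
      show "AE \<omega> in M. ennreal (c * sqrt (real (N k \<omega>) / real (Suc k))) \<le> ennreal c * ennreal (sqrt (Z \<omega>)) + ennreal (c * sqrt (1 / real (Suc k)))"
        using Z(2)
      proof eventually_elim
        case (elim \<omega>)
        have "sqrt (real (N k \<omega>) / real (Suc k)) \<le> sqrt (Z \<omega>) + sqrt (1 / real (Suc k))"
          using Nk(2)[OF elim, of k] sqrt_add_le_add_sqrt[of "Z \<omega>" "1 / real (Suc k)"] elim
          by (meson divide_nonneg_nonneg of_nat_0_le_iff order_trans real_sqrt_le_iff zero_le_one)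
        then have "c * sqrt (real (N k \<omega>) / real (Suc k)) \<le> c * sqrt (Z \<omega>) + c * sqrt (1 / real (Suc k))"
          using c by (metis distrib_left mult_left_mono)
        then show ?case
          using c elim by (simp add: ennreal_mult[symmetric] ennreal_plus[symmetric] ennreal_leI del: ennreal_plus of_nat_Suc)
      qed
    qed
    also have "\<dots> = ennreal c * (\<integral>\<^sup>+\<omega>. ennreal (sqrt (Z \<omega>)) \<partial>M) + ennreal (c * sqrt (1 / real (Suc k)))"
      by (simp add: nn_integral_add nn_integral_cmult emeasure_space_1)
    finally show ?thesis .
  qed
  have "(\<integral>\<^sup>+\<omega>. ennreal (h (W (Z \<omega>) \<omega>)) \<partial>M) = (\<integral>\<^sup>+\<omega>. liminf (\<lambda>k. u k \<omega>) \<partial>M)"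
  proof (rule nn_integral_cong_AE)
    show "AE \<omega> in M. ennreal (h (W (Z \<omega>) \<omega>)) = liminf (\<lambda>k. u k \<omega>)"
      using W Z(2) AE_space
    proof eventually_elim
      case (elim \<omega>)
      have "(\<lambda>k. real (N k \<omega>) / real (Suc k)) \<longlonglongrightarrow> Z \<omega>"
      proof (rule tendsto_sandwich[where f = "\<lambda>_. Z \<omega>" and h = "\<lambda>k. Z \<omega> + 1 / real (Suc k)"])
        show "(\<lambda>k. Z \<omega> + 1 / real (Suc k)) \<longlonglongrightarrow> Z \<omega>"
          using tendsto_add[OF tendsto_const LIMSEQ_Suc[OF lim_const_over_n[of 1]]] by simp
      qed (use Nk[OF elim(2)] in auto)
      then have "(\<lambda>k. W (real (N k \<omega>) / real (Suc k)) \<omega>) \<longlonglongrightarrow> W (Z \<omega>) \<omega>"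
        using elim(1,2) by (intro continuous_on_tendsto_compose[of "{0..}" "\<lambda>t. W t \<omega>"]) auto
      then have "(\<lambda>k. ennreal (h (W (real (N k \<omega>) / real (Suc k)) \<omega>))) \<longlonglongrightarrow> ennreal (h (W (Z \<omega>) \<omega>))"
        by (intro tendsto_ennrealI continuous_on_tendsto_compose[OF h(1)]) auto
      then have "(\<lambda>k. u k \<omega>) \<longlonglongrightarrow> ennreal (h (W (Z \<omega>) \<omega>))" using u_eq[OF elim(3)] by simp
      then show ?case by (simp add: lim_imp_Liminf)
    qed
  qed
  also have "\<dots> \<le> liminf (\<lambda>k. \<integral>\<^sup>+\<omega>. u k \<omega> \<partial>M)"
    by (rule nn_integral_liminf[OF um])
  also have "\<dots> \<le> liminf (\<lambda>k. ennreal c * (\<integral>\<^sup>+\<omega>. ennreal (sqrt (Z \<omega>)) \<partial>M) + ennreal (c * sqrt (1 / real (Suc k))))"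
    by (intro Liminf_mono always_eventually allI int_u)
  also have "\<dots> = ennreal c * (\<integral>\<^sup>+\<omega>. ennreal (sqrt (Z \<omega>)) \<partial>M)"
  proof (rule lim_imp_Liminf)
    have "(\<lambda>k. c * sqrt (1 / real (Suc k))) \<longlonglongrightarrow> c * sqrt 0"
      by (intro tendsto_mult tendsto_const tendsto_real_sqrt LIMSEQ_Suc[OF lim_const_over_n])
    then have "(\<lambda>k. ennreal (c * sqrt (1 / real (Suc k)))) \<longlonglongrightarrow> ennreal (c * sqrt 0)" by (rule tendsto_ennrealI)
    from tendsto_add[OF tendsto_const this]
    show "(\<lambda>k. ennreal c * (\<integral>\<^sup>+\<omega>. ennreal (sqrt (Z \<omega>)) \<partial>M) + ennreal (c * sqrt (1 / real (Suc k))))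
      \<longlonglongrightarrow> ennreal c * (\<integral>\<^sup>+\<omega>. ennreal (sqrt (Z \<omega>)) \<partial>M)" by simp
  qed simp
  finally show ?thesis .
qed

text \<open>Up to a constant this dominates the mean size of a jump of \<open>L\<close> given a jump
  s of \<gamma>: the first term is for the clock itself, the root for the Brownian component. It is
  subadditive, and its integral for the Gamma Levy measure is finite.\<close>

definition sqrt_lin :: "real \<Rightarrow> ennreal" where
  "sqrt_lin s = ennreal (\<bar>s\<bar> + sqrt \<bar>s\<bar>)"

lemma borel_measurable_sqrt_lin [measurable]: "sqrt_lin \<in> borel_measurable borel"
  unfolding sqrt_lin_def[abs_def] by measurable

lemma sqrt_lin_sum: "sqrt_lin (sum f A) \<le> (\<Sum>z\<in>A. sqrt_lin (f z))"
proof (induct A rule: infinite_finite_induct)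
  case (insert x A)
  have "\<bar>f x + sum f A\<bar> \<le> \<bar>f x\<bar> + \<bar>sum f A\<bar>" by simp
  moreover have "sqrt \<bar>f x + sum f A\<bar> \<le> sqrt \<bar>f x\<bar> + sqrt \<bar>sum f A\<bar>"
    using sqrt_add_le_add_sqrt[of "\<bar>f x\<bar>" "\<bar>sum f A\<bar>"] by (smt (verit) real_sqrt_le_mono abs_triangle_ineq)
  ultimately have "sqrt_lin (f x + sum f A) \<le> sqrt_lin (f x) + sqrt_lin (sum f A)"
    unfolding sqrt_lin_def by (subst ennreal_plus[symmetric]) (auto intro: ennreal_leI simp del: ennreal_plus)
  also have "\<dots> \<le> sqrt_lin (f x) + (\<Sum>z\<in>A. sqrt_lin (f z))" using insert by (intro add_left_mono) auto
  finally show ?case using insert by simp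
qed (simp_all add: sqrt_lin_def)

text \<open>Countable subadditivity: finite partial sums obey it, and \<open>sqrt_lin\<close> is
  continuous.\<close>

lemma sqrt_lin_has_sum:
  assumes "(f has_sum S) A"
  shows "sqrt_lin S \<le> (\<integral>\<^sup>+z. indicator A z * sqrt_lin (f z) \<partial>count_space UNIV)"
proof (rule tendsto_upperbound)
  have "(sum f \<longlongrightarrow> S) (finite_subsets_at_top A)" using assms by (simp add: has_sum_def)
  then show "((\<lambda>B. sqrt_lin (sum f B)) \<longlongrightarrow> sqrt_lin S) (finite_subsets_at_top A)"
    unfolding sqrt_lin_def by (intro tendsto_ennrealI tendsto_add tendsto_rabs tendsto_real_sqrt)
  show "\<forall>\<^sub>F B in finite_subsets_at_top A. sqrt_lin (sum f B) \<le> (\<integral>\<^sup>+z. indicator A z * sqrt_lin (f z) \<partial>count_space UNIV)"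
  proof (rule eventually_finite_subsets_at_top_weakI)
    fix B assume B: "finite B" "B \<subseteq> A"
    have "sqrt_lin (sum f B) \<le> (\<Sum>z\<in>B. sqrt_lin (f z))" by (rule sqrt_lin_sum)
    also have "\<dots> = (\<integral>\<^sup>+z. indicator B z * sqrt_lin (f z) \<partial>count_space UNIV)"
      using B(1) by (subst nn_integral_count_space'[OF B(1)]) (auto intro!: sum.cong)
    also have "\<dots> \<le> (\<integral>\<^sup>+z. indicator A z * sqrt_lin (f z) \<partial>count_space UNIV)"
      using B(2) by (intro nn_integral_mono mult_right_mono) (auto simp: indicator_def)
    finally show "sqrt_lin (sum f B) \<le> (\<integral>\<^sup>+z. indicator A z * sqrt_lin (f z) \<partial>count_space UNIV)" .
  qed
qed simp

text \<open>A pure-jump path has as increment over a cell the sum of its jumps there. Subadditivity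
  applies cell by cell, and the cells are disjoint.\<close>

lemma sqrt_lin_increments:
  fixes f :: "real \<Rightarrow> real"
  assumes f: "\<And>t. 0 \<le> t \<Longrightarrow> ((\<lambda>z. jump f z) has_sum f t) {0<..t}" and q: "0 < q"
  shows "(\<Sum>i<q. sqrt_lin (f (real (Suc i) / real q) - f (real i / real q)))
    \<le> (\<integral>\<^sup>+(z, s). indicator {0<..1} z * sqrt_lin s \<partial>jump_measure f)"
proof -
  let ?I = "\<lambda>i. {real i / real q <.. real (Suc i) / real q}"
  have "(\<Sum>i<q. sqrt_lin (f (real (Suc i) / real q) - f (real i / real q)))
    \<le> (\<Sum>i<q. \<integral>\<^sup>+z. indicator (?I i) z * sqrt_lin (jump f z) \<partial>count_space UNIV)"
  proof (rule sum_mono)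
    fix i
    have le: "real i / real q \<le> real (Suc i) / real q" by (intro divide_right_mono) auto
    have "((\<lambda>z. jump f z) has_sum f (real (Suc i) / real q) - f (real i / real q))
      ({0<..real (Suc i) / real q} - {0<..real i / real q})"
      using le by (intro has_sum_Diff f) auto
    moreover have "{0<..real (Suc i) / real q} - {0<..real i / real q} = ?I i"
    proof -
      have "{0<..b} - {0<..a} = {a<..b}" if "0 \<le> a" "a \<le> b" for a b :: real using that by auto
      then show ?thesis using le by simp
    qed
    ultimately show "sqrt_lin (f (real (Suc i) / real q) - f (real i / real q))
      \<le> (\<integral>\<^sup>+z. indicator (?I i) z * sqrt_lin (jump f z) \<partial>count_space UNIV)"
      by (intro sqrt_lin_has_sum) simp
  qed
  also have "\<dots> = (\<integral>\<^sup>+z. (\<Sum>i<q. indicator (?I i) z * sqrt_lin (jump f z)) \<partial>count_space UNIV)"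
    by (rule nn_integral_sum[symmetric]) simp
  also have "\<dots> \<le> (\<integral>\<^sup>+z. indicator {0<..1} z * sqrt_lin (jump f z) \<partial>count_space UNIV)"
  proof (intro nn_integral_mono)
    fix z
    have "m = n" if x: "x \<in> ?I m" "x \<in> ?I n" for m n x
    proof -
      have "real m / real q < real (Suc n) / real q" "real n / real q < real (Suc m) / real q"
        using x by (auto simp del: of_nat_Suc)
      then have "m < Suc n" "n < Suc m" using q by (auto simp: divide_less_cancel simp del: of_nat_Suc)
      then show ?thesis by simp
    qed
    then have disj: "disjoint_family_on ?I {..<q}" unfolding disjoint_family_on_def by blast
    have "(\<Union>i<q. ?I i) \<subseteq> {0<..1}"
    proof safe
      fix i x assume i: "i < q" and x: "x \<in> ?I i"
      have "real (Suc i) / real q \<le> 1" using i q by (simp add: divide_le_eq)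
      moreover have "0 \<le> real i / real q" by simp
      ultimately show "x \<in> {0<..1}" using x by (simp only: greaterThanAtMost_iff) linarith
    qed
    then have "indicator (\<Union>i<q. ?I i) z \<le> (indicator {0<..1} z :: ennreal)" by (rule indicator_leI[OF subsetD])
    then show "(\<Sum>i<q. indicator (?I i) z * sqrt_lin (jump f z)) \<le> indicator {0<..1} z * sqrt_lin (jump f z)"
      unfolding indicator_UN_disjoint[OF finite_lessThan disj] sum_distrib_right[symmetric] by (rule mult_right_mono) simp
  qed
  also have "\<dots> = (\<integral>\<^sup>+z. indicator {0<..1} z * sqrt_lin (jump f z) \<partial>count_space {z. 0 < z \<and> jump f z \<noteq> 0})"
  proof -
    have "(\<integral>\<^sup>+z. indicator {0<..1} z * sqrt_lin (jump f z) \<partial>count_space {z. 0 < z \<and> jump f z \<noteq> 0})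
      = (\<integral>\<^sup>+z. indicator {0<..1} z * sqrt_lin (jump f z) * indicator {z. 0 < z \<and> jump f z \<noteq> 0} z \<partial>count_space UNIV)"
      by (subst nn_integral_count_space_indicator) auto
    also have "\<dots> = (\<integral>\<^sup>+z. indicator {0<..1} z * sqrt_lin (jump f z) \<partial>count_space UNIV)"
      by (intro nn_integral_cong) (auto simp: indicator_def sqrt_lin_def)
    finally show ?thesis by simp
  qed
  also have "\<dots> = (\<integral>\<^sup>+(z, s). indicator {0<..1} z * sqrt_lin s \<partial>jump_measure f)"
    by (subst nn_integral_jump_measure[OF borel_measurable_time_mark]) auto
  finally show ?thesis .
qed


context complete_filtration
begin

lemma levy_cadlag_process: "levy_process M F L \<Longrightarrow> cadlag_process M F L"
  by unfold_locales (auto simp: levy_process_def)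

lemma levy_increment_distr:
  assumes "levy_process M F L" "0 \<le> s" "s \<le> t" "f \<in> borel_measurable borel"
  shows "(\<integral>\<^sup>+\<omega>. f (L t \<omega> - L s \<omega>) \<partial>M) = (\<integral>\<^sup>+\<omega>. f (L (t - s) \<omega>) \<partial>M)"
proof -
  interpret cadlag_process M F L by (rule levy_cadlag_process[OF assms(1)])
  have m[measurable]: "L u \<in> borel_measurable M" if "0 \<le> u" for u
    using borel_measurable_F_M[OF adapted] that by blast
  have eq: "distr M borel (\<lambda>\<omega>. L t \<omega> - L s \<omega>) = distr M borel (\<lambda>\<omega>. L (t - s) \<omega> - L 0 \<omega>)"
    using assms unfolding levy_process_def by blast
  have L0: "AE \<omega> in M. L 0 \<omega> = 0" using assms(1) by (simp add: levy_process_def)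
  have "(\<integral>\<^sup>+\<omega>. f (L t \<omega> - L s \<omega>) \<partial>M) = (\<integral>\<^sup>+y. f y \<partial>distr M borel (\<lambda>\<omega>. L t \<omega> - L s \<omega>))"
    using assms by (intro nn_integral_distr[symmetric] borel_measurable_diff m) auto
  also have "\<dots> = (\<integral>\<^sup>+\<omega>. f (L (t - s) \<omega> - L 0 \<omega>) \<partial>M)"
    unfolding eq using assms by (intro nn_integral_distr borel_measurable_diff m) auto
  also have "\<dots> = (\<integral>\<^sup>+\<omega>. f (L (t - s) \<omega>) \<partial>M)"
    using L0 by (intro nn_integral_cong_AE) (auto elim!: eventually_mono)
  finally show ?thesis .
qed

text \<open>By stationarity the q cells of the unit interval have increments of equal law, so q
  times the mean over one cell is the mean of a sum. That sum is at most a sum over jumps, whose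
  mean is given by Campbell's formula; the bound does not depend on q.\<close>

lemma subordinator_small_time:
  assumes \<gamma>: "gamma_subordinator M F \<alpha> \<beta> \<gamma>" and \<alpha>: "0 < \<alpha>" "0 < \<beta>" and q: "0 < q"
  shows "of_nat q * (\<integral>\<^sup>+\<omega>. sqrt_lin (\<gamma> (1 / real q) \<omega>) \<partial>M)
    \<le> (\<integral>\<^sup>+s. ennreal (gamma_density \<alpha> \<beta> s) * sqrt_lin s \<partial>lborel)"
proof -
  have levy: "levy_process M F \<gamma>" and pj: "pure_jump_increasing M \<gamma>"
    and lm: "has_levy_measure M \<gamma> (density lborel (\<lambda>s. ennreal (gamma_density \<alpha> \<beta> s)))"
    using \<gamma> by (auto simp: gamma_subordinator_def)
  interpret G: cadlag_process M F \<gamma> by (rule levy_cadlag_process[OF levy])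
  have m[measurable]: "\<gamma> u \<in> borel_measurable M" if "0 \<le> u" for u
    using borel_measurable_F_M[OF G.adapted] that by blast
  have "of_nat q * (\<integral>\<^sup>+\<omega>. sqrt_lin (\<gamma> (1 / real q) \<omega>) \<partial>M)
    = (\<Sum>i<q. \<integral>\<^sup>+\<omega>. sqrt_lin (\<gamma> (real (Suc i) / real q) \<omega> - \<gamma> (real i / real q) \<omega>) \<partial>M)"
  proof -
    have "(\<integral>\<^sup>+\<omega>. sqrt_lin (\<gamma> (real (Suc i) / real q) \<omega> - \<gamma> (real i / real q) \<omega>) \<partial>M) = (\<integral>\<^sup>+\<omega>. sqrt_lin (\<gamma> (1 / real q) \<omega>) \<partial>M)" for i
    proof -
      have "real (Suc i) / real q - real i / real q = 1 / real q" by (simp add: diff_divide_distrib[symmetric])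
      moreover have "real i / real q \<le> real (Suc i) / real q" by (intro divide_right_mono) auto
      ultimately show ?thesis using levy_increment_distr[OF levy, of "real i / real q" "real (Suc i) / real q" sqrt_lin] by simp
    qed
    then show ?thesis by simp
  qed
  also have "\<dots> = (\<integral>\<^sup>+\<omega>. (\<Sum>i<q. sqrt_lin (\<gamma> (real (Suc i) / real q) \<omega> - \<gamma> (real i / real q) \<omega>)) \<partial>M)"
    by (rule nn_integral_sum[symmetric]) (use m[of "real (Suc _) / real q"] m[of "real _ / real q"] in measurable)
  also have "\<dots> \<le> (\<integral>\<^sup>+\<omega>. (\<integral>\<^sup>+(z, s). indicator {0<..1} z * sqrt_lin s \<partial>jump_measure (\<lambda>t. \<gamma> t \<omega>)) \<partial>M)"
  proof (rule nn_integral_mono_AE)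
    show "AE \<omega> in M. (\<Sum>i<q. sqrt_lin (\<gamma> (real (Suc i) / real q) \<omega> - \<gamma> (real i / real q) \<omega>))
      \<le> (\<integral>\<^sup>+(z, s). indicator {0<..1} z * sqrt_lin s \<partial>jump_measure (\<lambda>t. \<gamma> t \<omega>))"
      using pj unfolding pure_jump_increasing_def
      by eventually_elim (rule sqrt_lin_increments[OF _ q], blast)
  qed
  also have "\<dots> = (\<integral>\<^sup>+s. sqrt_lin s \<partial>density lborel (\<lambda>s. ennreal (gamma_density \<alpha> \<beta> s)))"
    by (rule G.campbell[OF lm]) (auto simp: sqrt_lin_def)
  also have "\<dots> = (\<integral>\<^sup>+s. ennreal (gamma_density \<alpha> \<beta> s) * sqrt_lin s \<partial>lborel)"
    by (subst nn_integral_density) auto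
  finally show ?thesis .
qed

text \<open>The jumps of the subordinated Brownian motion are summable because \<open>sqrt\<close> is integrable
  near 0 for the Levy measure of the subordinator: on the scale \<open>1 / q\<close> the expected increment is
  controlled by \<open>E (sqrt (\<gamma> (1 / q)))\<close>, and \<open>q\<close> such terms add up to at most the expected sum of
  \<open>sqrt\<close> over the jumps of \<open>\<gamma>\<close> in the unit interval.\<close>

lemma subordinated_small_time:
  fixes W :: "real \<Rightarrow> 'w \<Rightarrow> real^'n" and B :: "real^'n^'m"
  assumes \<gamma>: "gamma_subordinator M F \<alpha> \<beta> \<gamma>" and \<alpha>: "0 < \<alpha>" "0 < \<beta>"
    and W: "brownian_motion M \<Sigma> W" "positive_definite \<Sigma>" and indep: "independent_processes M \<gamma> W"
    and meas: "\<And>h. 0 \<le> h \<Longrightarrow> (\<lambda>\<omega>. B *v W (\<gamma> h \<omega>) \<omega>) \<in> borel_measurable M"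
  obtains C where "0 \<le> C"
    "\<And>q::nat. 0 < q \<Longrightarrow> of_nat q * (\<integral>\<^sup>+\<omega>. ennreal (norm (\<gamma> (1 / real q) \<omega>, B *v W (\<gamma> (1 / real q) \<omega>) \<omega>)) \<partial>M) \<le> ennreal C"
proof -
  have levy: "levy_process M F \<gamma>" and pj: "pure_jump_increasing M \<gamma>"
    using \<gamma> by (auto simp: gamma_subordinator_def)
  interpret G: cadlag_process M F \<gamma> by (rule levy_cadlag_process[OF levy])
  have m[measurable]: "\<gamma> u \<in> borel_measurable M" if "0 \<le> u" for u
    using borel_measurable_F_M[OF G.adapted] that by blast
  obtain c where c: "0 \<le> c" "\<And>t. 0 \<le> t \<Longrightarrow> (\<integral>\<^sup>+\<omega>. ennreal (norm (B *v W t \<omega>)) \<partial>M) \<le> ennreal (c * sqrt t)"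
    using brownian_norm_bound[OF prob_space_axioms W] by blast
  have bm: "AE \<omega> in M. continuous_on {0..} (\<lambda>t. W t \<omega>)"
    using W(1) by (simp add: brownian_motion_def)
  have g0: "AE \<omega> in M. \<gamma> 0 \<omega> = 0" using levy by (simp add: levy_process_def)
  have nn: "AE \<omega> in M. 0 \<le> \<gamma> h \<omega>" if "0 \<le> h" for h
    using pj g0 unfolding pure_jump_increasing_def
  proof eventually_elim
    case (elim \<omega>)
    then have "mono_on {0..} (\<lambda>t. \<gamma> t \<omega>)" by blast
    from mono_onD[OF this, of 0 h] have "\<gamma> 0 \<omega> \<le> \<gamma> h \<omega>" using that by simp
    then show ?case using elim by simp
  qed
  define I where "I = (\<integral>\<^sup>+s. ennreal (gamma_density \<alpha> \<beta> s) * sqrt_lin s \<partial>lborel)"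
  have "I < \<infinity>"
    unfolding I_def sqrt_lin_def by (rule gamma_density_sqrt_moment[OF \<alpha>, of _ 1]) auto
  have B_cont: "continuous_on UNIV (\<lambda>v. norm (B *v v))"
    by (intro continuous_intros linear_continuous_on matrix_vector_mul_bounded_linear)
  \<comment> \<open>The clock contributes its own size and the Brownian part, by independence of
    \<gamma> and \<open>W\<close>, at most c times the mean root of the clock;
    \<open>sqrt_lin\<close> dominates both, hence the factor 1 + c.\<close>
  have step: "(\<integral>\<^sup>+\<omega>. ennreal (norm (\<gamma> h \<omega>, B *v W (\<gamma> h \<omega>) \<omega>)) \<partial>M) \<le> ennreal (1 + c) * (\<integral>\<^sup>+\<omega>. sqrt_lin (\<gamma> h \<omega>) \<partial>M)"
    if h: "0 \<le> h" for h
  proof -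
    have "(\<integral>\<^sup>+\<omega>. ennreal (norm (\<gamma> h \<omega>, B *v W (\<gamma> h \<omega>) \<omega>)) \<partial>M)
      \<le> (\<integral>\<^sup>+\<omega>. ennreal \<bar>\<gamma> h \<omega>\<bar> + ennreal (norm (B *v W (\<gamma> h \<omega>) \<omega>)) \<partial>M)"
    proof (rule nn_integral_mono)
      fix \<omega>
      have "norm (\<gamma> h \<omega>, B *v W (\<gamma> h \<omega>) \<omega>) \<le> \<bar>\<gamma> h \<omega>\<bar> + norm (B *v W (\<gamma> h \<omega>) \<omega>)"
        using norm_Pair_le[of "\<gamma> h \<omega>" "B *v W (\<gamma> h \<omega>) \<omega>"] by simp
      then show "ennreal (norm (\<gamma> h \<omega>, B *v W (\<gamma> h \<omega>) \<omega>)) \<le> ennreal \<bar>\<gamma> h \<omega>\<bar> + ennreal (norm (B *v W (\<gamma> h \<omega>) \<omega>))"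
        by (subst ennreal_plus[symmetric]) (auto intro: ennreal_leI simp del: ennreal_plus)
    qed
    also have "\<dots> = (\<integral>\<^sup>+\<omega>. ennreal \<bar>\<gamma> h \<omega>\<bar> \<partial>M) + (\<integral>\<^sup>+\<omega>. ennreal (norm (B *v W (\<gamma> h \<omega>) \<omega>)) \<partial>M)"
      by (intro nn_integral_add measurable_compose[OF _ measurable_ennreal] measurable_compose[OF meas[OF h] borel_measurable_norm]
          borel_measurable_abs m h)
    also have "(\<integral>\<^sup>+\<omega>. ennreal (norm (B *v W (\<gamma> h \<omega>) \<omega>)) \<partial>M) \<le> ennreal c * (\<integral>\<^sup>+\<omega>. ennreal (sqrt (\<gamma> h \<omega>)) \<partial>M)"
    proof (rule nn_integral_time_change[OF _ _ nn[OF h] bm B_cont _ c])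
      show "indep_set (sets (process_sigma M {0..} \<gamma>)) (sets (process_sigma M {0..} W))"
        using indep by (simp add: independent_processes_def)
      fix A :: "real set" assume A: "A \<in> sets borel"
      have "(\<lambda>\<omega>. \<lambda>t\<in>{0..}. \<gamma> t \<omega>) \<in> measurable (process_sigma M {0..} \<gamma>) (PiM {0..} (\<lambda>_. borel))"
        unfolding process_sigma_def by (rule measurable_vimage_algebra1) (auto simp: space_PiM)
      from measurable_compose[OF this measurable_component_singleton[of h]] h
      have "\<gamma> h \<in> borel_measurable (process_sigma M {0..} \<gamma>)" by simp
      from measurable_sets[OF this A] show "\<gamma> h -` A \<inter> space M \<in> sets (process_sigma M {0..} \<gamma>)"
        by (simp add: process_sigma_def)
    qed auto
    finally have "(\<integral>\<^sup>+\<omega>. ennreal (norm (\<gamma> h \<omega>, B *v W (\<gamma> h \<omega>) \<omega>)) \<partial>M)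
      \<le> (\<integral>\<^sup>+\<omega>. ennreal \<bar>\<gamma> h \<omega>\<bar> \<partial>M) + ennreal c * (\<integral>\<^sup>+\<omega>. ennreal (sqrt (\<gamma> h \<omega>)) \<partial>M)" by (simp add: add_left_mono)
    also have "\<dots> \<le> 1 * (\<integral>\<^sup>+\<omega>. sqrt_lin (\<gamma> h \<omega>) \<partial>M) + ennreal c * (\<integral>\<^sup>+\<omega>. sqrt_lin (\<gamma> h \<omega>) \<partial>M)"
      unfolding mult_1
      by (intro add_mono mult_left_mono nn_integral_mono) (auto simp: sqrt_lin_def intro!: ennreal_leI add_increasing)
    also have "\<dots> = ennreal (1 + c) * (\<integral>\<^sup>+\<omega>. sqrt_lin (\<gamma> h \<omega>) \<partial>M)"
      using c(1) by (simp add: distrib_right)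
    finally show ?thesis .
  qed
  have "of_nat q * (\<integral>\<^sup>+\<omega>. ennreal (norm (\<gamma> (1 / real q) \<omega>, B *v W (\<gamma> (1 / real q) \<omega>) \<omega>)) \<partial>M) \<le> ennreal (enn2real (ennreal (1 + c) * I))"
    if q: "0 < q" for q :: nat
  proof -
    have "of_nat q * (\<integral>\<^sup>+\<omega>. ennreal (norm (\<gamma> (1 / real q) \<omega>, B *v W (\<gamma> (1 / real q) \<omega>) \<omega>)) \<partial>M)
      \<le> of_nat q * (ennreal (1 + c) * (\<integral>\<^sup>+\<omega>. sqrt_lin (\<gamma> (1 / real q) \<omega>) \<partial>M))"
      by (intro mult_left_mono step) auto
    also have "\<dots> = ennreal (1 + c) * (of_nat q * (\<integral>\<^sup>+\<omega>. sqrt_lin (\<gamma> (1 / real q) \<omega>) \<partial>M))"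
      by (simp add: ac_simps)
    also have "\<dots> \<le> ennreal (1 + c) * I"
      unfolding I_def by (intro mult_left_mono subordinator_small_time[OF \<gamma> \<alpha> q]) auto
    also have "\<dots> = ennreal (enn2real (ennreal (1 + c) * I))"
      using \<open>I < \<infinity>\<close> by (simp add: ennreal_mult_less_top)
    finally show ?thesis .
  qed
  then show ?thesis using that[of "enn2real (ennreal (1 + c) * I)"] by auto
qed

text \<open>The mean of the sum of jump sizes up to p is at most the lower limit of mean sums of
  increment sizes, each at most p * C by stationarity. Continuous truncation makes the grid sums
  converge; Fatou's lemma and then monotone convergence give the bound.\<close>

lemma finite_variation_jumps:
  fixes L :: "real \<Rightarrow> 'w \<Rightarrow> 'y::euclidean_space"
  assumes levy: "levy_process M F L" and C: "0 \<le> C"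
    "\<And>q::nat. 0 < q \<Longrightarrow> of_nat q * (\<integral>\<^sup>+\<omega>. ennreal (norm (L (1 / real q) \<omega>)) \<partial>M) \<le> ennreal C"
  shows "AE \<omega> in M. \<forall>T. (\<integral>\<^sup>+(z, y). indicator {0<..T} z * ennreal (norm y) \<partial>jump_measure (\<lambda>t. L t \<omega>)) < \<infinity>"
proof -
  interpret cadlag_process M F L by (rule levy_cadlag_process[OF levy])
  have m[measurable]: "L u \<in> borel_measurable M" if "0 \<le> u" for u
    using borel_measurable_F_M[OF adapted] that by blast
  define \<phi> where "\<phi> j y = max (norm y - 1 / real (Suc j)) 0" for j :: nat and y :: 'y
  have \<phi>_cont: "continuous_on UNIV (\<phi> j)" for j unfolding \<phi>_def by (intro continuous_intros)
  have [measurable]: "\<phi> j \<in> borel_measurable borel" for j by (rule borel_measurable_continuous_onI[OF \<phi>_cont])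
  have \<phi>_nonneg: "0 \<le> \<phi> j y" for j y by (simp add: \<phi>_def)
  have \<phi>_inc: "incseq (\<lambda>j. ennreal (\<phi> j y))" and \<phi>_sup: "(SUP j. ennreal (\<phi> j y)) = ennreal (norm y)" for y
    unfolding \<phi>_def by (rule SUP_truncation[OF norm_ge_zero])+
  \<comment> \<open>\<open>riemann_jump_sum\<close> divides the interval into \<open>Suc n\<close>
    cells; n = p * (q + 1) - 1 gives cells of length 1/(q+1), for which the bound \<open>C\<close>
    is available.\<close>
  define S where "S p q j \<omega> = (\<Sum>i<Suc (p * Suc q - 1). \<phi> j (L (real p * real (Suc i) / real (Suc (p * Suc q - 1))) \<omega>
      - L (real p * real i / real (Suc (p * Suc q - 1))) \<omega>))" for p q j :: nat and \<omega>
  have S_le: "(\<integral>\<^sup>+\<omega>. ennreal (S p q j \<omega>) \<partial>M) \<le> of_nat p * ennreal C" if p: "0 < p" for p q j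
  proof -
    have e: "Suc (p * Suc q - 1) = p * Suc q" using p by simp
    have r: "real p * real i / real (p * Suc q) = real i / real (Suc q)" for i
      using p unfolding of_nat_mult by (intro mult_divide_mult_cancel_left) simp
    have "(\<integral>\<^sup>+\<omega>. ennreal (S p q j \<omega>) \<partial>M)
      \<le> (\<integral>\<^sup>+\<omega>. (\<Sum>i<p * Suc q. ennreal (norm (L (real (Suc i) / real (Suc q)) \<omega> - L (real i / real (Suc q)) \<omega>))) \<partial>M)"
      unfolding S_def e r
      by (intro nn_integral_mono, subst sum_ennreal) (auto simp: \<phi>_def intro!: ennreal_leI sum_mono)
    also have "\<dots> = (\<Sum>i<p * Suc q. \<integral>\<^sup>+\<omega>. ennreal (norm (L (real (Suc i) / real (Suc q)) \<omega> - L (real i / real (Suc q)) \<omega>)) \<partial>M)"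
      using m by (intro nn_integral_sum measurable_compose[OF _ measurable_ennreal] borel_measurable_norm borel_measurable_diff) auto
    also have "\<dots> = (\<Sum>i<p * Suc q. \<integral>\<^sup>+\<omega>. ennreal (norm (L (1 / real (Suc q)) \<omega>)) \<partial>M)"
    proof (rule sum.cong[OF refl])
      fix i
      have "real (Suc i) / real (Suc q) - real i / real (Suc q) = 1 / real (Suc q)"
        unfolding diff_divide_distrib[symmetric] by simp
      moreover have "real i / real (Suc q) \<le> real (Suc i) / real (Suc q)" by (intro divide_right_mono) auto
      ultimately show "(\<integral>\<^sup>+\<omega>. ennreal (norm (L (real (Suc i) / real (Suc q)) \<omega> - L (real i / real (Suc q)) \<omega>)) \<partial>M)
        = (\<integral>\<^sup>+\<omega>. ennreal (norm (L (1 / real (Suc q)) \<omega>)) \<partial>M)"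
        using levy_increment_distr[OF levy, of "real i / real (Suc q)" "real (Suc i) / real (Suc q)" "\<lambda>y. ennreal (norm y)"] by simp
    qed
    also have "\<dots> = of_nat p * (of_nat (Suc q) * (\<integral>\<^sup>+\<omega>. ennreal (norm (L (1 / real (Suc q)) \<omega>)) \<partial>M))"
      by (simp only: sum_constant card_lessThan of_nat_mult mult.assoc)
    also have "\<dots> \<le> of_nat p * ennreal C" by (intro mult_left_mono C) auto
    finally show ?thesis .
  qed
  have E_j: "(\<integral>\<^sup>+\<omega>. (\<integral>\<^sup>+(z, y). indicator {0<..real p} z * ennreal (\<phi> j y) \<partial>jump_measure (path \<omega>)) \<partial>M) \<le> of_nat p * ennreal C"
    if p: "0 < p" for p j
  proof -
    have "(\<integral>\<^sup>+\<omega>. (\<integral>\<^sup>+(z, y). indicator {0<..real p} z * ennreal (\<phi> j y) \<partial>jump_measure (path \<omega>)) \<partial>M)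
      = (\<integral>\<^sup>+\<omega>. liminf (\<lambda>q. ennreal (S p q j \<omega>)) \<partial>M)"
    proof (rule nn_integral_cong_AE)
      show "AE \<omega> in M. (\<integral>\<^sup>+(z, y). indicator {0<..real p} z * ennreal (\<phi> j y) \<partial>jump_measure (path \<omega>))
        = liminf (\<lambda>q. ennreal (S p q j \<omega>))"
        using cadlag
      proof eventually_elim
        case (elim \<omega>)
        have e: "0 < 1 / real (Suc j)" by simp
        have v: "\<phi> j y = 0" if "norm y < 1 / real (Suc j)" for y using that by (simp add: \<phi>_def)
        have "(\<lambda>n. \<Sum>i<Suc n. \<phi> j (L (real p * real (Suc i) / real (Suc n)) \<omega> - L (real p * real i / real (Suc n)) \<omega>))
          \<longlonglongrightarrow> (\<Sum>z\<in>{z\<in>{0<..real p}. 1 / real (Suc j) \<le> norm (jump (path \<omega>) z)}. \<phi> j (jump (path \<omega>) z))"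
          by (rule riemann_jump_sum[OF elim _ _ e \<phi>_cont v]) (use p in auto)
        moreover have "filterlim (\<lambda>q. p * Suc q - 1) sequentially sequentially"
          using p by (intro filterlim_subseq strict_monoI) (auto simp: diff_less_mono)
        ultimately have "(\<lambda>q. S p q j \<omega>)
          \<longlonglongrightarrow> (\<Sum>z\<in>{z\<in>{0<..real p}. 1 / real (Suc j) \<le> norm (jump (path \<omega>) z)}. \<phi> j (jump (path \<omega>) z))"
          unfolding S_def by (rule filterlim_compose)
        then have "(\<lambda>q. ennreal (S p q j \<omega>))
          \<longlonglongrightarrow> ennreal (\<Sum>z\<in>{z\<in>{0<..real p}. 1 / real (Suc j) \<le> norm (jump (path \<omega>) z)}. \<phi> j (jump (path \<omega>) z))"
          by (rule tendsto_ennrealI)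
        then have "liminf (\<lambda>q. ennreal (S p q j \<omega>))
          = ennreal (\<Sum>z\<in>{z\<in>{0<..real p}. 1 / real (Suc j) \<le> norm (jump (path \<omega>) z)}. \<phi> j (jump (path \<omega>) z))"
          by (simp add: lim_imp_Liminf)
        then show ?case
          using nn_integral_jump_measure_vanishing[OF elim _ e, of "real p" "\<lambda>y. ennreal (\<phi> j y)"] v
          by (simp add: \<phi>_nonneg del: of_nat_Suc)
      qed
    qed
    also have "\<dots> \<le> liminf (\<lambda>q. \<integral>\<^sup>+\<omega>. ennreal (S p q j \<omega>) \<partial>M)"
    proof (rule nn_integral_liminf)
      show "(\<lambda>\<omega>. ennreal (S p q j \<omega>)) \<in> borel_measurable M" for q
        unfolding S_def
        by (intro measurable_compose[OF _ measurable_ennreal] borel_measurable_sum measurable_compose[OF _ \<open>\<phi> j \<in> borel_measurable borel\<close>] borel_measurable_diff m) auto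
    qed
    also have "\<dots> \<le> liminf (\<lambda>q. of_nat p * ennreal C)"
      by (intro Liminf_mono always_eventually allI S_le p)
    finally show ?thesis by (simp add: Liminf_const)
  qed
  have E: "(\<integral>\<^sup>+\<omega>. (\<integral>\<^sup>+(z, y). indicator {0<..real p} z * ennreal (norm y) \<partial>jump_measure (path \<omega>)) \<partial>M) \<le> of_nat p * ennreal C"
    if p: "0 < p" for p
  proof -
    have "(\<integral>\<^sup>+\<omega>. (\<integral>\<^sup>+(z, y). indicator {0<..real p} z * ennreal (norm y) \<partial>jump_measure (path \<omega>)) \<partial>M)
      = (\<integral>\<^sup>+\<omega>. (SUP j. \<integral>\<^sup>+(z, y). indicator {0<..real p} z * ennreal (\<phi> j y) \<partial>jump_measure (path \<omega>)) \<partial>M)"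
      unfolding \<phi>_sup[symmetric] by (intro nn_integral_cong nn_integral_jump_SUP \<phi>_inc) measurable
    also have "\<dots> = (SUP j. \<integral>\<^sup>+\<omega>. (\<integral>\<^sup>+(z, y). indicator {0<..real p} z * ennreal (\<phi> j y) \<partial>jump_measure (path \<omega>)) \<partial>M)"
    proof (rule nn_integral_monotone_convergence_SUP)
      show "incseq (\<lambda>j \<omega>. \<integral>\<^sup>+(z, y). indicator {0<..real p} z * ennreal (\<phi> j y) \<partial>jump_measure (path \<omega>))"
        using \<phi>_inc by (auto simp: incseq_def le_fun_def intro!: nn_integral_mono mult_left_mono)
      show "(\<lambda>\<omega>. \<integral>\<^sup>+(z, y). indicator {0<..real p} z * ennreal (\<phi> j y) \<partial>jump_measure (path \<omega>)) \<in> borel_measurable M" for j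
        by (rule borel_measurable_F_M[OF nn_integral_jump_adapted[OF _ \<phi>_cont]]) (auto simp: \<phi>_def)
    qed
    also have "\<dots> \<le> of_nat p * ennreal C" by (intro SUP_least E_j p)
    finally show ?thesis .
  qed
  have "AE \<omega> in M. (\<integral>\<^sup>+(z, y). indicator {0<..real (Suc p)} z * ennreal (norm y) \<partial>jump_measure (path \<omega>)) \<noteq> \<infinity>" for p
  proof (rule nn_integral_PInf_AE)
    show "(\<lambda>\<omega>. \<integral>\<^sup>+(z, y). indicator {0<..real (Suc p)} z * ennreal (norm y) \<partial>jump_measure (path \<omega>)) \<in> borel_measurable M"
      by (rule borel_measurable_F_M[OF nn_integral_jump_adapted]) (auto intro!: continuous_intros)
    have "of_nat (Suc p) * ennreal C < \<infinity>" by (simp add: ennreal_mult_less_top of_nat_less_top del: of_nat_Suc)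
    then show "(\<integral>\<^sup>+\<omega>. (\<integral>\<^sup>+(z, y). indicator {0<..real (Suc p)} z * ennreal (norm y) \<partial>jump_measure (path \<omega>)) \<partial>M) \<noteq> \<infinity>"
      using E[of "Suc p"] by auto
  qed
  then have "AE \<omega> in M. \<forall>p. (\<integral>\<^sup>+(z, y). indicator {0<..real (Suc p)} z * ennreal (norm y) \<partial>jump_measure (path \<omega>)) \<noteq> \<infinity>"
    by (simp add: AE_all_countable)
  then show ?thesis
  proof eventually_elim
    case (elim \<omega>)
    show ?case
    proof
      fix T
      obtain p :: nat where p: "T \<le> real (Suc p)" using real_arch_simple[of T] by (metis of_nat_Suc add.commute add_increasing zero_le_one)
      have "(\<integral>\<^sup>+(z, y). indicator {0<..T} z * ennreal (norm y) \<partial>jump_measure (path \<omega>))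
        \<le> (\<integral>\<^sup>+(z, y). indicator {0<..real (Suc p)} z * ennreal (norm y) \<partial>jump_measure (path \<omega>))"
        using p by (intro nn_integral_mono) (auto simp: indicator_def)
      also have "\<dots> < \<infinity>" using elim[rule_format, of p] by (simp add: less_top)
      finally show "(\<integral>\<^sup>+(z, y). indicator {0<..T} z * ennreal (norm y) \<partial>jump_measure (path \<omega>)) < \<infinity>" .
    qed
  qed
qed

end

section \<open>A Gronwall inequality with jumps\<close>

text \<open>While V has risen by at most 1/(2K), the supremum c of \<phi> satisfies c \<le> e0 +
  \<epsilon> + c/2. The a priori bound \<open>B\<close> makes c finite, so c/2 can be
  absorbed.\<close>

lemma gronwall_step:
  fixes \<phi> V :: "real \<Rightarrow> real"
  assumes bdd: "\<And>u. 0 \<le> u \<Longrightarrow> u \<le> T \<Longrightarrow> \<phi> u \<le> B" and nn: "\<And>u. 0 \<le> \<phi> u"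
    and step: "\<And>s t c. 0 \<le> s \<Longrightarrow> s \<le> t \<Longrightarrow> t \<le> T \<Longrightarrow> 0 \<le> c \<Longrightarrow> (\<And>u. 0 \<le> u \<Longrightarrow> u < t \<Longrightarrow> \<phi> u \<le> c) \<Longrightarrow>
      \<phi> t \<le> \<phi> s + \<epsilon> + K * (V t - V s) * c"
    and a: "0 \<le> a" "a < x" "x \<le> T" and e0: "\<And>u. 0 \<le> u \<Longrightarrow> u \<le> a \<Longrightarrow> \<phi> u \<le> e0"
    and V: "\<And>r. a \<le> r \<Longrightarrow> r < x \<Longrightarrow> K * (V r - V a) \<le> 1/2" and \<epsilon>: "0 \<le> \<epsilon>"
    and u: "0 \<le> u" "u < x"
  shows "\<phi> u \<le> 2 * (e0 + \<epsilon>)"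
proof -
  define c where "c = Sup (\<phi> ` {0..<x})"
  have ne: "\<phi> ` {0..<x} \<noteq> {}" using a by auto
  have "bdd_above (\<phi> ` {0..<x})" using bdd a(3) by (intro bdd_aboveI[of _ B]) auto
  then have le_c: "\<phi> r \<le> c" if "0 \<le> r" "r < x" for r
    unfolding c_def using that by (intro cSUP_upper) auto
  have "0 \<le> c" using le_c[of 0] nn[of 0] a by auto
  have "0 \<le> e0" using e0[of 0] nn[of 0] a by auto
  have "c \<le> e0 + \<epsilon> + c / 2"
    unfolding c_def
  proof (rule cSUP_least)
    fix r assume r: "r \<in> {0..<x}"
    show "\<phi> r \<le> e0 + \<epsilon> + Sup (\<phi> ` {0..<x}) / 2"
      unfolding c_def[symmetric]
    proof (cases "r \<le> a")
      case True
      then show "\<phi> r \<le> e0 + \<epsilon> + c / 2" using e0[of r] r \<epsilon> \<open>0 \<le> c\<close> by auto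
    next
      case False
      have "\<phi> r \<le> \<phi> a + \<epsilon> + K * (V r - V a) * c"
        by (rule step) (use False a r le_c \<open>0 \<le> c\<close> in auto)
      also have "\<dots> \<le> e0 + \<epsilon> + (1/2) * c"
        using e0[of a] a V[of r] False r \<open>0 \<le> c\<close> by (intro add_mono mult_right_mono) auto
      finally show "\<phi> r \<le> e0 + \<epsilon> + c / 2" by simp
    qed
  qed (use a in auto)
  then show ?thesis using le_c[OF u] by simp
qed

text \<open>V may jump by more than any prescribed amount, so the smallness needed for absorption
  holds only on intervals open on the right. The value at the right end is then estimated once more,
  which is possible because \<open>c\<close> need only bound \<phi> strictly before t. The constant
  depends on V, K and T alone, hence is the same for all \<phi> and \<epsilon>, that is, for all
  meshes.\<close>

lemma gronwall_cadlag:
  fixes V :: "real \<Rightarrow> real"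
  assumes V: "\<And>s t. 0 \<le> s \<Longrightarrow> s \<le> t \<Longrightarrow> t \<le> T \<Longrightarrow> V s \<le> V t" "cadlag_on \<infinity> V" and T: "0 \<le> T" and K: "0 \<le> K"
  obtains C where "0 \<le> C"
    "\<And>\<phi> \<epsilon> B u. (\<And>u. 0 \<le> \<phi> u) \<Longrightarrow> (\<And>u. 0 \<le> u \<Longrightarrow> u \<le> T \<Longrightarrow> \<phi> u \<le> B) \<Longrightarrow> 0 \<le> \<epsilon> \<Longrightarrow>
      (\<And>s t c. 0 \<le> s \<Longrightarrow> s \<le> t \<Longrightarrow> t \<le> T \<Longrightarrow> 0 \<le> c \<Longrightarrow> (\<And>u. 0 \<le> u \<Longrightarrow> u < t \<Longrightarrow> \<phi> u \<le> c) \<Longrightarrow>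
        \<phi> t \<le> \<phi> s + \<epsilon> + K * (V t - V s) * c) \<Longrightarrow>
      0 \<le> u \<Longrightarrow> u \<le> T \<Longrightarrow> \<phi> u \<le> C * (\<phi> 0 + \<epsilon>)"
proof -
  define G where "G \<phi> \<epsilon> B \<longleftrightarrow> (\<forall>u. 0 \<le> \<phi> u) \<and> (\<forall>u\<in>{0..T}. \<phi> u \<le> B) \<and> 0 \<le> \<epsilon> \<and>
    (\<forall>s t c. 0 \<le> s \<longrightarrow> s \<le> t \<longrightarrow> t \<le> T \<longrightarrow> 0 \<le> c \<longrightarrow> (\<forall>u. 0 \<le> u \<longrightarrow> u < t \<longrightarrow> \<phi> u \<le> c) \<longrightarrow>
      \<phi> t \<le> \<phi> s + \<epsilon> + K * (V t - V s) * c)" for \<phi> :: "real \<Rightarrow> real" and \<epsilon> B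
  \<comment> \<open>The property is vacuous outside \<open>{0..T}\<close>, because the local step of
    Bolzano's principle also concerns intervals reaching beyond it.\<close>
  define P where "P a b \<longleftrightarrow> (0 \<le> a \<longrightarrow> a \<le> b \<longrightarrow> b \<le> T \<longrightarrow> (\<exists>C\<ge>0. \<forall>\<phi> \<epsilon> B e0. G \<phi> \<epsilon> B \<longrightarrow> (\<forall>u\<in>{0..a}. \<phi> u \<le> e0) \<longrightarrow>
    (\<forall>u\<in>{0..b}. \<phi> u \<le> C * (e0 + \<epsilon>))))" for a b
  have ext: "\<exists>C\<ge>0. \<forall>\<phi> \<epsilon> B e0. G \<phi> \<epsilon> B \<longrightarrow> (\<forall>u\<in>{0..a}. \<phi> u \<le> e0) \<longrightarrow> (\<forall>u\<in>{0..x}. \<phi> u \<le> C * (e0 + \<epsilon>))"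
    if a: "0 \<le> a" "a \<le> x" "x \<le> T" and Va: "\<And>r. a \<le> r \<Longrightarrow> r < x \<Longrightarrow> K * (V r - V a) \<le> 1/2" for a x
  proof -
    \<comment> \<open>Before x the absorption gives the factor 2; crossing a possible jump at x adds
      K times the rise of V, multiplied by that bound.\<close>
    define D where "D = 2 + K * (V x - V a) * 2"
    have D: "2 \<le> D" using V(1)[OF a] K by (simp add: D_def)
    have "\<phi> u \<le> D * (e0 + \<epsilon>)" if G: "G \<phi> \<epsilon> B" and e0: "\<forall>u\<in>{0..a}. \<phi> u \<le> e0" and u: "u \<in> {0..x}" for \<phi> \<epsilon> B e0 u
    proof -
      have g: "\<And>u. 0 \<le> u \<Longrightarrow> u \<le> T \<Longrightarrow> \<phi> u \<le> B" "\<And>u. 0 \<le> \<phi> u" "0 \<le> \<epsilon>"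
        "\<And>s t c. 0 \<le> s \<Longrightarrow> s \<le> t \<Longrightarrow> t \<le> T \<Longrightarrow> 0 \<le> c \<Longrightarrow> (\<And>u. 0 \<le> u \<Longrightarrow> u < t \<Longrightarrow> \<phi> u \<le> c) \<Longrightarrow>
          \<phi> t \<le> \<phi> s + \<epsilon> + K * (V t - V s) * c"
        using G unfolding G_def by auto
      have e0': "0 \<le> e0" using bspec[OF e0, of 0] g(2)[of 0] a by simp
      have mono: "k * (e0 + \<epsilon>) \<le> D * (e0 + \<epsilon>)" if "k \<le> 2" for k
        using that D e0' g(3) by (intro mult_right_mono) auto
      show ?thesis
      proof (cases "u \<le> a")
        case True
        then show ?thesis using bspec[OF e0, of u] u mono[of 1] g(3) by simp
      next
        case False
        then have ax: "a < x" using u by auto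
        have lt: "\<phi> r \<le> 2 * (e0 + \<epsilon>)" if "0 \<le> r" "r < x" for r
          by (rule gronwall_step[where T = T and V = V and K = K and B = B, OF g(1,2,4) a(1) ax a(3) _ Va g(3) that])
            (use e0 in auto)
        show ?thesis
        proof (cases "u < x")
          case True
          then show ?thesis using lt[of u] u mono[of 2] by auto
        next
          case False
          then have [simp]: "u = x" using u by auto
          have "\<phi> x \<le> \<phi> a + \<epsilon> + K * (V x - V a) * (2 * (e0 + \<epsilon>))"
            by (rule g(4)) (use a e0' g(3) lt in auto)
          also have "\<dots> \<le> 2 * (e0 + \<epsilon>) + K * (V x - V a) * (2 * (e0 + \<epsilon>))"
            using bspec[OF e0, of a] a e0' g(3) by (intro add_right_mono) simp
          also have "\<dots> = D * (e0 + \<epsilon>)" by (simp add: D_def algebra_simps)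
          finally show ?thesis by simp
        qed
      qed
    qed
    then show ?thesis using D by (intro exI[of _ D]) auto
  qed
  have trans: "P a c" if p: "P a b" "P b c" "a \<le> b" "b \<le> c" for a b c
    unfolding P_def
  proof (intro impI)
    assume h: "0 \<le> a" "a \<le> c" "c \<le> T"
    have bb: "0 \<le> b" "b \<le> T" using p(3,4) h by auto
    obtain C1 where C1: "0 \<le> C1" "\<And>\<phi> \<epsilon> B e0 u. G \<phi> \<epsilon> B \<Longrightarrow> (\<forall>u\<in>{0..a}. \<phi> u \<le> e0) \<Longrightarrow> u \<in> {0..b} \<Longrightarrow> \<phi> u \<le> C1 * (e0 + \<epsilon>)"
      using p(1)[unfolded P_def, rule_format, OF h(1) p(3) bb(2)] by blast
    obtain C2 where C2: "0 \<le> C2" "\<And>\<phi> \<epsilon> B e0 u. G \<phi> \<epsilon> B \<Longrightarrow> (\<forall>u\<in>{0..b}. \<phi> u \<le> e0) \<Longrightarrow> u \<in> {0..c} \<Longrightarrow> \<phi> u \<le> C2 * (e0 + \<epsilon>)"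
      using p(2)[unfolded P_def, rule_format, OF bb(1) p(4) h(3)] by blast
    \<comment> \<open>The second stretch starts from the bound C1 * (e0 + \<epsilon>) reached at the
      end of the first and adds its own \<epsilon>, whence C1 + 1.\<close>
    have "\<phi> u \<le> (C2 * (C1 + 1)) * (e0 + \<epsilon>)" if G: "G \<phi> \<epsilon> B" and e: "\<forall>u\<in>{0..a}. \<phi> u \<le> e0" and u: "u \<in> {0..c}" for \<phi> \<epsilon> B e0 u
    proof -
      have nn: "0 \<le> \<phi> 0" "0 \<le> \<epsilon>" using G by (auto simp: G_def)
      have "0 \<le> e0" using bspec[OF e, of 0] nn(1) h(1) by simp
      have "\<phi> u \<le> C2 * (C1 * (e0 + \<epsilon>) + \<epsilon>)"
        by (rule C2(2)[OF G _ u]) (use C1(2)[OF G e] in blast)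
      also have "\<dots> \<le> C2 * ((C1 + 1) * (e0 + \<epsilon>))"
        using C2(1) nn \<open>0 \<le> e0\<close> by (intro mult_left_mono) (auto simp: algebra_simps)
      finally show ?thesis by (simp add: mult.assoc)
    qed
    then show "\<exists>C\<ge>0. \<forall>\<phi> \<epsilon> B e0. G \<phi> \<epsilon> B \<longrightarrow> (\<forall>u\<in>{0..a}. \<phi> u \<le> e0) \<longrightarrow> (\<forall>u\<in>{0..c}. \<phi> u \<le> C * (e0 + \<epsilon>))"
      using C1(1) C2(1) by (intro exI[of _ "C2 * (C1 + 1)"]) (auto simp del: atLeastAtMost_iff)
  qed
  have "P 0 T"
    using T
  proof (induct rule: Bolzano)
    case (trans a b c) then show ?case using \<open>\<And>c b a. P a b \<Longrightarrow> P b c \<Longrightarrow> a \<le> b \<Longrightarrow> b \<le> c \<Longrightarrow> P a c\<close> by blast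
  next
    case (local x)
    \<comment> \<open>Two values within r of a common reference differ by less than 2r, and 2rK
      \<le> 1/2; K + 1 keeps the denominator positive for K = 0. The references are the left limit
      before x and the value from x on.\<close>
    define r where "r = 1 / (4 * (K + 1))"
    have r: "0 < r" "\<And>y. y \<le> 2 * r \<Longrightarrow> K * y \<le> 1/2"
    proof -
      show "0 < r" using K by (simp add: r_def)
      fix y assume "y \<le> 2 * r"
      then have "K * y \<le> K * (2 * r)" using K by (rule mult_left_mono)
      also have "\<dots> \<le> 1/2" using K by (simp add: r_def field_simps)
      finally show "K * y \<le> 1/2" .
    qed
    from cadlag_on_local[OF V(2) local(1) _ r(1)] obtain d where d: "0 < d"
      "\<And>a. 0 \<le> a \<Longrightarrow> x - d < a \<Longrightarrow> a < x \<Longrightarrow> norm (V a - left_lim V x) < r"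
      "\<And>b. x \<le> b \<Longrightarrow> b < x + d \<Longrightarrow> norm (V b - V x) < r" by auto
    have "P a b" if ab: "a \<le> x" "x \<le> b" "b - a < d" for a b
    proof (cases "0 \<le> a \<and> b \<le> T")
      case True
      have "P a x"
        unfolding P_def
      proof (intro impI ext)
        fix q assume "a \<le> q" "q < x"
        then have "norm (V q - left_lim V x) < r" "norm (V a - left_lim V x) < r"
          using d(2)[of q] d(2)[of a] True ab by auto
        then show "K * (V q - V a) \<le> 1/2" by (intro r(2)) (simp add: abs_less_iff)
      qed
      moreover have "P x b"
        unfolding P_def
      proof (intro impI ext)
        fix q assume "x \<le> q" "q < b"
        then have "norm (V q - V x) < r" using d(3)[of q] True ab by auto
        then show "K * (V q - V x) \<le> 1/2" using r(1) by (intro r(2)) (simp add: abs_less_iff)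
      qed
      ultimately show ?thesis using trans ab by blast
    next
      case False
      then show ?thesis using ab unfolding P_def by auto
    qed
    then show ?case using d(1) by blast
  qed
  obtain C where C: "0 \<le> C" "\<And>\<phi> \<epsilon> B e0 u. G \<phi> \<epsilon> B \<Longrightarrow> (\<forall>u\<in>{0..0}. \<phi> u \<le> e0) \<Longrightarrow> u \<in> {0..T} \<Longrightarrow> \<phi> u \<le> C * (e0 + \<epsilon>)"
    using \<open>P 0 T\<close>[unfolded P_def, rule_format, OF order_refl T order_refl] by blast
  show ?thesis
  proof (rule that[OF C(1)])
    fix \<phi> :: "real \<Rightarrow> real" and \<epsilon> B u
    assume "\<And>u. 0 \<le> \<phi> u" "\<And>u. 0 \<le> u \<Longrightarrow> u \<le> T \<Longrightarrow> \<phi> u \<le> B" "0 \<le> \<epsilon>"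
      "\<And>s t c. 0 \<le> s \<Longrightarrow> s \<le> t \<Longrightarrow> t \<le> T \<Longrightarrow> 0 \<le> c \<Longrightarrow> (\<And>u. 0 \<le> u \<Longrightarrow> u < t \<Longrightarrow> \<phi> u \<le> c) \<Longrightarrow>
        \<phi> t \<le> \<phi> s + \<epsilon> + K * (V t - V s) * c" "0 \<le> u" "u \<le> T"
    then show "\<phi> u \<le> C * (\<phi> 0 + \<epsilon>)" by (intro C(2)[of \<phi> \<epsilon> B]) (auto simp: G_def)
  qed
qed

section \<open>Equations driven by a single path\<close>

lemma cadlag_on_add:
  assumes "cadlag_on \<tau> f" "cadlag_on \<tau> g"
  shows "cadlag_on \<tau> (\<lambda>t. f t + g t)"
  unfolding cadlag_on_def
proof (intro allI impI conjI)
  fix t assume t: "0 \<le> t" "ereal t < \<tau>"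
  show "((\<lambda>t. f t + g t) \<longlongrightarrow> f t + g t) (at_right t)"
    using assms t by (intro tendsto_add) (auto simp: cadlag_on_def)
  assume "0 < t"
  then show "\<exists>l. ((\<lambda>t. f t + g t) \<longlongrightarrow> l) (at_left t)"
    using t cadlag_on_left_lim[OF assms(1)] cadlag_on_left_lim[OF assms(2)]
    by (intro exI[of _ "left_lim f t + left_lim g t"] tendsto_add) auto
qed

lemma cadlag_on_continuous:
  assumes "continuous_on UNIV f"
  shows "cadlag_on \<tau> f"
proof -
  have "(f \<longlongrightarrow> f t) (at t)" for t
    using assms by (simp add: continuous_on_eq_continuous_at isCont_def)
  then show ?thesis
    unfolding cadlag_on_def by (meson filterlim_at_split)
qed

lemma left_lim_diff:
  assumes "cadlag_on \<tau> f" "cadlag_on \<tau>' g" "0 \<le> t" "ereal t < \<tau>" "ereal t < \<tau>'"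
  shows "left_lim (\<lambda>u. f u - g u) t = left_lim f t - left_lim g t"
proof (cases "t = 0")
  case False
  then show ?thesis
    using assms by (intro left_lim_unique tendsto_diff cadlag_on_left_lim[of \<tau>] cadlag_on_left_lim[of \<tau>']) auto
qed simp

lemma left_lim_diff_le:
  assumes "cadlag_on \<tau> f" "cadlag_on \<tau>' g" "0 \<le> t" "ereal t < \<tau>" "ereal t < \<tau>'"
    and "\<And>u. 0 \<le> u \<Longrightarrow> u \<le> t \<Longrightarrow> norm (f u - g u) \<le> c"
  shows "norm (left_lim f t - left_lim g t) \<le> c"
proof -
  have "cadlag_on (min \<tau> \<tau>') (\<lambda>u. f u + - g u)"
  proof (rule cadlag_on_add)
    show "cadlag_on (min \<tau> \<tau>') (\<lambda>u. - g u)"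
      unfolding cadlag_on_def
    proof (intro allI impI conjI)
      fix t assume t: "0 \<le> t" "ereal t < min \<tau> \<tau>'"
      show "((\<lambda>t. - g t) \<longlongrightarrow> - g t) (at_right t)" using assms(2) t by (intro tendsto_minus) (auto simp: cadlag_on_def)
      assume "0 < t"
      then show "\<exists>l. ((\<lambda>t. - g t) \<longlongrightarrow> l) (at_left t)"
        using t cadlag_on_left_lim[OF assms(2)]
        by (intro exI[of _ "- left_lim g t"] tendsto_minus) auto
    qed
  qed (rule cadlag_on_mono[OF assms(1)], simp)
  from left_lim_norm_le[OF this assms(3)] show ?thesis
    using assms left_lim_diff[OF assms(1-5)] by simp
qed

text \<open>Dominated convergence on both sides; the left limit at t is the integral over the
  interval without its right end, so atoms at t become jumps.\<close>

lemma cadlag_set_integral: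
  fixes \<mu> :: "(real \<times> 'y::euclidean_space) measure" and h :: "real \<times> 'y \<Rightarrow> 'e::euclidean_space"
  assumes \<mu>: "sets \<mu> = sets borel" and h: "\<And>T. set_integrable \<mu> ({0<..T} \<times> UNIV) h"
  shows "cadlag_on \<infinity> (\<lambda>t. set_lebesgue_integral \<mu> ({0<..t} \<times> UNIV) h)"
proof -
  have lim: "(\<lambda>n. set_lebesgue_integral \<mu> ({0<..S n} \<times> UNIV) h) \<longlonglongrightarrow> set_lebesgue_integral \<mu> (I \<times> UNIV) h"
    if S: "\<And>n. S n \<le> T" and I: "I \<in> sets borel" "I \<subseteq> {0<..T}"
      and ev: "\<And>z. eventually (\<lambda>n. z \<in> {0<..S n} \<longleftrightarrow> z \<in> I) sequentially" for S T and I :: "real set"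
    unfolding set_lebesgue_integral_def
  proof (rule integral_dominated_convergence)
    have sub: "set_integrable \<mu> (A \<times> UNIV) h" if "A \<subseteq> {0<..T}" "A \<in> sets borel" for A
      using that by (intro set_integrable_subset[OF h[of T]]) (auto simp: \<mu> intro: sets_time_mark)
    show "(\<lambda>x. indicat_real (I \<times> UNIV) x *\<^sub>R h x) \<in> borel_measurable \<mu>"
      using sub[OF I(2,1)] by (simp add: set_integrable_def)
    show "(\<lambda>x. indicat_real ({0<..S n} \<times> UNIV) x *\<^sub>R h x) \<in> borel_measurable \<mu>" for n
    proof -
      have "{0<..S n} \<subseteq> {0<..T}" using S[of n] by auto
      then have "set_integrable \<mu> ({0<..S n} \<times> UNIV) h" by (rule sub) simp
      then show ?thesis unfolding set_integrable_def by (rule borel_measurable_integrable)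
    qed
    show "integrable \<mu> (\<lambda>x. norm (indicat_real ({0<..T} \<times> UNIV) x *\<^sub>R h x))"
      using h[of T] unfolding set_integrable_def by (rule integrable_norm)
    show "AE x in \<mu>. norm (indicat_real ({0<..S n} \<times> UNIV) x *\<^sub>R h x) \<le> norm (indicat_real ({0<..T} \<times> UNIV) x *\<^sub>R h x)" for n
      using S[of n] by (auto simp: indicator_def)
    show "AE x in \<mu>. (\<lambda>n. indicat_real ({0<..S n} \<times> UNIV) x *\<^sub>R h x) \<longlonglongrightarrow> indicat_real (I \<times> UNIV) x *\<^sub>R h x"
    proof (rule AE_I2)
      fix x :: "real \<times> 'y"
      show "(\<lambda>n. indicat_real ({0<..S n} \<times> UNIV) x *\<^sub>R h x) \<longlonglongrightarrow> indicat_real (I \<times> UNIV) x *\<^sub>R h x"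
        by (rule tendsto_eventually) (use ev[of "fst x"] in \<open>auto elim!: eventually_mono simp: indicator_def mem_Times_iff\<close>)
    qed
  qed
  show ?thesis
    unfolding cadlag_on_def
  proof (intro allI impI conjI)
    fix t :: real assume t: "0 \<le> t"
    show "((\<lambda>t. set_lebesgue_integral \<mu> ({0<..t} \<times> UNIV) h) \<longlongrightarrow> set_lebesgue_integral \<mu> ({0<..t} \<times> UNIV) h) (at_right t)"
    proof (rule tendsto_at_right_sequentially[of t "t + 1"])
      fix S assume S: "\<And>n. t < S n" "\<And>n. S n < t + 1" "decseq S" "S \<longlonglongrightarrow> t"
      show "(\<lambda>n. set_lebesgue_integral \<mu> ({0<..S n} \<times> UNIV) h) \<longlonglongrightarrow> set_lebesgue_integral \<mu> ({0<..t} \<times> UNIV) h"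
      proof (rule lim[of S "t + 1"])
        show "eventually (\<lambda>n. z \<in> {0<..S n} \<longleftrightarrow> z \<in> {0<..t}) sequentially" for z
        proof (cases "z \<le> t")
          case True
          have "z \<le> S n" for n using True S(1)[of n] by simp
          then show ?thesis using True by simp
        next
          case False
          then have "eventually (\<lambda>n. S n < z) sequentially" using order_tendstoD(2)[OF S(4)] by simp
          then show ?thesis by eventually_elim (use False in auto)
        qed
      qed (use S in \<open>auto intro: less_imp_le\<close>)
    qed simp
    assume t0: "0 < t"
    have "((\<lambda>t. set_lebesgue_integral \<mu> ({0<..t} \<times> UNIV) h) \<longlongrightarrow> set_lebesgue_integral \<mu> ({0<..<t} \<times> UNIV) h) (at_left t)"
    proof (rule tendsto_at_left_sequentially[of 0])
      fix S assume S: "\<And>n. S n < t" "\<And>n. 0 < S n" "incseq S" "S \<longlonglongrightarrow> t"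
      show "(\<lambda>n. set_lebesgue_integral \<mu> ({0<..S n} \<times> UNIV) h) \<longlonglongrightarrow> set_lebesgue_integral \<mu> ({0<..<t} \<times> UNIV) h"
      proof (rule lim[of S t])
        show "eventually (\<lambda>n. z \<in> {0<..S n} \<longleftrightarrow> z \<in> {0<..<t}) sequentially" for z
        proof (cases "z < t")
          case True
          then have "eventually (\<lambda>n. z < S n) sequentially" using order_tendstoD(1)[OF S(4)] by simp
          then show ?thesis by eventually_elim (use True in auto)
        next
          case False
          have "\<not> z \<le> S n" for n using False S(1)[of n] by simp
          then show ?thesis using False by simp
        qed
      qed (use S in \<open>auto intro: less_imp_le\<close>)
    qed (use t0 in simp)
    then show "\<exists>l. ((\<lambda>t. set_lebesgue_integral \<mu> ({0<..t} \<times> UNIV) h) \<longlongrightarrow> l) (at_left t)" by blast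
  qed
qed

text \<open>The jump part is integrated against the uncompensated jump measure. Its compensator will
  be part of \<open>b\<close>.\<close>

definition path_integral ::
  "(real \<Rightarrow> 'y::euclidean_space) \<Rightarrow> ('e \<Rightarrow> 'e) \<Rightarrow> ('y \<Rightarrow> 'e \<Rightarrow> 'e) \<Rightarrow> (real \<Rightarrow> 'e) \<Rightarrow> real \<Rightarrow> real \<Rightarrow> 'e::euclidean_space"
  where
  "path_integral f b g \<xi> s t = (LINT z:{s<..t}|lborel. b (\<xi> z))
     + set_lebesgue_integral (jump_measure f) ({s<..t} \<times> UNIV) (\<lambda>(z, y). g y (\<xi> z))"

text \<open>Multiplying by the indicator asks for measurability on \<open>{0<..T}\<close> only,
  since a path may be arbitrary after its life time.\<close>

definition admissible :: "real \<Rightarrow> (real \<Rightarrow> 'e::euclidean_space) \<Rightarrow> bool" where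
  "admissible T \<xi> \<longleftrightarrow> (\<lambda>z. indicat_real {0<..T} z *\<^sub>R \<xi> z) \<in> borel_measurable borel \<and>
     (\<exists>R. \<forall>z\<in>{0<..T}. norm (\<xi> z) \<le> R)"

text \<open>Only lags of this form occur: \<open>h z = z\<close> for an equation and \<open>h z\<close> the left grid point for
  its Euler scheme.\<close>

definition time_lag :: "(real \<Rightarrow> real) \<Rightarrow> bool" where
  "time_lag h \<longleftrightarrow> h = (\<lambda>z. z) \<or> (\<exists>\<Delta>>0. h = grid_left \<Delta>)"

lemma time_lag_id [simp]: "time_lag (\<lambda>z. z)" and time_lag_grid: "0 < \<Delta> \<Longrightarrow> time_lag (grid_left \<Delta>)"
  by (auto simp: time_lag_def)

lemma time_lag_bounds:
  assumes "time_lag h" "0 < z"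
  shows "0 \<le> h z" "h z \<le> z"
  using assms grid_left_bounds[of _ z] by (auto simp: time_lag_def less_imp_le)

lemma admissible_lagged:
  fixes f :: "real \<Rightarrow> 'e::euclidean_space"
  assumes h: "time_lag h" and f: "cadlag_on \<tau> f" "ereal T < \<tau>" and B: "\<forall>t\<in>{0..T}. norm (f t) \<le> B"
  shows "admissible T (\<lambda>z. left_lim f (h z))" "\<And>z. 0 < z \<Longrightarrow> z \<le> T \<Longrightarrow> norm (left_lim f (h z)) \<le> B"
proof -
  show le: "norm (left_lim f (h z)) \<le> B" if "0 < z" "z \<le> T" for z
  proof (rule left_lim_norm_le[OF f(1)])
    show "ereal (h z) < \<tau>" using time_lag_bounds[OF h that(1)] that(2) f(2) by (auto intro: le_less_trans[of _ "ereal T"])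
  qed (use time_lag_bounds[OF h that(1)] that B in auto)
  show "admissible T (\<lambda>z. left_lim f (h z))"
    unfolding admissible_def
  proof (intro conjI exI[of _ B] ballI)
    show "(\<lambda>z. indicat_real {0<..T} z *\<^sub>R left_lim f (h z)) \<in> borel_measurable borel"
    proof (cases "h = (\<lambda>z. z)")
      case True
      then show ?thesis using borel_measurable_left_lim[OF f] by simp
    next
      case False
      then obtain \<Delta> where "h = grid_left \<Delta>" using h by (auto simp: time_lag_def)
      then show ?thesis
        by (auto intro!: borel_measurable_scaleR borel_measurable_indicator borel_measurable_grid_comp)
    qed
  qed (use le in auto)
qed

lemma path_integral_cong:
  assumes "\<And>z. s < z \<Longrightarrow> z \<le> t \<Longrightarrow> b (\<xi> z) = b' (\<xi>' z)" "\<And>z y. s < z \<Longrightarrow> z \<le> t \<Longrightarrow> g y (\<xi> z) = g' y (\<xi>' z)"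
  shows "path_integral f b g \<xi> s t = path_integral f b' g' \<xi>' s t"
  unfolding path_integral_def set_lebesgue_integral_def using assms
  by (intro arg_cong2[where f = "(+)"] Bochner_Integration.integral_cong) (auto simp: indicator_def)

lemma path_integral_refl [simp]: "path_integral f b g \<xi> t t = 0"
  by (simp add: path_integral_def set_lebesgue_integral_def)

lemma emeasure_lborel_Ioc_finite: "emeasure lborel {s<..t::real} < \<top>"
  by (cases "s \<le> t") auto

text \<open>Linearity in the mark has two effects: for bounded x the coefficient is at most a
  multiple of \<open>norm y\<close>, so summable jumps suffice for integrability, and a frozen
  coefficient sees only the sum of the jumps.\<close>

locale linear_coefficients =
  fixes b :: "'e::euclidean_space \<Rightarrow> 'e" and g :: "'y::euclidean_space \<Rightarrow> 'e \<Rightarrow> 'e"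
  assumes continuous_drift: "continuous_on UNIV b"
    and continuous_jump: "continuous_on UNIV (\<lambda>(y, x). g y x)"
    and linear_jump: "linear (\<lambda>y. g y x)"
begin

lemma jump_zero [simp]: "g 0 x = 0"
  using linear_0[OF linear_jump] .

lemma measurable_drift: "b \<in> borel_measurable borel"
  by (rule borel_measurable_continuous_onI[OF continuous_drift])

lemma measurable_jump:
  assumes "u \<in> borel_measurable N" "v \<in> borel_measurable N"
  shows "(\<lambda>x. g (u x) (v x)) \<in> borel_measurable N"
  using borel_measurable_continuous_Pair[OF assms, of g] continuous_jump by (simp add: case_prod_unfold)

lemma local_bound:
  obtains C where "0 \<le> C" "\<And>x. norm x \<le> R \<Longrightarrow> norm (b x) \<le> C" "\<And>x y. norm x \<le> R \<Longrightarrow> norm (g y x) \<le> C * norm y"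
proof -
  have "compact (b ` cball 0 R)"
    by (rule compact_continuous_image[OF continuous_on_subset[OF continuous_drift]]) auto
  then obtain C1 where C1: "\<And>x. norm x \<le> R \<Longrightarrow> norm (b x) \<le> C1"
    unfolding bounded_iff[THEN iffD1, OF compact_imp_bounded] by (force dest: compact_imp_bounded simp: bounded_iff)
  have "compact ((\<lambda>(y, x). g y x) ` (cball 0 1 \<times> cball 0 R))"
    by (rule compact_continuous_image[OF continuous_on_subset[OF continuous_jump]]) (auto intro: compact_Times)
  then obtain C2 where C2: "\<And>x y. norm x \<le> R \<Longrightarrow> norm y \<le> 1 \<Longrightarrow> norm (g y x) \<le> C2"
    by (force dest: compact_imp_bounded simp: bounded_iff)
  have "norm (g y x) \<le> \<bar>C2\<bar> * norm y" if x: "norm x \<le> R" for x y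
  proof (cases "y = 0")
    case False
    \<comment> \<open>Homogeneity reduces all marks to the unit ball, where compactness gives the
      bound.\<close>
    have "g y x = norm y *\<^sub>R g (y /\<^sub>R norm y) x"
      using False linear_scale[OF linear_jump[of x], of "norm y" "y /\<^sub>R norm y"] by simp
    then have "norm (g y x) = norm y * norm (g (y /\<^sub>R norm y) x)" by simp
    also have "\<dots> \<le> norm y * \<bar>C2\<bar>"
      using C2[OF x, of "y /\<^sub>R norm y"] False by (intro mult_left_mono) auto
    finally show ?thesis by (simp add: mult.commute)
  qed simp
  moreover have "norm (b x) \<le> max \<bar>C1\<bar> \<bar>C2\<bar>" if "norm x \<le> R" for x using C1[OF that] by simp
  moreover have "\<bar>C2\<bar> * norm y \<le> max \<bar>C1\<bar> \<bar>C2\<bar> * norm y" for y :: 'y by (intro mult_right_mono) auto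
  ultimately show ?thesis using that[of "max \<bar>C1\<bar> \<bar>C2\<bar>"] by (meson abs_ge_zero max.coboundedI1 order_trans)
qed

lemma set_integrable_drift:
  assumes "admissible T \<xi>" "0 \<le> s" "t \<le> T"
  shows "set_integrable lborel {s<..t} (\<lambda>z. b (\<xi> z))"
proof -
  obtain R where R: "\<And>z. z \<in> {0<..T} \<Longrightarrow> norm (\<xi> z) \<le> R"
    using assms(1) unfolding admissible_def by blast
  obtain C where C: "0 \<le> C" "\<And>x. norm x \<le> R \<Longrightarrow> norm (b x) \<le> C" "\<And>x y. norm x \<le> R \<Longrightarrow> norm (g y x) \<le> C * norm y"
    by (rule local_bound[of R]) (rule that)
  \<comment> \<open>Only the cut integrand is known to be measurable, so the cut is inserted inside
    \<open>b\<close>, where it has no effect on the cell.\<close>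
  have eq: "indicat_real {s<..t} z *\<^sub>R b (\<xi> z) = indicat_real {s<..t} z *\<^sub>R b (indicat_real {0<..T} z *\<^sub>R \<xi> z)" for z
    using assms(2,3) by (auto simp: indicator_def)
  show ?thesis
    unfolding set_integrable_def
  proof (rule Bochner_Integration.integrable_bound[where f = "\<lambda>z. C * indicat_real {s<..t} z"])
    show "integrable lborel (\<lambda>z. C * indicat_real {s<..t} z)"
      by (intro integrable_mult_right integrable_real_indicator) (auto simp: emeasure_lborel_Ioc_finite)
    show "(\<lambda>z. indicat_real {s<..t} z *\<^sub>R b (\<xi> z)) \<in> borel_measurable lborel"
    proof -
      have m\<xi>: "(\<lambda>z. indicat_real {0<..T} z *\<^sub>R \<xi> z) \<in> borel_measurable lborel" using assms(1) by (simp add: admissible_def)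
      show ?thesis
        unfolding eq by (intro borel_measurable_scaleR borel_measurable_indicator measurable_compose[OF m\<xi> measurable_drift]) auto
    qed
    show "AE z in lborel. norm (indicat_real {s<..t} z *\<^sub>R b (\<xi> z)) \<le> norm (C * indicat_real {s<..t} z)"
      using C R assms(2,3) by (intro AE_I2) (auto simp: indicator_def)
  qed
qed

lemma measurable_jump_integrand:
  assumes "admissible T \<xi>" "0 \<le> s" "t \<le> T" and A: "A \<in> sets borel"
  shows "(\<lambda>x. indicat_real ({s<..t} \<times> A) x *\<^sub>R (case x of (z, y) \<Rightarrow> g y (\<xi> z))) \<in> borel_measurable borel"
proof -
  have eq: "indicat_real ({s<..t} \<times> A) x *\<^sub>R (case x of (z, y) \<Rightarrow> g y (\<xi> z))
    = indicat_real ({s<..t} \<times> A) x *\<^sub>R g (snd x) (indicat_real {0<..T} (fst x) *\<^sub>R \<xi> (fst x))" for x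
    using assms(2,3) by (auto simp: indicator_def split: prod.splits)
  have m: "(\<lambda>x::real \<times> 'y. fst x) \<in> borel_measurable borel" "(\<lambda>x::real \<times> 'y. snd x) \<in> borel_measurable borel"
    by (auto simp: borel_prod[symmetric])
  have m\<xi>: "(\<lambda>z. indicat_real {0<..T} z *\<^sub>R \<xi> z) \<in> borel_measurable borel" using assms(1) by (simp add: admissible_def)
  show ?thesis
    unfolding eq using sets_time_mark[OF _ A, of "{s<..t}"]
    by (intro borel_measurable_scaleR borel_measurable_indicator measurable_jump m measurable_compose[OF m(1) m\<xi>]) auto
qed

end

locale jump_path =
  fixes f :: "real \<Rightarrow> 'y::euclidean_space"
  assumes cadlag_f: "cadlag_on \<infinity> f"
    and finite_variation: "\<And>T. (\<integral>\<^sup>+(z, y). indicator {0<..T} z * ennreal (norm y) \<partial>jump_measure f) < \<infinity>"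
begin

abbreviation "N \<equiv> jump_measure f"

lemma set_integrable_mark: "set_integrable N ({0<..T} \<times> UNIV) (\<lambda>(z, y). y)"
proof -
  have m: "(\<lambda>x::real \<times> 'y. snd x) \<in> borel_measurable borel" by (simp add: borel_prod[symmetric])
  show ?thesis
    unfolding set_integrable_def
  proof (rule integrableI_bounded)
    show "(\<lambda>x. indicat_real ({0<..T} \<times> UNIV) x *\<^sub>R (case x of (z, y) \<Rightarrow> y)) \<in> borel_measurable N"
      unfolding measurable_cong_sets[OF sets_jump_measure refl] case_prod_beta
      by (intro borel_measurable_scaleR borel_measurable_indicator m sets_time_mark) auto
    have "(\<integral>\<^sup>+x. ennreal (norm (indicat_real ({0<..T} \<times> UNIV) x *\<^sub>R (case x of (z, y) \<Rightarrow> y))) \<partial>N)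
      = (\<integral>\<^sup>+(z, y). indicator {0<..T} z * ennreal (norm y) \<partial>N)"
      by (intro nn_integral_cong) (auto simp: indicator_def)
    then show "(\<integral>\<^sup>+x. ennreal (norm (indicat_real ({0<..T} \<times> UNIV) x *\<^sub>R (case x of (z, y) \<Rightarrow> y))) \<partial>N) < \<infinity>"
      using finite_variation by simp
  qed
qed

lemma set_integrable_jump_bound:
  fixes h :: "real \<times> 'y \<Rightarrow> 'e::euclidean_space"
  assumes "0 \<le> s" "(\<lambda>x. indicat_real ({s<..t} \<times> A) x *\<^sub>R h x) \<in> borel_measurable borel"
    and "\<And>z y. s < z \<Longrightarrow> z \<le> t \<Longrightarrow> norm (h (z, y)) \<le> C * norm y"
  shows "set_integrable N ({s<..t} \<times> A) h"
  unfolding set_integrable_def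
proof (rule Bochner_Integration.integrable_bound)
  show "integrable N (\<lambda>x. C *\<^sub>R (indicat_real ({0<..t} \<times> UNIV) x *\<^sub>R (case x of (z, y) \<Rightarrow> y)))"
    using set_integrable_mark[of t] unfolding set_integrable_def by (rule integrable_scaleR_right)
  show "AE x in N. norm (indicat_real ({s<..t} \<times> A) x *\<^sub>R h x)
    \<le> norm (C *\<^sub>R (indicat_real ({0<..t} \<times> UNIV) x *\<^sub>R (case x of (z, y) \<Rightarrow> y)))"
  proof (rule AE_I2)
    fix x :: "real \<times> 'y"
    obtain z y where [simp]: "x = (z, y)" by (cases x)
    show "norm (indicat_real ({s<..t} \<times> A) x *\<^sub>R h x)
      \<le> norm (C *\<^sub>R (indicat_real ({0<..t} \<times> UNIV) x *\<^sub>R (case x of (z, y) \<Rightarrow> y)))"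
    proof (cases "s < z \<and> z \<le> t \<and> y \<in> A")
      case True
      have "C * norm y \<le> \<bar>C\<bar> * norm y" by (intro mult_right_mono) auto
      then show ?thesis using assms(3)[of z y] True assms(1) by (simp add: indicator_def)
    qed (auto simp: indicator_def)
  qed
qed (use assms(2) in \<open>simp add: measurable_cong_sets[OF sets_jump_measure refl]\<close>)

definition total_jump :: "real \<Rightarrow> 'y" where
  "total_jump t = set_lebesgue_integral N ({0<..t} \<times> UNIV) (\<lambda>(z, y). y)"

text \<open>The sum of elapsed time and total size of jumps controls the drift and the jump integral
  at once; it is the increasing function V of the Gronwall inequality.\<close>

definition clock :: "real \<Rightarrow> real" where
  "clock t = t + set_lebesgue_integral N ({0<..t} \<times> UNIV) (\<lambda>(z, y). norm y)"

lemma cadlag_total_jump: "cadlag_on \<infinity> total_jump"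
  unfolding total_jump_def[abs_def] by (intro cadlag_set_integral set_integrable_mark) simp

lemma set_integrable_norm_mark: "set_integrable N ({0<..T} \<times> UNIV) (\<lambda>(z, y). norm y)"
  using set_integrable_norm[OF set_integrable_mark] by (simp add: case_prod_unfold)

lemma cadlag_clock: "cadlag_on \<infinity> clock"
  unfolding clock_def[abs_def]
  by (intro cadlag_on_add cadlag_on_continuous cadlag_set_integral set_integrable_norm_mark continuous_intros) simp

lemma set_integral_jump_split:
  fixes h :: "real \<times> 'y \<Rightarrow> 'e::euclidean_space"
  assumes "0 \<le> s" "s \<le> t" "set_integrable N ({0<..t} \<times> UNIV) h"
  shows "set_lebesgue_integral N ({0<..t} \<times> UNIV) h
    = set_lebesgue_integral N ({0<..s} \<times> UNIV) h + set_lebesgue_integral N ({s<..t} \<times> UNIV) h"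
proof -
  have eq: "{0<..t} \<times> (UNIV::'y set) = {0<..s} \<times> UNIV \<union> {s<..t} \<times> UNIV" using assms by auto
  show ?thesis
    unfolding eq
    using assms by (intro set_integral_Un set_integrable_subset[OF assms(3)]) (auto intro!: sets_time_mark)
qed

lemma clock_diff:
  assumes "0 \<le> s" "s \<le> t"
  shows "clock t - clock s = (t - s) + set_lebesgue_integral N ({s<..t} \<times> UNIV) (\<lambda>(z, y). norm y)"
  using set_integral_jump_split[OF assms set_integrable_norm_mark] by (simp add: clock_def)

lemma clock_mono:
  assumes "0 \<le> s" "s \<le> t"
  shows "clock s \<le> clock t"
proof -
  have "0 \<le> set_lebesgue_integral N ({s<..t} \<times> UNIV) (\<lambda>(z, y). norm y)"
    unfolding set_lebesgue_integral_def by (rule Bochner_Integration.integral_nonneg) (auto simp: indicator_def)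
  then show ?thesis using clock_diff[OF assms] assms(2) by linarith
qed

text \<open>The distance of two integrands in L1 of the measure dz + |y| N(dz,dy), whose
  distribution function is \<open>clock\<close>.\<close>

definition deviation :: "(real \<Rightarrow> 'e::euclidean_space) \<Rightarrow> (real \<Rightarrow> 'e) \<Rightarrow> real \<Rightarrow> real \<Rightarrow> real" where
  "deviation \<xi> \<xi>' s t = (LINT z:{s<..t}|lborel. norm (\<xi> z - \<xi>' z))
     + set_lebesgue_integral N ({s<..t} \<times> UNIV) (\<lambda>(z, y). norm y * norm (\<xi> z - \<xi>' z))"

lemma deviation_integrable:
  assumes "admissible T \<xi>" "admissible T \<xi>'" "0 \<le> s" "t \<le> T"
  shows "set_integrable lborel {s<..t} (\<lambda>z. norm (\<xi> z - \<xi>' z))"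
    "set_integrable N ({s<..t} \<times> UNIV) (\<lambda>(z, y). norm y * norm (\<xi> z - \<xi>' z))"
proof -
  obtain R where R: "\<And>z. z \<in> {0<..T} \<Longrightarrow> norm (\<xi> z) \<le> R" using assms(1) unfolding admissible_def by blast
  obtain R' where R': "\<And>z. z \<in> {0<..T} \<Longrightarrow> norm (\<xi>' z) \<le> R'" using assms(2) unfolding admissible_def by blast
  have le: "norm (\<xi> z - \<xi>' z) \<le> R + R'" if "s < z" "z \<le> t" for z
    using norm_triangle_ineq4[of "\<xi> z" "\<xi>' z"] R[of z] R'[of z] that assms(3,4) by simp
  have [measurable]: "(\<lambda>z. indicat_real {0<..T} z *\<^sub>R \<xi> z) \<in> borel_measurable borel"
    "(\<lambda>z. indicat_real {0<..T} z *\<^sub>R \<xi>' z) \<in> borel_measurable borel"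
    using assms(1,2) by (auto simp: admissible_def)
  have eq: "norm (\<xi> z - \<xi>' z) = norm (indicat_real {0<..T} z *\<^sub>R \<xi> z - indicat_real {0<..T} z *\<^sub>R \<xi>' z)"
    if "s < z" "z \<le> t" for z using that assms(3,4) by simp
  have m: "(\<lambda>z. indicat_real {s<..t} z * norm (\<xi> z - \<xi>' z)) \<in> borel_measurable borel"
  proof -
    have "(\<lambda>z. indicat_real {s<..t} z * norm (indicat_real {0<..T} z *\<^sub>R \<xi> z - indicat_real {0<..T} z *\<^sub>R \<xi>' z)) \<in> borel_measurable borel"
      by measurable
    also have "(\<lambda>z. indicat_real {s<..t} z * norm (indicat_real {0<..T} z *\<^sub>R \<xi> z - indicat_real {0<..T} z *\<^sub>R \<xi>' z))
      = (\<lambda>z. indicat_real {s<..t} z * norm (\<xi> z - \<xi>' z))"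
      using eq by (auto simp: indicator_def fun_eq_iff)
    finally show ?thesis .
  qed
  show "set_integrable lborel {s<..t} (\<lambda>z. norm (\<xi> z - \<xi>' z))"
    unfolding set_integrable_def
  proof (rule Bochner_Integration.integrable_bound[where f = "\<lambda>z. (R + R') * indicat_real {s<..t} z"])
    show "integrable lborel (\<lambda>z. (R + R') * indicat_real {s<..t} z)"
      by (intro integrable_mult_right integrable_real_indicator) (auto simp: emeasure_lborel_Ioc_finite)
    show "AE z in lborel. norm (indicat_real {s<..t} z *\<^sub>R norm (\<xi> z - \<xi>' z)) \<le> norm ((R + R') * indicat_real {s<..t} z)"
      using le by (intro AE_I2) (force simp: indicator_def)
  qed (use m in simp)
  show "set_integrable N ({s<..t} \<times> UNIV) (\<lambda>(z, y). norm y * norm (\<xi> z - \<xi>' z))"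
  proof (rule set_integrable_jump_bound[OF assms(3)])
    have mf: "(\<lambda>x::real \<times> 'y. fst x) \<in> borel_measurable borel" "(\<lambda>x::real \<times> 'y. snd x) \<in> borel_measurable borel"
      by (auto simp: borel_prod[symmetric])
    have "(\<lambda>x::real \<times> 'y. norm (snd x)) \<in> borel_measurable borel"
      by (rule measurable_compose[OF mf(2)]) simp
    from borel_measurable_times[OF this measurable_compose[OF mf(1) m]]
    have "(\<lambda>x::real \<times> 'y. norm (snd x) * (indicat_real {s<..t} (fst x) * norm (\<xi> (fst x) - \<xi>' (fst x)))) \<in> borel_measurable borel" .
    also have "(\<lambda>x::real \<times> 'y. norm (snd x) * (indicat_real {s<..t} (fst x) * norm (\<xi> (fst x) - \<xi>' (fst x))))
      = (\<lambda>x::real \<times> 'y. indicat_real ({s<..t} \<times> UNIV) x *\<^sub>R (case x of (z, y) \<Rightarrow> norm y * norm (\<xi> z - \<xi>' z)))"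
      by (auto simp: fun_eq_iff indicator_def)
    finally show "(\<lambda>x::real \<times> 'y. indicat_real ({s<..t} \<times> UNIV) x *\<^sub>R (case x of (z, y) \<Rightarrow> norm y * norm (\<xi> z - \<xi>' z))) \<in> borel_measurable borel" .
    show "norm (case (z, y) of (z, y) \<Rightarrow> norm y * norm (\<xi> z - \<xi>' z)) \<le> (R + R') * norm y" if "s < z" "z \<le> t" for z y
      using mult_right_mono[OF le[OF that] norm_ge_zero[of y]] by (simp add: mult.commute)
  qed
qed

lemma deviation_mono:
  assumes "admissible T \<xi>" "admissible T \<xi>'" "0 \<le> s" "t \<le> T"
  shows "deviation \<xi> \<xi>' s t \<le> deviation \<xi> \<xi>' 0 T"
proof -
  note i = deviation_integrable[OF assms] deviation_integrable[OF assms(1,2) order_refl order_refl]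
  show ?thesis
    unfolding deviation_def
  proof (rule add_mono)
    show "(LINT z:{s<..t}|lborel. norm (\<xi> z - \<xi>' z)) \<le> (LINT z:{0<..T}|lborel. norm (\<xi> z - \<xi>' z))"
      unfolding set_lebesgue_integral_def using i assms(3,4)
      by (intro Bochner_Integration.integral_mono) (auto simp: set_integrable_def indicator_def)
    show "set_lebesgue_integral N ({s<..t} \<times> UNIV) (\<lambda>(z, y). norm y * norm (\<xi> z - \<xi>' z))
      \<le> set_lebesgue_integral N ({0<..T} \<times> UNIV) (\<lambda>(z, y). norm y * norm (\<xi> z - \<xi>' z))"
      unfolding set_lebesgue_integral_def using i assms(3,4)
      by (intro Bochner_Integration.integral_mono) (auto simp: set_integrable_def indicator_def)
  qed
qed

lemma deviation_le_clock:
  assumes "admissible T \<xi>" "admissible T \<xi>'" "0 \<le> s" "s \<le> t" "t \<le> T" and c: "\<And>z. s < z \<Longrightarrow> z \<le> t \<Longrightarrow> norm (\<xi> z - \<xi>' z) \<le> c"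
  shows "deviation \<xi> \<xi>' s t \<le> (clock t - clock s) * c"
proof -
  note i = deviation_integrable[OF assms(1-3,5)]
  have n: "set_integrable N ({s<..t} \<times> UNIV) (\<lambda>(z, y). norm y)"
    by (rule set_integrable_subset[OF set_integrable_norm_mark[of t]]) (use assms(3) in \<open>auto intro!: sets_time_mark\<close>)
  have "(LINT z:{s<..t}|lborel. norm (\<xi> z - \<xi>' z)) \<le> (LINT z:{s<..t}|lborel. c)"
    using c i(1) by (intro set_integral_mono)
      (auto simp: set_integrable_def emeasure_lborel_Ioc_finite intro!: integrable_mult_left integrable_real_indicator)
  also have "\<dots> = (t - s) * c" using assms(4) by (simp add: set_integral_const)
  finally have 1: "(LINT z:{s<..t}|lborel. norm (\<xi> z - \<xi>' z)) \<le> (t - s) * c" .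
  have "set_lebesgue_integral N ({s<..t} \<times> UNIV) (\<lambda>(z, y). norm y * norm (\<xi> z - \<xi>' z))
    \<le> set_lebesgue_integral N ({s<..t} \<times> UNIV) (\<lambda>x. (case x of (z, y) \<Rightarrow> norm y) * c)"
    using c i(2) set_integrable_mult_left[OF n, of c] by (intro set_integral_mono) (auto intro!: mult_left_mono)
  also have "\<dots> = set_lebesgue_integral N ({s<..t} \<times> UNIV) (\<lambda>(z, y). norm y) * c"
    by simp
  finally show ?thesis using 1 unfolding deviation_def clock_diff[OF assms(3,4)] by (simp add: algebra_simps)
qed

text \<open>The jump measure charges single times, so the integrands have to converge at every z
  rather than almost everywhere. The bound R times \<open>norm y\<close> is integrable because the
  jumps are summable.\<close>

lemma deviation_tendsto_zero:
  fixes \<xi> :: "real \<Rightarrow> 'e::euclidean_space"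
  assumes "admissible T \<xi>" "\<And>m. admissible T (\<zeta> m)"
    and R: "\<And>z. 0 < z \<Longrightarrow> z \<le> T \<Longrightarrow> norm (\<xi> z) \<le> R" "\<And>m z. 0 < z \<Longrightarrow> z \<le> T \<Longrightarrow> norm (\<zeta> m z) \<le> R"
    and lim: "\<And>z. 0 < z \<Longrightarrow> z \<le> T \<Longrightarrow> (\<lambda>m. \<zeta> m z) \<longlonglongrightarrow> \<xi> z"
  shows "(\<lambda>m. deviation \<xi> (\<zeta> m) 0 T) \<longlonglongrightarrow> 0"
proof -
  note i = deviation_integrable[OF assms(1,2) order_refl order_refl]
  have le: "norm (\<xi> z - \<zeta> m z) \<le> 2 * R" if "0 < z" "z \<le> T" for m z
    using norm_triangle_ineq4[of "\<xi> z" "\<zeta> m z"] R(1)[OF that] R(2)[OF that, of m] by simp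
  have l0: "(\<lambda>m. norm (\<xi> z - \<zeta> m z)) \<longlonglongrightarrow> 0" if "0 < z" "z \<le> T" for z
    using tendsto_norm[OF tendsto_diff[OF tendsto_const lim[OF that]], of "\<xi> z"] by simp
  have "(\<lambda>m. LINT z:{0<..T}|lborel. norm (\<xi> z - \<zeta> m z)) \<longlonglongrightarrow> (LINT z::real|lborel. (0::real))"
    unfolding set_lebesgue_integral_def
  proof (rule integral_dominated_convergence)
    show "integrable lborel (\<lambda>z. (2 * R) * indicat_real {0<..T} z)"
      by (intro integrable_mult_right integrable_real_indicator) (auto simp: emeasure_lborel_Ioc_finite)
    show "AE z in lborel. norm (indicat_real {0<..T} z *\<^sub>R norm (\<xi> z - \<zeta> m z)) \<le> (2 * R) * indicat_real {0<..T} z" for m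
      using le by (intro AE_I2) (auto simp: indicator_def)
    show "AE z in lborel. (\<lambda>m. indicat_real {0<..T} z *\<^sub>R norm (\<xi> z - \<zeta> m z)) \<longlonglongrightarrow> 0"
      using l0 by (intro AE_I2) (auto simp: indicator_def)
  qed (use i(1) in \<open>auto simp: set_integrable_def intro: borel_measurable_integrable\<close>)
  moreover have "(\<lambda>m. set_lebesgue_integral N ({0<..T} \<times> UNIV) (\<lambda>(z, y). norm y * norm (\<xi> z - \<zeta> m z))) \<longlonglongrightarrow> (LINT x|N. (0::real))"
    unfolding set_lebesgue_integral_def
  proof (rule integral_dominated_convergence)
    show "integrable N (\<lambda>x. (2 * R) * (indicat_real ({0<..T} \<times> UNIV) x *\<^sub>R (case x of (z, y) \<Rightarrow> norm y)))"
      using set_integrable_norm_mark[of T] unfolding set_integrable_def by (rule integrable_mult_right)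
    show "AE x in N. norm (indicat_real ({0<..T} \<times> UNIV) x *\<^sub>R (case x of (z, y) \<Rightarrow> norm y * norm (\<xi> z - \<zeta> m z)))
      \<le> (2 * R) * (indicat_real ({0<..T} \<times> UNIV) x *\<^sub>R (case x of (z, y) \<Rightarrow> norm y))" for m
    proof (rule AE_I2)
      fix x :: "real \<times> 'y"
      show "norm (indicat_real ({0<..T} \<times> UNIV) x *\<^sub>R (case x of (z, y) \<Rightarrow> norm y * norm (\<xi> z - \<zeta> m z)))
        \<le> (2 * R) * (indicat_real ({0<..T} \<times> UNIV) x *\<^sub>R (case x of (z, y) \<Rightarrow> norm y))"
        using mult_right_mono[OF le[of "fst x" m] norm_ge_zero[of "snd x"]]
        by (cases x) (auto simp: indicator_def mult.commute)
    qed
    show "AE x in N. (\<lambda>m. indicat_real ({0<..T} \<times> UNIV) x *\<^sub>R (case x of (z, y) \<Rightarrow> norm y * norm (\<xi> z - \<zeta> m z))) \<longlonglongrightarrow> 0"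
    proof (rule AE_I2)
      fix x :: "real \<times> 'y"
      show "(\<lambda>m. indicat_real ({0<..T} \<times> UNIV) x *\<^sub>R (case x of (z, y) \<Rightarrow> norm y * norm (\<xi> z - \<zeta> m z))) \<longlonglongrightarrow> 0"
        using tendsto_mult_right_zero[OF l0[of "fst x"], of "norm (snd x)"]
        by (cases x) (auto simp: indicator_def)
    qed
  qed (use i(2) in \<open>auto simp: set_integrable_def intro: borel_measurable_integrable\<close>)
  ultimately show ?thesis
    unfolding deviation_def using tendsto_add by force
qed

end

locale path_coefficients = jump_path f + linear_coefficients b g
  for f :: "real \<Rightarrow> 'y::euclidean_space" and b :: "'e::euclidean_space \<Rightarrow> 'e" and g :: "'y \<Rightarrow> 'e \<Rightarrow> 'e"
begin

abbreviation "integral_along \<equiv> path_integral f b g"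

lemma set_integrable_jump:
  assumes "admissible T \<xi>" "0 \<le> s" "t \<le> T" "A \<in> sets borel"
  shows "set_integrable N ({s<..t} \<times> A) (\<lambda>(z, y). g y (\<xi> z))"
proof -
  obtain R where R: "\<And>z. z \<in> {0<..T} \<Longrightarrow> norm (\<xi> z) \<le> R" using assms(1) unfolding admissible_def by blast
  obtain C where C: "0 \<le> C" "\<And>x. norm x \<le> R \<Longrightarrow> norm (b x) \<le> C" "\<And>x y. norm x \<le> R \<Longrightarrow> norm (g y x) \<le> C * norm y"
    by (rule local_bound[of R]) (rule that)
  show ?thesis
    using C R assms(2,3)
    by (intro set_integrable_jump_bound[where C = C] measurable_jump_integrand[OF assms(1)] assms) auto
qed

lemma path_integral_add:
  assumes "admissible T \<xi>" "0 \<le> s" "s \<le> t" "t \<le> T"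
  shows "integral_along \<xi> 0 t = integral_along \<xi> 0 s + integral_along \<xi> s t"
proof -
  have "{0<..t} = {0<..s} \<union> {s<..t}" using assms by auto
  then have "(LINT z:{0<..t}|lborel. b (\<xi> z)) = (LINT z:{0<..s}|lborel. b (\<xi> z)) + (LINT z:{s<..t}|lborel. b (\<xi> z))"
    using assms set_integrable_drift[OF assms(1)] by (simp add: set_integral_Un)
  then show ?thesis
    using set_integral_jump_split[OF assms(2,3) set_integrable_jump[OF assms(1) order_refl assms(4)]]
    by (simp add: path_integral_def)
qed

lemma path_integral_diff_le:
  assumes \<xi>: "admissible T \<xi>" "admissible T \<xi>'" and st: "0 \<le> s" "t \<le> T"
    and lip: "\<And>x x'. norm (b x - b x') \<le> K * norm (x - x')" "\<And>x x' y. norm (g y x - g y x') \<le> K * (norm y * norm (x - x'))"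
  shows "norm (integral_along \<xi> s t - integral_along \<xi>' s t) \<le> K * deviation \<xi> \<xi>' s t"
proof -
  note i = deviation_integrable[OF \<xi> st]
  note d = set_integrable_drift[OF \<xi>(1) st] set_integrable_drift[OF \<xi>(2) st]
  note j = set_integrable_jump[OF \<xi>(1) st, of UNIV, simplified] set_integrable_jump[OF \<xi>(2) st, of UNIV, simplified]
  have "norm ((LINT z:{s<..t}|lborel. b (\<xi> z)) - (LINT z:{s<..t}|lborel. b (\<xi>' z))) \<le> K * (LINT z:{s<..t}|lborel. norm (\<xi> z - \<xi>' z))"
  proof -
    have "(LINT z:{s<..t}|lborel. b (\<xi> z)) - (LINT z:{s<..t}|lborel. b (\<xi>' z)) = (LINT z:{s<..t}|lborel. b (\<xi> z) - b (\<xi>' z))"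
      using d by (simp add: set_integral_diff)
    also have "norm \<dots> \<le> (LINT z:{s<..t}|lborel. norm (b (\<xi> z) - b (\<xi>' z)))"
      using set_integral_diff(1)[OF d] by (rule set_integral_norm_bound)
    also have "\<dots> \<le> (LINT z:{s<..t}|lborel. K * norm (\<xi> z - \<xi>' z))"
      using set_integrable_norm[OF set_integral_diff(1)[OF d]] set_integrable_mult_right[OF i(1)] lip(1)
      by (intro set_integral_mono) auto
    finally show ?thesis by simp
  qed
  moreover have "norm (set_lebesgue_integral N ({s<..t} \<times> UNIV) (\<lambda>(z, y). g y (\<xi> z)) - set_lebesgue_integral N ({s<..t} \<times> UNIV) (\<lambda>(z, y). g y (\<xi>' z)))
    \<le> K * set_lebesgue_integral N ({s<..t} \<times> UNIV) (\<lambda>(z, y). norm y * norm (\<xi> z - \<xi>' z))"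
  proof -
    have "set_lebesgue_integral N ({s<..t} \<times> UNIV) (\<lambda>(z, y). g y (\<xi> z)) - set_lebesgue_integral N ({s<..t} \<times> UNIV) (\<lambda>(z, y). g y (\<xi>' z))
      = set_lebesgue_integral N ({s<..t} \<times> UNIV) (\<lambda>x. (case x of (z, y) \<Rightarrow> g y (\<xi> z)) - (case x of (z, y) \<Rightarrow> g y (\<xi>' z)))"
      by (rule set_integral_diff(2)[OF j, symmetric])
    also have "norm \<dots> \<le> set_lebesgue_integral N ({s<..t} \<times> UNIV) (\<lambda>x. norm ((case x of (z, y) \<Rightarrow> g y (\<xi> z)) - (case x of (z, y) \<Rightarrow> g y (\<xi>' z))))"
      using set_integral_diff(1)[OF j] by (rule set_integral_norm_bound)
    also have "\<dots> \<le> set_lebesgue_integral N ({s<..t} \<times> UNIV) (\<lambda>x. K * (case x of (z, y) \<Rightarrow> norm y * norm (\<xi> z - \<xi>' z)))"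
      using set_integrable_norm[OF set_integral_diff(1)[OF j]] set_integrable_mult_right[OF i(2)] lip(2)
      by (intro set_integral_mono) auto
    finally show ?thesis by simp
  qed
  ultimately show ?thesis
    unfolding path_integral_def deviation_def distrib_left
    by (smt (verit) add_diff_add norm_triangle_ineq)
qed

text \<open>The perturbation bound is linear in the last supremum, so the Gronwall inequality for the
  clock process applies; the error committed by freezing the coefficients on the grid vanishes by
  dominated convergence, because the grid points approach \<open>z\<close> strictly from the left.\<close>

lemma euler_scheme_converges:
  assumes X: "cadlag_on \<tau> X" "ereal T < \<tau>" and T: "0 \<le> T" and K: "0 \<le> K"
    and eqX: "\<And>t. 0 \<le> t \<Longrightarrow> t \<le> T \<Longrightarrow> X t = x0 + integral_along (left_lim X) 0 t"
    and lip: "\<And>x x'. norm (b x - b x') \<le> K * norm (x - x')" "\<And>x x' y. norm (g y x - g y x') \<le> K * (norm y * norm (x - x'))"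
    and \<Delta>: "\<And>m. 0 < \<Delta> m" "\<Delta> \<longlonglongrightarrow> 0"
    and Z: "\<And>m. cadlag_on \<infinity> (Z m)"
    and eqZ: "\<And>m t. 0 \<le> t \<Longrightarrow> t \<le> T \<Longrightarrow> Z m t = x0 + integral_along (\<lambda>z. left_lim (Z m) (grid_left (\<Delta> m) z)) 0 t"
    and e: "0 < e"
  shows "eventually (\<lambda>m. \<forall>t\<in>{0..T}. norm (X t - Z m t) \<le> e) sequentially"
proof -
  define \<xi> where "\<xi> = left_lim X"
  \<comment> \<open>Between the integrand \<xi> of the equation and the integrand \<zeta>' of the
    scheme stands the solution itself frozen on the grid. The distance from \<xi> to \<zeta> gives
    the error \<epsilon> m, that from \<zeta> to \<zeta>' the Gronwall term.\<close>
  define \<zeta> where "\<zeta> m z = left_lim X (grid_left (\<Delta> m) z)" for m z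
  define \<zeta>' where "\<zeta>' m z = left_lim (Z m) (grid_left (\<Delta> m) z)" for m z
  obtain R where R: "\<And>t. 0 \<le> t \<Longrightarrow> t \<le> T \<Longrightarrow> norm (X t) \<le> R" using cadlag_on_bounded[OF X] by blast
  have lt_inf: "ereal T < \<infinity>" by simp
  have lt: "ereal t < \<tau>" if "t \<le> T" for t using that X(2) by (auto intro: le_less_trans[of _ "ereal T"])
  have R': "norm (left_lim X t) \<le> R" if "0 \<le> t" "t \<le> T" for t
    using left_lim_norm_le[OF X(1) that(1) lt[OF that(2)]] R that by auto
  have grid: "0 \<le> grid_left (\<Delta> m) z" "grid_left (\<Delta> m) z < z" if "0 < z" for m z
    using grid_left_bounds[OF \<Delta>(1) that] by auto
  have RX: "\<forall>t\<in>{0..T}. norm (X t) \<le> R" using R by simp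
  have \<xi>: "admissible T \<xi>"
    unfolding \<xi>_def by (rule admissible_lagged(1)[OF time_lag_id X RX])
  have \<zeta>: "admissible T (\<zeta> m)" for m
    unfolding \<zeta>_def[abs_def] by (rule admissible_lagged(1)[OF time_lag_grid[OF \<Delta>(1)] X RX])
  have \<zeta>': "admissible T (\<zeta>' m)" for m
  proof -
    obtain B where "\<And>t. 0 \<le> t \<Longrightarrow> t \<le> T \<Longrightarrow> norm (Z m t) \<le> B" using cadlag_on_bounded[OF Z[of m] lt_inf] by blast
    then have B: "\<forall>t\<in>{0..T}. norm (Z m t) \<le> B" by simp
    show ?thesis
      unfolding \<zeta>'_def[abs_def] by (rule admissible_lagged(1)[OF time_lag_grid[OF \<Delta>(1)] Z lt_inf B])
  qed
  define \<epsilon> where "\<epsilon> m = K * deviation \<xi> (\<zeta> m) 0 T" for m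
  have "(\<lambda>m. deviation \<xi> (\<zeta> m) 0 T) \<longlonglongrightarrow> 0"
  proof (rule deviation_tendsto_zero[OF \<xi> \<zeta>])
    show "norm (\<xi> z) \<le> R" if "0 < z" "z \<le> T" for z using R'[of z] that by (simp add: \<xi>_def)
    show "norm (\<zeta> m z) \<le> R" if "0 < z" "z \<le> T" for m z
      using R'[of "grid_left (\<Delta> m) z"] grid[of z m] that by (simp add: \<zeta>_def)
    show "(\<lambda>m. \<zeta> m z) \<longlonglongrightarrow> \<xi> z" if "0 < z" "z \<le> T" for z
      unfolding \<xi>_def \<zeta>_def using grid[OF that(1)] that
      by (intro left_lim_tendsto_left_lim[OF X(1) that(1) lt[OF that(2)]] grid_left_tendsto \<Delta>) auto
  qed
  then have \<epsilon>_lim: "\<epsilon> \<longlonglongrightarrow> 0" unfolding \<epsilon>_def[abs_def] by (rule tendsto_mult_right_zero)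
  have "\<exists>C. \<forall>m t. 0 \<le> t \<longrightarrow> t \<le> T \<longrightarrow> norm (X t - Z m t) \<le> C * \<epsilon> m"
  proof (rule gronwall_cadlag[OF _ cadlag_clock T K])
    show "clock s \<le> clock t" if "0 \<le> s" "s \<le> t" "t \<le> T" for s t by (rule clock_mono[OF that(1,2)])
    fix C
    assume C: "0 \<le> C"
    "\<And>\<phi> \<epsilon> B u. (\<And>u. 0 \<le> \<phi> u) \<Longrightarrow> (\<And>u. 0 \<le> u \<Longrightarrow> u \<le> T \<Longrightarrow> \<phi> u \<le> B) \<Longrightarrow> 0 \<le> \<epsilon> \<Longrightarrow>
      (\<And>s t c. 0 \<le> s \<Longrightarrow> s \<le> t \<Longrightarrow> t \<le> T \<Longrightarrow> 0 \<le> c \<Longrightarrow> (\<And>u. 0 \<le> u \<Longrightarrow> u < t \<Longrightarrow> \<phi> u \<le> c) \<Longrightarrow>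
        \<phi> t \<le> \<phi> s + \<epsilon> + K * (clock t - clock s) * c) \<Longrightarrow>
      0 \<le> u \<Longrightarrow> u \<le> T \<Longrightarrow> \<phi> u \<le> C * (\<phi> 0 + \<epsilon>)"
    have bound: "norm (X t - Z m t) \<le> C * \<epsilon> m" if t: "0 \<le> t" "t \<le> T" for m t
    proof -
      obtain B where B: "\<And>t. 0 \<le> t \<Longrightarrow> t \<le> T \<Longrightarrow> norm (Z m t) \<le> B" using cadlag_on_bounded[OF Z[of m] lt_inf] by blast
      have zero: "norm (X 0 - Z m 0) = 0" using eqX[of 0] eqZ[of 0 m] T by simp
      have "norm (X t - Z m t) \<le> C * (norm (X 0 - Z m 0) + \<epsilon> m)"
      proof (rule C(2)[of "\<lambda>u. norm (X u - Z m u)" "R + B" "\<epsilon> m", OF _ _ _ _ t])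
        show "norm (X u - Z m u) \<le> R + B" if "0 \<le> u" "u \<le> T" for u
          using R[OF that] B[OF that] norm_triangle_ineq4[of "X u" "Z m u"] by simp
        show "0 \<le> \<epsilon> m"
          unfolding \<epsilon>_def deviation_def set_lebesgue_integral_def using K
          by (intro mult_nonneg_nonneg add_nonneg_nonneg Bochner_Integration.integral_nonneg) (auto simp: case_prod_unfold)
        show "norm (X t - Z m t) \<le> norm (X s - Z m s) + \<epsilon> m + K * (clock t - clock s) * c"
          if st: "0 \<le> s" "s \<le> t" "t \<le> T" and c: "0 \<le> c" "\<And>u. 0 \<le> u \<Longrightarrow> u < t \<Longrightarrow> norm (X u - Z m u) \<le> c" for s t c
        proof -
          have dX: "X t = X s + integral_along \<xi> s t"
            using eqX[of s] eqX[of t] path_integral_add[OF \<xi> st] st by (simp add: \<xi>_def)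
          have dZ: "Z m t = Z m s + integral_along (\<zeta>' m) s t"
            using eqZ[of s m] eqZ[of t m] path_integral_add[OF \<zeta>'[of m] st] st by (simp add: \<zeta>'_def[abs_def])
          have 1: "norm (integral_along \<xi> s t - integral_along (\<zeta> m) s t) \<le> \<epsilon> m"
          proof -
            have "norm (integral_along \<xi> s t - integral_along (\<zeta> m) s t) \<le> K * deviation \<xi> (\<zeta> m) s t"
              by (rule path_integral_diff_le[OF \<xi> \<zeta> st(1,3) lip])
            also have "\<dots> \<le> \<epsilon> m" unfolding \<epsilon>_def by (intro mult_left_mono deviation_mono[OF \<xi> \<zeta> st(1,3)] K)
            finally show ?thesis .
          qed
          have 2: "norm (integral_along (\<zeta> m) s t - integral_along (\<zeta>' m) s t) \<le> K * (clock t - clock s) * c"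
          proof -
            have "norm (integral_along (\<zeta> m) s t - integral_along (\<zeta>' m) s t) \<le> K * deviation (\<zeta> m) (\<zeta>' m) s t"
              by (rule path_integral_diff_le[OF \<zeta> \<zeta>' st(1,3) lip])
            also have "\<dots> \<le> K * ((clock t - clock s) * c)"
            proof (intro mult_left_mono deviation_le_clock[OF \<zeta> \<zeta>' st] K)
              fix z assume z: "s < z" "z \<le> t"
              then have z0: "0 < z" using st by simp
              \<comment> \<open>The left limits are taken at a grid point strictly before z \<le> t,
                so a bound for the difference of the paths strictly before t suffices.\<close>
              show "norm (\<zeta> m z - \<zeta>' m z) \<le> c"
                unfolding \<zeta>_def \<zeta>'_def using grid[OF z0, of m] z st c(2)
                by (intro left_lim_diff_le[OF X(1) Z] lt) auto
            qed
            finally show ?thesis by simp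
          qed
          have "X t - Z m t = (X s - Z m s) + ((integral_along \<xi> s t - integral_along (\<zeta> m) s t)
              + (integral_along (\<zeta> m) s t - integral_along (\<zeta>' m) s t))"
            unfolding dX dZ by simp
          then have "norm (X t - Z m t) \<le> norm (X s - Z m s) + (norm (integral_along \<xi> s t - integral_along (\<zeta> m) s t)
              + norm (integral_along (\<zeta> m) s t - integral_along (\<zeta>' m) s t))"
            by (metis norm_triangle_ineq norm_triangle_mono order_refl)
          then show "norm (X t - Z m t) \<le> norm (X s - Z m s) + \<epsilon> m + K * (clock t - clock s) * c"
            using 1 2 by linarith
        qed
      qed simp
      then show ?thesis using zero by simp
    qed
    then show "\<exists>C. \<forall>m t. 0 \<le> t \<longrightarrow> t \<le> T \<longrightarrow> norm (X t - Z m t) \<le> C * \<epsilon> m" by blast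
  qed
  then obtain C where bound: "\<And>m t. 0 \<le> t \<Longrightarrow> t \<le> T \<Longrightarrow> norm (X t - Z m t) \<le> C * \<epsilon> m" by blast
  have "(\<lambda>m. C * \<epsilon> m) \<longlonglongrightarrow> 0" by (rule tendsto_mult_right_zero[OF \<epsilon>_lim])
  from order_tendstoD(2)[OF this e] show ?thesis
  proof eventually_elim
    case (elim m)
    show ?case
    proof
      fix t assume "t \<in> {0..T}"
      then show "norm (X t - Z m t) \<le> e" using bound[of t m] elim by auto
    qed
  qed
qed

end

text \<open>The integrand on a cell depends only on the path up to the cell's left end, so equality
  propagates from cell to cell. The downward closed predicate \<open>A\<close> covers both a fixed
  horizon and a random life time, and the two coefficient pairs need only agree along
  \<open>Y\<close>.\<close>

lemma euler_equation_unique: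
  assumes \<Delta>: "0 < \<Delta>" and down: "\<And>s t. A t \<Longrightarrow> s \<le> t \<Longrightarrow> A s"
    and Y: "\<And>t. 0 \<le> t \<Longrightarrow> A t \<Longrightarrow> Y t = x0 + path_integral f b g (\<lambda>z. left_lim Y (grid_left \<Delta> z)) 0 t"
    and Y': "\<And>t. 0 \<le> t \<Longrightarrow> A t \<Longrightarrow> Y' t = x0 + path_integral f b' g' (\<lambda>z. left_lim Y' (grid_left \<Delta> z)) 0 t"
    and agree: "\<And>z. 0 < z \<Longrightarrow> A z \<Longrightarrow> b (left_lim Y (grid_left \<Delta> z)) = b' (left_lim Y (grid_left \<Delta> z))"
      "\<And>z y. 0 < z \<Longrightarrow> A z \<Longrightarrow> g y (left_lim Y (grid_left \<Delta> z)) = g' y (left_lim Y (grid_left \<Delta> z))"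
    and t: "0 \<le> t" "A t"
  shows "Y t = Y' t"
proof -
  have "\<forall>t. 0 \<le> t \<longrightarrow> t \<le> real k * \<Delta> \<longrightarrow> A t \<longrightarrow> Y t = Y' t" for k
  proof (induct k)
    case 0
    then show ?case using Y[of 0] Y'[of 0] by (auto dest!: antisym)
  next
    case (Suc k)
    show ?case
    proof (intro allI impI)
      fix t assume t: "0 \<le> t" "t \<le> real (Suc k) * \<Delta>" "A t"
      have "path_integral f b g (\<lambda>z. left_lim Y (grid_left \<Delta> z)) 0 t
        = path_integral f b' g' (\<lambda>z. left_lim Y' (grid_left \<Delta> z)) 0 t"
      proof (rule path_integral_cong)
        fix z assume z: "0 < z" "z \<le> t"
        have Az: "A z" using down[OF t(3) z(2)] .
        obtain j :: nat where j: "grid_left \<Delta> z = real j * \<Delta>" using grid_left_bounds(4)[OF \<Delta> z(1)] by blast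
        have "real j * \<Delta> < real (Suc k) * \<Delta>" using grid_left_bounds(2)[OF \<Delta> z(1)] z(2) t(2) j by linarith
        \<comment> \<open>The grid point before z belongs to cells already settled by the induction
          hypothesis.\<close>
        then have "j \<le> k" using \<Delta> by simp
        then have jk: "real j * \<Delta> \<le> real k * \<Delta>" using \<Delta> by (intro mult_right_mono) auto
        have "left_lim Y (grid_left \<Delta> z) = left_lim Y' (grid_left \<Delta> z)"
        proof (rule left_lim_cong)
          fix u assume u: "0 \<le> u" "u < grid_left \<Delta> z \<or> grid_left \<Delta> z = 0 \<and> u = 0"
          then have "u \<le> real k * \<Delta>" "u \<le> z"
            using jk j grid_left_bounds(2)[OF \<Delta> z(1)] z(1) by auto
          moreover have "A u" using down[OF Az \<open>u \<le> z\<close>] .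
          ultimately show "Y u = Y' u" using Suc u(1) by blast
        qed (rule grid_left_bounds(1)[OF \<Delta> z(1)])
        then show "b (left_lim Y (grid_left \<Delta> z)) = b' (left_lim Y' (grid_left \<Delta> z))"
          "g y (left_lim Y (grid_left \<Delta> z)) = g' y (left_lim Y' (grid_left \<Delta> z))" for y
          using agree[OF z(1) Az] by auto
      qed
      then show "Y t = Y' t" using Y[OF t(1,3)] Y'[OF t(1,3)] by simp
    qed
  qed
  moreover obtain k :: nat where "t / \<Delta> \<le> real k" using real_arch_simple by blast
  ultimately show ?thesis using t \<Delta> by (auto simp: pos_divide_le_eq)
qed

text \<open>The state at the grid point \<open>k \<Delta>\<close> consists of the left limit, at which the coefficients are
  frozen on the next cell, and the value itself.\<close>

primrec euler_state ::
  "real \<Rightarrow> ('e \<Rightarrow> 'e) \<Rightarrow> ('y \<Rightarrow> 'e \<Rightarrow> 'e) \<Rightarrow> 'e \<Rightarrow> (real \<Rightarrow> 'y::euclidean_space) \<Rightarrow> nat \<Rightarrow> 'e \<times> 'e::euclidean_space" where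
  "euler_state \<Delta> b g x0 P 0 = (x0, x0)"
| "euler_state \<Delta> b g x0 P (Suc k) = (case euler_state \<Delta> b g x0 P k of (x, y) \<Rightarrow>
     (y + \<Delta> *\<^sub>R b x + g (left_lim P (real (Suc k) * \<Delta>) - P (real k * \<Delta>)) x,
      y + \<Delta> *\<^sub>R b x + g (P (real (Suc k) * \<Delta>) - P (real k * \<Delta>)) x))"

definition euler ::
  "real \<Rightarrow> ('e \<Rightarrow> 'e) \<Rightarrow> ('y \<Rightarrow> 'e \<Rightarrow> 'e) \<Rightarrow> 'e \<Rightarrow> (real \<Rightarrow> 'y::euclidean_space) \<Rightarrow> real \<Rightarrow> 'e::euclidean_space" where
  "euler \<Delta> b g x0 P t = (if t \<le> 0 then x0 else
     let k = nat (\<lceil>t / \<Delta>\<rceil> - 1) in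
     snd (euler_state \<Delta> b g x0 P k) + (t - real k * \<Delta>) *\<^sub>R b (fst (euler_state \<Delta> b g x0 P k))
       + g (P t - P (real k * \<Delta>)) (fst (euler_state \<Delta> b g x0 P k)))"

lemma euler_zero [simp]: "euler \<Delta> b g x0 P 0 = x0"
  by (simp add: euler_def)

context linear_coefficients
begin

context
  fixes \<Delta> :: real and x0 :: 'e and P :: "real \<Rightarrow> 'y"
  assumes \<Delta>: "0 < \<Delta>"
begin

abbreviation (input) "st \<equiv> euler_state \<Delta> b g x0 P"
abbreviation (input) "eul \<equiv> euler \<Delta> b g x0 P"

lemma euler_half_open_cell:
  assumes "real k * \<Delta> < t" "t \<le> real (Suc k) * \<Delta>"
  shows "eul t = snd (st k) + (t - real k * \<Delta>) *\<^sub>R b (fst (st k)) + g (P t - P (real k * \<Delta>)) (fst (st k))"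
proof -
  have "\<lceil>t / \<Delta>\<rceil> = int k + 1"
    using assms \<Delta> by (intro ceiling_unique) (auto simp: pos_less_divide_eq pos_divide_le_eq algebra_simps)
  moreover have "0 \<le> real k * \<Delta>" using \<Delta> by simp
  then have "\<not> t \<le> 0" using assms(1) by linarith
  ultimately show ?thesis by (simp add: euler_def)
qed

lemma euler_grid: "eul (real k * \<Delta>) = snd (st k)"
proof (cases k)
  case (Suc j)
  have "real (Suc j) * \<Delta> - real j * \<Delta> = \<Delta>" by (simp add: algebra_simps)
  then show ?thesis
    unfolding Suc using \<Delta> euler_half_open_cell[of j "real (Suc j) * \<Delta>"] by (simp add: case_prod_unfold)
qed simp

text \<open>At the left end of the cell the elapsed time and the increment of \<open>P\<close> are
  both zero, so the formula extends to the closed cell.\<close>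

lemma euler_cell:
  assumes "real k * \<Delta> \<le> t" "t \<le> real (Suc k) * \<Delta>"
  shows "eul t = snd (st k) + (t - real k * \<Delta>) *\<^sub>R b (fst (st k)) + g (P t - P (real k * \<Delta>)) (fst (st k))"
proof (cases "t = real k * \<Delta>")
  case True
  then show ?thesis by (simp add: euler_grid)
next
  case False
  then show ?thesis using euler_half_open_cell[OF _ assms(2)] assms(1) by simp
qed

lemma tendsto_cell:
  assumes "(P \<longlongrightarrow> p) F" "((\<lambda>u. u) \<longlongrightarrow> t) F"
  shows "((\<lambda>u. y + (u - a) *\<^sub>R b x + g (P u - q) x) \<longlongrightarrow> y + (t - a) *\<^sub>R b x + g (p - q) x) F"
proof -
  have "continuous_on UNIV (\<lambda>v. g v x)" using linear_continuous_on[OF linear_conv_bounded_linear[THEN iffD1, OF linear_jump]] .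
  then have "((\<lambda>u. g (P u - q) x) \<longlongrightarrow> g (p - q) x) F"
    by (intro continuous_on_tendsto_compose[of UNIV "\<lambda>v. g v x"] tendsto_diff assms(1) tendsto_const) auto
  then show ?thesis by (intro tendsto_add tendsto_scaleR tendsto_diff assms tendsto_const)
qed

lemma cadlag_euler:
  assumes P: "cadlag_on \<infinity> P"
  shows "cadlag_on \<infinity> eul"
    and left_lim_euler_cell: "real k * \<Delta> < t \<Longrightarrow> t \<le> real (Suc k) * \<Delta> \<Longrightarrow>
      left_lim eul t = snd (st k) + (t - real k * \<Delta>) *\<^sub>R b (fst (st k)) + g (left_lim P t - P (real k * \<Delta>)) (fst (st k))"
proof -
  have left: "(eul \<longlongrightarrow> snd (st k) + (t - real k * \<Delta>) *\<^sub>R b (fst (st k)) + g (left_lim P t - P (real k * \<Delta>)) (fst (st k))) (at_left t)"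
    if k: "real k * \<Delta> < t" "t \<le> real (Suc k) * \<Delta>" for t k
  proof (rule Lim_transform_eventually)
    have "0 \<le> real k * \<Delta>" using \<Delta> by simp
    then have "0 < t" using k by linarith
    then show "((\<lambda>u. snd (st k) + (u - real k * \<Delta>) *\<^sub>R b (fst (st k)) + g (P u - P (real k * \<Delta>)) (fst (st k))) \<longlongrightarrow>
      snd (st k) + (t - real k * \<Delta>) *\<^sub>R b (fst (st k)) + g (left_lim P t - P (real k * \<Delta>)) (fst (st k))) (at_left t)"
      by (intro tendsto_cell cadlag_on_left_lim[OF P] tendsto_ident_at) auto
    show "\<forall>\<^sub>F u in at_left t. snd (st k) + (u - real k * \<Delta>) *\<^sub>R b (fst (st k)) + g (P u - P (real k * \<Delta>)) (fst (st k)) = eul u"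
      unfolding eventually_at_left_field using k by (intro exI[of _ "real k * \<Delta>"]) (auto intro!: euler_cell[symmetric] simp del: of_nat_Suc)
  qed
  show "left_lim eul t = snd (st k) + (t - real k * \<Delta>) *\<^sub>R b (fst (st k)) + g (left_lim P t - P (real k * \<Delta>)) (fst (st k))"
    if k: "real k * \<Delta> < t" "t \<le> real (Suc k) * \<Delta>" for t k
  proof (rule left_lim_unique[OF _ left[OF k]])
    have "0 \<le> real k * \<Delta>" using \<Delta> by simp
    then show "0 < t" using k by linarith
  qed
  show "cadlag_on \<infinity> eul"
    unfolding cadlag_on_def
  proof (intro allI impI conjI)
    fix t :: real assume t: "0 \<le> t"
    \<comment> \<open>Limits from the right need the cell starting at or before t, hence the floor;
      limits from the left need the cell ending at or after t, hence the ceiling minus one further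
      down.\<close>
    define k where "k = nat \<lfloor>t / \<Delta>\<rfloor>"
    have fl: "real k = of_int \<lfloor>t / \<Delta>\<rfloor>" using t \<Delta> by (simp add: k_def)
    have k1: "real k * \<Delta> \<le> t"
      unfolding fl by (rule pos_le_divide_eq[OF \<Delta>, THEN iffD1, OF of_int_floor_le])
    have "t / \<Delta> < real k + 1" unfolding fl by linarith
    then have k2: "t < real (Suc k) * \<Delta>" using \<Delta> by (simp add: pos_divide_less_eq algebra_simps)
    have "((\<lambda>u. snd (st k) + (u - real k * \<Delta>) *\<^sub>R b (fst (st k)) + g (P u - P (real k * \<Delta>)) (fst (st k))) \<longlongrightarrow>
      snd (st k) + (t - real k * \<Delta>) *\<^sub>R b (fst (st k)) + g (P t - P (real k * \<Delta>)) (fst (st k))) (at_right t)"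
      using P t by (intro tendsto_cell tendsto_ident_at) (auto simp: cadlag_on_def)
    moreover have "\<forall>\<^sub>F u in at_right t. snd (st k) + (u - real k * \<Delta>) *\<^sub>R b (fst (st k)) + g (P u - P (real k * \<Delta>)) (fst (st k)) = eul u"
      unfolding eventually_at_right_field using k1 k2 by (intro exI[of _ "real (Suc k) * \<Delta>"]) (auto intro!: euler_cell[symmetric] simp del: of_nat_Suc)
    ultimately have "(eul \<longlongrightarrow> snd (st k) + (t - real k * \<Delta>) *\<^sub>R b (fst (st k)) + g (P t - P (real k * \<Delta>)) (fst (st k))) (at_right t)"
      by (rule Lim_transform_eventually)
    then show "(eul \<longlongrightarrow> eul t) (at_right t)" using euler_cell[of k t] k1 k2 by simp
    assume t0: "0 < t"
    define j where "j = nat (\<lceil>t / \<Delta>\<rceil> - 1)"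
    have "1 \<le> \<lceil>t / \<Delta>\<rceil>" using t0 \<Delta> by (simp add: le_ceiling_iff)
    then have cl: "real j = of_int \<lceil>t / \<Delta>\<rceil> - 1" by (simp add: j_def)
    have "real j < t / \<Delta>" "t / \<Delta> \<le> real j + 1" unfolding cl by linarith+
    then have "real j * \<Delta> < t" "t \<le> real (Suc j) * \<Delta>"
      using \<Delta> by (auto simp: pos_less_divide_eq pos_divide_le_eq algebra_simps)
    from left[OF this] show "\<exists>l. (eul \<longlongrightarrow> l) (at_left t)" by blast
  qed
qed

text \<open>This justifies the recursion: its first component really is the left limit at which the
  scheme freezes the coefficients.\<close>

lemma left_lim_euler_grid:
  assumes P: "cadlag_on \<infinity> P"
  shows "left_lim eul (real k * \<Delta>) = fst (st k)"
proof (cases k)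
  case (Suc j)
  have "real (Suc j) * \<Delta> - real j * \<Delta> = \<Delta>" by (simp add: algebra_simps)
  then show ?thesis
    unfolding Suc using \<Delta> left_lim_euler_cell[OF P, of j "real (Suc j) * \<Delta>"] by (simp add: case_prod_unfold)
qed simp

end

end

context path_coefficients
begin

text \<open>With a constant integrand, the linear map can be pulled out of the integral over the
  jumps.\<close>

lemma path_integral_const:
  assumes "0 \<le> s" "s \<le> t"
  shows "integral_along (\<lambda>_. x) s t = (t - s) *\<^sub>R b x + g (total_jump t - total_jump s) x"
proof -
  have bl: "bounded_linear (\<lambda>y. g y x)" using linear_jump linear_conv_bounded_linear by blast
  have sub: "set_integrable N ({s<..t} \<times> UNIV) (\<lambda>(z, y). y)"
    by (rule set_integrable_subset[OF set_integrable_mark[of t]]) (use assms in \<open>auto intro!: sets_time_mark\<close>)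
  have "set_lebesgue_integral N ({s<..t} \<times> UNIV) (\<lambda>(z, y). g y x)
    = (LINT p|N. g (indicat_real ({s<..t} \<times> UNIV) p *\<^sub>R (case p of (z, y) \<Rightarrow> y)) x)"
    unfolding set_lebesgue_integral_def by (intro Bochner_Integration.integral_cong) (auto simp: indicator_def)
  also have "\<dots> = g (set_lebesgue_integral N ({s<..t} \<times> UNIV) (\<lambda>(z, y). y)) x"
    unfolding set_lebesgue_integral_def using sub
    by (intro integral_bounded_linear[OF bl]) (simp add: set_integrable_def)
  also have "set_lebesgue_integral N ({s<..t} \<times> UNIV) (\<lambda>(z, y). y) = total_jump t - total_jump s"
    using set_integral_jump_split[OF assms set_integrable_mark] by (simp add: total_jump_def)
  finally show ?thesis
    using assms by (simp add: path_integral_def set_integral_const)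
qed

text \<open>The lagged left limit is constant on every cell, so \<open>path_integral_const\<close>
  evaluates the integral there, and the cells add up.\<close>

lemma euler_equation:
  assumes \<Delta>: "0 < \<Delta>" and t: "0 \<le> t"
  shows "euler \<Delta> b g x0 total_jump t
    = x0 + integral_along (\<lambda>z. left_lim (euler \<Delta> b g x0 total_jump) (grid_left \<Delta> z)) 0 t"
proof -
  let ?E = "euler \<Delta> b g x0 total_jump"
  let ?st = "euler_state \<Delta> b g x0 total_jump"
  define \<xi> where "\<xi> z = left_lim ?E (grid_left \<Delta> z)" for z
  have cad: "cadlag_on \<infinity> ?E" by (rule cadlag_euler[OF \<Delta> cadlag_total_jump])
  have adm: "admissible T \<xi>" for T
  proof -
    have lt_inf: "ereal T < \<infinity>" by simp
    obtain B where "\<And>t. 0 \<le> t \<Longrightarrow> t \<le> T \<Longrightarrow> norm (?E t) \<le> B" using cadlag_on_bounded[OF cad lt_inf] by blast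
    then have B: "\<forall>t\<in>{0..T}. norm (?E t) \<le> B" by simp
    show ?thesis
      unfolding \<xi>_def[abs_def] by (rule admissible_lagged(1)[OF time_lag_grid[OF \<Delta>] cad lt_inf B])
  qed
  have cell: "integral_along \<xi> (real k * \<Delta>) t
      = (t - real k * \<Delta>) *\<^sub>R b (fst (?st k)) + g (total_jump t - total_jump (real k * \<Delta>)) (fst (?st k))"
    if k: "real k * \<Delta> \<le> t" "t \<le> real (Suc k) * \<Delta>" for k t
  proof -
    have "integral_along \<xi> (real k * \<Delta>) t = integral_along (\<lambda>_. fst (?st k)) (real k * \<Delta>) t"
    proof -
      have "\<xi> z = fst (?st k)" if "real k * \<Delta> < z" "z \<le> t" for z
      proof -
        have "grid_left \<Delta> z = real k * \<Delta>" using that k by (intro grid_left_eq[OF \<Delta>]) (auto simp: algebra_simps)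
        then show ?thesis by (simp add: \<xi>_def left_lim_euler_grid[OF \<Delta> cadlag_total_jump])
      qed
      then show ?thesis by (intro path_integral_cong) auto
    qed
    then show ?thesis using path_integral_const[OF _ k(1)] \<Delta> by simp
  qed
  have grid: "?E (real k * \<Delta>) = x0 + integral_along \<xi> 0 (real k * \<Delta>)" for k
  proof (induct k)
    case (Suc k)
    have le: "real k * \<Delta> \<le> real (Suc k) * \<Delta>" "0 \<le> real k * \<Delta>" using \<Delta> by auto
    show ?case
      using euler_cell[OF \<Delta> le(1) order_refl, of x0 total_jump] cell[OF le(1) order_refl] Suc
        path_integral_add[OF adm le(2,1) order_refl] euler_grid[OF \<Delta>, of x0 total_jump k]
      by simp
  qed simp
  define k where "k = nat \<lfloor>t / \<Delta>\<rfloor>"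
  have fl: "real k = of_int \<lfloor>t / \<Delta>\<rfloor>" using t \<Delta> by (simp add: k_def)
  have k1: "real k * \<Delta> \<le> t"
    unfolding fl by (rule pos_le_divide_eq[OF \<Delta>, THEN iffD1, OF of_int_floor_le])
  have "t / \<Delta> \<le> real k + 1" unfolding fl by linarith
  then have k2: "t \<le> real (Suc k) * \<Delta>" using \<Delta> by (simp add: pos_divide_le_eq algebra_simps)
  have "0 \<le> real k * \<Delta>" using \<Delta> by simp
  from path_integral_add[OF adm this k1 order_refl]
  show ?thesis
    using euler_cell[OF \<Delta> k1 k2, of x0 total_jump] cell[OF k1 k2] grid[of k] euler_grid[OF \<Delta>, of x0 total_jump k]
    by (simp add: \<xi>_def[abs_def])
qed

end

section \<open>From stochastic to pathwise equations\<close>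

text \<open>Right continuity lets rational times slightly later than u decide; T is added because no
  later time of the interval exists for it. This reduces the supremum over the interval to a
  countable, hence measurable, one.\<close>

lemma cadlag_norm_le_rational:
  fixes f :: "real \<Rightarrow> 'e::real_normed_vector"
  assumes f: "cadlag_on \<tau> f" "ereal T < \<tau>" and u: "0 \<le> u" "u \<le> T"
    and B: "\<And>r. r \<in> \<rat> \<inter> {0..T} \<union> {T} \<Longrightarrow> norm (f r) \<le> B"
  shows "norm (f u) \<le> B"
proof (cases "u = T")
  case True then show ?thesis using B[of T] by simp
next
  case False
  then have uT: "u < T" using u by simp
  show ?thesis
  proof (rule ccontr)
    assume "\<not> norm (f u) \<le> B"
    then have e: "0 < norm (f u) - B" by simp
    have "ereal u < \<tau>" using u f(2) by (auto intro: le_less_trans[of _ "ereal T"])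
    from cadlag_on_local[OF f(1) u(1) this e] obtain d where d: "0 < d"
      "\<And>b. u \<le> b \<Longrightarrow> b < u + d \<Longrightarrow> norm (f b - f u) < norm (f u) - B" by metis
    obtain r where r: "r \<in> \<rat>" "u < r" "r < min (u + d) T"
      using Rats_dense_in_real[of u "min (u + d) T"] d(1) uT by auto
    have "norm (f r) \<le> B" using B[of r] r u by auto
    moreover have "norm (f r - f u) < norm (f u) - B" using d(2)[of r] r by auto
    ultimately show False using norm_triangle_ineq2[of "f u" "f r"] by (simp add: norm_minus_commute)
  qed
qed

locale finite_variation_noise = cadlag_process M F L
  for M :: "'w measure" and F and L :: "real \<Rightarrow> 'w \<Rightarrow> 'y::euclidean_space" +
  fixes \<nu> :: "'y measure"
  assumes summable_jumps: "AE \<omega> in M. \<forall>T. (\<integral>\<^sup>+(z, y). indicator {0<..T} z * ennreal (norm y) \<partial>jump_measure (\<lambda>t. L t \<omega>)) < \<infinity>"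
    and sets_\<nu> [simp, measurable_cong]: "sets \<nu> = sets borel"
    and sigma_finite_\<nu>: "sigma_finite_measure \<nu>"
    and \<nu>_moment1: "(\<integral>\<^sup>+y. ennreal (norm y) \<partial>\<nu>) < \<infinity>"
    and \<nu>_moment2: "(\<integral>\<^sup>+y. ennreal ((norm y)\<^sup>2) \<partial>\<nu>) < \<infinity>"
begin

lemma jump_path_AE: "AE \<omega> in M. jump_path (path \<omega>)"
  using cadlag summable_jumps by eventually_elim (auto simp: jump_path_def)

definition mean_jump :: 'y where
  "mean_jump = (LINT y|\<nu>. y)"

text \<open>The minimum with \<epsilon> is used instead of discarding jumps larger than \<epsilon>,
  because it is continuous in the mark and hence gives a measurable variable; it dominates the small
  jumps and still tends to 0.\<close>

definition small_jumps :: "real \<Rightarrow> real \<Rightarrow> 'w \<Rightarrow> ennreal" where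
  "small_jumps T \<epsilon> \<omega> = (\<integral>\<^sup>+(z, y). indicator {0<..T} z * ennreal (min (norm y) \<epsilon>) \<partial>jump_measure (path \<omega>))"

definition small_mass :: "real \<Rightarrow> ennreal" where
  "small_mass \<epsilon> = (\<integral>\<^sup>+y. ennreal (min (norm y) \<epsilon>) \<partial>\<nu>)"

lemma small_jumps_measurable:
  assumes "0 \<le> T" "0 \<le> \<epsilon>"
  shows "small_jumps T \<epsilon> \<in> borel_measurable M"
  unfolding small_jumps_def using assms
  by (intro borel_measurable_F_M[OF nn_integral_jump_adapted]) (auto intro!: continuous_intros)

lemma small_jumps_tendsto:
  "AE \<omega> in M. (\<lambda>j. small_jumps T (1 / real (Suc j)) \<omega>) \<longlonglongrightarrow> 0"
  using summable_jumps
proof eventually_elim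
  case (elim \<omega>)
  have m: "(\<lambda>(z, y). indicator {0<..T} z * ennreal (\<phi> y)) \<in> borel_measurable (jump_measure (path \<omega>))"
    if "\<phi> \<in> borel_measurable borel" for \<phi> :: "'y \<Rightarrow> real"
    using borel_measurable_time_mark[of "\<lambda>y. ennreal (\<phi> y)" "{0<..T}"] that
    by (simp add: measurable_cong_sets[OF sets_jump_measure refl])
  have "(\<lambda>j. small_jumps T (1 / real (Suc j)) \<omega>) \<longlonglongrightarrow> (\<integral>\<^sup>+x. 0 \<partial>jump_measure (path \<omega>))"
    unfolding small_jumps_def
  proof (rule nn_integral_dominated_convergence)
    show "(\<lambda>(z, y). indicator {0<..T} z * ennreal (min (norm y) (1 / real (Suc j)))) \<in> borel_measurable (jump_measure (path \<omega>))" for j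
      by (rule m) measurable
    show "(\<lambda>(z, y). indicator {0<..T} z * ennreal (norm y)) \<in> borel_measurable (jump_measure (path \<omega>))"
      by (rule m) measurable
    show "(\<integral>\<^sup>+(z, y). indicator {0<..T} z * ennreal (norm y) \<partial>jump_measure (path \<omega>)) < \<infinity>"
      using elim by blast
    show "AE x in jump_measure (path \<omega>). (\<lambda>j. case x of (z, y) \<Rightarrow> indicator {0<..T} z * ennreal (min (norm y) (1 / real (Suc j)))) \<longlonglongrightarrow> 0"
    proof (rule AE_I2)
      fix x :: "real \<times> 'y"
      have "(\<lambda>j. min (norm (snd x)) (1 / real (Suc j))) \<longlonglongrightarrow> min (norm (snd x)) 0"
        by (intro tendsto_min tendsto_const LIMSEQ_Suc[OF lim_const_over_n])
      then have "(\<lambda>j. ennreal (min (norm (snd x)) (1 / real (Suc j)))) \<longlonglongrightarrow> ennreal 0"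
        by (intro tendsto_ennrealI) (simp add: min_absorb2)
      then show "(\<lambda>j. case x of (z, y) \<Rightarrow> indicator {0<..T} z * ennreal (min (norm y) (1 / real (Suc j)))) \<longlonglongrightarrow> 0"
        by (cases x) (auto simp: indicator_def)
    qed
  qed (auto intro!: AE_I2 mult_left_mono ennreal_leI split: prod.splits)
  then show ?case by simp
qed

lemma small_mass_tendsto: "(\<lambda>j. small_mass (1 / real (Suc j))) \<longlonglongrightarrow> 0"
proof -
  have "(\<lambda>j. small_mass (1 / real (Suc j))) \<longlonglongrightarrow> (\<integral>\<^sup>+y. 0 \<partial>\<nu>)"
    unfolding small_mass_def
  proof (rule nn_integral_dominated_convergence)
    show "(\<integral>\<^sup>+y. ennreal (norm y) \<partial>\<nu>) < \<infinity>" by (rule \<nu>_moment1)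
    show "AE y in \<nu>. (\<lambda>j. ennreal (min (norm y) (1 / real (Suc j)))) \<longlonglongrightarrow> 0"
    proof (rule AE_I2)
      fix y :: 'y
      have "(\<lambda>j. min (norm y) (1 / real (Suc j))) \<longlonglongrightarrow> min (norm y) 0"
        by (intro tendsto_min tendsto_const LIMSEQ_Suc[OF lim_const_over_n])
      then have "(\<lambda>j. ennreal (min (norm y) (1 / real (Suc j)))) \<longlonglongrightarrow> ennreal (min (norm y) 0)"
        by (rule tendsto_ennrealI)
      then show "(\<lambda>j. ennreal (min (norm y) (1 / real (Suc j)))) \<longlonglongrightarrow> 0" by (simp add: min_absorb2)
    qed
  qed (auto intro!: AE_I2 ennreal_leI)
  then show ?thesis by simp
qed

lemma small_jumps_mono: "\<epsilon> \<le> \<epsilon>' \<Longrightarrow> small_jumps T \<epsilon> \<omega> \<le> small_jumps T \<epsilon>' \<omega>"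
  unfolding small_jumps_def by (intro nn_integral_mono) (auto intro!: mult_left_mono ennreal_leI)

text \<open>Almost sure convergence to 0 becomes convergence in probability through the decreasing
  events \<open>A j\<close>, whose intersection is null; the same \<epsilon> is made to serve the
  deterministic compensator.\<close>

lemma small_jumps_in_probability:
  assumes T: "0 \<le> T" and \<delta>: "0 < \<delta>" and e: "0 < e"
  obtains \<epsilon> where "0 < \<epsilon>" "small_mass \<epsilon> < ennreal \<delta>"
    "{\<omega>\<in>space M. ennreal \<delta> \<le> small_jumps T \<epsilon> \<omega>} \<in> sets M"
    "measure M {\<omega>\<in>space M. ennreal \<delta> \<le> small_jumps T \<epsilon> \<omega>} < e"
proof -
  define A where "A j = {\<omega>\<in>space M. ennreal \<delta> \<le> small_jumps T (1 / real (Suc j)) \<omega>}" for j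
  have A: "A j \<in> sets M" for j
    unfolding A_def using small_jumps_measurable[OF T, of "1 / real (Suc j)"] by measurable
  have dec: "decseq A"
    unfolding decseq_Suc_iff A_def
    by (auto intro: order_trans[OF _ small_jumps_mono] simp: frac_le)
  have "(\<lambda>j. measure M (A j)) \<longlonglongrightarrow> measure M (\<Inter>j. A j)"
    using A dec by (intro finite_Lim_measure_decseq) auto
  moreover have "measure M (\<Inter>j. A j) = 0"
  proof -
    have "AE \<omega> in M. \<omega> \<notin> (\<Inter>j. A j)"
      using small_jumps_tendsto[of T]
    proof eventually_elim
      case (elim \<omega>)
      then have "eventually (\<lambda>j. small_jumps T (1 / real (Suc j)) \<omega> < ennreal \<delta>) sequentially"
        using \<delta> by (intro order_tendstoD(2)[of _ 0]) auto
      then obtain j where "small_jumps T (1 / real (Suc j)) \<omega> < ennreal \<delta>"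
        by (auto simp: eventually_sequentially)
      then have "\<omega> \<notin> A j" by (simp add: A_def not_le)
      then show ?case by blast
    qed
    then show ?thesis using A by (simp add: prob_eq_0 sets.countable_INT'')
  qed
  ultimately have "eventually (\<lambda>j. measure M (A j) < e) sequentially"
    using e by (intro order_tendstoD(2)[of _ 0]) auto
  moreover have "eventually (\<lambda>j. small_mass (1 / real (Suc j)) < ennreal \<delta>) sequentially"
    using \<delta> by (intro order_tendstoD(2)[OF small_mass_tendsto]) auto
  ultimately have "eventually (\<lambda>j. measure M (A j) < e \<and> small_mass (1 / real (Suc j)) < ennreal \<delta>) sequentially"
    by eventually_elim simp
  then obtain j where "measure M (A j) < e" "small_mass (1 / real (Suc j)) < ennreal \<delta>"
    by (auto simp: eventually_sequentially)
  then show ?thesis using that[of "1 / real (Suc j)"] A[of j] by (simp add: A_def)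
qed

text \<open>Outside sets of small measure both versions are within \<delta> of the same truncated
  integral. The exceptional sets are only contained in events, so completeness of the measure is
  what makes them null sets.\<close>

lemma has_compensated_integral_unique:
  assumes J: "has_compensated_integral M L \<nu> \<tau> G J" and J': "has_compensated_integral M L \<nu> \<tau> G J'"
  shows "AE \<omega> in M. \<forall>t\<ge>0. ereal t < \<tau> \<omega> \<longrightarrow> J t \<omega> = J' t \<omega>"
proof -
  have null: "{\<omega>\<in>space M. ereal T < \<tau> \<omega> \<and> (\<exists>t\<in>{0..T}. 2 * \<delta> < norm (J t \<omega> - J' t \<omega>))} \<in> null_sets M"
    (is "?B \<in> _") if T: "0 \<le> T" and \<delta>: "0 < \<delta>" for T \<delta>
  proof -
    have ex: "\<exists>A\<in>sets M. measure M A < e \<and> ?B \<subseteq> A" if e: "0 < e" for e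
    proof -
      let ?tr = "truncated_compensated_integral L \<nu> G"
      have "eventually (\<lambda>\<epsilon>. \<exists>A\<in>sets M. measure M A < e/2 \<and>
           {\<omega>\<in>space M. ereal T < \<tau> \<omega> \<and> (\<exists>t\<in>{0..T}. \<delta> < norm (J t \<omega> - ?tr \<epsilon> t \<omega>))} \<subseteq> A) (at_right 0)"
        "eventually (\<lambda>\<epsilon>. \<exists>A\<in>sets M. measure M A < e/2 \<and>
           {\<omega>\<in>space M. ereal T < \<tau> \<omega> \<and> (\<exists>t\<in>{0..T}. \<delta> < norm (J' t \<omega> - ?tr \<epsilon> t \<omega>))} \<subseteq> A) (at_right 0)"
        using J J' T \<delta> e unfolding has_compensated_integral_def by (meson half_gt_zero)+
      from eventually_happens[OF eventually_conj[OF this]]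
      obtain \<epsilon> A A' where A: "A \<in> sets M" "measure M A < e/2"
           "{\<omega>\<in>space M. ereal T < \<tau> \<omega> \<and> (\<exists>t\<in>{0..T}. \<delta> < norm (J t \<omega> - ?tr \<epsilon> t \<omega>))} \<subseteq> A"
           "A' \<in> sets M" "measure M A' < e/2"
           "{\<omega>\<in>space M. ereal T < \<tau> \<omega> \<and> (\<exists>t\<in>{0..T}. \<delta> < norm (J' t \<omega> - ?tr \<epsilon> t \<omega>))} \<subseteq> A'"
        by (auto simp: trivial_limit_at_right_real)
      have "?B \<subseteq> A \<union> A'"
      proof
        fix \<omega> assume "\<omega> \<in> ?B"
        then obtain t where t: "\<omega> \<in> space M" "ereal T < \<tau> \<omega>" "t \<in> {0..T}" "2 * \<delta> < norm (J t \<omega> - J' t \<omega>)" by blast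
        have "norm (J t \<omega> - J' t \<omega>) \<le> norm (J t \<omega> - ?tr \<epsilon> t \<omega>) + norm (J' t \<omega> - ?tr \<epsilon> t \<omega>)"
          by (metis dist_norm dist_triangle2)
        then have "\<delta> < norm (J t \<omega> - ?tr \<epsilon> t \<omega>) \<or> \<delta> < norm (J' t \<omega> - ?tr \<epsilon> t \<omega>)" using t(4) by linarith
        then show "\<omega> \<in> A \<union> A'" using A(3,6) t by blast
      qed
      moreover have "measure M (A \<union> A') < e"
        using measure_Un_le[of A M A'] A by linarith
      ultimately show ?thesis using A(1,4) by (intro bexI[of _ "A \<union> A'"]) auto
    qed
    then have "\<forall>n. \<exists>A. A \<in> sets M \<and> measure M A < 1 / real (Suc n) \<and> ?B \<subseteq> A" by (simp add: Bex_def)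
    from choice[OF this] obtain A where "\<forall>n. A n \<in> sets M \<and> measure M (A n) < 1 / real (Suc n) \<and> ?B \<subseteq> A n" ..
    then have A: "\<And>n. A n \<in> sets M" "\<And>n. measure M (A n) < 1 / real (Suc n)" "\<And>n. ?B \<subseteq> A n" by blast+
    have m: "(\<Inter>n. A n) \<in> sets M" using A(1) by auto
    have "measure M (\<Inter>n. A n) \<le> 1 / real (Suc n)" for n
      using finite_measure_mono[of "\<Inter>n. A n" "A n"] A(1)[of n] A(2)[of n] by (force intro: order_trans less_imp_le)
    then have "measure M (\<Inter>n. A n) \<le> 0"
      using LIMSEQ_le_const[OF LIMSEQ_Suc[OF lim_const_over_n[of 1]]] by blast
    then have null: "(\<Inter>n. A n) \<in> null_sets M" using m by (simp add: null_sets_def emeasure_eq_measure measure_le_0_iff)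
    have sub: "?B \<subseteq> (\<Inter>n. A n)" using A(3) by blast
    show ?thesis
      by (rule null_sets_subset[OF null complete_measure.complete[OF complete_M sub null] sub])
  qed
  \<comment> \<open>Rational horizons suffice, since the events already contain all times up to the
    horizon and any time before \<tau> lies below a rational one before \<tau>.\<close>
  have "AE \<omega> in M. \<forall>n::nat. \<forall>r\<in>\<rat>. 0 \<le> r \<longrightarrow> \<not> (ereal r < \<tau> \<omega> \<and> (\<exists>t\<in>{0..r}. 2 * (1 / real (Suc n)) < norm (J t \<omega> - J' t \<omega>)))"
  proof (intro AE_all_countable[THEN iffD2] allI AE_ball_countable[THEN iffD2] ballI)
    show "AE \<omega> in M. 0 \<le> r \<longrightarrow> \<not> (ereal r < \<tau> \<omega> \<and> (\<exists>t\<in>{0..r}. 2 * (1 / real (Suc n)) < norm (J t \<omega> - J' t \<omega>)))"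
      if "r \<in> \<rat>" for n :: nat and r
    proof (cases "0 \<le> r")
      case True
      have "0 < 1 / real (Suc n)" by simp
      from AE_not_in[OF null[OF True this]] AE_space
      show ?thesis by eventually_elim auto
    qed simp
  qed (rule countable_rat)
  then show ?thesis
  proof eventually_elim
    case (elim \<omega>)
    show ?case
    proof (intro allI impI)
      fix t assume t: "0 \<le> t" "ereal t < \<tau> \<omega>"
      obtain q where q: "ereal t < ereal q" "ereal q < \<tau> \<omega>" using ereal_dense2[OF t(2)] by auto
      obtain r where r: "r \<in> \<rat>" "t < r" "r < q" using Rats_dense_in_real[of t q] q by auto
      have "ereal r < \<tau> \<omega>" using r q by (auto intro: less_trans[of _ "ereal q"])
      then have "norm (J t \<omega> - J' t \<omega>) \<le> 2 * (1 / real (Suc n))" for n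
        using elim r t by (force simp: not_less)
      moreover have "(\<lambda>n. 2 * (1 / real (Suc n))) \<longlonglongrightarrow> 2 * 0"
        by (intro tendsto_mult tendsto_const LIMSEQ_Suc[OF lim_const_over_n])
      ultimately have "norm (J t \<omega> - J' t \<omega>) \<le> 0" using LIMSEQ_le_const by fastforce
      then show "J t \<omega> = J' t \<omega>" by simp
    qed
  qed
qed


section \<open>The pathwise compensated integral\<close>

abbreviation product_measure :: "(real \<times> 'y) measure" where
  "product_measure \<equiv> lborel \<Otimes>\<^sub>M \<nu>"

lemma sets_product_measure [simp]: "sets product_measure = sets borel"
  unfolding borel_prod[symmetric] by (intro sets_pair_measure_cong) auto

lemma nn_integral_product:
  fixes \<phi> :: "'y \<Rightarrow> ennreal"
  assumes [measurable]: "\<phi> \<in> borel_measurable borel" and t: "0 \<le> t"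
  shows "(\<integral>\<^sup>+(z, y). indicator {0<..t} z * \<phi> y \<partial>product_measure) = ennreal t * (\<integral>\<^sup>+y. \<phi> y \<partial>\<nu>)"
proof -
  interpret \<nu>: sigma_finite_measure \<nu> by (rule sigma_finite_\<nu>)
  have m: "(\<lambda>(z, y). indicator {0<..t} z * \<phi> y) \<in> borel_measurable product_measure"
    by measurable
  have "(\<integral>\<^sup>+(z, y). indicator {0<..t} z * \<phi> y \<partial>product_measure) = (\<integral>\<^sup>+z. \<integral>\<^sup>+y. indicator {0<..t} z * \<phi> y \<partial>\<nu> \<partial>lborel)"
    using \<nu>.nn_integral_fst[OF m] by simp
  also have "\<dots> = (\<integral>\<^sup>+z. indicator {0<..t} z * (\<integral>\<^sup>+y. \<phi> y \<partial>\<nu>) \<partial>lborel)"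
    by (intro nn_integral_cong nn_integral_cmult) measurable
  also have "\<dots> = ennreal t * (\<integral>\<^sup>+y. \<phi> y \<partial>\<nu>)"
    using t by (simp add: nn_integral_multc)
  finally show ?thesis .
qed

lemma set_integrable_product:
  fixes h :: "real \<times> 'y \<Rightarrow> 'e::euclidean_space"
  assumes "(\<lambda>x. indicat_real ({0<..t} \<times> UNIV) x *\<^sub>R h x) \<in> borel_measurable borel" "0 \<le> t" "0 \<le> C"
    and le: "\<And>z y. 0 < z \<Longrightarrow> z \<le> t \<Longrightarrow> norm (h (z, y)) \<le> C * \<phi> y"
    and \<phi>: "\<phi> \<in> borel_measurable borel" "\<And>y. 0 \<le> \<phi> y" "(\<integral>\<^sup>+y. ennreal (\<phi> y) \<partial>\<nu>) < \<infinity>"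
  shows "set_integrable product_measure ({0<..t} \<times> UNIV) h"
  unfolding set_integrable_def
proof (rule integrableI_bounded)
  show "(\<lambda>x. indicat_real ({0<..t} \<times> UNIV) x *\<^sub>R h x) \<in> borel_measurable product_measure"
    using assms(1) by (simp add: measurable_cong_sets[OF sets_product_measure refl])
  have "(\<integral>\<^sup>+x. ennreal (norm (indicat_real ({0<..t} \<times> UNIV) x *\<^sub>R h x)) \<partial>product_measure)
    \<le> (\<integral>\<^sup>+(z, y). indicator {0<..t} z * ennreal (C * \<phi> y) \<partial>product_measure)"
  proof (rule nn_integral_mono)
    fix x :: "real \<times> 'y"
    show "ennreal (norm (indicat_real ({0<..t} \<times> UNIV) x *\<^sub>R h x)) \<le> (case x of (z, y) \<Rightarrow> indicator {0<..t} z * ennreal (C * \<phi> y))"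
      using le[of "fst x" "snd x"] by (cases x) (auto simp: indicator_def intro: ennreal_leI)
  qed
  also have "\<dots> = ennreal t * (\<integral>\<^sup>+y. ennreal (C * \<phi> y) \<partial>\<nu>)"
    using \<phi>(1) assms(2) by (intro nn_integral_product) measurable
  also have "(\<integral>\<^sup>+y. ennreal (C * \<phi> y) \<partial>\<nu>) = ennreal C * (\<integral>\<^sup>+y. ennreal (\<phi> y) \<partial>\<nu>)"
    using \<phi>(1,2) assms(3) by (simp add: ennreal_mult nn_integral_cmult)
  also have "ennreal t * \<dots> < \<infinity>"
    using \<phi>(3) by (simp add: ennreal_mult_less_top)
  finally show "(\<integral>\<^sup>+x. ennreal (norm (indicat_real ({0<..t} \<times> UNIV) x *\<^sub>R h x)) \<partial>product_measure) < \<infinity>" .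
qed

text \<open>Stated for a general measure, since it serves both the jump measure and the compensator;
  the fixed level \<epsilon>0 gives one bound for all smaller truncations and all t \<le> T.\<close>

lemma truncation_error:
  fixes h :: "real \<times> 'y \<Rightarrow> 'e::euclidean_space"
  assumes \<mu>: "sets \<mu> = sets borel" and h: "set_integrable \<mu> ({0<..t} \<times> UNIV) h"
    and le: "\<And>z y. 0 < z \<Longrightarrow> z \<le> t \<Longrightarrow> norm (h (z, y)) \<le> C * norm y" and C: "0 \<le> C" and \<epsilon>: "\<epsilon> \<le> \<epsilon>0" and t: "t \<le> T"
  shows "ennreal (norm (set_lebesgue_integral \<mu> ({0<..t} \<times> UNIV) h - set_lebesgue_integral \<mu> ({0<..t} \<times> {y. \<epsilon> < norm y}) h))
    \<le> ennreal C * (\<integral>\<^sup>+(z, y). indicator {0<..T} z * ennreal (min (norm y) \<epsilon>0) \<partial>\<mu>)"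
proof -
  have s: "{0<..t} \<times> {y::'y. \<epsilon> < norm y} \<in> sets borel" "{0<..t} \<times> {y::'y. norm y \<le> \<epsilon>} \<in> sets borel"
    by (intro sets_time_mark; simp)+
  have eq: "{0<..t} \<times> (UNIV::'y set) = {0<..t} \<times> {y. \<epsilon> < norm y} \<union> {0<..t} \<times> {y. norm y \<le> \<epsilon>}" by auto
  have i: "set_integrable \<mu> ({0<..t} \<times> {y. \<epsilon> < norm y}) h" "set_integrable \<mu> ({0<..t} \<times> {y. norm y \<le> \<epsilon>}) h"
    by (rule set_integrable_subset[OF h]; use s \<mu> in auto)+
  have "set_lebesgue_integral \<mu> ({0<..t} \<times> UNIV) h
    = set_lebesgue_integral \<mu> ({0<..t} \<times> {y. \<epsilon> < norm y}) h + set_lebesgue_integral \<mu> ({0<..t} \<times> {y. norm y \<le> \<epsilon>}) h"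
    unfolding eq by (rule set_integral_Un[OF _ i]) auto
  then have "ennreal (norm (set_lebesgue_integral \<mu> ({0<..t} \<times> UNIV) h - set_lebesgue_integral \<mu> ({0<..t} \<times> {y. \<epsilon> < norm y}) h))
    = ennreal (norm (set_lebesgue_integral \<mu> ({0<..t} \<times> {y. norm y \<le> \<epsilon>}) h))" by simp
  also have "\<dots> \<le> (\<integral>\<^sup>+x. ennreal (norm (indicat_real ({0<..t} \<times> {y. norm y \<le> \<epsilon>}) x *\<^sub>R h x)) \<partial>\<mu>)"
    unfolding set_lebesgue_integral_def using i(2) unfolding set_integrable_def by (rule integral_norm_bound_ennreal)
  also have "\<dots> \<le> (\<integral>\<^sup>+x. ennreal C * (case x of (z, y) \<Rightarrow> indicator {0<..T} z * ennreal (min (norm y) \<epsilon>0)) \<partial>\<mu>)"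
  proof (rule nn_integral_mono)
    fix x :: "real \<times> 'y"
    obtain z y where [simp]: "x = (z, y)" by (cases x)
    show "ennreal (norm (indicat_real ({0<..t} \<times> {y. norm y \<le> \<epsilon>}) x *\<^sub>R h x))
      \<le> ennreal C * (case x of (z, y) \<Rightarrow> indicator {0<..T} z * ennreal (min (norm y) \<epsilon>0))"
    proof (cases "0 < z \<and> z \<le> t \<and> norm y \<le> \<epsilon>")
      case True
      then have "min (norm y) \<epsilon>0 = norm y" using \<epsilon> by simp
      then show ?thesis using True le[of z y] C t by (simp add: indicator_def ennreal_mult[symmetric] ennreal_leI)
    qed (auto simp: indicator_def)
  qed
  also have "\<dots> = ennreal C * (\<integral>\<^sup>+(z, y). indicator {0<..T} z * ennreal (min (norm y) \<epsilon>0) \<partial>\<mu>)"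
  proof (rule nn_integral_cmult)
    have "(\<lambda>(z, y). indicator {0<..T} z * ennreal (min (norm y) \<epsilon>0)) \<in> borel_measurable (borel :: (real \<times> 'y) measure)"
      by (intro borel_measurable_time_mark) measurable
    then show "(\<lambda>(z, y). indicator {0<..T} z * ennreal (min (norm y) \<epsilon>0)) \<in> borel_measurable \<mu>"
      using \<mu> by (simp add: measurable_cong_sets[OF \<mu> refl])
  qed
  finally show ?thesis .
qed

definition pathwise_integral :: "(real \<Rightarrow> 'w \<Rightarrow> 'y \<Rightarrow> 'e::euclidean_space) \<Rightarrow> real \<Rightarrow> 'w \<Rightarrow> 'e" where
  "pathwise_integral G t \<omega> =
     set_lebesgue_integral (jump_measure (path \<omega>)) ({0<..t} \<times> UNIV) (\<lambda>(z, y). G z \<omega> y)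
     - set_lebesgue_integral product_measure ({0<..t} \<times> UNIV) (\<lambda>(z, y). G z \<omega> y)"

text \<open>Where the path is bounded by n up to T, the integrand is at most C times
  \<open>norm y\<close>, so the truncation error is at most C times the small jumps plus T times the
  small mass, uniformly in t. The remaining outcomes form an event of small probability.\<close>

lemma has_compensated_integral_pathwise:
  fixes Y :: "real \<Rightarrow> 'w \<Rightarrow> 'e::euclidean_space"
  assumes lin: "linear_coefficients b g" and h: "time_lag h"
    and ad: "\<forall>t\<ge>0. (\<lambda>\<omega>. if ereal t < \<tau> \<omega> then Y t \<omega> else 0) \<in> borel_measurable (F t)"
    and cad: "AE \<omega> in M. cadlag_on (\<tau> \<omega>) (\<lambda>t. Y t \<omega>)"
  defines "G \<equiv> \<lambda>z \<omega> y. g y (left_lim (\<lambda>r. Y r \<omega>) (h z))"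
  shows "has_compensated_integral M L \<nu> \<tau> G (pathwise_integral G)"
  unfolding has_compensated_integral_def
proof (intro conjI allI impI)
  interpret linear_coefficients b g by (rule lin)
  show "AE \<omega> in M. \<forall>t\<ge>0. ereal t < \<tau> \<omega> \<longrightarrow>
    set_borel_measurable product_measure ({0<..t} \<times> UNIV) (\<lambda>(z, y). G z \<omega> y) \<and>
    set_integrable product_measure ({0<..t} \<times> UNIV) (\<lambda>(z, y). (norm (G z \<omega> y))\<^sup>2)"
    using cad
  proof (eventually_elim, intro allI impI)
    fix \<omega> t assume c: "cadlag_on (\<tau> \<omega>) (\<lambda>t. Y t \<omega>)" and t: "0 \<le> t" "ereal t < \<tau> \<omega>"
    obtain B where "\<And>u. 0 \<le> u \<Longrightarrow> u \<le> t \<Longrightarrow> norm (Y u \<omega>) \<le> B" using cadlag_on_bounded[OF c t(2)] by blast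
    then have B: "\<forall>u\<in>{0..t}. norm (Y u \<omega>) \<le> B" by simp
    note adm = admissible_lagged[OF h c t(2) B]
    obtain C where C: "0 \<le> C" "\<And>x. norm x \<le> B \<Longrightarrow> norm (b x) \<le> C" "\<And>x y. norm x \<le> B \<Longrightarrow> norm (g y x) \<le> C * norm y"
      by (rule local_bound[of B]) (rule that)
    have m: "(\<lambda>x. indicat_real ({0<..t} \<times> UNIV) x *\<^sub>R (case x of (z, y) \<Rightarrow> G z \<omega> y)) \<in> borel_measurable borel"
      unfolding G_def by (rule measurable_jump_integrand[OF adm(1)]) auto
    have "set_integrable product_measure ({0<..t} \<times> UNIV) (\<lambda>(z, y). (norm (G z \<omega> y))\<^sup>2)"
    proof (rule set_integrable_product[where C = "C\<^sup>2" and \<phi> = "\<lambda>y. (norm y)\<^sup>2"])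
      have "(\<lambda>x. (norm (indicat_real ({0<..t} \<times> UNIV) x *\<^sub>R (case x of (z, y) \<Rightarrow> G z \<omega> y)))\<^sup>2) \<in> borel_measurable borel"
        using m by measurable
      also have "(\<lambda>x. (norm (indicat_real ({0<..t} \<times> UNIV) x *\<^sub>R (case x of (z, y) \<Rightarrow> G z \<omega> y)))\<^sup>2)
        = (\<lambda>x. indicat_real ({0<..t} \<times> UNIV) x *\<^sub>R (case x of (z, y) \<Rightarrow> (norm (G z \<omega> y))\<^sup>2))"
        by (auto simp: fun_eq_iff indicator_def)
      finally show "(\<lambda>x. indicat_real ({0<..t} \<times> UNIV) x *\<^sub>R (case x of (z, y) \<Rightarrow> (norm (G z \<omega> y))\<^sup>2)) \<in> borel_measurable borel" .
      show "norm (case (z, y) of (z, y) \<Rightarrow> (norm (G z \<omega> y))\<^sup>2) \<le> C\<^sup>2 * (norm y)\<^sup>2" if "0 < z" "z \<le> t" for z y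
        using power_mono[OF C(3)[OF adm(2)[OF that]] norm_ge_zero, where n = 2] by (simp add: G_def power_mult_distrib)
    qed (use t C(1) \<nu>_moment2 in auto)
    moreover have "set_borel_measurable product_measure ({0<..t} \<times> UNIV) (\<lambda>(z, y). G z \<omega> y)"
      unfolding set_borel_measurable_def using m by (simp add: measurable_cong_sets[OF sets_product_measure refl])
    ultimately show "set_borel_measurable product_measure ({0<..t} \<times> UNIV) (\<lambda>(z, y). G z \<omega> y) \<and>
      set_integrable product_measure ({0<..t} \<times> UNIV) (\<lambda>(z, y). (norm (G z \<omega> y))\<^sup>2)" by blast
  qed
next
  interpret linear_coefficients b g by (rule lin)
  fix T \<delta> e :: real assume T: "0 \<le> T" and \<delta>: "0 < \<delta>" and e: "0 < e"
  let ?Q = "\<rat> \<inter> {0..T} \<union> {T}"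
  \<comment> \<open>A measurable stand-in for the supremum of the path; setting the path to 0 after
    its life time keeps every term measurable.\<close>
  define c where "c \<omega> = (SUP r\<in>?Q. ennreal (norm (if ereal r < \<tau> \<omega> then Y r \<omega> else 0)))" for \<omega>
  have c_meas[measurable]: "c \<in> borel_measurable M"
    unfolding c_def
  proof (rule borel_measurable_SUP)
    show "countable ?Q" using countable_rat by (intro countable_Un countable_Int1) auto
    fix r assume "r \<in> ?Q"
    then have "0 \<le> r" using T by auto
    from borel_measurable_F_M[OF ad[rule_format, OF this] this]
    show "(\<lambda>\<omega>. ennreal (norm (if ereal r < \<tau> \<omega> then Y r \<omega> else 0))) \<in> borel_measurable M" by measurable
  qed
  \<comment> \<open>Infinite values of \<open>c\<close>, possible when the path explodes at \<tau>
    before T, are left out so that the events decrease to the empty set. For T < \<tau> and a cadlag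
    path \<open>c\<close> is finite.\<close>
  define D where "D n = {\<omega>\<in>space M. of_nat n < c \<omega> \<and> c \<omega> < \<infinity>}" for n :: nat
  have D: "D n \<in> sets M" for n unfolding D_def by measurable
  have "(\<lambda>n. measure M (D n)) \<longlonglongrightarrow> measure M (\<Inter>n. D n)"
  proof (rule finite_Lim_measure_decseq)
    show "decseq D" unfolding decseq_Suc_iff D_def by (auto intro: le_less_trans[rotated])
  qed (use D in auto)
  moreover have "(\<Inter>n. D n) = {}"
  proof (rule ccontr)
    assume "(\<Inter>n. D n) \<noteq> {}"
    then obtain \<omega> where "\<And>n. \<omega> \<in> D n" by blast
    then have "c \<omega> < \<infinity>" "\<And>n. of_nat n < c \<omega>" by (auto simp: D_def)
    moreover from this(1) obtain n :: nat where "c \<omega> < of_nat n" using ennreal_Ex_less_of_nat by auto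
    ultimately show False by (meson less_asym)
  qed
  ultimately have "eventually (\<lambda>n. measure M (D n) < e / 2) sequentially"
    using e by (intro order_tendstoD(2)[of _ 0]) auto
  then obtain n where n: "measure M (D n) < e / 2" by (auto simp: eventually_sequentially)
  obtain C where C: "0 \<le> C" "\<And>x. norm x \<le> real n \<Longrightarrow> norm (b x) \<le> C" "\<And>x y. norm x \<le> real n \<Longrightarrow> norm (g y x) \<le> C * norm y"
    by (rule local_bound[of "real n"]) (rule that)
  \<comment> \<open>The two error contributions are C * \<delta>' from the jumps and C * T *
    \<delta>' from the compensator; C + 1 avoids a division by 0.\<close>
  define \<delta>' where "\<delta>' = \<delta> / ((C + 1) * (1 + T))"
  have \<delta>': "0 < \<delta>'" "C * (\<delta>' + T * \<delta>') \<le> \<delta>"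
  proof -
    have pos: "0 < (C + 1) * (1 + T)" using C(1) T by (intro mult_pos_pos) auto
    then show "0 < \<delta>'" using \<delta> by (simp add: \<delta>'_def)
    have "C * (\<delta>' + T * \<delta>') \<le> (C + 1) * (\<delta>' + T * \<delta>')" using \<open>0 < \<delta>'\<close> T by (intro mult_right_mono) auto
    also have "\<dots> = \<delta>' * ((C + 1) * (1 + T))" by (simp add: algebra_simps)
    also have "\<dots> = \<delta>" using C(1) T by (simp add: \<delta>'_def add_nonneg_eq_0_iff)
    finally show "C * (\<delta>' + T * \<delta>') \<le> \<delta>" .
  qed
  obtain \<epsilon>0 where \<epsilon>0: "0 < \<epsilon>0" "small_mass \<epsilon>0 < ennreal \<delta>'"
    "{\<omega>\<in>space M. ennreal \<delta>' \<le> small_jumps T \<epsilon>0 \<omega>} \<in> sets M"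
    "measure M {\<omega>\<in>space M. ennreal \<delta>' \<le> small_jumps T \<epsilon>0 \<omega>} < e / 2"
    by (rule small_jumps_in_probability[OF T \<delta>'(1), of "e / 2"]) (use e in simp, rule that)
  obtain Z where Z: "Z \<in> null_sets M" "\<And>\<omega>. \<omega> \<in> space M \<Longrightarrow> \<omega> \<notin> Z \<Longrightarrow> cadlag_on (\<tau> \<omega>) (\<lambda>t. Y t \<omega>) \<and> jump_path (path \<omega>)"
    using AE_conjI[OF cad jump_path_AE] by (auto elim!: AE_E3)
  define A where "A = D n \<union> {\<omega>\<in>space M. ennreal \<delta>' \<le> small_jumps T \<epsilon>0 \<omega>} \<union> Z"
  have A: "A \<in> sets M" unfolding A_def using D \<epsilon>0(3) Z(1) by auto
  have "measure M A \<le> (measure M (D n) + measure M {\<omega>\<in>space M. ennreal \<delta>' \<le> small_jumps T \<epsilon>0 \<omega>}) + measure M Z"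
    unfolding A_def using D \<epsilon>0(3) Z(1)
    by (intro order_trans[OF measure_Un_le] add_mono measure_Un_le order_refl) auto
  also have "measure M Z = 0" using Z(1) by (simp add: measure_eq_0_null_sets)
  finally have mA: "measure M A < e" using n \<epsilon>0(4) by simp
  have "{\<omega>\<in>space M. ereal T < \<tau> \<omega> \<and> (\<exists>t\<in>{0..T}. \<delta> < norm (pathwise_integral G t \<omega> - truncated_compensated_integral L \<nu> G \<epsilon> t \<omega>))} \<subseteq> A"
    if \<epsilon>: "0 < \<epsilon>" "\<epsilon> < \<epsilon>0" for \<epsilon>
  proof
    fix \<omega> assume "\<omega> \<in> {\<omega>\<in>space M. ereal T < \<tau> \<omega> \<and> (\<exists>t\<in>{0..T}. \<delta> < norm (pathwise_integral G t \<omega> - truncated_compensated_integral L \<nu> G \<epsilon> t \<omega>))}"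
    then obtain t where \<omega>: "\<omega> \<in> space M" "ereal T < \<tau> \<omega>" and t: "0 \<le> t" "t \<le> T"
      and gt: "\<delta> < norm (pathwise_integral G t \<omega> - truncated_compensated_integral L \<nu> G \<epsilon> t \<omega>)" by auto
    show "\<omega> \<in> A"
    proof (rule ccontr)
      assume "\<omega> \<notin> A"
      then have cd: "cadlag_on (\<tau> \<omega>) (\<lambda>t. Y t \<omega>)" and "jump_path (path \<omega>)"
        and sj: "small_jumps T \<epsilon>0 \<omega> < ennreal \<delta>'" and nD: "\<omega> \<notin> D n"
        using Z(2)[of \<omega>] \<omega>(1) by (auto simp: A_def not_le)
      then interpret jump_path "path \<omega>" by simp
      interpret path_coefficients "path \<omega>" b g ..
      have bd: "norm (Y r \<omega>) \<le> real n" if "r \<in> ?Q" for r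
      proof -
        obtain B where B: "0 \<le> B" "\<And>u. 0 \<le> u \<Longrightarrow> u \<le> T \<Longrightarrow> norm (Y u \<omega>) \<le> B"
          by (rule cadlag_on_bounded[OF cd \<omega>(2)]) (rule that)
        have lt: "ereal r < \<tau> \<omega>" "0 \<le> r" "r \<le> T" if "r \<in> ?Q" for r using that \<omega>(2) T by (auto intro: le_less_trans[of _ "ereal T"])
        have "c \<omega> \<le> ennreal B"
          unfolding c_def
        proof (rule SUP_least)
          fix r assume "r \<in> ?Q"
          from lt[OF this] show "ennreal (norm (if ereal r < \<tau> \<omega> then Y r \<omega> else 0)) \<le> ennreal B"
            using B(2)[of r] by (simp add: ennreal_leI)
        qed
        then have "c \<omega> < \<infinity>" by (rule le_less_trans) simp
        then have "c \<omega> \<le> of_nat n" using nD \<omega>(1) by (auto simp: D_def not_less)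
        moreover have "ennreal (norm (Y r \<omega>)) \<le> c \<omega>"
          unfolding c_def using that lt[OF that] by (intro SUP_upper2[of r]) auto
        ultimately have "ennreal (norm (Y r \<omega>)) \<le> ennreal (real n)"
          unfolding ennreal_of_nat_eq_real_of_nat by (rule order_trans[rotated])
        then show ?thesis by simp
      qed
      have bd': "\<forall>u\<in>{0..T}. norm (Y u \<omega>) \<le> real n"
        using cadlag_norm_le_rational[OF cd \<omega>(2) _ _ bd] by simp
      note adm = admissible_lagged[OF h cd \<omega>(2) bd']
      have le: "norm (case (z, y) of (z, y) \<Rightarrow> G z \<omega> y) \<le> C * norm y" if "0 < z" "z \<le> t" for z y
        using C(3)[OF adm(2)[of z]] that t by (simp add: G_def)
      have iN: "set_integrable N ({0<..t} \<times> UNIV) (\<lambda>(z, y). G z \<omega> y)"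
        unfolding G_def by (rule set_integrable_jump[OF adm(1)]) (use t in auto)
      have iP: "set_integrable product_measure ({0<..t} \<times> UNIV) (\<lambda>(z, y). G z \<omega> y)"
      proof (rule set_integrable_product[where \<phi> = norm, OF _ t(1) C(1) le])
        show "(\<lambda>x. indicat_real ({0<..t} \<times> UNIV) x *\<^sub>R (case x of (z, y) \<Rightarrow> G z \<omega> y)) \<in> borel_measurable borel"
          unfolding G_def by (rule measurable_jump_integrand[OF adm(1)]) (use t in auto)
      qed (use \<nu>_moment1 in auto)
      note eN = truncation_error[OF sets_jump_measure iN le C(1) less_imp_le[OF \<epsilon>(2)] t(2)]
      note eP = truncation_error[OF sets_product_measure iP le C(1) less_imp_le[OF \<epsilon>(2)] t(2)]
      define x where "x = set_lebesgue_integral N ({0<..t} \<times> UNIV) (\<lambda>(z, y). G z \<omega> y)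
          - set_lebesgue_integral N ({0<..t} \<times> {y. \<epsilon> < norm y}) (\<lambda>(z, y). G z \<omega> y)"
      define y where "y = set_lebesgue_integral product_measure ({0<..t} \<times> UNIV) (\<lambda>(z, y). G z \<omega> y)
          - set_lebesgue_integral product_measure ({0<..t} \<times> {y. \<epsilon> < norm y}) (\<lambda>(z, y). G z \<omega> y)"
      have "pathwise_integral G t \<omega> - truncated_compensated_integral L \<nu> G \<epsilon> t \<omega> = x - y"
        by (simp add: pathwise_integral_def truncated_compensated_integral_def x_def y_def)
      then have "\<delta> < norm (x - y)" using gt by simp
      moreover have "ennreal (norm (x - y)) \<le> ennreal (norm x) + ennreal (norm y)"
        using norm_triangle_ineq4[of x y] by (simp add: ennreal_plus[symmetric] ennreal_leI del: ennreal_plus)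
      moreover have "ennreal (norm x) \<le> ennreal C * ennreal \<delta>'"
        using order_trans[OF eN mult_left_mono[OF less_imp_le[OF sj[unfolded small_jumps_def]]]] unfolding x_def by simp
      moreover have "ennreal (norm y) \<le> ennreal C * (ennreal T * ennreal \<delta>')"
      proof -
        have "(\<integral>\<^sup>+(z, y). indicator {0<..T} z * ennreal (min (norm y) \<epsilon>0) \<partial>product_measure) = ennreal T * small_mass \<epsilon>0"
          unfolding small_mass_def by (intro nn_integral_product T) measurable
        then have "ennreal (norm y) \<le> ennreal C * (ennreal T * small_mass \<epsilon>0)" using eP unfolding y_def by simp
        also have "\<dots> \<le> ennreal C * (ennreal T * ennreal \<delta>')" using \<epsilon>0(2) by (intro mult_left_mono) auto
        finally show ?thesis .
      qed
      ultimately have "ennreal (norm (x - y)) \<le> ennreal C * ennreal \<delta>' + ennreal C * (ennreal T * ennreal \<delta>')"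
        by (meson add_mono order_trans)
      also have "\<dots> = ennreal (C * (\<delta>' + T * \<delta>'))"
        using C(1) T \<delta>'(1) by (simp add: ennreal_mult[symmetric] ennreal_plus[symmetric] distrib_left del: ennreal_plus)
      finally have "norm (x - y) \<le> C * (\<delta>' + T * \<delta>')" using C(1) T \<delta>'(1) by simp
      then show False using \<open>\<delta> < norm (x - y)\<close> \<delta>'(2) by linarith
    qed
  qed
  then have "eventually (\<lambda>\<epsilon>. {\<omega>\<in>space M. ereal T < \<tau> \<omega> \<and> (\<exists>t\<in>{0..T}. \<delta> < norm (pathwise_integral G t \<omega> - truncated_compensated_integral L \<nu> G \<epsilon> t \<omega>))} \<subseteq> A) (at_right 0)"
    unfolding eventually_at_right_field using \<epsilon>0(1) by blast
  then show "\<forall>\<^sub>F \<epsilon> in at_right 0. \<exists>A\<in>sets M. measure M A < e \<and>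
     {\<omega>\<in>space M. ereal T < \<tau> \<omega> \<and> (\<exists>t\<in>{0..T}. \<delta> < norm (pathwise_integral G t \<omega> - truncated_compensated_integral L \<nu> G \<epsilon> t \<omega>))} \<subseteq> A"
    by eventually_elim (use A mA in blast)
qed


text \<open>By linearity the mean of \<open>g y x\<close> over the Levy measure is
  \<open>g mean_jump x\<close>, so subtracting it from the drift accounts for the
  compensator.\<close>

definition compensated_drift :: "('e::euclidean_space \<Rightarrow> 'e) \<Rightarrow> ('y \<Rightarrow> 'e \<Rightarrow> 'e) \<Rightarrow> 'e \<Rightarrow> 'e" where
  "compensated_drift b g x = b x - g mean_jump x"

lemma linear_coefficients_compensated:
  assumes "linear_coefficients b g"
  shows "linear_coefficients (compensated_drift b g) g" "linear_coefficients (\<lambda>x. g mean_jump x) g"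
proof -
  interpret linear_coefficients b g by (rule assms)
  have g: "continuous_on UNIV (\<lambda>x. g mean_jump x)"
    using continuous_on_compose2[OF continuous_jump, of UNIV "\<lambda>x. (mean_jump, x)"] by (simp add: continuous_on_Pair)
  show "linear_coefficients (compensated_drift b g) g"
    unfolding compensated_drift_def[abs_def]
    by (rule linear_coefficients.intro[OF continuous_on_diff[OF continuous_drift g] continuous_jump linear_jump])
  show "linear_coefficients (\<lambda>x. g mean_jump x) g"
    by (rule linear_coefficients.intro[OF g continuous_jump linear_jump])
qed

lemma integral_compensator:
  assumes lin: "linear_coefficients b g" and adm: "admissible t \<xi>" and t: "0 \<le> t"
  shows "set_lebesgue_integral product_measure ({0<..t} \<times> UNIV) (\<lambda>(z, y). g y (\<xi> z)) = (LINT z:{0<..t}|lborel. g mean_jump (\<xi> z))"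
proof -
  interpret linear_coefficients b g by (rule lin)
  interpret \<nu>: sigma_finite_measure \<nu> by (rule sigma_finite_\<nu>)
  interpret pair_sigma_finite lborel \<nu> ..
  obtain R where R: "\<And>z. z \<in> {0<..t} \<Longrightarrow> norm (\<xi> z) \<le> R" using adm unfolding admissible_def by blast
  obtain C where C: "0 \<le> C" "\<And>x. norm x \<le> R \<Longrightarrow> norm (b x) \<le> C" "\<And>x y. norm x \<le> R \<Longrightarrow> norm (g y x) \<le> C * norm y"
    by (rule local_bound[of R]) (rule that)
  have iP: "set_integrable product_measure ({0<..t} \<times> UNIV) (\<lambda>(z, y). g y (\<xi> z))"
  proof (rule set_integrable_product[where \<phi> = norm, OF _ t C(1)])
    show "(\<lambda>x. indicat_real ({0<..t} \<times> UNIV) x *\<^sub>R (case x of (z, y) \<Rightarrow> g y (\<xi> z))) \<in> borel_measurable borel"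
      by (rule measurable_jump_integrand[OF adm]) auto
  qed (use \<nu>_moment1 C(3) R in auto)
  have int: "integrable \<nu> (\<lambda>y. y)"
    using \<nu>_moment1 by (intro integrableI_bounded) auto
  have eq: "indicat_real ({0<..t} \<times> UNIV) (z, y) *\<^sub>R g y (\<xi> z) = indicat_real {0<..t} z *\<^sub>R g y (\<xi> z)" for z y
    by (simp add: indicator_def)
  have "set_lebesgue_integral product_measure ({0<..t} \<times> UNIV) (\<lambda>(z, y). g y (\<xi> z))
    = (LINT z|lborel. LINT y|\<nu>. indicat_real {0<..t} z *\<^sub>R g y (\<xi> z))"
    using integral_fst'[OF iP[unfolded set_integrable_def]] by (simp add: set_lebesgue_integral_def eq)
  also have "\<dots> = (LINT z|lborel. indicat_real {0<..t} z *\<^sub>R g mean_jump (\<xi> z))"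
  proof (rule Bochner_Integration.integral_cong[OF refl])
    fix z
    have "bounded_linear (\<lambda>y. g y (\<xi> z))" using linear_jump linear_conv_bounded_linear by blast
    from integral_bounded_linear[OF this int]
    show "(LINT y|\<nu>. indicat_real {0<..t} z *\<^sub>R g y (\<xi> z)) = indicat_real {0<..t} z *\<^sub>R g mean_jump (\<xi> z)"
      by (simp add: mean_jump_def)
  qed
  finally show ?thesis by (simp add: set_lebesgue_integral_def)
qed

lemma pathwise_equation:
  fixes b :: "'e::euclidean_space \<Rightarrow> 'e"
  assumes lin: "linear_coefficients b g" and jp: "jump_path (path \<omega>)" and adm: "admissible t \<xi>" and t: "0 \<le> t"
  shows "(LINT z:{0<..t}|lborel. b (\<xi> z)) + (set_lebesgue_integral (jump_measure (path \<omega>)) ({0<..t} \<times> UNIV) (\<lambda>(z, y). g y (\<xi> z))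
      - set_lebesgue_integral product_measure ({0<..t} \<times> UNIV) (\<lambda>(z, y). g y (\<xi> z)))
    = path_integral (path \<omega>) (compensated_drift b g) g \<xi> 0 t"
proof -
  note i = linear_coefficients.set_integrable_drift[OF lin adm order_refl order_refl]
    linear_coefficients.set_integrable_drift[OF linear_coefficients_compensated(2)[OF lin] adm order_refl order_refl]
  show ?thesis
    unfolding integral_compensator[OF lin adm t] path_integral_def compensated_drift_def
    by (simp add: set_integral_diff[OF i])
qed

text \<open>The version \<open>J\<close> in the equation is unknown, but the pathwise integral is
  another version for the same integrand; uniqueness identifies the two, and the equation holds path
  by path off one null set.\<close>

lemma solves_equation_pathwise:
  fixes Y :: "real \<Rightarrow> 'w \<Rightarrow> 'e::euclidean_space"
  assumes sol: "solves_equation M F L \<nu> b g D h x0 \<tau> Y" and lin: "linear_coefficients b g" and h: "time_lag h"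
  shows "AE \<omega> in M. cadlag_on (\<tau> \<omega>) (\<lambda>t. Y t \<omega>) \<and> (\<forall>t\<ge>0. ereal t < \<tau> \<omega> \<longrightarrow>
    (\<forall>z\<in>{0<..t}. left_lim (\<lambda>r. Y r \<omega>) (h z) \<in> D) \<and>
    Y t \<omega> = x0 + path_integral (path \<omega>) (compensated_drift b g) g (\<lambda>z. left_lim (\<lambda>r. Y r \<omega>) (h z)) 0 t)"
proof -
  let ?G = "\<lambda>z \<omega> y. g y (left_lim (\<lambda>r. Y r \<omega>) (h z))"
  obtain J where J: "has_compensated_integral M L \<nu> \<tau> ?G J"
    "AE \<omega> in M. \<forall>t\<ge>0. ereal t < \<tau> \<omega> \<longrightarrow>
           Y t \<omega> = x0 + (LINT z:{0<..t}|lborel. b (left_lim (\<lambda>r. Y r \<omega>) (h z))) + J t \<omega>"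
    using sol[unfolded solves_equation_def, THEN conjunct2, THEN conjunct2, THEN conjunct2] by blast
  note sol' = sol[unfolded solves_equation_def]
  have ad: "\<forall>t\<ge>0. (\<lambda>\<omega>. if ereal t < \<tau> \<omega> then Y t \<omega> else 0) \<in> borel_measurable (F t)"
    by (rule sol'[THEN conjunct1])
  have cad: "AE \<omega> in M. cadlag_on (\<tau> \<omega>) (\<lambda>t. Y t \<omega>)"
    by (rule sol'[THEN conjunct2, THEN conjunct1])
  have dom: "AE \<omega> in M. \<forall>t\<ge>0. ereal t < \<tau> \<omega> \<longrightarrow>
        (\<forall>z\<in>{0<..t}. left_lim (\<lambda>r. Y r \<omega>) (h z) \<in> D) \<and>
        set_integrable lborel {0<..t} (\<lambda>z. b (left_lim (\<lambda>r. Y r \<omega>) (h z)))"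
    by (rule sol'[THEN conjunct2, THEN conjunct2, THEN conjunct1])
  note u = has_compensated_integral_unique[OF J(1) has_compensated_integral_pathwise[OF lin h ad cad]]
  show ?thesis
    using cad dom J(2) u jump_path_AE
  proof eventually_elim
    case (elim \<omega>)
    show ?case
    proof (intro conjI allI impI)
      fix t assume t: "0 \<le> t" "ereal t < \<tau> \<omega>"
      show "\<forall>z\<in>{0<..t}. left_lim (\<lambda>r. Y r \<omega>) (h z) \<in> D" using elim(2) t by blast
      obtain B where "\<And>u. 0 \<le> u \<Longrightarrow> u \<le> t \<Longrightarrow> norm (Y u \<omega>) \<le> B" using cadlag_on_bounded[OF elim(1) t(2)] by blast
      then have B: "\<forall>u\<in>{0..t}. norm (Y u \<omega>) \<le> B" by simp
      note adm = admissible_lagged(1)[OF h elim(1) t(2) B]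
      show "Y t \<omega> = x0 + path_integral (path \<omega>) (compensated_drift b g) g (\<lambda>z. left_lim (\<lambda>r. Y r \<omega>) (h z)) 0 t"
        using elim(3) elim(4) t unfolding pathwise_equation[OF lin elim(5) adm t(1), symmetric]
        by (simp add: pathwise_integral_def add.assoc)
    qed (rule elim(1))
  qed
qed

text \<open>The converse passage, by which the explicitly constructed scheme becomes a solution in
  the stochastic sense.\<close>

lemma solves_equationI:
  fixes Y :: "real \<Rightarrow> 'w \<Rightarrow> 'e::euclidean_space"
  assumes lin: "linear_coefficients b g" and h: "time_lag h"
    and ad: "\<forall>t\<ge>0. (\<lambda>\<omega>. if ereal t < \<tau> \<omega> then Y t \<omega> else 0) \<in> borel_measurable (F t)"
    and cad: "AE \<omega> in M. cadlag_on (\<tau> \<omega>) (\<lambda>t. Y t \<omega>)"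
    and eq: "AE \<omega> in M. \<forall>t\<ge>0. ereal t < \<tau> \<omega> \<longrightarrow> (\<forall>z\<in>{0<..t}. left_lim (\<lambda>r. Y r \<omega>) (h z) \<in> D) \<and>
      Y t \<omega> = x0 + path_integral (path \<omega>) (compensated_drift b g) g (\<lambda>z. left_lim (\<lambda>r. Y r \<omega>) (h z)) 0 t"
  shows "solves_equation M F L \<nu> b g D h x0 \<tau> Y"
proof -
  let ?G = "\<lambda>z \<omega> y. g y (left_lim (\<lambda>r. Y r \<omega>) (h z))"
  have adm: "admissible t (\<lambda>z. left_lim (\<lambda>r. Y r \<omega>) (h z))"
    if cd: "cadlag_on (\<tau> \<omega>) (\<lambda>t. Y t \<omega>)" and t: "0 \<le> t" "ereal t < \<tau> \<omega>" for \<omega> t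
  proof -
    obtain B where "\<And>u. 0 \<le> u \<Longrightarrow> u \<le> t \<Longrightarrow> norm (Y u \<omega>) \<le> B" using cadlag_on_bounded[OF cd t(2)] by blast
    then have B: "\<forall>u\<in>{0..t}. norm (Y u \<omega>) \<le> B" by simp
    show ?thesis by (rule admissible_lagged(1)[OF h cd t(2) B])
  qed
  have "AE \<omega> in M. \<forall>t\<ge>0. ereal t < \<tau> \<omega> \<longrightarrow>
        (\<forall>z\<in>{0<..t}. left_lim (\<lambda>r. Y r \<omega>) (h z) \<in> D) \<and>
        set_integrable lborel {0<..t} (\<lambda>z. b (left_lim (\<lambda>r. Y r \<omega>) (h z)))"
    using cad eq
  proof eventually_elim
    case (elim \<omega>)
    then show ?case
      using linear_coefficients.set_integrable_drift[OF lin adm[OF elim(1)] order_refl order_refl] by blast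
  qed
  moreover have "AE \<omega> in M. \<forall>t\<ge>0. ereal t < \<tau> \<omega> \<longrightarrow>
    Y t \<omega> = x0 + (LINT z:{0<..t}|lborel. b (left_lim (\<lambda>r. Y r \<omega>) (h z))) + pathwise_integral ?G t \<omega>"
    using cad eq jump_path_AE
  proof eventually_elim
    case (elim \<omega>)
    show ?case
    proof (intro allI impI)
      fix t assume t: "0 \<le> t" "ereal t < \<tau> \<omega>"
      show "Y t \<omega> = x0 + (LINT z:{0<..t}|lborel. b (left_lim (\<lambda>r. Y r \<omega>) (h z))) + pathwise_integral ?G t \<omega>"
        using elim(2) t pathwise_equation[OF lin elim(3) adm[OF elim(1) t] t(1)]
        by (simp add: pathwise_integral_def add.assoc)
    qed
  qed
  ultimately show ?thesis
    unfolding solves_equation_def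
    by (intro conjI exI[of _ "pathwise_integral ?G"] ad cad has_compensated_integral_pathwise[OF lin h ad cad])
qed

end

section \<open>The Euler scheme of a stochastic equation\<close>

text \<open>The cut-off factor is 0 for marks of norm up to 1/(j+1) and 1 from 2/(j+1) on,
  continuous in between. So \<open>jump_sum_adapted\<close> applies to each approximation, and
  dominated convergence by the summable jumps gives the limit.\<close>

lemma total_jump_limit:
  fixes f :: "real \<Rightarrow> 'y::euclidean_space"
  assumes "jump_path f"
  defines "\<phi> \<equiv> \<lambda>j y. min 1 (max 0 (real (Suc j) * norm y - 1)) *\<^sub>R y"
  shows "(\<lambda>j. \<Sum>z\<in>{z\<in>{0<..t}. 1 / real (Suc j) \<le> norm (jump f z)}. \<phi> j (jump f z)) \<longlonglongrightarrow> jump_path.total_jump f t"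
proof -
  interpret jump_path f by fact
  have cont: "continuous_on UNIV (\<phi> j)" for j unfolding \<phi>_def by (intro continuous_intros)
  have [measurable]: "\<phi> j \<in> borel_measurable borel" for j by (rule borel_measurable_continuous_onI[OF cont])
  have le: "norm (\<phi> j y) \<le> norm y" for j y
    unfolding \<phi>_def by (simp add: mult_left_le_one_le)
  have msnd: "(\<lambda>x::real \<times> 'y. snd x) \<in> borel_measurable borel" by (simp add: borel_prod[symmetric])
  have m: "(\<lambda>x. indicat_real ({0<..t} \<times> UNIV) x *\<^sub>R (case x of (z, y) \<Rightarrow> \<phi> j y)) \<in> borel_measurable (borel :: (real \<times> 'y) measure)" for j
    unfolding case_prod_beta using measurable_compose[OF msnd, of "\<phi> j"]
    by (intro borel_measurable_scaleR borel_measurable_indicator sets_time_mark) auto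
  have eq: "set_lebesgue_integral N ({0<..t} \<times> UNIV) (\<lambda>(z, y). \<phi> j y)
    = (\<Sum>z\<in>{z\<in>{0<..t}. 1 / real (Suc j) \<le> norm (jump f z)}. \<phi> j (jump f z))" for j
  proof -
    let ?J = "{z. 0 < z \<and> jump f z \<noteq> 0}"
    have v: "\<phi> j y = 0" if "norm y < 1 / real (Suc j)" for y
    proof -
      have "real (Suc j) * norm y \<le> 1" using that by (simp add: field_simps)
      then show ?thesis by (simp add: \<phi>_def max_absorb1)
    qed
    have sub: "{z \<in> ?J. indicat_real {0<..t} z *\<^sub>R \<phi> j (jump f z) \<noteq> 0} \<subseteq> {z\<in>{0<..t}. 1 / real (Suc j) \<le> norm (jump f z)}"
      using v by (auto simp: indicator_def not_le[symmetric] split: if_splits)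
    have fin: "finite {z\<in>{0<..t}. 1 / real (Suc j) \<le> norm (jump f z)}"
      by (rule finite_large_jumps[OF cadlag_f]) auto
    have "set_lebesgue_integral N ({0<..t} \<times> UNIV) (\<lambda>(z, y). \<phi> j y)
      = (\<integral>z. indicat_real {0<..t} z *\<^sub>R \<phi> j (jump f z) \<partial>count_space ?J)"
      unfolding set_lebesgue_integral_def jump_measure_def
      by (subst integral_distr[OF _ m]) (auto simp: indicator_def)
    also have "\<dots> = (\<Sum>z | z \<in> ?J \<and> indicat_real {0<..t} z *\<^sub>R \<phi> j (jump f z) \<noteq> 0. indicat_real {0<..t} z *\<^sub>R \<phi> j (jump f z))"
      by (rule lebesgue_integral_count_space_finite_support) (rule finite_subset[OF sub fin])
    also have "\<dots> = (\<Sum>z\<in>{z\<in>{0<..t}. 1 / real (Suc j) \<le> norm (jump f z)}. indicat_real {0<..t} z *\<^sub>R \<phi> j (jump f z))"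
    proof (rule sum.mono_neutral_left[OF fin sub], rule ballI)
      fix z assume "z \<in> {z\<in>{0<..t}. 1 / real (Suc j) \<le> norm (jump f z)} - {z \<in> ?J. indicat_real {0<..t} z *\<^sub>R \<phi> j (jump f z) \<noteq> 0}"
      then show "indicat_real {0<..t} z *\<^sub>R \<phi> j (jump f z) = 0"
        by (cases "jump f z = 0") (auto simp: \<phi>_def)
    qed
    finally show ?thesis by (simp add: indicator_def)
  qed
  have "(\<lambda>j. set_lebesgue_integral N ({0<..t} \<times> UNIV) (\<lambda>(z, y). \<phi> j y)) \<longlonglongrightarrow> set_lebesgue_integral N ({0<..t} \<times> UNIV) (\<lambda>(z, y). y)"
    unfolding set_lebesgue_integral_def
  proof (rule integral_dominated_convergence)
    show "integrable N (\<lambda>x. norm (indicat_real ({0<..t} \<times> UNIV) x *\<^sub>R (case x of (z, y) \<Rightarrow> y)))"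
      using set_integrable_mark[of t] unfolding set_integrable_def by (rule integrable_norm)
    show "(\<lambda>x. indicat_real ({0<..t} \<times> UNIV) x *\<^sub>R (case x of (z, y) \<Rightarrow> y)) \<in> borel_measurable N"
      using set_integrable_mark[of t] unfolding set_integrable_def by (rule borel_measurable_integrable)
    show "(\<lambda>x. indicat_real ({0<..t} \<times> UNIV) x *\<^sub>R (case x of (z, y) \<Rightarrow> \<phi> j y)) \<in> borel_measurable N" for j
      using m[of j] by (simp add: measurable_cong_sets[OF sets_jump_measure refl])
    show "AE x in N. norm (indicat_real ({0<..t} \<times> UNIV) x *\<^sub>R (case x of (z, y) \<Rightarrow> \<phi> j y))
      \<le> norm (indicat_real ({0<..t} \<times> UNIV) x *\<^sub>R (case x of (z, y) \<Rightarrow> y))" for j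
      using le by (intro AE_I2) (auto simp: indicator_def)
    show "AE x in N. (\<lambda>j. indicat_real ({0<..t} \<times> UNIV) x *\<^sub>R (case x of (z, y) \<Rightarrow> \<phi> j y))
      \<longlonglongrightarrow> indicat_real ({0<..t} \<times> UNIV) x *\<^sub>R (case x of (z, y) \<Rightarrow> y)"
    proof (rule AE_I2)
      fix x :: "real \<times> 'y"
      have "(\<lambda>j. \<phi> j y) \<longlonglongrightarrow> y" for y :: 'y
      proof (cases "y = 0")
        case False
        then obtain k :: nat where k: "2 < real k * norm y" using reals_Archimedean3[of "norm y"] by auto
        have "\<phi> j y = y" if "k \<le> j" for j
        proof -
          have "real k * norm y \<le> real (Suc j) * norm y" using that by (intro mult_right_mono) auto
          then show ?thesis using k by (simp add: \<phi>_def min_absorb1 del: of_nat_Suc)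
        qed
        then show ?thesis by (intro tendsto_eventually) (auto simp: eventually_sequentially)
      qed (simp add: \<phi>_def)
      then show "(\<lambda>j. indicat_real ({0<..t} \<times> UNIV) x *\<^sub>R (case x of (z, y) \<Rightarrow> \<phi> j y))
        \<longlonglongrightarrow> indicat_real ({0<..t} \<times> UNIV) x *\<^sub>R (case x of (z, y) \<Rightarrow> y)"
        by (cases x) (auto simp: indicator_def)
    qed
  qed
  then show ?thesis by (simp add: eq total_jump_def)
qed

context finite_variation_noise
begin

abbreviation jump_sum :: "'w \<Rightarrow> real \<Rightarrow> 'y" where
  "jump_sum \<omega> \<equiv> jump_path.total_jump (path \<omega>)"

lemma jump_sum_path_adapted:
  assumes t: "0 \<le> t"
  shows "(\<lambda>\<omega>. jump_sum \<omega> t) \<in> borel_measurable (F t)"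
proof (rule borel_measurable_F_AE_LIMSEQ[OF _ _ t])
  let ?\<phi> = "\<lambda>j (y::'y). min 1 (max 0 (real (Suc j) * norm y - 1)) *\<^sub>R y"
  show "(\<lambda>\<omega>. \<Sum>z\<in>{z\<in>{0<..t}. 1 / real (Suc j) \<le> norm (jump (path \<omega>) z)}. ?\<phi> j (jump (path \<omega>) z)) \<in> borel_measurable (F t)" for j
  proof (rule jump_sum_adapted[OF t])
    show "continuous_on UNIV (?\<phi> j)" by (intro continuous_intros)
    fix y :: 'y assume "norm y < 1 / real (Suc j)"
    then have "real (Suc j) * norm y \<le> 1" by (simp add: field_simps)
    then show "?\<phi> j y = 0" by (simp add: max_absorb1)
  qed simp
  show "AE \<omega> in M. (\<lambda>j. \<Sum>z\<in>{z\<in>{0<..t}. 1 / real (Suc j) \<le> norm (jump (path \<omega>) z)}. ?\<phi> j (jump (path \<omega>) z)) \<longlonglongrightarrow> jump_sum \<omega> t"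
    using jump_path_AE by eventually_elim (rule total_jump_limit)
qed

lemma jump_sum_left_lim_adapted:
  assumes t: "0 < t"
  shows "(\<lambda>\<omega>. left_lim (jump_sum \<omega>) t) \<in> borel_measurable (F t)"
proof (rule borel_measurable_F_AE_LIMSEQ)
  define u where "u n = t - t / real (Suc (Suc n))" for n
  have u: "0 \<le> u n" "u n < t" for n
    using t by (auto simp: u_def field_simps)
  have lim: "u \<longlonglongrightarrow> t"
    unfolding u_def[abs_def] using tendsto_diff[OF tendsto_const LIMSEQ_Suc[OF LIMSEQ_Suc[OF lim_const_over_n[of t]]], of t] by simp
  show "(\<lambda>\<omega>. jump_sum \<omega> (u n)) \<in> borel_measurable (F t)" for n
    by (rule borel_measurable_F_mono[OF jump_sum_path_adapted[OF u(1)] u(1) less_imp_le[OF u(2)]])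
  show "AE \<omega> in M. (\<lambda>n. jump_sum \<omega> (u n)) \<longlonglongrightarrow> left_lim (jump_sum \<omega>) t"
    using jump_path_AE
  proof eventually_elim
    case (elim \<omega>)
    then interpret jump_path "path \<omega>" .
    show ?case
      by (rule filterlim_compose[OF cadlag_on_left_lim[OF cadlag_total_jump t] filterlim_at_left_seq[OF u(2) lim]]) simp
  qed
qed (use t in simp)

context
  fixes b :: "'e::euclidean_space \<Rightarrow> 'e" and g :: "'y \<Rightarrow> 'e \<Rightarrow> 'e" and \<Delta> :: real and x0 :: 'e
  assumes lin: "linear_coefficients b g" and \<Delta>: "0 < \<Delta>"
begin

interpretation C: linear_coefficients "compensated_drift b g" g
  by (rule linear_coefficients_compensated(1)[OF lin])

definition frozen :: "'w \<Rightarrow> nat \<Rightarrow> 'e" where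
  "frozen \<omega> k = fst (euler_state \<Delta> (compensated_drift b g) g x0 (jump_sum \<omega>) k)"

definition euler_process :: "real \<Rightarrow> 'w \<Rightarrow> 'e" where
  "euler_process t \<omega> = euler \<Delta> (compensated_drift b g) g x0 (jump_sum \<omega>) t"

definition euler_time :: "'e set \<Rightarrow> 'w \<Rightarrow> ereal" where
  "euler_time D \<omega> = Inf {ereal (real k * \<Delta>) | k. frozen \<omega> k \<notin> D}"

lemma euler_state_adapted:
  "(\<lambda>\<omega>. fst (euler_state \<Delta> (compensated_drift b g) g x0 (jump_sum \<omega>) k)) \<in> borel_measurable (F (real k * \<Delta>))"
  "(\<lambda>\<omega>. snd (euler_state \<Delta> (compensated_drift b g) g x0 (jump_sum \<omega>) k)) \<in> borel_measurable (F (real k * \<Delta>))"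
proof (induct k)
  case (Suc k)
  let ?s = "\<lambda>\<omega>. euler_state \<Delta> (compensated_drift b g) g x0 (jump_sum \<omega>) k"
  let ?F = "F (real (Suc k) * \<Delta>)"
  have le: "0 \<le> real k * \<Delta>" "real k * \<Delta> \<le> real (Suc k) * \<Delta>" "0 < real (Suc k) * \<Delta>" using \<Delta> by auto
  have x: "(\<lambda>\<omega>. fst (?s \<omega>)) \<in> borel_measurable ?F" and y: "(\<lambda>\<omega>. snd (?s \<omega>)) \<in> borel_measurable ?F"
    using Suc borel_measurable_F_mono[OF _ le(1,2)] by auto
  have P: "(\<lambda>\<omega>. jump_sum \<omega> (real k * \<Delta>)) \<in> borel_measurable ?F"
    by (rule borel_measurable_F_mono[OF jump_sum_path_adapted[OF le(1)] le(1,2)])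
  have step: "(\<lambda>\<omega>. snd (?s \<omega>) + \<Delta> *\<^sub>R compensated_drift b g (fst (?s \<omega>)) + g (q \<omega> - jump_sum \<omega> (real k * \<Delta>)) (fst (?s \<omega>))) \<in> borel_measurable ?F"
    if "q \<in> borel_measurable ?F" for q
    by (intro borel_measurable_add y borel_measurable_scaleR borel_measurable_const measurable_compose[OF x C.measurable_drift]
        C.measurable_jump borel_measurable_diff that P x)
  show "(\<lambda>\<omega>. fst (euler_state \<Delta> (compensated_drift b g) g x0 (jump_sum \<omega>) (Suc k))) \<in> borel_measurable ?F"
    "(\<lambda>\<omega>. snd (euler_state \<Delta> (compensated_drift b g) g x0 (jump_sum \<omega>) (Suc k))) \<in> borel_measurable ?F"
    using step[OF jump_sum_left_lim_adapted[OF le(3)]] step[OF jump_sum_path_adapted[OF less_imp_le[OF le(3)]]]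
    by (simp_all add: case_prod_unfold)
qed simp_all

lemma euler_process_adapted:
  assumes t: "0 \<le> t"
  shows "euler_process t \<in> borel_measurable (F t)"
proof (cases "t = 0")
  case True
  then show ?thesis by (simp add: euler_process_def[abs_def])
next
  case False
  define k where "k = nat (\<lceil>t / \<Delta>\<rceil> - 1)"
  have "1 \<le> \<lceil>t / \<Delta>\<rceil>" using t False \<Delta> by (simp add: le_ceiling_iff)
  then have cl: "real k = of_int \<lceil>t / \<Delta>\<rceil> - 1" by (simp add: k_def)
  have "real k < t / \<Delta>" unfolding cl by linarith
  then have k: "0 \<le> real k * \<Delta>" "real k * \<Delta> \<le> t"
    using \<Delta> by (auto simp: pos_less_divide_eq)
  have x: "(\<lambda>\<omega>. fst (euler_state \<Delta> (compensated_drift b g) g x0 (jump_sum \<omega>) k)) \<in> borel_measurable (F t)"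
    and y: "(\<lambda>\<omega>. snd (euler_state \<Delta> (compensated_drift b g) g x0 (jump_sum \<omega>) k)) \<in> borel_measurable (F t)"
    using euler_state_adapted[of k] borel_measurable_F_mono[OF _ k] by auto
  have P: "(\<lambda>\<omega>. jump_sum \<omega> (real k * \<Delta>)) \<in> borel_measurable (F t)"
    by (rule borel_measurable_F_mono[OF jump_sum_path_adapted[OF k(1)] k])
  have "(\<lambda>\<omega>. snd (euler_state \<Delta> (compensated_drift b g) g x0 (jump_sum \<omega>) k)
      + (t - real k * \<Delta>) *\<^sub>R compensated_drift b g (fst (euler_state \<Delta> (compensated_drift b g) g x0 (jump_sum \<omega>) k))
      + g (jump_sum \<omega> t - jump_sum \<omega> (real k * \<Delta>)) (fst (euler_state \<Delta> (compensated_drift b g) g x0 (jump_sum \<omega>) k))) \<in> borel_measurable (F t)"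
    by (intro borel_measurable_add y borel_measurable_scaleR borel_measurable_const measurable_compose[OF x C.measurable_drift]
        C.measurable_jump borel_measurable_diff P x jump_sum_path_adapted t)
  then show ?thesis
    using t False by (simp add: euler_process_def[abs_def] euler_def k_def Let_def)
qed

text \<open>The grid is discrete, so the infimum is attained: if no grid point up to t is bad, the
  first candidate is the grid point strictly beyond t.\<close>

lemma euler_time_le_iff: "euler_time D \<omega> \<le> ereal t \<longleftrightarrow> (\<exists>k. real k * \<Delta> \<le> t \<and> frozen \<omega> k \<notin> D)"
proof
  assume "\<exists>k. real k * \<Delta> \<le> t \<and> frozen \<omega> k \<notin> D"
  then obtain k where k: "real k * \<Delta> \<le> t" "frozen \<omega> k \<notin> D" by blast
  then have "euler_time D \<omega> \<le> ereal (real k * \<Delta>)" unfolding euler_time_def by (intro Inf_lower) auto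
  also have "\<dots> \<le> ereal t" using k by simp
  finally show "euler_time D \<omega> \<le> ereal t" .
next
  assume le: "euler_time D \<omega> \<le> ereal t"
  show "\<exists>k. real k * \<Delta> \<le> t \<and> frozen \<omega> k \<notin> D"
  proof (rule ccontr)
    assume no: "\<not> (\<exists>k. real k * \<Delta> \<le> t \<and> frozen \<omega> k \<notin> D)"
    define j where "j = nat (\<lfloor>t / \<Delta>\<rfloor> + 1)"
    have j: "t < real j * \<Delta>"
    proof -
      have "t / \<Delta> < of_int (\<lfloor>t / \<Delta>\<rfloor> + 1)" by linarith
      also have "\<dots> \<le> real j" by (simp add: j_def)
      finally show ?thesis using \<Delta> by (simp add: pos_divide_less_eq)
    qed
    have "ereal (real j * \<Delta>) \<le> euler_time D \<omega>"
      unfolding euler_time_def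
    proof (rule Inf_greatest)
      fix x assume "x \<in> {ereal (real k * \<Delta>) | k. frozen \<omega> k \<notin> D}"
      then obtain k where k: "x = ereal (real k * \<Delta>)" "frozen \<omega> k \<notin> D" by blast
      then have "t < real k * \<Delta>" using no by force
      then have "t / \<Delta> < real k" using \<Delta> by (simp add: pos_divide_less_eq)
      then have "\<lfloor>t / \<Delta>\<rfloor> < int k" by (simp add: floor_less_iff)
      then have "j \<le> k" by (simp add: j_def nat_le_iff)
      then show "ereal (real j * \<Delta>) \<le> x" using k(1) \<Delta> by (simp add: mult_right_mono)
    qed
    also note le
    finally show False using j by simp
  qed
qed

lemma euler_time_markov:
  assumes D: "closed D"
  shows "markov_time M F (euler_time D)"
  unfolding markov_time_def
proof (intro conjI ballI allI impI)
  fix \<omega> show "0 \<le> euler_time D \<omega>"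
    unfolding euler_time_def using \<Delta> by (intro Inf_greatest) auto
next
  fix t :: real assume t: "0 \<le> t"
  have "{\<omega>\<in>space M. euler_time D \<omega> \<le> ereal t} = (\<Union>k\<in>{k. real k * \<Delta> \<le> t}. {\<omega>\<in>space M. frozen \<omega> k \<notin> D})"
    by (auto simp: euler_time_le_iff)
  also have "\<dots> \<in> sets (F t)"
  proof (rule sets.countable_UN'')
    fix k assume "k \<in> {k. real k * \<Delta> \<le> t}"
    then have k: "0 \<le> real k * \<Delta>" "real k * \<Delta> \<le> t" using \<Delta> by auto
    have "(\<lambda>\<omega>. frozen \<omega> k) \<in> borel_measurable (F t)"
      unfolding frozen_def using borel_measurable_F_mono[OF euler_state_adapted(1) k] .
    from measurable_sets[OF this, of "- D"] show "{\<omega>\<in>space M. frozen \<omega> k \<notin> D} \<in> sets (F t)"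
      using D space_F[OF t] by (simp add: vimage_def Int_def conj_commute)
  qed simp
  finally show "{\<omega>\<in>space M. euler_time D \<omega> \<le> ereal t} \<in> sets (F t)" .
qed

lemma euler_time_pos:
  assumes "x0 \<in> D"
  shows "0 < euler_time D \<omega>"
proof -
  have "\<not> euler_time D \<omega> \<le> ereal 0"
    unfolding euler_time_le_iff
  proof
    assume "\<exists>k. real k * \<Delta> \<le> 0 \<and> frozen \<omega> k \<notin> D"
    then obtain k where k: "real k * \<Delta> \<le> 0" "frozen \<omega> k \<notin> D" by blast
    have "k = 0" using k(1) \<Delta> by (cases k) (auto simp: mult_le_0_iff)
    then show False using k(2) assms by (simp add: frozen_def)
  qed
  then show ?thesis by (simp add: zero_ereal_def)
qed

lemma euler_process_path:
  assumes "jump_path (path \<omega>)"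
  shows "cadlag_on \<infinity> (\<lambda>t. euler_process t \<omega>)"
    and "left_lim (\<lambda>t. euler_process t \<omega>) (real k * \<Delta>) = frozen \<omega> k"
    and "0 \<le> t \<Longrightarrow> euler_process t \<omega> = x0 + path_integral (path \<omega>) (compensated_drift b g) g
      (\<lambda>z. left_lim (\<lambda>r. euler_process r \<omega>) (grid_left \<Delta> z)) 0 t"
proof -
  interpret jump_path "path \<omega>" by fact
  interpret path_coefficients "path \<omega>" "compensated_drift b g" g ..
  have eq: "(\<lambda>t. euler_process t \<omega>) = euler \<Delta> (compensated_drift b g) g x0 total_jump"
    by (simp add: euler_process_def fun_eq_iff)
  show "cadlag_on \<infinity> (\<lambda>t. euler_process t \<omega>)"
    unfolding eq by (rule C.cadlag_euler[OF \<Delta> cadlag_total_jump])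
  show "left_lim (\<lambda>t. euler_process t \<omega>) (real k * \<Delta>) = frozen \<omega> k"
    unfolding eq frozen_def by (rule C.left_lim_euler_grid[OF \<Delta> cadlag_total_jump])
  show "euler_process t \<omega> = x0 + path_integral (path \<omega>) (compensated_drift b g) g
      (\<lambda>z. left_lim (\<lambda>r. euler_process r \<omega>) (grid_left \<Delta> z)) 0 t" if "0 \<le> t"
    unfolding eq using euler_equation[OF \<Delta> that, of x0] by (simp add: euler_process_def)
qed

lemma euler_process_solves:
  assumes "closed D"
  shows "solves_equation M F L \<nu> b g D (grid_left \<Delta>) x0 (euler_time D) euler_process"
proof (rule solves_equationI[OF lin time_lag_grid[OF \<Delta>]])
  show "\<forall>t\<ge>0. (\<lambda>\<omega>. if ereal t < euler_time D \<omega> then euler_process t \<omega> else 0) \<in> borel_measurable (F t)"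
  proof (intro allI impI)
    fix t :: real assume t: "0 \<le> t"
    have "{\<omega>\<in>space M. euler_time D \<omega> \<le> ereal t} \<in> sets (F t)"
      using euler_time_markov[OF assms] t by (simp add: markov_time_def)
    then have "{\<omega>\<in>space (F t). euler_time D \<omega> \<le> ereal t} \<in> sets (F t)" using space_F[OF t] by simp
    then have "(\<lambda>\<omega>. if euler_time D \<omega> \<le> ereal t then 0 else euler_process t \<omega>) \<in> borel_measurable (F t)"
      using euler_process_adapted[OF t] by (intro measurable_If) auto
    also have "(\<lambda>\<omega>. if euler_time D \<omega> \<le> ereal t then 0 else euler_process t \<omega>) = (\<lambda>\<omega>. if ereal t < euler_time D \<omega> then euler_process t \<omega> else 0)"
      by (auto simp: fun_eq_iff not_less)
    finally show "(\<lambda>\<omega>. if ereal t < euler_time D \<omega> then euler_process t \<omega> else 0) \<in> borel_measurable (F t)" .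
  qed
  show "AE \<omega> in M. cadlag_on (euler_time D \<omega>) (\<lambda>t. euler_process t \<omega>)"
    using jump_path_AE by eventually_elim (rule cadlag_on_mono[OF euler_process_path(1)], auto)
  show "AE \<omega> in M. \<forall>t\<ge>0. ereal t < euler_time D \<omega> \<longrightarrow> (\<forall>z\<in>{0<..t}. left_lim (\<lambda>r. euler_process r \<omega>) (grid_left \<Delta> z) \<in> D) \<and>
      euler_process t \<omega> = x0 + path_integral (path \<omega>) (compensated_drift b g) g (\<lambda>z. left_lim (\<lambda>r. euler_process r \<omega>) (grid_left \<Delta> z)) 0 t"
    using jump_path_AE
  proof (eventually_elim, intro allI impI conjI ballI)
    fix \<omega> t z assume jp: "jump_path (path \<omega>)" and t: "0 \<le> t" "ereal t < euler_time D \<omega>"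
    show "euler_process t \<omega> = x0 + path_integral (path \<omega>) (compensated_drift b g) g (\<lambda>z. left_lim (\<lambda>r. euler_process r \<omega>) (grid_left \<Delta> z)) 0 t"
      by (rule euler_process_path(3)[OF jp t(1)])
    assume z: "z \<in> {0<..t}"
    then obtain k :: nat where k: "grid_left \<Delta> z = real k * \<Delta>" using grid_left_bounds(4)[OF \<Delta>, of z] by auto
    have "real k * \<Delta> \<le> t" using grid_left_bounds(2)[OF \<Delta>, of z] z k by auto
    then show "left_lim (\<lambda>r. euler_process r \<omega>) (grid_left \<Delta> z) \<in> D"
      unfolding k euler_process_path(2)[OF jp] using t(2) euler_time_le_iff[of D \<omega> t] by (auto simp: not_le[symmetric])
  qed
qed

text \<open>Stated for an arbitrary life time \<tau>: before it any solution must follow the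
  explicit recursion, since both satisfy the same pathwise equation.\<close>

lemma euler_process_unique:
  assumes Y: "solves_equation M F L \<nu> b g D (grid_left \<Delta>) x0 \<tau> Y"
  shows "AE \<omega> in M. \<forall>t\<ge>0. ereal t < \<tau> \<omega> \<longrightarrow> Y t \<omega> = euler_process t \<omega>"
  using solves_equation_pathwise[OF Y lin time_lag_grid[OF \<Delta>]] jump_path_AE
proof eventually_elim
  case (elim \<omega>)
  show ?case
  proof (intro allI impI)
    fix t assume t: "0 \<le> t" "ereal t < \<tau> \<omega>"
    show "Y t \<omega> = euler_process t \<omega>"
    proof (rule euler_equation_unique[where A = "\<lambda>t. ereal t < \<tau> \<omega>", OF \<Delta> _ _ _ _ _ t])
      show "ereal s < \<tau> \<omega>" if "ereal u < \<tau> \<omega>" "s \<le> u" for s u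
        using that by (auto intro: le_less_trans[of _ "ereal u"])
      show "Y u \<omega> = x0 + path_integral (path \<omega>) (compensated_drift b g) g (\<lambda>z. left_lim (\<lambda>r. Y r \<omega>) (grid_left \<Delta> z)) 0 u"
        if "0 \<le> u" "ereal u < \<tau> \<omega>" for u using elim(1) that by blast
      show "euler_process u \<omega> = x0 + path_integral (path \<omega>) (compensated_drift b g) g (\<lambda>z. left_lim (\<lambda>r. euler_process r \<omega>) (grid_left \<Delta> z)) 0 u"
        if "0 \<le> u" for u by (rule euler_process_path(3)[OF elim(2) that])
    qed simp_all
  qed
qed

end

text \<open>Composing the coefficients with a retraction \<open>c\<close> onto a region where they are Lipschitz
  gives globally Lipschitz coefficients; as the modified scheme converges uniformly, it eventually
  stays where \<open>c\<close> is the identity and then coincides with the original scheme.\<close>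

lemma euler_process_converges:
  fixes b :: "'e::euclidean_space \<Rightarrow> 'e" and g :: "'y \<Rightarrow> 'e \<Rightarrow> 'e"
  assumes lin: "linear_coefficients b g" and jp: "jump_path (path \<omega>)"
    and X: "cadlag_on \<tau> X" "ereal T < \<tau>" and T: "0 \<le> T"
    and eqX: "\<And>t. 0 \<le> t \<Longrightarrow> t \<le> T \<Longrightarrow> X t = x0 + path_integral (path \<omega>) (compensated_drift b g) g (left_lim X) 0 t"
    and B: "closed B" "\<And>t. 0 \<le> t \<Longrightarrow> t \<le> T \<Longrightarrow> X t \<in> B"
    and c: "continuous_on UNIV c" "0 < d" "\<And>x y. x \<in> B \<Longrightarrow> norm (x - y) \<le> d \<Longrightarrow> c y = y \<and> y \<in> D"
    and K: "0 \<le> K" and lip: "\<And>x x'. norm (compensated_drift b g (c x) - compensated_drift b g (c x')) \<le> K * norm (x - x')"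
      "\<And>x x' y. norm (g y (c x) - g y (c x')) \<le> K * (norm y * norm (x - x'))"
    and \<Delta>: "\<And>m. 0 < \<Delta> m" "\<Delta> \<longlonglongrightarrow> 0" and e: "0 < e"
  shows "eventually (\<lambda>m. ereal T < euler_time b g (\<Delta> m) x0 D \<omega> \<and>
    (\<forall>t\<in>{0..T}. norm (X t - euler_process b g (\<Delta> m) x0 t \<omega>) \<le> e)) sequentially"
proof -
  interpret jump_path "path \<omega>" by (rule jp)
  interpret C: linear_coefficients "compensated_drift b g" g by (rule linear_coefficients_compensated(1)[OF lin])
  interpret PC: path_coefficients "path \<omega>" "compensated_drift b g" g ..
  have cont: "continuous_on UNIV (\<lambda>x. compensated_drift b g (c x))" "continuous_on UNIV (\<lambda>(y, x). g y (c x))"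
  proof -
    show "continuous_on UNIV (\<lambda>x. compensated_drift b g (c x))"
      by (rule continuous_on_compose2[OF C.continuous_drift c(1)]) simp
    have "continuous_on UNIV (\<lambda>p::'y \<times> 'e. (fst p, c (snd p)))"
      by (intro continuous_on_Pair continuous_on_fst continuous_on_id continuous_on_compose2[OF c(1)] continuous_on_snd) auto
    from continuous_on_compose2[OF C.continuous_jump this]
    show "continuous_on UNIV (\<lambda>(y, x). g y (c x))" by (simp add: case_prod_unfold)
  qed
  interpret C': linear_coefficients "\<lambda>x. compensated_drift b g (c x)" "\<lambda>y x. g y (c x)"
    by (rule linear_coefficients.intro[OF cont C.linear_jump])
  interpret PC': path_coefficients "path \<omega>" "\<lambda>x. compensated_drift b g (c x)" "\<lambda>y x. g y (c x)" ..
  define Z where "Z m = euler (\<Delta> m) (\<lambda>x. compensated_drift b g (c x)) (\<lambda>y x. g y (c x)) x0 total_jump" for m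
  have cadZ: "cadlag_on \<infinity> (Z m)" for m unfolding Z_def by (rule C'.cadlag_euler[OF \<Delta>(1) cadlag_total_jump])
  have eqZ: "Z m t = x0 + PC'.integral_along (\<lambda>z. left_lim (Z m) (grid_left (\<Delta> m) z)) 0 t" if "0 \<le> t" for m t
    unfolding Z_def by (rule PC'.euler_equation[OF \<Delta>(1) that])
  have lt: "ereal t < \<tau>" if "t \<le> T" for t using that X(2) by (auto intro: le_less_trans[of _ "ereal T"])
  have leftB: "left_lim X t \<in> B" if "0 \<le> t" "t \<le> T" for t
    by (rule left_lim_closed[OF X(1) that(1) lt[OF that(2)] B(1)]) (use B(2) that in auto)
  have cB: "c x = x" if "x \<in> B" for x using c(3)[OF that, of x] c(2) by simp
  have eqX': "X t = x0 + PC'.integral_along (left_lim X) 0 t" if t: "0 \<le> t" "t \<le> T" for t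
  proof -
    have "path_integral (path \<omega>) (compensated_drift b g) g (left_lim X) 0 t = PC'.integral_along (left_lim X) 0 t"
      by (rule path_integral_cong) (use cB leftB t in auto)
    then show ?thesis using eqX[OF t] by simp
  qed
  \<comment> \<open>Accuracy e is the claim; accuracy d keeps the left limits of the modified scheme
    in the neighbourhood of \<open>B\<close> described by the assumption on c.\<close>
  have "eventually (\<lambda>m. \<forall>t\<in>{0..T}. norm (X t - Z m t) \<le> min e d) sequentially"
    by (rule PC'.euler_scheme_converges[OF X T K eqX' lip \<Delta> cadZ eqZ]) (use e c(2) in auto)
  then show ?thesis
  proof eventually_elim
    case (elim m)
    have left: "c (left_lim (Z m) t) = left_lim (Z m) t \<and> left_lim (Z m) t \<in> D" if t: "0 \<le> t" "t \<le> T" for t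
    proof (rule c(3)[OF leftB[OF t]])
      show "norm (left_lim X t - left_lim (Z m) t) \<le> d"
        by (rule left_lim_diff_le[OF X(1) cadZ t(1) lt[OF t(2)]]) (use elim t in auto)
    qed
    have eq: "Z m t = euler_process b g (\<Delta> m) x0 t \<omega>" if t: "0 \<le> t" "t \<le> T" for t
    proof (rule euler_equation_unique[where A = "\<lambda>t. t \<le> T", OF \<Delta>(1) _ _ _ _ _ t])
      show "Z m u = x0 + PC'.integral_along (\<lambda>z. left_lim (Z m) (grid_left (\<Delta> m) z)) 0 u" if "0 \<le> u" for u
        by (rule eqZ[OF that])
      show "euler_process b g (\<Delta> m) x0 u \<omega> = x0 + path_integral (path \<omega>) (compensated_drift b g) g
          (\<lambda>z. left_lim (\<lambda>r. euler_process b g (\<Delta> m) x0 r \<omega>) (grid_left (\<Delta> m) z)) 0 u" if "0 \<le> u" for u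
        by (rule euler_process_path(3)[OF lin \<Delta>(1) jp that])
      fix z assume z: "0 < z" "z \<le> T"
      have "c (left_lim (Z m) (grid_left (\<Delta> m) z)) = left_lim (Z m) (grid_left (\<Delta> m) z)"
        using left grid_left_bounds[OF \<Delta>(1) z(1), of m] z(2) by auto
      then show "compensated_drift b g (c (left_lim (Z m) (grid_left (\<Delta> m) z))) = compensated_drift b g (left_lim (Z m) (grid_left (\<Delta> m) z))"
        "g y (c (left_lim (Z m) (grid_left (\<Delta> m) z))) = g y (left_lim (Z m) (grid_left (\<Delta> m) z))" for y
        by simp_all
    qed auto
    have "frozen b g (\<Delta> m) x0 \<omega> k \<in> D" if k: "real k * \<Delta> m \<le> T" for k
    proof -
      have k0: "0 \<le> real k * \<Delta> m" using \<Delta>(1)[of m] by simp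
      have "left_lim (\<lambda>t. euler_process b g (\<Delta> m) x0 t \<omega>) (real k * \<Delta> m) = left_lim (Z m) (real k * \<Delta> m)"
        by (rule left_lim_cong[OF _ k0]) (use eq k in auto)
      then show ?thesis
        using left[OF k0 k] euler_process_path(2)[OF lin \<Delta>(1) jp, of m x0 k] by simp
    qed
    then have "\<not> euler_time b g (\<Delta> m) x0 D \<omega> \<le> ereal T" using euler_time_le_iff[OF lin \<Delta>(1)] by blast
    then show ?case using elim eq by auto
  qed
qed

end

section \<open>The model\<close>

text \<open>Boundedness is included because a product of Lipschitz functions is Lipschitz only when
  the factors are bounded.\<close>

definition bounded_lipschitz :: "'a::real_normed_vector set \<Rightarrow> ('a \<Rightarrow> real) \<Rightarrow> bool" where
  "bounded_lipschitz S f \<longleftrightarrow> (\<exists>B K. \<forall>x\<in>S. \<bar>f x\<bar> \<le> B \<and> (\<forall>y\<in>S. \<bar>f x - f y\<bar> \<le> K * norm (x - y)))"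

lemma bounded_lipschitzI:
  assumes "\<And>x. x \<in> S \<Longrightarrow> \<bar>f x\<bar> \<le> B" "\<And>x y. x \<in> S \<Longrightarrow> y \<in> S \<Longrightarrow> \<bar>f x - f y\<bar> \<le> K * norm (x - y)"
  shows "bounded_lipschitz S f"
  using assms unfolding bounded_lipschitz_def by blast

lemma bounded_lipschitz_const: "bounded_lipschitz S (\<lambda>_. c)"
  by (rule bounded_lipschitzI[of _ _ "\<bar>c\<bar>" 0]) auto

lemma bounded_lipschitz_add:
  assumes "bounded_lipschitz S f" "bounded_lipschitz S g"
  shows "bounded_lipschitz S (\<lambda>x. f x + g x)"
proof -
  obtain B K where f: "\<And>x. x \<in> S \<Longrightarrow> \<bar>f x\<bar> \<le> B" "\<And>x y. x \<in> S \<Longrightarrow> y \<in> S \<Longrightarrow> \<bar>f x - f y\<bar> \<le> K * norm (x - y)"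
    using assms(1) unfolding bounded_lipschitz_def by blast
  obtain B' K' where g: "\<And>x. x \<in> S \<Longrightarrow> \<bar>g x\<bar> \<le> B'" "\<And>x y. x \<in> S \<Longrightarrow> y \<in> S \<Longrightarrow> \<bar>g x - g y\<bar> \<le> K' * norm (x - y)"
    using assms(2) unfolding bounded_lipschitz_def by blast
  show ?thesis
  proof (rule bounded_lipschitzI[of _ _ "B + B'" "K + K'"])
    show "\<bar>f x + g x\<bar> \<le> B + B'" if "x \<in> S" for x using f(1)[OF that] g(1)[OF that] by linarith
    show "\<bar>f x + g x - (f y + g y)\<bar> \<le> (K + K') * norm (x - y)" if "x \<in> S" "y \<in> S" for x y
      using f(2)[OF that] g(2)[OF that] unfolding distrib_right by linarith
  qed
qed

lemma bounded_lipschitz_mult: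
  assumes "bounded_lipschitz S f" "bounded_lipschitz S g"
  shows "bounded_lipschitz S (\<lambda>x. f x * g x)"
proof -
  obtain B K where f: "\<And>x. x \<in> S \<Longrightarrow> \<bar>f x\<bar> \<le> B" "\<And>x y. x \<in> S \<Longrightarrow> y \<in> S \<Longrightarrow> \<bar>f x - f y\<bar> \<le> K * norm (x - y)"
    using assms(1) unfolding bounded_lipschitz_def by blast
  obtain B' K' where g: "\<And>x. x \<in> S \<Longrightarrow> \<bar>g x\<bar> \<le> B'" "\<And>x y. x \<in> S \<Longrightarrow> y \<in> S \<Longrightarrow> \<bar>g x - g y\<bar> \<le> K' * norm (x - y)"
    using assms(2) unfolding bounded_lipschitz_def by blast
  show ?thesis
  proof (rule bounded_lipschitzI[of _ _ "B * B'" "B * K' + K * B'"])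
    show "\<bar>f x * g x\<bar> \<le> B * B'" if "x \<in> S" for x
      unfolding abs_mult using f(1)[OF that] g(1)[OF that] by (intro mult_mono) auto
    show "\<bar>f x * g x - f y * g y\<bar> \<le> (B * K' + K * B') * norm (x - y)" if "x \<in> S" "y \<in> S" for x y
    proof -
      have "f x * g x - f y * g y = f x * (g x - g y) + (f x - f y) * g y" by (simp add: algebra_simps)
      then have "\<bar>f x * g x - f y * g y\<bar> \<le> \<bar>f x\<bar> * \<bar>g x - g y\<bar> + \<bar>f x - f y\<bar> * \<bar>g y\<bar>"
        by (metis abs_mult abs_triangle_ineq)
      also have "\<dots> \<le> B * (K' * norm (x - y)) + (K * norm (x - y)) * B'"
        using f(1)[OF that(1)] f(2)[OF that] g(1)[OF that(2)] g(2)[OF that]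
        by (intro add_mono mult_mono) auto
      finally show ?thesis by (simp add: algebra_simps)
    qed
  qed
qed

lemma bounded_lipschitz_diff:
  assumes "bounded_lipschitz S f" "bounded_lipschitz S g"
  shows "bounded_lipschitz S (\<lambda>x. f x - g x)"
  using bounded_lipschitz_add[OF assms(1) bounded_lipschitz_mult[OF bounded_lipschitz_const[of S "-1"] assms(2)]] by simp

lemma bounded_lipschitz_component:
  assumes "0 < n"
  shows "bounded_lipschitz (box4 n) (\<lambda>x. x $ i)"
proof (rule bounded_lipschitzI[of _ _ "real n" 1])
  show "\<bar>x $ i\<bar> \<le> real n" if "x \<in> box4 n" for x
  proof -
    have "0 \<le> 1 / real n" by simp
    also have "\<dots> \<le> x $ i" using that by (simp add: box4_def)
    finally show ?thesis using that by (simp add: box4_def)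
  qed
  show "\<bar>x $ i - y $ i\<bar> \<le> 1 * norm (x - y)" for x y :: "real^4"
    using component_le_norm_cart[of "x - y" i] by simp
qed

text \<open>The difference of the roots is the difference of the arguments divided by the sum of the
  roots, and that sum is at least 1 / \<open>sqrt (real n)\<close> on the box; the constant blows up
  as the box approaches the boundary.\<close>

lemma bounded_lipschitz_sqrt_component:
  assumes "0 < n"
  shows "bounded_lipschitz (box4 n) (\<lambda>x. sqrt (x $ i))"
proof (rule bounded_lipschitzI[of _ _ "sqrt (real n)" "sqrt (real n)"])
  have pos: "0 < x $ i" "1 / real n \<le> x $ i" if "x \<in> box4 n" for x
  proof -
    have "0 < 1 / real n" using assms by simp
    also show "\<dots> \<le> x $ i" using that by (simp add: box4_def)
    finally show "0 < x $ i" .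
  qed
  show "\<bar>sqrt (x $ i)\<bar> \<le> sqrt (real n)" if "x \<in> box4 n" for x
    using pos[OF that] that by (simp add: box4_def)
  show "\<bar>sqrt (x $ i) - sqrt (y $ i)\<bar> \<le> sqrt (real n) * norm (x - y)" if "x \<in> box4 n" "y \<in> box4 n" for x y
  proof -
    have sx: "1 / sqrt (real n) \<le> sqrt (x $ i)"
      using real_sqrt_le_mono[OF pos(2)[OF that(1)]] by (simp add: real_sqrt_divide)
    have "0 < 1 / sqrt (real n)" using assms by simp
    have "(sqrt (x $ i) - sqrt (y $ i)) * (sqrt (x $ i) + sqrt (y $ i)) = x $ i - y $ i"
      using pos[OF that(1)] pos[OF that(2)] by (simp add: algebra_simps)
    then have "\<bar>(sqrt (x $ i) - sqrt (y $ i)) * (sqrt (x $ i) + sqrt (y $ i))\<bar> = \<bar>x $ i - y $ i\<bar>" by simp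
    moreover have "0 \<le> sqrt (x $ i) + sqrt (y $ i)"
      using pos(1)[OF that(1)] pos(1)[OF that(2)] by simp
    ultimately have "\<bar>sqrt (x $ i) - sqrt (y $ i)\<bar> * (sqrt (x $ i) + sqrt (y $ i)) = \<bar>x $ i - y $ i\<bar>"
      by (simp only: abs_mult abs_of_nonneg)
    moreover have "\<bar>sqrt (x $ i) - sqrt (y $ i)\<bar> * (1 / sqrt (real n)) \<le> \<bar>sqrt (x $ i) - sqrt (y $ i)\<bar> * (sqrt (x $ i) + sqrt (y $ i))"
      using sx pos[OF that(2)] by (intro mult_left_mono) (auto intro: add_increasing2)
    ultimately have "\<bar>sqrt (x $ i) - sqrt (y $ i)\<bar> * (1 / sqrt (real n)) \<le> norm (x - y)"
      using component_le_norm_cart[of "x - y" i] by simp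
    then show ?thesis using assms by (simp add: field_simps)
  qed
qed

text \<open>In this form the standard continuity rules apply to vectors given by their
  entries.\<close>

lemma vector_4_axis:
  "(vector [a, b, c, d] :: real^4) = a *\<^sub>R axis 1 1 + b *\<^sub>R axis 2 1 + c *\<^sub>R axis 3 1 + d *\<^sub>R axis 4 1"
  by (simp add: vec_eq_iff forall_4 axis_def)

lemma lipschitz_vector_4:
  fixes f :: "real^4 \<Rightarrow> real^4"
  assumes "\<And>i. bounded_lipschitz S (\<lambda>x. f x $ i)"
  obtains K where "0 \<le> K" "\<And>x y. x \<in> S \<Longrightarrow> y \<in> S \<Longrightarrow> norm (f x - f y) \<le> K * norm (x - y)"
proof -
  have "\<forall>i. \<exists>K. \<forall>x\<in>S. \<forall>y\<in>S. \<bar>f x $ i - f y $ i\<bar> \<le> K * norm (x - y)"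
    using assms unfolding bounded_lipschitz_def by meson
  from choice[OF this] obtain K where K: "\<And>i x y. x \<in> S \<Longrightarrow> y \<in> S \<Longrightarrow> \<bar>f x $ i - f y $ i\<bar> \<le> K i * norm (x - y)" by blast
  have "norm (f x - f y) \<le> (\<Sum>i\<in>UNIV. \<bar>K i\<bar>) * norm (x - y)" if "x \<in> S" "y \<in> S" for x y
  proof -
    have "norm (f x - f y) \<le> (\<Sum>i\<in>UNIV. \<bar>(f x - f y) $ i\<bar>)" by (rule norm_le_l1_cart)
    also have "\<dots> \<le> (\<Sum>i\<in>UNIV. \<bar>K i\<bar> * norm (x - y))"
    proof (rule sum_mono)
      fix i :: 4
      have "\<bar>(f x - f y) $ i\<bar> \<le> K i * norm (x - y)" using K[OF that, of i] by simp
      also have "\<dots> \<le> \<bar>K i\<bar> * norm (x - y)" by (intro mult_right_mono) auto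
      finally show "\<bar>(f x - f y) $ i\<bar> \<le> \<bar>K i\<bar> * norm (x - y)" .
    qed
    finally show ?thesis by (simp add: sum_distrib_right)
  qed
  then show ?thesis using that[of "\<Sum>i\<in>UNIV. \<bar>K i\<bar>"] by (simp add: sum_nonneg)
qed

text \<open>Expanding the mark in the basis leaves finitely many Lipschitz constants, one per basis
  vector; their sum works for all marks after multiplication by \<open>norm y\<close>.\<close>

lemma lipschitz_linear_family:
  fixes g :: "'y::euclidean_space \<Rightarrow> 'e::real_normed_vector \<Rightarrow> 'f::real_normed_vector"
  assumes lin: "\<And>x. linear (\<lambda>y. g y x)"
    and lip: "\<forall>y. \<exists>K. \<forall>x\<in>S. \<forall>x'\<in>S. norm (g y x - g y x') \<le> K * norm (x - x')"
  obtains K where "0 \<le> K" "\<And>x x' y. x \<in> S \<Longrightarrow> x' \<in> S \<Longrightarrow> norm (g y x - g y x') \<le> K * (norm y * norm (x - x'))"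
proof -
  from choice[OF lip] obtain K where K: "\<And>y x x'. x \<in> S \<Longrightarrow> x' \<in> S \<Longrightarrow> norm (g y x - g y x') \<le> K y * norm (x - x')" by blast
  have "norm (g y x - g y x') \<le> (\<Sum>e\<in>Basis. \<bar>K e\<bar>) * (norm y * norm (x - x'))" if "x \<in> S" "x' \<in> S" for x x' y
  proof -
    have ex: "g y x = (\<Sum>e\<in>Basis. (y \<bullet> e) *\<^sub>R g e x)" for x
      using linear_sum[OF lin[of x], of "\<lambda>e. (y \<bullet> e) *\<^sub>R e" Basis]
      by (simp add: euclidean_representation linear_scale[OF lin[of x]])
    have "g y x - g y x' = (\<Sum>e\<in>Basis. (y \<bullet> e) *\<^sub>R (g e x - g e x'))"
      unfolding ex[of x] ex[of x'] by (simp add: sum_subtractf scaleR_diff_right)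
    also have "norm \<dots> \<le> (\<Sum>e\<in>Basis. norm y * (\<bar>K e\<bar> * norm (x - x')))"
    proof (rule sum_norm_le)
      fix e :: 'y assume e: "e \<in> Basis"
      have "norm (g e x - g e x') \<le> \<bar>K e\<bar> * norm (x - x')"
        using K[OF that, of e] mult_right_mono[OF abs_ge_self norm_ge_zero, of "K e" "x - x'"] by linarith
      then show "norm ((y \<bullet> e) *\<^sub>R (g e x - g e x')) \<le> norm y * (\<bar>K e\<bar> * norm (x - x'))"
        using Basis_le_norm[OF e, of y] by (simp add: mult_mono)
    qed
    also have "\<dots> = (\<Sum>e\<in>Basis. \<bar>K e\<bar>) * (norm y * norm (x - x'))"
      by (simp add: sum_distrib_left sum_distrib_right ac_simps)
    finally show ?thesis .
  qed
  then show ?thesis using that[of "\<Sum>e\<in>Basis. \<bar>K e\<bar>"] by (simp add: sum_nonneg)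
qed

text \<open>The function \<open>sqrt\<close> is total and continuous on the reals, so the
  coefficients are continuous on the whole space and not only on
  \<open>coeff_domain\<close>.\<close>

lemma linear_coefficients_model:
  "linear_coefficients (drift_coeff \<kappa>v \<kappa>d \<kappa>f av ad af \<sigma>f \<rho>sf) (jump_coeff \<theta>s \<theta>v \<theta>d \<theta>f \<sigma>v \<sigma>d \<sigma>f H)"
proof (rule linear_coefficients.intro)
  have comp: "continuous_on UNIV (\<lambda>x. f x $ i)" if "continuous_on UNIV f" for f :: "'z::topological_space \<Rightarrow> real^4" and i
    unfolding cart_eq_inner_axis by (intro continuous_intros that)
  show "continuous_on UNIV (drift_coeff \<kappa>v \<kappa>d \<kappa>f av ad af \<sigma>f \<rho>sf)"
    unfolding drift_coeff_def[abs_def] vector_4_axis by (intro continuous_intros comp)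
  show "continuous_on UNIV (\<lambda>(y, x). jump_coeff \<theta>s \<theta>v \<theta>d \<theta>f \<sigma>v \<sigma>d \<sigma>f H y x)"
    unfolding jump_coeff_def case_prod_unfold vector_4_axis by (intro continuous_intros comp)
  show "linear (\<lambda>y. jump_coeff \<theta>s \<theta>v \<theta>d \<theta>f \<sigma>v \<sigma>d \<sigma>f H y x)" for x
    by (rule linearI) (auto simp: jump_coeff_def case_prod_unfold vec_eq_iff forall_4 algebra_simps)
qed

lemma bounded_lipschitz_drift:
  assumes "0 < n"
  shows "bounded_lipschitz (box4 n) (\<lambda>x. drift_coeff \<kappa>v \<kappa>d \<kappa>f av ad af \<sigma>f \<rho>sf x $ i)"
proof -
  note r = bounded_lipschitz_add bounded_lipschitz_mult bounded_lipschitz_diff bounded_lipschitz_const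
    bounded_lipschitz_component[OF assms] bounded_lipschitz_sqrt_component[OF assms]
  have "\<forall>i. bounded_lipschitz (box4 n) (\<lambda>x. drift_coeff \<kappa>v \<kappa>d \<kappa>f av ad af \<sigma>f \<rho>sf x $ i)"
    unfolding forall_4 drift_coeff_def vector_4 real_sqrt_mult by (intro conjI r)
  then show ?thesis ..
qed

lemma bounded_lipschitz_jump:
  assumes "0 < n"
  shows "bounded_lipschitz (box4 n) (\<lambda>x. jump_coeff \<theta>s \<theta>v \<theta>d \<theta>f \<sigma>v \<sigma>d \<sigma>f H y x $ i)"
proof -
  note r = bounded_lipschitz_add bounded_lipschitz_mult bounded_lipschitz_diff bounded_lipschitz_const
    bounded_lipschitz_component[OF assms] bounded_lipschitz_sqrt_component[OF assms]
  have "\<forall>i. bounded_lipschitz (box4 n) (\<lambda>x. jump_coeff \<theta>s \<theta>v \<theta>d \<theta>f \<sigma>v \<sigma>d \<sigma>f H y x $ i)"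
    unfolding forall_4 jump_coeff_def case_prod_unfold vector_4 by (intro conjI r)
  then show ?thesis ..
qed

section \<open>Boxes, cut-offs and exit times\<close>

lemma closed_box4: "closed (box4 n)"
proof -
  have "box4 n = cbox (\<chi> i. 1 / real n) (\<chi> i. real n)" by (auto simp: box4_def mem_box_cart)
  then show ?thesis by (simp only: closed_cbox)
qed

lemma closed_coeff_domain: "closed coeff_domain"
  unfolding coeff_domain_def cart_eq_inner_axis
  by (intro closed_Collect_conj closed_Collect_le continuous_intros)

lemma box4_mono: "0 < n \<Longrightarrow> n \<le> m \<Longrightarrow> box4 n \<subseteq> box4 m"
proof
  fix x assume n: "0 < n" "n \<le> m" and x: "x \<in> box4 n"
  have "1 / real m \<le> 1 / real n" "real n \<le> real m" using n by (auto simp: frac_le)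
  then show "x \<in> box4 m" using x unfolding box4_def by (auto intro: order_trans)
qed

text \<open>The radius is the gap between the lower faces of consecutive boxes; the upper faces are
  1 apart, which is at least as much.\<close>

lemma box4_neighbourhood:
  assumes "0 < n" "x \<in> box4 n" "norm (x - y) \<le> 1 / real n - 1 / real (Suc n)"
  shows "y \<in> box4 (Suc n)" "y \<in> coeff_domain"
proof -
  have d: "\<bar>x $ i - y $ i\<bar> \<le> 1 / real n - 1 / real (Suc n)" for i
    using component_le_norm_cart[of "x - y" i] assms(3) by simp
  have "1 / real n - 1 / real (Suc n) \<le> 1"
  proof -
    have "1 / real n \<le> 1" using assms(1) by simp
    moreover have "0 \<le> 1 / real (Suc n)" by simp
    ultimately show ?thesis by linarith
  qed
  then have y: "1 / real (Suc n) \<le> y $ i" "y $ i \<le> real (Suc n)" for i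
    using d[of i] assms(2) by (auto simp: box4_def abs_le_iff dest!: spec[of _ i])
  then show "y \<in> box4 (Suc n)" by (simp add: box4_def)
  have "0 \<le> y $ i" for i using y(1)[of i] by (rule order_trans[rotated]) simp
  then show "y \<in> coeff_domain" by (simp add: coeff_domain_def)
qed

text \<open>The projection onto the box, the retraction through which the coefficients of the model
  become globally Lipschitz.\<close>

definition clamp4 :: "nat \<Rightarrow> real^4 \<Rightarrow> real^4" where
  "clamp4 n = clamp (\<chi> i. 1 / real n) (\<chi> i. real n)"

lemma clamp4_props:
  assumes "0 < n"
  shows "clamp4 n x \<in> box4 n" "x \<in> box4 n \<Longrightarrow> clamp4 n x = x" "norm (clamp4 n x - clamp4 n y) \<le> norm (x - y)"
    "continuous_on UNIV (clamp4 n)"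
proof -
  let ?a = "(\<chi> i. 1 / real n) :: real^4" and ?b = "(\<chi> i. real n) :: real^4"
  have box: "box4 n = cbox ?a ?b" by (auto simp: box4_def mem_box_cart)
  have "1 / real n \<le> 1" "1 \<le> real n" using assms by auto
  then have "1 / real n \<le> real n" by linarith
  then have "?a \<bullet> i \<le> ?b \<bullet> i" if "i \<in> Basis" for i
    using that by (auto simp: Basis_vec_def inner_axis)
  then show "clamp4 n x \<in> box4 n" unfolding clamp4_def box by (rule clamp_in_interval)
  show "x \<in> box4 n \<Longrightarrow> clamp4 n x = x" unfolding clamp4_def box by (rule clamp_cancel_cbox)
  show le: "norm (clamp4 n x - clamp4 n y) \<le> norm (x - y)" for x y
    using dist_clamps_le_dist_args[of ?a ?b x y] by (simp add: clamp4_def dist_norm)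
  show "continuous_on UNIV (clamp4 n)"
    unfolding continuous_on_iff dist_norm using le by (blast intro: le_less_trans)
qed

lemma linear_coefficients_cutoff:
  assumes "linear_coefficients b g" "cutoff n \<psi>"
  shows "linear_coefficients (\<lambda>x. cutoff4 \<psi> x *\<^sub>R b x) (\<lambda>y x. cutoff4 \<psi> x *\<^sub>R g y x)"
proof -
  interpret linear_coefficients b g by fact
  have "(deriv ^^ 0) \<psi> differentiable_on UNIV" using assms(2) unfolding cutoff_def by blast
  then have "continuous_on UNIV \<psi>" by (simp add: differentiable_imp_continuous_on)
  then have \<psi>: "continuous_on UNIV (\<lambda>x. \<psi> (x $ i))" for i :: 4
    using continuous_on_compose2[of UNIV \<psi> UNIV "\<lambda>x. x \<bullet> axis i 1"]
    by (simp add: cart_eq_inner_axis continuous_on_inner)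
  then have c: "continuous_on UNIV (cutoff4 \<psi>)"
    unfolding cutoff4_def[abs_def] by (intro continuous_on_prod) auto
  show ?thesis
  proof (rule linear_coefficients.intro)
    show "continuous_on UNIV (\<lambda>x. cutoff4 \<psi> x *\<^sub>R b x)" by (intro continuous_on_scaleR c continuous_drift)
    have "continuous_on UNIV (\<lambda>p. cutoff4 \<psi> (snd p) *\<^sub>R g (fst p) (snd p))"
      using continuous_jump continuous_on_compose2[OF c continuous_on_snd[OF continuous_on_id]]
      by (intro continuous_on_scaleR) (auto simp: case_prod_unfold)
    then show "continuous_on UNIV (\<lambda>(y, x). cutoff4 \<psi> x *\<^sub>R g y x)" by (simp add: case_prod_unfold)
    show "linear (\<lambda>y. cutoff4 \<psi> x *\<^sub>R g y x)" for x
      by (rule linear_compose_scale_right[OF linear_jump])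
  qed
qed

lemma cutoff4_eq_1: "cutoff n \<psi> \<Longrightarrow> x \<in> box4 n \<Longrightarrow> cutoff4 \<psi> x = 1"
  unfolding cutoff_def cutoff4_def box4_def by (intro prod.neutral) auto

lemma less_exit_time_imp:
  assumes "ereal t < exit_time B f" "0 \<le> t"
  shows "f t \<in> B"
proof (rule ccontr)
  assume "f t \<notin> B"
  then have "exit_time B f \<le> ereal t"
    unfolding exit_time_def using assms(2) by (intro Inf_lower) auto
  then show False using assms(1) by simp
qed

text \<open>If the later exit came first, the two localized solutions would agree before and, their
  coefficients agreeing on the smaller box, also at that time; the process would then still be in
  the smaller box and could not leave the larger one immediately.\<close>

lemma exit_time_box4_mono:
  assumes n: "0 < n" and X: "cadlag_on \<infinity> X" and Y: "cadlag_on \<infinity> Y"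
    and eqX: "\<And>t. 0 \<le> t \<Longrightarrow> X t = x0 + path_integral f b g (left_lim X) 0 t"
    and eqY: "\<And>t. 0 \<le> t \<Longrightarrow> Y t = x0 + path_integral f b' g' (left_lim Y) 0 t"
    and coeff: "\<And>x. x \<in> box4 n \<Longrightarrow> b x = b' x" "\<And>x y. x \<in> box4 n \<Longrightarrow> g y x = g' y x"
    and agree: "\<And>t. 0 \<le> t \<Longrightarrow> ereal t < exit_time (box4 n) X \<Longrightarrow> ereal t < exit_time (box4 (Suc n)) Y \<Longrightarrow> X t = Y t"
  shows "exit_time (box4 n) X \<le> exit_time (box4 (Suc n)) Y"
proof (rule ccontr)
  assume "\<not> ?thesis"
  then have less: "exit_time (box4 (Suc n)) Y < exit_time (box4 n) X" by simp
  have "0 \<le> exit_time (box4 (Suc n)) Y" unfolding exit_time_def by (intro Inf_greatest) auto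
  moreover have "exit_time (box4 (Suc n)) Y \<noteq> \<infinity>" using less by auto
  ultimately obtain s where s: "exit_time (box4 (Suc n)) Y = ereal s" "0 \<le> s"
    by (cases "exit_time (box4 (Suc n)) Y") auto
  have before: "X u = Y u" "X u \<in> box4 n" if "0 \<le> u" "u < s" for u
  proof -
    have u: "ereal u < exit_time (box4 (Suc n)) Y" using that s by simp
    then have u': "ereal u < exit_time (box4 n) X" using less by (rule less_trans)
    show "X u = Y u" by (rule agree[OF that(1) u' u])
    show "X u \<in> box4 n" by (rule less_exit_time_imp[OF u' that(1)])
  qed
  have "path_integral f b g (left_lim X) 0 s = path_integral f b' g' (left_lim Y) 0 s"
  proof (rule path_integral_cong)
    fix z assume z: "0 < z" "z \<le> s"
    have "left_lim X z = left_lim Y z" by (rule left_lim_cong) (use before z in auto)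
    moreover have "left_lim X z \<in> box4 n"
      by (rule left_lim_closed[OF X _ _ closed_box4]) (use before z in auto)
    ultimately show "b (left_lim X z) = b' (left_lim Y z)" "g y (left_lim X z) = g' y (left_lim Y z)" for y
      using coeff by simp_all
  qed
  then have "X s = Y s" using eqX[OF s(2)] eqY[OF s(2)] by simp
  moreover have "X s \<in> box4 n" by (rule less_exit_time_imp[OF _ s(2)]) (use less s in simp)
  ultimately have Ys: "Y s \<in> box4 n" by simp
  have "0 < 1 / real n - 1 / real (Suc n)" using n by (simp add: frac_less2)
  from cadlag_on_local[OF Y s(2) _ this] obtain d where d: "0 < d"
    "\<And>u. 0 \<le> u \<Longrightarrow> s - d < u \<Longrightarrow> u < s \<Longrightarrow> norm (Y u - left_lim Y s) < 1 / real n - 1 / real (Suc n)"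
    "\<And>u. s \<le> u \<Longrightarrow> u < s + d \<Longrightarrow> norm (Y u - Y s) < 1 / real n - 1 / real (Suc n)" by auto
  have "ereal (s + d) \<le> exit_time (box4 (Suc n)) Y"
    unfolding exit_time_def
  proof (rule Inf_greatest)
    fix x assume "x \<in> ereal ` {t. 0 \<le> t \<and> Y t \<notin> box4 (Suc n)}"
    then obtain t where t: "x = ereal t" "0 \<le> t" "Y t \<notin> box4 (Suc n)" by blast
    have "s \<le> t" using less_exit_time_imp[of t "box4 (Suc n)" Y] t s by (force simp: not_less[symmetric])
    moreover have "\<not> t < s + d"
    proof
      assume "t < s + d"
      from box4_neighbourhood(1)[OF n Ys, of "Y t"] d(3)[OF \<open>s \<le> t\<close> this] t(3)
      show False by (simp add: norm_minus_commute)
    qed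
    ultimately show "ereal (s + d) \<le> x" using t(1) by simp
  qed
  then show False using s d(1) by simp
qed

theorem theorem4p8:
  fixes M :: "'w measure" and F :: "real \<Rightarrow> 'w measure"
    and W Wbar :: "real \<Rightarrow> 'w \<Rightarrow> real^4" and \<gamma> :: "real \<Rightarrow> 'w \<Rightarrow> real"
    and L :: "real \<Rightarrow> 'w \<Rightarrow> real \<times> (real^4)"
    and \<Sigma> H :: "real^4^4"
    and \<rho>sv \<rho>sd \<rho>sf \<rho>vd \<rho>vf \<rho>df \<alpha> \<beta> :: real
    and \<kappa>v \<kappa>d \<kappa>f av ad af \<sigma>v \<sigma>d \<sigma>f \<theta>s \<theta>v \<theta>d \<theta>f :: real
    and b :: "real^4 \<Rightarrow> real^4" and g :: "real \<times> (real^4) \<Rightarrow> real^4 \<Rightarrow> real^4"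
    and X0 :: "real^4" and n0 :: nat and \<psi> :: "nat \<Rightarrow> real \<Rightarrow> real"
    and Xn :: "nat \<Rightarrow> real \<Rightarrow> 'w \<Rightarrow> real^4" and \<tau>X :: "nat \<Rightarrow> 'w \<Rightarrow> ereal"
    and \<tau>lim :: "'w \<Rightarrow> ereal" and X :: "real \<Rightarrow> 'w \<Rightarrow> real^4"
    and \<delta>t :: real and \<eta> :: "nat \<Rightarrow> real \<Rightarrow> real"
  assumes "complete_filtered_prob_space M F"
    \<comment> \<open>driving noise\<close>
    and "\<Sigma> = correlation_matrix \<rho>sv \<rho>sd \<rho>sf \<rho>vd \<rho>vf \<rho>df" and "positive_definite \<Sigma>"
    and "brownian_motion M \<Sigma> W"
    and "cholesky_factor H \<Sigma>"
    and "Wbar = (\<lambda>t \<omega>. matrix_inv H *v W t \<omega>)"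
    and "0 < \<alpha>" and "0 < \<beta>" and "gamma_subordinator M F \<alpha> \<beta> \<gamma>"
    and "independent_processes M \<gamma> W"
    and "L = (\<lambda>t \<omega>. (\<gamma> t \<omega>, Wbar (\<gamma> t \<omega>) \<omega>))" and "levy_process M F L"
    \<comment> \<open>coefficients\<close>
    and "0 < \<kappa>v" and "0 < \<kappa>d" and "0 < \<kappa>f" and "0 < av" and "0 < ad" and "0 < af"
    and "0 < \<sigma>v" and "0 < \<sigma>d" and "0 < \<sigma>f"
    and "0 \<le> \<theta>s" and "0 \<le> \<theta>v" and "0 \<le> \<theta>d" and "0 \<le> \<theta>f"
    and "b = drift_coeff \<kappa>v \<kappa>d \<kappa>f av ad af \<sigma>f \<rho>sf"
    and "g = jump_coeff \<theta>s \<theta>v \<theta>d \<theta>f \<sigma>v \<sigma>d \<sigma>f H"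
    \<comment> \<open>initial datum and localization\<close>
    and "\<forall>i. 0 < X0$i" and "X0 \<in> box4 n0"
    and "\<forall>n\<ge>n0. cutoff n (\<psi> n)"
    and "\<forall>n\<ge>n0. solves_equation M F L (nu4 \<alpha> \<beta>)
           (\<lambda>x. cutoff4 (\<psi> n) x *\<^sub>R b x) (\<lambda>y x. cutoff4 (\<psi> n) x *\<^sub>R g y x)
           UNIV (\<lambda>z. z) X0 (\<lambda>\<omega>. \<infinity>) (Xn n)"
    and "\<tau>X = (\<lambda>n \<omega>. exit_time (box4 n) (\<lambda>t. Xn n t \<omega>))"
    and "\<tau>lim = (\<lambda>\<omega>. lim (\<lambda>n. \<tau>X n \<omega>))"
    and "solves_equation M F L (nu4 \<alpha> \<beta>) b g coeff_domain (\<lambda>z. z) X0 \<tau>lim X"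
    and "AE \<omega> in M. \<forall>n\<ge>n0. \<forall>t\<ge>0. ereal t < \<tau>X n \<omega> \<longrightarrow> X t \<omega> = Xn n t \<omega>"
    \<comment> \<open>time grid\<close>
    and "0 < \<delta>t" and "\<eta> = (\<lambda>m. grid_left (\<delta>t / (real m)\<^sup>2))"
  shows "\<exists>\<tau> :: nat \<Rightarrow> 'w \<Rightarrow> ereal.
    (\<forall>m\<ge>1.
       markov_time M F (\<tau> m) \<and> measure M {\<omega>\<in>space M. 0 < \<tau> m \<omega>} = 1 \<and>
       (\<exists>Y. solves_equation M F L (nu4 \<alpha> \<beta>) b g coeff_domain (\<eta> m) X0 (\<tau> m) Y) \<and>
       (\<forall>Y Y'. solves_equation M F L (nu4 \<alpha> \<beta>) b g coeff_domain (\<eta> m) X0 (\<tau> m) Y \<longrightarrow>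
          solves_equation M F L (nu4 \<alpha> \<beta>) b g coeff_domain (\<eta> m) X0 (\<tau> m) Y' \<longrightarrow>
          (AE \<omega> in M. \<forall>t\<ge>0. ereal t < \<tau> m \<omega> \<longrightarrow> Y t \<omega> = Y' t \<omega>))) \<and>
    (\<forall>Xm. (\<forall>m\<ge>1. solves_equation M F L (nu4 \<alpha> \<beta>) b g coeff_domain (\<eta> m) X0 (\<tau> m) (Xm m)) \<longrightarrow>
       (AE \<omega> in M. \<forall>T\<ge>0. ereal T < \<tau>lim \<omega> \<longrightarrow>
          (\<exists>m0. \<forall>m\<ge>m0. ereal T < \<tau> m \<omega>) \<and>
          (\<lambda>m. SUP t\<in>{0..T}. ereal (norm (X t \<omega> - Xm m t \<omega>))) \<longlonglongrightarrow> 0))"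
proof -

  \<comment> \<open>The noise as a process with summable jumps\<close>
  interpret complete_filtration M F by (rule complete_filtration.intro[OF assms(1)])
  have levyL: "levy_process M F L" by (rule assms(12))
  note cadlag_L = levy_cadlag_process[OF levyL]
  have L_eq: "L t \<omega> = (\<gamma> t \<omega>, matrix_inv H *v W (\<gamma> t \<omega>) \<omega>)" for t \<omega>
    by (simp add: assms(6,11))
  have meas: "(\<lambda>\<omega>. matrix_inv H *v W (\<gamma> h \<omega>) \<omega>) \<in> borel_measurable M" if "0 \<le> h" for h
  proof -
    have "(\<lambda>p::real \<times> (real^4). snd p) \<in> borel_measurable borel" by (simp add: borel_prod[symmetric])
    from measurable_compose[OF borel_measurable_F_M[OF cadlag_process.adapted[OF cadlag_L that] that] this]
    show ?thesis by (simp add: L_eq)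
  qed
  \<comment> \<open>The matrix in the general bound is \<open>matrix_inv H\<close>, which turns
    \<open>W\<close> into \<open>Wbar\<close>; measurability comes from \<open>L\<close> being
    adapted.\<close>
  obtain C where C: "0 \<le> C" "\<And>q::nat. 0 < q \<Longrightarrow> of_nat q * (\<integral>\<^sup>+\<omega>. ennreal (norm (\<gamma> (1 / real q) \<omega>, matrix_inv H *v W (\<gamma> (1 / real q) \<omega>) \<omega>)) \<partial>M) \<le> ennreal C"
    by (rule subordinated_small_time[OF assms(9,7,8,4,3,10), of "matrix_inv H"], erule meas) (rule that)
  have fv: "AE \<omega> in M. \<forall>T. (\<integral>\<^sup>+(z, y). indicator {0<..T} z * ennreal (norm y) \<partial>jump_measure (\<lambda>t. L t \<omega>)) < \<infinity>"
    by (rule finite_variation_jumps[OF levyL C(1)]) (use C(2) in \<open>simp add: L_eq\<close>)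
  interpret finite_variation_noise M F L "nu4 \<alpha> \<beta>"
    by (intro finite_variation_noise.intro finite_variation_noise_axioms.intro cadlag_L
        fv sets_nu4 sigma_finite_nu4 nu4_moments assms(7,8))
  have lin: "linear_coefficients b g" unfolding assms(26,27) by (rule linear_coefficients_model)
  \<comment> \<open>As 1 / 0 = 0, the box of index 0 consists of the origin alone, which the
    positive initial datum excludes.\<close>
  have n0: "0 < n0"
  proof (rule ccontr)
    assume "\<not> 0 < n0"
    then have "X0 $ 1 \<le> 0" using assms(29) by (simp add: box4_def)
    then show False using assms(28) by (simp add: not_less[symmetric])
  qed
  have X0_D: "X0 \<in> coeff_domain" using assms(28) by (simp add: coeff_domain_def less_imp_le)

  \<comment> \<open>Localized solutions and their exit times\<close>
  have Xn: "AE \<omega> in M. \<forall>n\<ge>n0. cadlag_on \<infinity> (\<lambda>t. Xn n t \<omega>) \<and> (\<forall>t\<ge>0. Xn n t \<omega> = X0 + path_integral (path \<omega>)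
      (compensated_drift (\<lambda>x. cutoff4 (\<psi> n) x *\<^sub>R b x) (\<lambda>y x. cutoff4 (\<psi> n) x *\<^sub>R g y x))
      (\<lambda>y x. cutoff4 (\<psi> n) x *\<^sub>R g y x) (left_lim (\<lambda>r. Xn n r \<omega>)) 0 t)"
  proof (rule AE_all_countable[THEN iffD2], rule allI)
    fix n
    show "AE \<omega> in M. n0 \<le> n \<longrightarrow> cadlag_on \<infinity> (\<lambda>t. Xn n t \<omega>) \<and> (\<forall>t\<ge>0. Xn n t \<omega> = X0 + path_integral (path \<omega>)
      (compensated_drift (\<lambda>x. cutoff4 (\<psi> n) x *\<^sub>R b x) (\<lambda>y x. cutoff4 (\<psi> n) x *\<^sub>R g y x))
      (\<lambda>y x. cutoff4 (\<psi> n) x *\<^sub>R g y x) (left_lim (\<lambda>r. Xn n r \<omega>)) 0 t)"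
    proof (cases "n0 \<le> n")
      case True
      have sol: "solves_equation M F L (nu4 \<alpha> \<beta>) (\<lambda>x. cutoff4 (\<psi> n) x *\<^sub>R b x) (\<lambda>y x. cutoff4 (\<psi> n) x *\<^sub>R g y x)
          UNIV (\<lambda>z. z) X0 (\<lambda>\<omega>. \<infinity>) (Xn n)" using assms(31) True by blast
      have "linear_coefficients (\<lambda>x. cutoff4 (\<psi> n) x *\<^sub>R b x) (\<lambda>y x. cutoff4 (\<psi> n) x *\<^sub>R g y x)"
        using linear_coefficients_cutoff[OF lin] assms(30) True by blast
      from solves_equation_pathwise[OF sol this time_lag_id] show ?thesis
        by eventually_elim simp
    qed simp
  qed
  \<comment> \<open>The value of \<open>lim\<close> is meaningful only for a convergent sequence;
    monotonicity from n0 on makes \<open>\<tau>lim\<close> the supremum of the exit times. Two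
    consecutive localized solutions agree before both exits because each agrees with X
    there.\<close>
  have exit_mono: "AE \<omega> in M. \<forall>n\<ge>n0. \<tau>X n \<omega> \<le> \<tau>X (Suc n) \<omega>"
    using Xn assms(35)
  proof (eventually_elim, intro allI impI)
    fix \<omega> n
    assume eq: "\<forall>n\<ge>n0. cadlag_on \<infinity> (\<lambda>t. Xn n t \<omega>) \<and> (\<forall>t\<ge>0. Xn n t \<omega> = X0 + path_integral (path \<omega>)
      (compensated_drift (\<lambda>x. cutoff4 (\<psi> n) x *\<^sub>R b x) (\<lambda>y x. cutoff4 (\<psi> n) x *\<^sub>R g y x))
      (\<lambda>y x. cutoff4 (\<psi> n) x *\<^sub>R g y x) (left_lim (\<lambda>r. Xn n r \<omega>)) 0 t)"
      and agree: "\<forall>n\<ge>n0. \<forall>t\<ge>0. ereal t < \<tau>X n \<omega> \<longrightarrow> X t \<omega> = Xn n t \<omega>" and n: "n0 \<le> n"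
    have one: "cutoff4 (\<psi> k) x = 1" if "x \<in> box4 k" "n0 \<le> k" for x k
      using cutoff4_eq_1[OF _ that(1)] assms(30) that(2) by blast
    have box: "x \<in> box4 (Suc n)" if "x \<in> box4 n" for x
      using box4_mono[of n "Suc n"] n n0 that by auto
    show "\<tau>X n \<omega> \<le> \<tau>X (Suc n) \<omega>"
      unfolding assms(32)
    proof (rule exit_time_box4_mono[where ?x0.0 = X0 and f = "path \<omega>"
        and b = "compensated_drift (\<lambda>x. cutoff4 (\<psi> n) x *\<^sub>R b x) (\<lambda>y x. cutoff4 (\<psi> n) x *\<^sub>R g y x)"
        and g = "\<lambda>y x. cutoff4 (\<psi> n) x *\<^sub>R g y x"
        and b' = "compensated_drift (\<lambda>x. cutoff4 (\<psi> (Suc n)) x *\<^sub>R b x) (\<lambda>y x. cutoff4 (\<psi> (Suc n)) x *\<^sub>R g y x)"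
        and g' = "\<lambda>y x. cutoff4 (\<psi> (Suc n)) x *\<^sub>R g y x"])
      show "0 < n" using n n0 by simp
      show "Xn n t \<omega> = Xn (Suc n) t \<omega>"
        if "0 \<le> t" "ereal t < exit_time (box4 n) (\<lambda>t. Xn n t \<omega>)" "ereal t < exit_time (box4 (Suc n)) (\<lambda>t. Xn (Suc n) t \<omega>)" for t
        using agree[rule_format, OF n that(1)] agree[rule_format, of "Suc n" t] that n by (simp add: assms(32))
    qed (use eq n in \<open>auto simp: compensated_drift_def one box\<close>)
  qed
  have X: "AE \<omega> in M. cadlag_on (\<tau>lim \<omega>) (\<lambda>t. X t \<omega>) \<and> (\<forall>t\<ge>0. ereal t < \<tau>lim \<omega> \<longrightarrow>
      (\<forall>z\<in>{0<..t}. left_lim (\<lambda>r. X r \<omega>) z \<in> coeff_domain) \<and>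
      X t \<omega> = X0 + path_integral (path \<omega>) (compensated_drift b g) g (left_lim (\<lambda>r. X r \<omega>)) 0 t)"
    by (rule solves_equation_pathwise[OF assms(34) lin time_lag_id])

  \<comment> \<open>At m = 0 the mesh is \<delta>t / 0 = 0, so positivity is restricted to m \<ge> 1
    and the limit is stated for \<open>Suc m\<close>.\<close>
  define \<Delta> where "\<Delta> m = \<delta>t / (real m)\<^sup>2" for m
  have \<Delta>_pos: "0 < \<Delta> m" if "1 \<le> m" for m using assms(36) that by (simp add: \<Delta>_def)
  have \<Delta>_lim: "(\<lambda>m. \<Delta> (Suc m)) \<longlonglongrightarrow> 0"
  proof -
    have "(\<lambda>m. \<delta>t * (1 / real (Suc m))\<^sup>2) \<longlonglongrightarrow> \<delta>t * 0\<^sup>2"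
      by (intro tendsto_mult tendsto_const tendsto_power LIMSEQ_Suc[OF lim_const_over_n])
    then show ?thesis by (simp add: \<Delta>_def power_divide)
  qed
  have \<eta>_eq: "\<eta> m = grid_left (\<Delta> m)" for m by (simp add: assms(37) \<Delta>_def)
  define \<tau> where "\<tau> m = euler_time b g (\<Delta> m) X0 coeff_domain" for m
  let ?E = "\<lambda>m. euler_process b g (\<Delta> m) X0"
  note unique = euler_process_unique[OF lin \<Delta>_pos, folded \<eta>_eq]

  \<comment> \<open>The clamp uses the box of index n + 1 while X stays in that of index n; this
    leaves room for the approximations. The single constant covers the compensated drift and the
    jump coefficient.\<close>
  obtain K where K: "\<And>n. n0 \<le> n \<Longrightarrow> 0 \<le> K n \<and>
      (\<forall>x x'. norm (compensated_drift b g (clamp4 (Suc n) x) - compensated_drift b g (clamp4 (Suc n) x')) \<le> K n * norm (x - x')) \<and>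
      (\<forall>x x' y. norm (g y (clamp4 (Suc n) x) - g y (clamp4 (Suc n) x')) \<le> K n * (norm y * norm (x - x')))"
  proof -
    have "\<exists>K\<ge>0. (\<forall>x x'. norm (compensated_drift b g (clamp4 (Suc n) x) - compensated_drift b g (clamp4 (Suc n) x')) \<le> K * norm (x - x')) \<and>
      (\<forall>x x' y. norm (g y (clamp4 (Suc n) x) - g y (clamp4 (Suc n) x')) \<le> K * (norm y * norm (x - x')))" for n
    proof -
      have S: "0 < Suc n" by simp
      have bl_g: "bounded_lipschitz (box4 (Suc n)) (\<lambda>x. g y x $ i)" for y i
        unfolding assms(27) by (rule bounded_lipschitz_jump[OF S])
      have bl_b: "bounded_lipschitz (box4 (Suc n)) (\<lambda>x. compensated_drift b g x $ i)" for i
        using bounded_lipschitz_diff[OF bounded_lipschitz_drift[OF S] bl_g]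
        unfolding compensated_drift_def vector_minus_component assms(26) by blast
      obtain K1 where K1: "0 \<le> K1" "\<And>x x'. x \<in> box4 (Suc n) \<Longrightarrow> x' \<in> box4 (Suc n) \<Longrightarrow>
          norm (compensated_drift b g x - compensated_drift b g x') \<le> K1 * norm (x - x')"
        using lipschitz_vector_4[OF bl_b] by blast
      have lg: "\<forall>y. \<exists>K. \<forall>x\<in>box4 (Suc n). \<forall>x'\<in>box4 (Suc n). norm (g y x - g y x') \<le> K * norm (x - x')"
        using lipschitz_vector_4[OF bl_g] by meson
      obtain K2 where K2: "0 \<le> K2" "\<And>x x' y. x \<in> box4 (Suc n) \<Longrightarrow> x' \<in> box4 (Suc n) \<Longrightarrow>
          norm (g y x - g y x') \<le> K2 * (norm y * norm (x - x'))"
        using lipschitz_linear_family[OF linear_coefficients.linear_jump[OF lin] lg] by blast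
      note cl = clamp4_props(1,3)[OF S]
      have "norm (compensated_drift b g (clamp4 (Suc n) x) - compensated_drift b g (clamp4 (Suc n) x')) \<le> max K1 K2 * norm (x - x')" for x x'
      proof -
        have "norm (compensated_drift b g (clamp4 (Suc n) x) - compensated_drift b g (clamp4 (Suc n) x')) \<le> K1 * norm (clamp4 (Suc n) x - clamp4 (Suc n) x')"
          by (rule K1(2)[OF cl(1) cl(1)])
        also have "\<dots> \<le> max K1 K2 * norm (x - x')" using K1(1) cl(2) by (intro mult_mono) auto
        finally show ?thesis .
      qed
      moreover have "norm (g y (clamp4 (Suc n) x) - g y (clamp4 (Suc n) x')) \<le> max K1 K2 * (norm y * norm (x - x'))" for x x' y
      proof -
        have "norm (g y (clamp4 (Suc n) x) - g y (clamp4 (Suc n) x')) \<le> K2 * (norm y * norm (clamp4 (Suc n) x - clamp4 (Suc n) x'))"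
          by (rule K2(2)[OF cl(1) cl(1)])
        also have "\<dots> \<le> max K1 K2 * (norm y * norm (x - x'))" using K2(1) cl(2) by (intro mult_mono mult_left_mono) auto
        finally show ?thesis .
      qed
      ultimately show ?thesis using K1(1) by (intro exI[of _ "max K1 K2"]) auto
    qed
    then show ?thesis using that by metis
  qed

  \<comment> \<open>Convergence of the explicit scheme along almost every path\<close>
  have conv: "AE \<omega> in M. \<forall>T\<ge>0. ereal T < \<tau>lim \<omega> \<longrightarrow> (\<forall>e>0. eventually (\<lambda>m. ereal T < \<tau> m \<omega> \<and>
      (\<forall>t\<in>{0..T}. norm (X t \<omega> - ?E m t \<omega>) \<le> e)) sequentially)"
    using exit_mono X assms(35) jump_path_AE
  proof (eventually_elim, intro allI impI)
    fix \<omega> and T e :: real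
    assume mono: "\<forall>n\<ge>n0. \<tau>X n \<omega> \<le> \<tau>X (Suc n) \<omega>"
      and X: "cadlag_on (\<tau>lim \<omega>) (\<lambda>t. X t \<omega>) \<and> (\<forall>t\<ge>0. ereal t < \<tau>lim \<omega> \<longrightarrow>
      (\<forall>z\<in>{0<..t}. left_lim (\<lambda>r. X r \<omega>) z \<in> coeff_domain) \<and>
      X t \<omega> = X0 + path_integral (path \<omega>) (compensated_drift b g) g (left_lim (\<lambda>r. X r \<omega>)) 0 t)"
      and agree: "\<forall>n\<ge>n0. \<forall>t\<ge>0. ereal t < \<tau>X n \<omega> \<longrightarrow> X t \<omega> = Xn n t \<omega>"
      and jp: "jump_path (path \<omega>)" and T: "0 \<le> T" "ereal T < \<tau>lim \<omega>" and e: "0 < e"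
    \<comment> \<open>Below n0 nothing is known about the exit times, hence the shift. A horizon T
      below the supremum lies below one exit time, so X stays in one box up to T.\<close>
    have "incseq (\<lambda>k. \<tau>X (k + n0) \<omega>)" using mono by (intro incseq_SucI) simp
    from LIMSEQ_offset[OF LIMSEQ_SUP[OF this]]
    have "\<tau>lim \<omega> = (SUP k. \<tau>X (k + n0) \<omega>)" by (simp add: assms(33) limI)
    then obtain k where "ereal T < \<tau>X (k + n0) \<omega>" using T(2) by (auto simp: less_SUP_iff)
    then obtain n where n: "n0 \<le> n" "ereal T < \<tau>X n \<omega>" by (metis le_add2)
    have n_pos: "0 < n" using n n0 by simp
    have lt: "ereal t < \<tau>lim \<omega>" "ereal t < \<tau>X n \<omega>" if "t \<le> T" for t
      using that T(2) n(2) by (auto intro: le_less_trans[of _ "ereal T"])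
    have in_box: "X t \<omega> \<in> box4 n" if t: "0 \<le> t" "t \<le> T" for t
    proof -
      have "X t \<omega> = Xn n t \<omega>" using agree n(1) t lt(2)[OF t(2)] by blast
      moreover have "Xn n t \<omega> \<in> box4 n"
        using less_exit_time_imp[of t "box4 n" "\<lambda>t. Xn n t \<omega>"] lt(2)[OF t(2)] t(1) by (simp add: assms(32))
      ultimately show ?thesis by simp
    qed
    have "eventually (\<lambda>m. ereal T < euler_time b g (\<Delta> (Suc m)) X0 coeff_domain \<omega> \<and>
      (\<forall>t\<in>{0..T}. norm (X t \<omega> - euler_process b g (\<Delta> (Suc m)) X0 t \<omega>) \<le> e)) sequentially"
    proof (rule euler_process_converges[OF lin jp conjunct1[OF X] T(2,1) _ closed_box4 in_box clamp4_props(4)])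
      show "X t \<omega> = X0 + path_integral (path \<omega>) (compensated_drift b g) g (left_lim (\<lambda>t. X t \<omega>)) 0 t"
        if "0 \<le> t" "t \<le> T" for t using conjunct2[OF X] that lt(1)[OF that(2)] by blast
      show "0 < 1 / real n - 1 / real (Suc n)" using n_pos by (simp add: frac_less2)
      show "clamp4 (Suc n) y = y \<and> y \<in> coeff_domain" if "x \<in> box4 n" "norm (x - y) \<le> 1 / real n - 1 / real (Suc n)" for x y
        using box4_neighbourhood[OF n_pos that] clamp4_props(2)[of "Suc n" y] by simp
      show "0 < \<Delta> (Suc m)" for m by (rule \<Delta>_pos) simp
    qed (use K[OF n(1)] \<Delta>_lim e in auto)
    then show "eventually (\<lambda>m. ereal T < \<tau> m \<omega> \<and> (\<forall>t\<in>{0..T}. norm (X t \<omega> - ?E m t \<omega>) \<le> e)) sequentially"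
      unfolding \<tau>_def by (rule eventually_sequentially_Suc[THEN iffD1])
  qed

  \<comment> \<open>Properties of the stopping times and passage to arbitrary versions\<close>
  show ?thesis
  proof (intro exI[of _ \<tau>] conjI allI impI)
    fix m :: nat assume m: "1 \<le> m"
    show "markov_time M F (\<tau> m)"
      unfolding \<tau>_def by (rule euler_time_markov[OF lin \<Delta>_pos[OF m] closed_coeff_domain])
    have "{\<omega>\<in>space M. 0 < \<tau> m \<omega>} = space M"
      using euler_time_pos[OF lin \<Delta>_pos[OF m] X0_D] by (auto simp: \<tau>_def)
    then show "measure M {\<omega>\<in>space M. 0 < \<tau> m \<omega>} = 1" by (simp add: prob_space)
    show "\<exists>Y. solves_equation M F L (nu4 \<alpha> \<beta>) b g coeff_domain (\<eta> m) X0 (\<tau> m) Y"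
      unfolding \<tau>_def \<eta>_eq using euler_process_solves[OF lin \<Delta>_pos[OF m] closed_coeff_domain] by blast
    fix Y Y'
    assume "solves_equation M F L (nu4 \<alpha> \<beta>) b g coeff_domain (\<eta> m) X0 (\<tau> m) Y"
      "solves_equation M F L (nu4 \<alpha> \<beta>) b g coeff_domain (\<eta> m) X0 (\<tau> m) Y'"
    from unique[OF m this(1)] unique[OF m this(2)]
    show "AE \<omega> in M. \<forall>t\<ge>0. ereal t < \<tau> m \<omega> \<longrightarrow> Y t \<omega> = Y' t \<omega>"
      by eventually_elim simp
  next
    fix Xm assume Xm: "\<forall>m\<ge>1. solves_equation M F L (nu4 \<alpha> \<beta>) b g coeff_domain (\<eta> m) X0 (\<tau> m) (Xm m)"
    \<comment> \<open>One null set serves all m, so that every version may be replaced by the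
      explicit scheme before its stopping time.\<close>
    have "AE \<omega> in M. \<forall>m. 1 \<le> m \<longrightarrow> (\<forall>t\<ge>0. ereal t < \<tau> m \<omega> \<longrightarrow> Xm m t \<omega> = ?E m t \<omega>)"
    proof (rule AE_all_countable[THEN iffD2], rule allI)
      fix m :: nat
      show "AE \<omega> in M. 1 \<le> m \<longrightarrow> (\<forall>t\<ge>0. ereal t < \<tau> m \<omega> \<longrightarrow> Xm m t \<omega> = ?E m t \<omega>)"
        using unique[of m] Xm by (cases "1 \<le> m") auto
    qed
    with conv show "AE \<omega> in M. \<forall>T\<ge>0. ereal T < \<tau>lim \<omega> \<longrightarrow>
          (\<exists>m0. \<forall>m\<ge>m0. ereal T < \<tau> m \<omega>) \<and>
          (\<lambda>m. SUP t\<in>{0..T}. ereal (norm (X t \<omega> - Xm m t \<omega>))) \<longlonglongrightarrow> 0"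
    proof (eventually_elim, intro allI impI)
      fix \<omega> and T :: real
      assume conv: "\<forall>T\<ge>0. ereal T < \<tau>lim \<omega> \<longrightarrow> (\<forall>e>0. eventually (\<lambda>m. ereal T < \<tau> m \<omega> \<and>
          (\<forall>t\<in>{0..T}. norm (X t \<omega> - ?E m t \<omega>) \<le> e)) sequentially)"
        and eq: "\<forall>m. 1 \<le> m \<longrightarrow> (\<forall>t\<ge>0. ereal t < \<tau> m \<omega> \<longrightarrow> Xm m t \<omega> = ?E m t \<omega>)"
        and T: "0 \<le> T" "ereal T < \<tau>lim \<omega>"
      \<comment> \<open>Only for those m whose stopping time exceeds T is the version determined on
        the whole of \<open>{0..T}\<close>; from there on the supremum is that of the explicit
        scheme.\<close>
      have ev: "eventually (\<lambda>m. ereal T < \<tau> m \<omega> \<and> (SUP t\<in>{0..T}. ereal (norm (X t \<omega> - Xm m t \<omega>))) \<le> ereal e) sequentially"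
        if e: "0 < e" for e
        using conv[rule_format, OF T e] eventually_ge_at_top[of 1]
      proof eventually_elim
        case (elim m)
        have "Xm m t \<omega> = ?E m t \<omega>" if "t \<in> {0..T}" for t
        proof -
          have "ereal t < \<tau> m \<omega>" using that elim(1) by (auto intro: le_less_trans[of _ "ereal T"])
          then show ?thesis using eq elim(2) that by auto
        qed
        then show ?case using elim(1) by (auto intro!: SUP_least)
      qed
      show "(\<exists>m0. \<forall>m\<ge>m0. ereal T < \<tau> m \<omega>) \<and>
          (\<lambda>m. SUP t\<in>{0..T}. ereal (norm (X t \<omega> - Xm m t \<omega>))) \<longlonglongrightarrow> 0"
      proof
        show "\<exists>m0. \<forall>m\<ge>m0. ereal T < \<tau> m \<omega>"
          using ev[OF zero_less_one] unfolding eventually_sequentially by blast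
        show "(\<lambda>m. SUP t\<in>{0..T}. ereal (norm (X t \<omega> - Xm m t \<omega>))) \<longlonglongrightarrow> 0"
        proof (rule order_tendstoI)
          fix a :: ereal assume a: "a < 0"
          have "a < (SUP t\<in>{0..T}. ereal (norm (X t \<omega> - Xm m t \<omega>)))" for m
            by (rule less_le_trans[OF a], rule SUP_upper2[of 0]) (use T(1) in auto)
          then show "\<forall>\<^sub>F m in sequentially. a < (SUP t\<in>{0..T}. ereal (norm (X t \<omega> - Xm m t \<omega>)))" by simp
        next
          fix a :: ereal assume a: "0 < a"
          obtain e where e: "0 < ereal e" "ereal e < a" using ereal_dense2[OF a] by auto
          have "0 < e" using e(1) by simp
          from ev[OF this] show "\<forall>\<^sub>F m in sequentially. (SUP t\<in>{0..T}. ereal (norm (X t \<omega> - Xm m t \<omega>))) < a"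
            by eventually_elim (use e(2) in \<open>auto intro: le_less_trans\<close>)
        qed
      qed
    qed
  qed
qed

end
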